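(* Let $p$ be a prime and let $(G,\theta)$ be a finitely generated cyclo-oriented pro-$p$ group. Then there exists a closed subgroup $G_\circ$ of $G$ which is a complement for $\mathrm{Z}_\theta(G)$, i.e., the short exact sequence $$1\to\mathrm{Z}_\theta(G)\to G\to G/\mathrm{Z}_\theta(G)\to1$$ splits, with $G_\circ\simeq G/\mathrm{Z}_\theta(G)$, so that $G=G_\circ\ltimes_\theta\mathrm{Z}_\theta(G)$.
   Context: Subgroups are closed and generators are topological. An orientation of a pro-$p$ group $G$ is a continuous homomorphism $\theta\colon G\to\mathbb{Z}_p^\times$; $\mathbb{Z}_p(1)$ denotes $\mathbb{Z}_p$ with the $G$-action $g.\lambda=\theta(g)\lambda$. A Bloch-Kato pro-$p$ group is a pro-$p$ group $G$ such that for every closed subgroup $C\le G$ the cohomology ring $H^\bullet(C,\mathbb{F}_p)$ (with cup product) is a quadratic $\mathbb{F}_p$-algebra, i.e., generated in degree 1 with ideal of relations generated in degree 2. $(G,\theta)$ is cyclo-oriented if $G$ is Bloch-Kato and $H^2(C,\mathbb{Z}_p(1))$ (continuous cochain cohomology) is torsion-free for all closed subgroups $C$ of $G$. The $\theta$-centre is $\mathrm{Z}_\theta(G)=\{h\in\ker(\theta)\mid ghg^{-1}=h^{\theta(g)}\text{ for all }g\in G\}$, an abelian normal subgroup. The notation $G_\circ\ltimes_\theta\mathrm{Z}_\theta(G)$ means the semidirect product in which $g\in G_\circ$ acts on $\mathrm{Z}_\theta(G)$ by $z\mapsto z^{\theta(g)}$. *)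

theory Defs
  imports "HOL-Analysis.Analysis" "HOL-Algebra.QuotRing" "HOL-Algebra.Module" "HOL-Number_Theory.Residues"
begin

section \<open>Topological groups and pro-p groups\<close>

text \<open>A topological group is a pair of a group \<open>G\<close> and a topology \<open>T\<close> with underlying
  set \<open>carrier G\<close>.\<close>

definition topological_group :: "('a, 'b) monoid_scheme \<Rightarrow> 'a topology \<Rightarrow> bool" where
  "topological_group G T \<longleftrightarrow>
     group G \<and> topspace T = carrier G \<and>
     continuous_map (prod_topology T T) T (\<lambda>(x, y). x \<otimes>\<^bsub>G\<^esub> y) \<and>
     continuous_map T T (\<lambda>x. inv\<^bsub>G\<^esub> x)"

definition profinite_group :: "('a, 'b) monoid_scheme \<Rightarrow> 'a topology \<Rightarrow> bool" where
  "profinite_group G T \<longleftrightarrow>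
     topological_group G T \<and> compact_space T \<and> Hausdorff_space T \<and>
     (\<forall>U. openin T U \<and> \<one>\<^bsub>G\<^esub> \<in> U \<longrightarrow> (\<exists>N. subgroup N G \<and> openin T N \<and> N \<subseteq> U))"

definition pro_p_group :: "nat \<Rightarrow> ('a, 'b) monoid_scheme \<Rightarrow> 'a topology \<Rightarrow> bool" where
  "pro_p_group p G T \<longleftrightarrow>
     profinite_group G T \<and>
     (\<forall>N. N \<lhd> G \<and> openin T N \<longrightarrow> (\<exists>k. order (G Mod N) = p ^ k))"

definition closed_subgroup :: "'a set \<Rightarrow> ('a, 'b) monoid_scheme \<Rightarrow> 'a topology \<Rightarrow> bool" where
  "closed_subgroup C G T \<longleftrightarrow> subgroup C G \<and> closedin T C"

definition topologically_finitely_generated ::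
    "('a, 'b) monoid_scheme \<Rightarrow> 'a topology \<Rightarrow> bool" where
  "topologically_finitely_generated G T \<longleftrightarrow>
     (\<exists>S. finite S \<and> S \<subseteq> carrier G \<and> Abstract_Topology.closure_of T (generate G S) = carrier G)"

definition topological_group_iso ::
    "('a, 'b) monoid_scheme \<Rightarrow> 'a topology \<Rightarrow> ('c, 'd) monoid_scheme \<Rightarrow> 'c topology
      \<Rightarrow> ('a \<Rightarrow> 'c) \<Rightarrow> bool" where
  "topological_group_iso G T G' T' f \<longleftrightarrow> f \<in> iso G G' \<and> homeomorphic_map T T' f"

text \<open>The quotient topology on \<open>G Mod N\<close>: a set of cosets is open iff its preimage in \<open>G\<close>,
  that is, its union, is open.\<close>

definition coset_topology ::
    "('a, 'b) monoid_scheme \<Rightarrow> 'a topology \<Rightarrow> 'a set \<Rightarrow> 'a set topology" where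
  "coset_topology G T N = topology (\<lambda>\<U>. \<U> \<subseteq> rcosets\<^bsub>G\<^esub> N \<and> openin T (\<Union>\<U>))"

text \<open>The semidirect product of \<open>H\<close> and \<open>N\<close> for an action \<open>\<alpha>\<close> of \<open>H\<close> on \<open>N\<close> from the left.
  The pair \<open>(h, n)\<close> plays the role of the product \<open>n h\<close>, so that
  \<open>(n\<^sub>1 h\<^sub>1) (n\<^sub>2 h\<^sub>2) = (n\<^sub>1 (h\<^sub>1 n\<^sub>2 h\<^sub>1\<inverse>)) (h\<^sub>1 h\<^sub>2)\<close>.\<close>

definition semidirect_product ::
    "('a, 'b) monoid_scheme \<Rightarrow> ('c, 'd) monoid_scheme \<Rightarrow> ('a \<Rightarrow> 'c \<Rightarrow> 'c) \<Rightarrow> ('a \<times> 'c) monoid" where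
  "semidirect_product H N \<alpha> =
     \<lparr>carrier = carrier H \<times> carrier N,
      monoid.mult = (\<lambda>(h1, n1) (h2, n2). (h1 \<otimes>\<^bsub>H\<^esub> h2, n1 \<otimes>\<^bsub>N\<^esub> \<alpha> h1 n2)),
      one = (\<one>\<^bsub>H\<^esub>, \<one>\<^bsub>N\<^esub>)\<rparr>"


section \<open>The ring of p-adic integers\<close>

text \<open>\<open>\<int>\<^sub>p\<close> is the inverse limit of the rings \<open>\<int>/p\<^sup>n\<close>, the latter represented by
  \<open>{0..<p\<^sup>n}\<close>; an element is the sequence of its residues modulo \<open>p\<^sup>n\<close>.\<close>

definition padic_int_ring :: "nat \<Rightarrow> (nat \<Rightarrow> int) ring" where
  "padic_int_ring p =
     \<lparr>carrier = {x. \<forall>n. x n \<in> {0..<int p ^ n} \<and> x (Suc n) mod int p ^ n = x n},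
      monoid.mult = (\<lambda>x y n. (x n * y n) mod int p ^ n),
      one = (\<lambda>n. 1 mod int p ^ n),
      zero = (\<lambda>n. 0),
      add = (\<lambda>x y n. (x n + y n) mod int p ^ n)\<rparr>"

definition padic_int_topology :: "nat \<Rightarrow> (nat \<Rightarrow> int) topology" where
  "padic_int_topology p =
     subtopology (product_topology (\<lambda>_. discrete_topology UNIV) UNIV)
       (carrier (padic_int_ring p))"

text \<open>Powers \<open>h\<^sup>a\<close> with p-adic exponent in a pro-p group: the limit of \<open>h\<^sup>m\<close> as the integer
  \<open>m\<close> tends to \<open>a\<close> p-adically.\<close>

definition padic_pow ::
    "('a, 'b) monoid_scheme \<Rightarrow> 'a topology \<Rightarrow> 'a \<Rightarrow> (nat \<Rightarrow> int) \<Rightarrow> 'a" where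
  "padic_pow G T h a = (THE y. limitin T (\<lambda>n. h [^]\<^bsub>G\<^esub> a n) y sequentially)"


section \<open>Continuous cochain cohomology\<close>

text \<open>The coefficients are the additive group of \<open>M\<close> with topology \<open>TM\<close> and the action \<open>act\<close>
  of \<open>G\<close>. An \<open>n\<close>-tuple of elements of \<open>G\<close> is an extensional function on \<open>{..<n}\<close>, and
  \<open>tuples G n\<close> is the underlying set of the \<open>n\<close>-fold product topology.\<close>

abbreviation tuples :: "('a, 'b) monoid_scheme \<Rightarrow> nat \<Rightarrow> (nat \<Rightarrow> 'a) set" where
  "tuples G n \<equiv> {..<n} \<rightarrow>\<^sub>E carrier G"

definition cochains ::
    "('a, 'b) monoid_scheme \<Rightarrow> 'a topology \<Rightarrow> ('m, 'c) ring_scheme \<Rightarrow> 'm topology \<Rightarrow> nat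
      \<Rightarrow> ((nat \<Rightarrow> 'a) \<Rightarrow> 'm) monoid" where
  "cochains G T M TM n =
     \<lparr>carrier = {f \<in> extensional (tuples G n).
         continuous_map (product_topology (\<lambda>_. T) {..<n}) TM f},
      monoid.mult = (\<lambda>f f'. \<lambda>x\<in>tuples G n. f x \<oplus>\<^bsub>M\<^esub> f' x),
      one = (\<lambda>x\<in>tuples G n. \<zero>\<^bsub>M\<^esub>)\<rparr>"

definition contract_at :: "('a, 'b) monoid_scheme \<Rightarrow> nat \<Rightarrow> nat \<Rightarrow> (nat \<Rightarrow> 'a) \<Rightarrow> nat \<Rightarrow> 'a" where
  "contract_at G n i x =
     (\<lambda>j\<in>{..<n}. if j < i then x j else if j = i then x i \<otimes>\<^bsub>G\<^esub> x (Suc i) else x (Suc j))"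

text \<open>The inhomogeneous differential from degree \<open>n\<close> to degree \<open>n + 1\<close>; the arguments are
  numbered from \<open>0\<close>.\<close>

definition differential ::
    "('a, 'b) monoid_scheme \<Rightarrow> ('m, 'c) ring_scheme \<Rightarrow> ('a \<Rightarrow> 'm \<Rightarrow> 'm) \<Rightarrow> nat
      \<Rightarrow> ((nat \<Rightarrow> 'a) \<Rightarrow> 'm) \<Rightarrow> ((nat \<Rightarrow> 'a) \<Rightarrow> 'm)" where
  "differential G M act n f = (\<lambda>x\<in>tuples G (Suc n).
     act (x 0) (f (\<lambda>j\<in>{..<n}. x (Suc j)))
     \<oplus>\<^bsub>M\<^esub> (\<Oplus>\<^bsub>M\<^esub>i\<in>{..<n}. [((-1) ^ Suc i :: int)] \<cdot>\<^bsub>M\<^esub> f (contract_at G n i x))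
     \<oplus>\<^bsub>M\<^esub> [((-1) ^ Suc n :: int)] \<cdot>\<^bsub>M\<^esub> f (restrict x {..<n}))"

definition cocycles ::
    "('a, 'b) monoid_scheme \<Rightarrow> 'a topology \<Rightarrow> ('m, 'c) ring_scheme \<Rightarrow> 'm topology
      \<Rightarrow> ('a \<Rightarrow> 'm \<Rightarrow> 'm) \<Rightarrow> nat \<Rightarrow> ((nat \<Rightarrow> 'a) \<Rightarrow> 'm) set" where
  "cocycles G T M TM act n =
     {f \<in> carrier (cochains G T M TM n).
        differential G M act n f = \<one>\<^bsub>cochains G T M TM (Suc n)\<^esub>}"

definition coboundaries ::
    "('a, 'b) monoid_scheme \<Rightarrow> 'a topology \<Rightarrow> ('m, 'c) ring_scheme \<Rightarrow> 'm topology
      \<Rightarrow> ('a \<Rightarrow> 'm \<Rightarrow> 'm) \<Rightarrow> nat \<Rightarrow> ((nat \<Rightarrow> 'a) \<Rightarrow> 'm) set" where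
  "coboundaries G T M TM act n =
     (case n of
        0 \<Rightarrow> {\<one>\<^bsub>cochains G T M TM 0\<^esub>}
      | Suc m \<Rightarrow> differential G M act m ` carrier (cochains G T M TM m))"

text \<open>The abelian group \<open>H\<^sup>n(G, M)\<close>, written multiplicatively. Its elements are cosets of
  the group of coboundaries.\<close>

definition cohomology ::
    "('a, 'b) monoid_scheme \<Rightarrow> 'a topology \<Rightarrow> ('m, 'c) ring_scheme \<Rightarrow> 'm topology
      \<Rightarrow> ('a \<Rightarrow> 'm \<Rightarrow> 'm) \<Rightarrow> nat \<Rightarrow> ((nat \<Rightarrow> 'a) \<Rightarrow> 'm) set monoid" where
  "cohomology G T M TM act n =
     (cochains G T M TM n) \<lparr>carrier := cocycles G T M TM act n\<rparr>
       Mod coboundaries G T M TM act n"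

definition torsion_free_group :: "('a, 'b) monoid_scheme \<Rightarrow> bool" where
  "torsion_free_group A \<longleftrightarrow>
     (\<forall>x\<in>carrier A. \<forall>n::nat. n > 0 \<and> x [^]\<^bsub>A\<^esub> n = \<one>\<^bsub>A\<^esub> \<longrightarrow> x = \<one>\<^bsub>A\<^esub>)"


section \<open>The cohomology ring with trivial discrete coefficients\<close>

abbreviation trivial_cohomology ::
    "('a, 'b) monoid_scheme \<Rightarrow> 'a topology \<Rightarrow> ('k, 'c) ring_scheme \<Rightarrow> nat
      \<Rightarrow> ((nat \<Rightarrow> 'a) \<Rightarrow> 'k) set monoid" where
  "trivial_cohomology G T K \<equiv> cohomology G T K (discrete_topology (carrier K)) (\<lambda>g a. a)"

definition cohomology_class ::
    "('a, 'b) monoid_scheme \<Rightarrow> 'a topology \<Rightarrow> ('k, 'c) ring_scheme \<Rightarrow> nat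
      \<Rightarrow> ((nat \<Rightarrow> 'a) \<Rightarrow> 'k) \<Rightarrow> ((nat \<Rightarrow> 'a) \<Rightarrow> 'k) set" where
  "cohomology_class G T K n f =
     coboundaries G T K (discrete_topology (carrier K)) (\<lambda>g a. a) n
       #>\<^bsub>cochains G T K (discrete_topology (carrier K)) n\<^esub> f"

definition cup_cochain ::
    "('a, 'b) monoid_scheme \<Rightarrow> ('k, 'c) ring_scheme \<Rightarrow> nat \<Rightarrow> nat
      \<Rightarrow> ((nat \<Rightarrow> 'a) \<Rightarrow> 'k) \<Rightarrow> ((nat \<Rightarrow> 'a) \<Rightarrow> 'k) \<Rightarrow> ((nat \<Rightarrow> 'a) \<Rightarrow> 'k)" where
  "cup_cochain G K m n f f' = (\<lambda>x\<in>tuples G (m + n).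
     f (restrict x {..<m}) \<otimes>\<^bsub>K\<^esub> f' (\<lambda>j\<in>{..<n}. x (m + j)))"

text \<open>On classes, operations are defined as the union of the results over all
  representatives, as in \<^const>\<open>rcoset_mult\<close>.\<close>

definition cup_product ::
    "('a, 'b) monoid_scheme \<Rightarrow> 'a topology \<Rightarrow> ('k, 'c) ring_scheme \<Rightarrow> nat \<Rightarrow> nat
      \<Rightarrow> ((nat \<Rightarrow> 'a) \<Rightarrow> 'k) set \<Rightarrow> ((nat \<Rightarrow> 'a) \<Rightarrow> 'k) set \<Rightarrow> ((nat \<Rightarrow> 'a) \<Rightarrow> 'k) set" where
  "cup_product G T K m n a b =
     (\<Union>f\<in>a. \<Union>f'\<in>b. cohomology_class G T K (m + n) (cup_cochain G K m n f f'))"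

definition class_smult ::
    "('a, 'b) monoid_scheme \<Rightarrow> 'a topology \<Rightarrow> ('k, 'c) ring_scheme \<Rightarrow> nat \<Rightarrow> 'k
      \<Rightarrow> ((nat \<Rightarrow> 'a) \<Rightarrow> 'k) set \<Rightarrow> ((nat \<Rightarrow> 'a) \<Rightarrow> 'k) set" where
  "class_smult G T K n c a =
     (\<Union>f\<in>a. cohomology_class G T K n (\<lambda>x\<in>tuples G n. c \<otimes>\<^bsub>K\<^esub> f x))"

text \<open>\<open>H\<^sup>\<bullet>(G, K)\<close> is the direct sum of the groups \<open>H\<^sup>n(G, K)\<close>: its elements are the
  families with finitely many nonzero components.\<close>

definition cohomology_ring ::
    "('a, 'b) monoid_scheme \<Rightarrow> 'a topology \<Rightarrow> ('k, 'c) ring_scheme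
      \<Rightarrow> ('k, nat \<Rightarrow> ((nat \<Rightarrow> 'a) \<Rightarrow> 'k) set) module" where
  "cohomology_ring G T K =
     \<lparr>carrier = {x. (\<forall>n. x n \<in> carrier (trivial_cohomology G T K n)) \<and>
                    finite {n. x n \<noteq> \<one>\<^bsub>trivial_cohomology G T K n\<^esub>}},
      monoid.mult = (\<lambda>x y n. \<Otimes>\<^bsub>trivial_cohomology G T K n\<^esub>i\<in>{..n}.
                         cup_product G T K i (n - i) (x i) (y (n - i))),
      one = (\<lambda>n. if n = 0 then cohomology_class G T K 0 (\<lambda>x\<in>tuples G 0. \<one>\<^bsub>K\<^esub>)
                 else \<one>\<^bsub>trivial_cohomology G T K n\<^esub>),
      zero = (\<lambda>n. \<one>\<^bsub>trivial_cohomology G T K n\<^esub>),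
      add = (\<lambda>x y n. x n \<otimes>\<^bsub>trivial_cohomology G T K n\<^esub> y n),
      smult = (\<lambda>c x n. class_smult G T K n c (x n))\<rparr>"

definition cohomology_grading ::
    "('a, 'b) monoid_scheme \<Rightarrow> 'a topology \<Rightarrow> ('k, 'c) ring_scheme \<Rightarrow> nat
      \<Rightarrow> (nat \<Rightarrow> ((nat \<Rightarrow> 'a) \<Rightarrow> 'k) set) set" where
  "cohomology_grading G T K n =
     {x \<in> carrier (cohomology_ring G T K). \<forall>m. m \<noteq> n \<longrightarrow> x m = \<one>\<^bsub>trivial_cohomology G T K m\<^esub>}"


section \<open>Quadratic algebras\<close>

text \<open>The free associative \<open>K\<close>-algebra on a set \<open>X\<close> of letters: finitely supported
  \<open>K\<close>-valued functions on words, with the convolution product.\<close>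

definition free_algebra :: "('k, 'c) ring_scheme \<Rightarrow> 'x set \<Rightarrow> ('k, 'x list \<Rightarrow> 'k) module" where
  "free_algebra K X =
     \<lparr>carrier = {f. (\<forall>w. f w \<in> carrier K) \<and> (\<forall>w. w \<notin> lists X \<longrightarrow> f w = \<zero>\<^bsub>K\<^esub>) \<and>
                    finite {w. f w \<noteq> \<zero>\<^bsub>K\<^esub>}},
      monoid.mult = (\<lambda>f f' w. \<Oplus>\<^bsub>K\<^esub>i\<in>{..length w}. f (take i w) \<otimes>\<^bsub>K\<^esub> f' (drop i w)),
      one = (\<lambda>w. if w = [] then \<one>\<^bsub>K\<^esub> else \<zero>\<^bsub>K\<^esub>),
      zero = (\<lambda>w. \<zero>\<^bsub>K\<^esub>),
      add = (\<lambda>f f' w. f w \<oplus>\<^bsub>K\<^esub> f' w),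
      smult = (\<lambda>c f w. c \<otimes>\<^bsub>K\<^esub> f w)\<rparr>"

definition letter :: "('k, 'c) ring_scheme \<Rightarrow> 'x \<Rightarrow> 'x list \<Rightarrow> 'k" where
  "letter K v = (\<lambda>w. if w = [v] then \<one>\<^bsub>K\<^esub> else \<zero>\<^bsub>K\<^esub>)"

text \<open>The tensor algebra \<open>T\<^sub>K(V)\<close> of a subspace \<open>V\<close> of the \<open>K\<close>-module \<open>A\<close> is the quotient of
  the free algebra on the set \<open>V\<close> by the ideal forcing the letters to be \<open>K\<close>-linear.\<close>

definition linearity_ideal ::
    "('k, 'c) ring_scheme \<Rightarrow> ('k, 'v, 'd) module_scheme \<Rightarrow> 'v set \<Rightarrow> ('v list \<Rightarrow> 'k) set" where
  "linearity_ideal K A V =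
     (let F = free_algebra K V in
      Idl\<^bsub>F\<^esub> ({letter K (u \<oplus>\<^bsub>A\<^esub> v) \<ominus>\<^bsub>F\<^esub> (letter K u \<oplus>\<^bsub>F\<^esub> letter K v) | u v. u \<in> V \<and> v \<in> V} \<union>
           {letter K (c \<odot>\<^bsub>A\<^esub> v) \<ominus>\<^bsub>F\<^esub> (c \<odot>\<^bsub>F\<^esub> letter K v) | c v. c \<in> carrier K \<and> v \<in> V}))"

definition tensor_algebra ::
    "('k, 'c) ring_scheme \<Rightarrow> ('k, 'v, 'd) module_scheme \<Rightarrow> 'v set \<Rightarrow> ('v list \<Rightarrow> 'k) set ring" where
  "tensor_algebra K A V = free_algebra K V Quot linearity_ideal K A V"

definition tensor_power ::
    "('k, 'c) ring_scheme \<Rightarrow> ('k, 'v, 'd) module_scheme \<Rightarrow> 'v set \<Rightarrow> nat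
      \<Rightarrow> ('v list \<Rightarrow> 'k) set set" where
  "tensor_power K A V n =
     {linearity_ideal K A V +>\<^bsub>free_algebra K V\<^esub> f | f.
        f \<in> carrier (free_algebra K V) \<and> (\<forall>w. f w \<noteq> \<zero>\<^bsub>K\<^esub> \<longrightarrow> length w = n)}"

text \<open>Evaluation of noncommutative polynomials in \<open>A\<close>, and the algebra homomorphism
  \<open>T\<^sub>K(V) \<rightarrow> A\<close> it induces, which extends the inclusion of \<open>V\<close> in \<open>A\<close>.\<close>

definition free_algebra_eval ::
    "('k, 'c) ring_scheme \<Rightarrow> ('k, 'v, 'd) module_scheme \<Rightarrow> ('v list \<Rightarrow> 'k) \<Rightarrow> 'v" where
  "free_algebra_eval K A f =
     (\<Oplus>\<^bsub>A\<^esub>w\<in>{w. f w \<noteq> \<zero>\<^bsub>K\<^esub>}. f w \<odot>\<^bsub>A\<^esub> foldr (\<lambda>u v. u \<otimes>\<^bsub>A\<^esub> v) w \<one>\<^bsub>A\<^esub>)"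

definition tensor_algebra_map ::
    "('k, 'c) ring_scheme \<Rightarrow> ('k, 'v, 'd) module_scheme \<Rightarrow> ('v list \<Rightarrow> 'k) set \<Rightarrow> 'v" where
  "tensor_algebra_map K A t = the_elem (free_algebra_eval K A ` t)"

text \<open>A graded \<open>K\<close>-algebra \<open>A\<close> with homogeneous components \<open>gr n\<close> is quadratic if the canonical
  map \<open>T\<^sub>K(gr 1) \<rightarrow> A\<close> is surjective (\<open>A\<close> is generated in degree 1) and its kernel is
  generated, as a two-sided ideal, by its elements of degree 2. That \<open>A\<close> with \<open>gr\<close> is
  a graded \<open>K\<close>-algebra is presupposed.\<close>

definition quadratic_algebra ::
    "('k, 'c) ring_scheme \<Rightarrow> ('k, 'v, 'd) module_scheme \<Rightarrow> (nat \<Rightarrow> 'v set) \<Rightarrow> bool" where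
  "quadratic_algebra K A gr \<longleftrightarrow>
     (let TA = tensor_algebra K A (gr 1);
          J = a_kernel TA A (tensor_algebra_map K A)
      in tensor_algebra_map K A ` carrier TA = carrier A \<and>
         J = Idl\<^bsub>TA\<^esub> (J \<inter> tensor_power K A (gr 1) 2))"


section \<open>Cyclo-oriented pro-p groups\<close>

definition bloch_kato_group :: "nat \<Rightarrow> ('a, 'b) monoid_scheme \<Rightarrow> 'a topology \<Rightarrow> bool" where
  "bloch_kato_group p G T \<longleftrightarrow>
     pro_p_group p G T \<and>
     (\<forall>C. closed_subgroup C G T \<longrightarrow>
        quadratic_algebra (residue_ring (int p))
          (cohomology_ring (G\<lparr>carrier := C\<rparr>) (subtopology T C) (residue_ring (int p)))
          (cohomology_grading (G\<lparr>carrier := C\<rparr>) (subtopology T C) (residue_ring (int p))))"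

text \<open>The topology of \<open>\<int>\<^sub>p\<^sup>\<times>\<close> is the one induced from \<open>\<int>\<^sub>p\<close>.\<close>

definition orientation ::
    "nat \<Rightarrow> ('a, 'b) monoid_scheme \<Rightarrow> 'a topology \<Rightarrow> ('a \<Rightarrow> nat \<Rightarrow> int) \<Rightarrow> bool" where
  "orientation p G T \<theta> \<longleftrightarrow>
     \<theta> \<in> hom G (units_of (padic_int_ring p)) \<and>
     continuous_map T (subtopology (padic_int_topology p) (Units (padic_int_ring p))) \<theta>"

definition cyclo_oriented ::
    "nat \<Rightarrow> ('a, 'b) monoid_scheme \<Rightarrow> 'a topology \<Rightarrow> ('a \<Rightarrow> nat \<Rightarrow> int) \<Rightarrow> bool" where
  "cyclo_oriented p G T \<theta> \<longleftrightarrow>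
     bloch_kato_group p G T \<and> orientation p G T \<theta> \<and>
     (\<forall>C. closed_subgroup C G T \<longrightarrow>
        torsion_free_group
          (cohomology (G\<lparr>carrier := C\<rparr>) (subtopology T C)
             (padic_int_ring p) (padic_int_topology p)
             (\<lambda>g x. \<theta> g \<otimes>\<^bsub>padic_int_ring p\<^esub> x) 2))"

definition theta_centre ::
    "nat \<Rightarrow> ('a, 'b) monoid_scheme \<Rightarrow> 'a topology \<Rightarrow> ('a \<Rightarrow> nat \<Rightarrow> int) \<Rightarrow> 'a set" where
  "theta_centre p G T \<theta> =
     {h \<in> kernel G (units_of (padic_int_ring p)) \<theta>.
        \<forall>g\<in>carrier G. g \<otimes>\<^bsub>G\<^esub> h \<otimes>\<^bsub>G\<^esub> inv\<^bsub>G\<^esub> g = padic_pow G T h (\<theta> g)}"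

end

theory Submission
  imports Defs "HOL-Algebra.Group_Action"
begin

text \<open>Torsion-freeness of \<open>H\<^sup>2(C, \<int>\<^sub>p(1))\<close> means that every homomorphism \<open>C \<rightarrow> \<int>/p\<close> lifts to a 1-cocycle with
  values in \<open>\<int>/p\<^sup>k(1)\<close>; this implies that the \<open>\<theta>\<close>-centre \<open>Z\<close> contains every element of \<open>G\<close> having a nontrivial
  \<open>p\<close>-th power in \<open>Z\<close>. The main point is that an element \<open>z \<in> Z\<close> of a closed subgroup \<open>H\<close> lies
  outside the Frattini subgroup \<open>\<Phi>(H)\<close> if it has no \<open>p\<close>-th root in \<open>H\<close>. Otherwise let \<open>C\<close> be minimal with
  \<open>z \<in> \<Phi>(C)\<close>, and let \<open>U\<close> be the kernel of \<open>g: C \<rightarrow> \<int>/p\<close>, with \<open>g(y) = 1\<close>. By minimality there is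
  \<open>u: U \<rightarrow> \<int>/p\<close> with \<open>u(z) = 1\<close>. By the Bloch-Kato property, the corestriction to \<open>C\<close> of \<open>u \<union> v\<close>, where
  \<open>v: U \<rightarrow> \<int>/p\<close>, is a sum of cup products of homomorphisms vanishing at \<open>z\<close>, so it becomes trivial on
  the relation \<open>y z y\<inverse> = z\<^bsup>\<theta>(y)\<^esup>\<close>, where it evaluates to \<open>-v(y\<^sup>p)\<close> if \<open>v(z) = 0\<close>. So \<open>v(z) = 0\<close> implies
  \<open>v(y\<^sup>p) = 0\<close>, which is refuted by homomorphisms \<open>v\<close> obtained by dividing lifts of \<open>g\<close> by \<open>p\<close>.

  Consequently a minimal closed subgroup \<open>H\<close> with \<open>H Z = G\<close> is a complement: if \<open>H \<inter> Z\<close> is nontrivial, it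
  contains an element \<open>z\<close> without \<open>p\<close>-th root in \<open>H\<close>, and the kernel of a homomorphism
  \<open>H \<rightarrow> \<int>/p\<close> that does not vanish at \<open>z\<close> is a smaller supplement.\<close>

section \<open>Homomorphisms of finite p-groups\<close>

text \<open>Why the obstruction exists: evaluating a 2-cocycle modulo \<open>p\<close> on the
  relation y z y^{-1} = z^\<theta>(y) kills coboundaries because \<theta>(y) is 1 modulo
  \<open>p\<close>, and kills f \<union> f' because homomorphisms from \<open>C\<close> to Z/p
  vanish at \<open>z\<close> and its conjugates. The Bloch-Kato property makes these products span
  the second cohomology. How lifts contradict it: let \<open>c\<close> be a cocycle in Z/p^2(1),
  nonzero modulo \<open>p\<close>, with c(z) = 0. On the kernel \<open>U\<close> of its reduction
  c/p is additive, vanishes at \<open>z\<close>, and is c(y) at y^p. Sending a lift \<open>c\<close>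
  to c(z)/p in Z/p shows that such a \<open>c\<close> exists once \<open>C\<close> has two
  independent homomorphisms to Z/p. With at most one, \<open>C\<close> is procyclic, and an element
  of its Frattini subgroup is a \<open>p\<close>-th power; this is where the missing root of
  \<open>z\<close> enters. The value at y^p comes from 1 + \<theta>(y) + ... + \<theta>(y)^(p-1),
  which is \<open>p\<close> modulo p^2 for odd \<open>p\<close>. For p = 2 it is 1 + \<theta>(y),
  which may be 0 modulo 4; this is the reason for the long separate argument.\<close>

lemma (in group_action) p_group_fixed_point:
  assumes p: "Factorial_Ring.prime p" and ord: "order G = p ^ k" and fin: "finite E"
    and dvd: "p dvd card E" and e: "e \<in> E" "\<And>g. g \<in> carrier G \<Longrightarrow> \<phi> g e = e"
  shows "\<exists>e'\<in>E. e' \<noteq> e \<and> (\<forall>g\<in>carrier G. \<phi> g e' = e')"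
proof (rule ccontr)
  assume no: "\<not> ?thesis"
  have orb_e: "orbit G \<phi> e = {e}"
    using e orbit_refl[of e] by (auto simp: orbit_def)
  have disj: "X \<inter> Y = {}" if "X \<in> orbits G E \<phi>" "Y \<in> orbits G E \<phi>" "X \<noteq> Y" for X Y
    using disjoint_union that by blast
  have cover: "\<Union>(orbits G E \<phi>) = E" by (rule orbits_coverture)
  then have finO: "finite (orbits G E \<phi>)" using fin finite_UnionD by metis
  have "card E = sum card (orbits G E \<phi>)"
  proof -
    have "card (\<Union>(orbits G E \<phi>)) = sum card (orbits G E \<phi>)"
    proof (rule card_Union_disjoint)
      show "pairwise disjnt (orbits G E \<phi>)" using disj by (auto simp: pairwise_def disjnt_def)
      show "\<And>A. A \<in> orbits G E \<phi> \<Longrightarrow> finite A" using cover fin by (metis Union_upper finite_subset)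
    qed
    then show ?thesis using cover by simp
  qed
  also have "\<dots> = card (orbit G \<phi> e) + sum card (orbits G E \<phi> - {orbit G \<phi> e})"
    by (rule sum.remove[OF finO]) (use e in \<open>auto simp: orbits_def\<close>)
  finally have card_E: "card E = 1 + sum card (orbits G E \<phi> - {orbit G \<phi> e})" by (simp add: orb_e)
  \<comment> \<open>Orbit sizes divide p^k. An orbit of size 1 would be a second fixed point, so all
    orbits but that of \<open>e\<close> contribute multiples of \<open>p\<close> and
    \<open>card E\<close> is 1 modulo \<open>p\<close>.\<close>
  have "p dvd card X" if X: "X \<in> orbits G E \<phi> - {orbit G \<phi> e}" for X
  proof -
    obtain x where x: "x \<in> E" "X = orbit G \<phi> x" using X by (auto simp: orbits_def)
    have "x \<noteq> e" using X x by auto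
    then obtain g where g: "g \<in> carrier G" "\<phi> g x \<noteq> x" using no x by blast
    have "card X dvd p ^ k"
      using orbit_stabilizer_theorem[OF x(1)] x ord by (metis dvd_triv_left)
    then obtain i where i: "card X = p ^ i" using p by (meson divides_primepow_nat)
    have "finite X" using cover fin X by (metis DiffD1 Union_upper finite_subset)
    moreover have "{x, \<phi> g x} \<subseteq> X" using g x orbit_refl by (auto simp: orbit_def)
    ultimately have "card {x, \<phi> g x} \<le> card X" by (rule card_mono)
    then have "i \<noteq> 0" using g i by (auto intro!: Nat.gr0I)
    then show ?thesis using i by simp
  qed
  then have "p dvd sum card (orbits G E \<phi> - {orbit G \<phi> e})" by (rule dvd_sum)
  then have "p dvd 1" using dvd card_E by (metis dvd_add_left_iff)
  then show False using p not_prime_unit by auto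
qed

text \<open>Right multiplication by \<open>inv g\<close> is a left action, as a homomorphism into
  \<open>BijGroup\<close> requires.\<close>

lemma (in group) rcosets_action:
  assumes "subgroup M G"
  shows "group_action G (rcosets M) (\<lambda>g. \<lambda>X\<in>rcosets M. X #> inv g)"
proof -
  interpret M: subgroup M G by fact
  have closed: "X #> g \<in> rcosets M" if "X \<in> rcosets M" "g \<in> carrier G" for X g
    using that M.subset by (auto simp: RCOSETS_def coset_mult_assoc)
  have sub: "X \<subseteq> carrier G" if "X \<in> rcosets M" for X
    using that M.rcosets_carrier by simp
  have "(\<lambda>X\<in>rcosets M. X #> inv g) \<in> Bij (rcosets M)" if g: "g \<in> carrier G" for g
  proof -
    have "bij_betw (\<lambda>X. X #> inv g) (rcosets M) (rcosets M)"
      by (rule bij_betw_byWitness[where f' = "\<lambda>X. X #> g"])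
        (use g closed sub in \<open>auto simp: coset_mult_assoc\<close>)
    then show ?thesis by (simp add: Bij_def)
  qed
  then show ?thesis
    unfolding group_action_def group_hom_def group_hom_axioms_def hom_def
    using closed sub group_BijGroup[of "rcosets M"]
    by (auto simp: BijGroup_def compose_def coset_mult_assoc inv_mult_group intro!: restrict_ext)
qed

text \<open>Let \<open>M\<close> act on its right cosets. Their number is a positive power of
  \<open>p\<close> and \<open>M\<close> is fixed, so a second coset \<open>M #> b\<close> is fixed
  as well, which says that b M b^{-1} is contained in \<open>M\<close>.\<close>

lemma (in group) proper_subgroup_p_group_normalizes_more:
  assumes p: "Factorial_Ring.prime p" and ord: "order G = p ^ k"
    and M: "subgroup M G" "M \<noteq> carrier G"
  shows "\<exists>g\<in>carrier G - M. \<forall>m\<in>M. g \<otimes> m \<otimes> inv g \<in> M"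
proof -
  interpret M: subgroup M G by fact
  have fin: "finite (carrier G)"
    using ord p by (metis order_gt_0_iff_finite prime_gt_0_nat zero_less_power)
  let ?\<phi> = "\<lambda>g. \<lambda>X\<in>rcosets M. X #> inv g"
  interpret A: group_action "G\<lparr>carrier := M\<rparr>" "rcosets M" ?\<phi>
    by (rule group_action.induced_action[OF rcosets_action[OF M(1)] M(1)])
  have lag: "card (rcosets M) * card M = p ^ k" using lagrange[OF M(1)] ord by simp
  obtain i where i: "card M = p ^ i" using lag p by (metis divides_primepow_nat dvd_triv_right)
  obtain j where j: "card (rcosets M) = p ^ j" using lag p by (metis divides_primepow_nat dvd_triv_left)
  have "j \<noteq> 0"
  proof
    assume "j = 0"
    then have "card M = card (carrier G)" using lag j ord by (simp add: order_def)
    then show False using M card_subset_eq[OF fin M.subset] by simp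
  qed
  have Min: "M \<in> rcosets M" by (rule M.subgroup_in_rcosets[OF is_group])
  have "\<exists>X\<in>rcosets M. X \<noteq> M \<and> (\<forall>g\<in>carrier (G\<lparr>carrier := M\<rparr>). ?\<phi> g X = X)"
  proof (rule A.p_group_fixed_point[OF p])
    show "order (G\<lparr>carrier := M\<rparr>) = p ^ i" using i by (simp add: order_def)
    show "finite (rcosets M)" using j p by (metis card.infinite prime_gt_0_nat less_numeral_extra(3) zero_less_power)
    show "p dvd card (rcosets M)" using j \<open>j \<noteq> 0\<close> by simp
    show "?\<phi> g M = M" if "g \<in> carrier (G\<lparr>carrier := M\<rparr>)" for g
      using that Min by (simp add: coset_join2 M(1))
  qed (rule Min)
  then obtain X where X: "X \<in> rcosets M" "X \<noteq> M" "\<And>g. g \<in> M \<Longrightarrow> X #> inv g = X" by auto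
  then obtain b where b: "b \<in> carrier G" "X = M #> b" by (auto simp: RCOSETS_def)
  have "b \<notin> M" using X b by (metis coset_join2 M(1))
  moreover have "b \<otimes> m \<otimes> inv b \<in> M" if m: "m \<in> M" for m
  proof -
    have "M #> (b \<otimes> m) = M #> b"
      using X(3)[of "inv m"] m b M.subset by (simp add: coset_mult_assoc)
    then have "b \<otimes> m \<in> M #> b" using b m M.subset rcos_self[OF _ M(1), of "b \<otimes> m"] by auto
    then obtain n where n: "n \<in> M" "b \<otimes> m = n \<otimes> b" by (auto simp: r_coset_def)
    then have "b \<otimes> m \<otimes> inv b = n" using b by (simp add: m_assoc)
    then show ?thesis using n by simp
  qed
  ultimately show ?thesis using b by blast
qed

text \<open>A proper subgroup of a finite p-group is killed by a nonzero homomorphism to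
  \<open>\<int>/p\<close>, since a maximal subgroup is normal of index \<open>p\<close>.\<close>

lemma (in group) p_group_hom_killing_subgroup:
  assumes p: "Factorial_Ring.prime p" and ord: "order G = p ^ k"
    and D: "subgroup D G" "D \<noteq> carrier G"
  shows "\<exists>f :: 'a \<Rightarrow> int. (\<forall>x\<in>carrier G. \<forall>y\<in>carrier G. [f (x \<otimes> y) = f x + f y] (mod int p)) \<and>
           (\<forall>x\<in>D. f x = 0) \<and> (\<exists>x\<in>carrier G. f x = 1)"
proof -
  have fin: "finite (carrier G)"
    using ord p by (metis order_gt_0_iff_finite prime_gt_0_nat zero_less_power)
  let ?S = "{M. subgroup M G \<and> M \<noteq> carrier G \<and> D \<subseteq> M}"
  have "finite ?S" by (rule finite_subset[of _ "Pow (carrier G)"]) (use fin subgroup.subset in auto)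
  moreover have "D \<in> ?S" using D by auto
  ultimately obtain M where M: "M \<in> ?S" and maxM: "\<And>N. N \<in> ?S \<Longrightarrow> M \<subseteq> N \<Longrightarrow> M = N"
    using finite_has_maximal[of ?S] by (metis (no_types, lifting) empty_iff)
  then have sM: "subgroup M G" and neM: "M \<noteq> carrier G" and DM: "D \<subseteq> M" by auto
  interpret M: subgroup M G by fact
  \<comment> \<open>The normaliser of \<open>M\<close>; both conjugation conditions are demanded so
    that closure under inverses is immediate.\<close>
  define N where "N = {g \<in> carrier G. \<forall>m\<in>M. g \<otimes> m \<otimes> inv g \<in> M \<and> inv g \<otimes> m \<otimes> g \<in> M}"
  obtain g where g: "g \<in> carrier G - M" "\<And>m. m \<in> M \<Longrightarrow> g \<otimes> m \<otimes> inv g \<in> M"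
    using proper_subgroup_p_group_normalizes_more[OF p ord sM neM] by blast
  have sN: "subgroup N G"
  proof (rule subgroupI)
    show "N \<subseteq> carrier G" by (auto simp: N_def)
    show "N \<noteq> {}" by (auto simp: N_def intro!: exI[of _ \<one>] M.mem_carrier)
    fix a assume a: "a \<in> N"
    then show "inv a \<in> N" by (auto simp: N_def)
    fix b assume b: "b \<in> N"
    have ab: "a \<in> carrier G" "b \<in> carrier G" using a b by (auto simp: N_def)
    show "a \<otimes> b \<in> N" unfolding N_def
    proof (intro CollectI conjI ballI)
      fix m assume m: "m \<in> M"
      have "(a \<otimes> b) \<otimes> m \<otimes> inv (a \<otimes> b) = a \<otimes> (b \<otimes> m \<otimes> inv b) \<otimes> inv a"
        using ab m by (simp add: m_assoc inv_mult_group)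
      then show "(a \<otimes> b) \<otimes> m \<otimes> inv (a \<otimes> b) \<in> M" using a b m by (auto simp: N_def)
      have "inv (a \<otimes> b) \<otimes> m \<otimes> (a \<otimes> b) = inv b \<otimes> (inv a \<otimes> m \<otimes> a) \<otimes> b"
        using ab m by (simp add: m_assoc inv_mult_group)
      then show "inv (a \<otimes> b) \<otimes> m \<otimes> (a \<otimes> b) \<in> M" using a b m by (auto simp: N_def)
    qed (use ab in auto)
  qed
  have MN: "M \<subseteq> N" by (auto simp: N_def)
  have gN: "g \<in> N"
  proof -
    \<comment> \<open>Conjugation is injective, so on the finite set \<open>M\<close> the inclusion
      of g M g^{-1} in \<open>M\<close> is an equality.\<close>
    let ?c = "\<lambda>m. g \<otimes> m \<otimes> inv g"
    have "?c ` M = M"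
    proof (rule card_subset_eq)
      show "finite M" using fin M.subset finite_subset by blast
      show "?c ` M \<subseteq> M" using g by auto
      show "card (?c ` M) = card M" by (rule card_image) (use g in \<open>auto simp: inj_on_def\<close>)
    qed
    then have "inv g \<otimes> m \<otimes> g \<in> M" if m: "m \<in> M" for m
    proof -
      obtain n where n: "n \<in> M" "m = g \<otimes> n \<otimes> inv g" using \<open>?c ` M = M\<close> m by auto
      have "inv g \<otimes> m \<otimes> g = n" using n g by (simp add: m_assoc inv_solve_left')
      then show ?thesis using n by simp
    qed
    then show ?thesis using g by (auto simp: N_def)
  qed
  have "N = carrier G" using maxM[of N] sN MN gN g DM by blast
  then have normM: "M \<lhd> G" using sM unfolding normal_inv_iff by (auto simp: N_def)
  interpret M: normal M G by fact
  interpret Q: group "G Mod M" by (rule M.factorgroup_is_group)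
  have carrQ: "carrier (G Mod M) = rcosets M" by (simp add: FactGroup_def)
  have "card (rcosets M) * card M = p ^ k" using lagrange[OF sM] ord by simp
  then obtain j where j: "order (G Mod M) = p ^ j"
    using p by (metis divides_primepow_nat dvd_triv_left carrQ order_def)
  have oneQ: "\<one>\<^bsub>G Mod M\<^esub> = M" by simp
  have gQ: "M #> g \<in> carrier (G Mod M)" using g by (auto simp: carrQ RCOSETS_def)
  have gM: "M #> g \<noteq> M" using g by (metis DiffD1 DiffD2 rcos_self sM)
  obtain l where l: "Q.ord (M #> g) = p ^ l"
    using Q.ord_dvd_group_order[OF gQ] j p by (metis divides_primepow_nat)
  have "l \<noteq> 0" using l gM Q.ord_eq_1[OF gQ] oneQ by (metis power_0)
  then obtain l' where l': "l = Suc l'" by (cases l) auto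
  \<comment> \<open>\<open>M #> g\<close> has order p^(l'+1) in the quotient, so the coset of this
    power of \<open>g\<close> has order exactly \<open>p\<close>.\<close>
  define b where "b = g [^] (p ^ l')"
  have b: "b \<in> carrier G" using g by (simp add: b_def)
  have Mb: "M #> b = (M #> g) [^]\<^bsub>G Mod M\<^esub> (p ^ l')"
    using g M.FactGroup_pow[of g "p ^ l'"] by (simp add: b_def)
  have ordb: "Q.ord (M #> b) = p"
    unfolding Mb using Q.ord_pow_gen[OF gQ, of "p ^ l'"] l l' p by (simp add: gcd_nat.absorb2 prime_gt_0_nat)
  have bQ: "M #> b \<in> carrier (G Mod M)" using b by (auto simp: carrQ RCOSETS_def)
  have Mbi: "M #> (b [^] i) = (M #> b) [^]\<^bsub>G Mod M\<^esub> i" for i :: nat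
    using b M.FactGroup_pow[of b i] by simp
  have bM: "b [^] i \<in> M \<longleftrightarrow> p dvd i" for i :: nat
  proof -
    have "b [^] i \<in> M \<longleftrightarrow> M #> (b [^] i) = M"
      using b by (metis coset_join1 coset_join2 nat_pow_closed sM M.subset)
    also have "\<dots> \<longleftrightarrow> (M #> b) [^]\<^bsub>G Mod M\<^esub> i = \<one>\<^bsub>G Mod M\<^esub>" by (simp add: Mbi)
    also have "\<dots> \<longleftrightarrow> p dvd i" using Q.pow_eq_id[OF bQ] ordb by simp
    finally show ?thesis .
  qed
  \<comment> \<open>The preimage of the cyclic group generated by \<open>M #> b\<close>. It strictly
    contains \<open>M\<close>, so by maximality it is everything: the quotient is cyclic of order
    \<open>p\<close>.\<close>
  define N' where "N' = {x \<in> carrier G. \<exists>i::nat. M #> x = M #> (b [^] i)}"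
  have "subgroup N' G"
  proof (rule subgroupI)
    show "N' \<subseteq> carrier G" by (auto simp: N'_def)
    show "N' \<noteq> {}" using b by (auto simp: N'_def)
    fix x assume x: "x \<in> N'"
    then obtain i :: nat where i: "x \<in> carrier G" "M #> x = M #> (b [^] i)" by (auto simp: N'_def)
    define X where "X = M #> b"
    have "i * (p - 1) + i = p * i" using p by (cases p) (auto simp: algebra_simps)
    then have "X [^]\<^bsub>G Mod M\<^esub> (i * (p - 1)) \<otimes>\<^bsub>G Mod M\<^esub> X [^]\<^bsub>G Mod M\<^esub> i = \<one>\<^bsub>G Mod M\<^esub>"
      using bQ Q.pow_eq_id[OF bQ, of "p * i"] ordb unfolding X_def by (simp add: Q.nat_pow_mult del: mult_FactGroup one_FactGroup)
    then have "inv\<^bsub>G Mod M\<^esub> (X [^]\<^bsub>G Mod M\<^esub> i) = X [^]\<^bsub>G Mod M\<^esub> (i * (p - 1))"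
      using bQ unfolding X_def by (intro Q.inv_equality) auto
    moreover have "inv\<^bsub>G Mod M\<^esub> (M #> x) = M #> inv x"
      using M.inv_FactGroup[of "M #> x"] M.rcos_inv[OF i(1)] i by (auto simp: carrQ RCOSETS_def)
    ultimately have "M #> inv x = M #> (b [^] (i * (p - 1)))"
      using i Mbi unfolding X_def by metis
    then show "inv x \<in> N'" using i by (auto simp: N'_def)
    fix y assume y: "y \<in> N'"
    then obtain j :: nat where j: "y \<in> carrier G" "M #> y = M #> (b [^] j)" by (auto simp: N'_def)
    have "M #> (x \<otimes> y) = M #> (b [^] (i + j))"
      using i j b M.rcos_sum[of x y] M.rcos_sum[of "b [^] i" "b [^] j"] by (simp add: nat_pow_mult)
    then show "x \<otimes> y \<in> N'" using i j by (auto simp: N'_def)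
  qed
  moreover have "M \<subseteq> N'"
  proof
    fix x assume x: "x \<in> M"
    have "M #> x = M #> (b [^] (0::nat))" using x by (simp add: coset_join2 M(1) sM)
    then show "x \<in> N'" using x M.subset unfolding N'_def by blast
  qed
  moreover have "b \<in> N'" using b by (auto simp: N'_def intro!: exI[of _ 1])
  moreover have "b \<notin> M" using bM[of 1] b p by (simp add: prime_nat_iff)
  ultimately have N': "N' = carrier G" using maxM[of N'] DM by blast
  \<comment> \<open>A discrete logarithm to the base \<open>M #> b\<close>. The chosen exponent is
    well defined only modulo \<open>p\<close>, by \<open>uniq\<close>.\<close>
  define f where "f x = int (SOME i. M #> x = M #> (b [^] (i::nat)))" for x
  have f: "M #> x = M #> (b [^] nat (f x))" if "x \<in> carrier G" for x
    using that N' someI_ex[of "\<lambda>i. M #> x = M #> (b [^] (i::nat))"] by (auto simp: f_def N'_def)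
  have fpos: "f x \<ge> 0" for x by (simp add: f_def)
  have uniq: "[int i = int j] (mod int p)" if "M #> (b [^] i) = M #> (b [^] j)" for i j :: nat
    using that Q.int_pow_eq[OF bQ, of "int i" "int j"] ordb Mbi
    by (simp add: int_pow_int cong_iff_dvd_diff dvd_diff_commute)
  have hom: "[f (x \<otimes> y) = f x + f y] (mod int p)" if "x \<in> carrier G" "y \<in> carrier G" for x y
  proof -
    have "M #> (b [^] nat (f (x \<otimes> y))) = M #> (b [^] (nat (f x) + nat (f y)))"
      using that f[of x] f[of y] f[of "x \<otimes> y"] b M.rcos_sum[of x y] M.rcos_sum[of "b [^] nat (f x)" "b [^] nat (f y)"]
      by (simp add: nat_pow_mult)
    from uniq[OF this] show ?thesis using fpos by simp
  qed
  have D0: "[f x = 0] (mod int p)" if "x \<in> D" for x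
  proof -
    have "x \<in> M" using that DM by auto
    then have "M #> (b [^] nat (f x)) = M #> (b [^] (0::nat))"
      using f[of x] M.subset by (auto simp: coset_join2 sM)
    from uniq[OF this] show ?thesis using fpos by simp
  qed
  have b1: "[f b = 1] (mod int p)"
  proof -
    have "M #> (b [^] nat (f b)) = M #> (b [^] (1::nat))" using f[of b] b by simp
    from uniq[OF this] show ?thesis using fpos by simp
  qed
  show ?thesis
  proof (intro exI[of _ "\<lambda>x. f x mod int p"] conjI ballI)
    fix x y assume "x \<in> carrier G" "y \<in> carrier G"
    then show "[f (x \<otimes> y) mod int p = f x mod int p + f y mod int p] (mod int p)"
      using hom by (simp add: cong_def mod_simps)
  next
    fix x assume "x \<in> D" then show "f x mod int p = 0" using D0 by (simp add: cong_def)
  next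
    show "\<exists>x\<in>carrier G. f x mod int p = 1"
      using b b1 prime_gt_1_nat[OF p] by (intro bexI[of _ b]) (simp_all add: cong_def)
  qed
qed

section \<open>Pro-p groups\<close>

text \<open>Zorn's lemma for reverse inclusion, obtained by passing to set complements.\<close>

lemma minimal_member_of_family:
  assumes ne: "\<A> \<noteq> {}" and chain: "\<And>\<C>. \<C> \<noteq> {} \<Longrightarrow> \<C> \<subseteq> \<A> \<Longrightarrow> (\<And>A B. A \<in> \<C> \<Longrightarrow> B \<in> \<C> \<Longrightarrow> A \<subseteq> B \<or> B \<subseteq> A) \<Longrightarrow> \<Inter>\<C> \<in> \<A>"
  shows "\<exists>M\<in>\<A>. \<forall>A\<in>\<A>. A \<subseteq> M \<longrightarrow> A = M"
proof -
  have "\<exists>M\<in>uminus ` \<A>. \<forall>X\<in>uminus ` \<A>. M \<subseteq> X \<longrightarrow> X = M"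
  proof (rule subset_Zorn)
    fix \<C> assume C: "subset.chain (uminus ` \<A>) \<C>"
    show "\<exists>U\<in>uminus ` \<A>. \<forall>X\<in>\<C>. X \<subseteq> U"
    proof (cases "\<C> = {}")
      case True
      then show ?thesis using ne by auto
    next
      case False
      have sub: "uminus ` \<C> \<subseteq> \<A>" using C by (auto simp: subset_chain_def)
      have "A \<subseteq> B \<or> B \<subseteq> A" if AB: "A \<in> uminus ` \<C>" "B \<in> uminus ` \<C>" for A B
      proof -
        obtain X Y where "X \<in> \<C>" "Y \<in> \<C>" "A = - X" "B = - Y" using AB by blast
        moreover have "X \<subseteq> Y \<or> Y \<subseteq> X" using C calculation by (auto simp: subset_chain_def)
        ultimately show ?thesis by auto
      qed
      then have "\<Inter>(uminus ` \<C>) \<in> \<A>"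
        using False sub by (intro chain) auto
      then have "- \<Inter>(uminus ` \<C>) \<in> uminus ` \<A>" by blast
      moreover have "X \<subseteq> - \<Inter>(uminus ` \<C>)" if "X \<in> \<C>" for X using that by auto
      ultimately show ?thesis by blast
    qed
  qed
  then show ?thesis by auto
qed

text \<open>Otherwise the sets C - W are nonempty, closed and nested, and compactness gives them a
  common point. With \<open>W\<close> empty this says that nested nonempty closed sets have a common
  point.\<close>

lemma compact_space_chain_Inter_subset_open:
  assumes "compact_space X" "\<C> \<noteq> {}" and chain: "\<And>A B. A \<in> \<C> \<Longrightarrow> B \<in> \<C> \<Longrightarrow> A \<subseteq> B \<or> B \<subseteq> A"
    and closed: "\<And>C. C \<in> \<C> \<Longrightarrow> closedin X C" and W: "openin X W" "\<Inter>\<C> \<subseteq> W"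
  shows "\<exists>C\<in>\<C>. C \<subseteq> W"
proof (rule ccontr)
  assume no: "\<not> ?thesis"
  have "\<Inter>((\<lambda>C. C - W) ` \<C>) \<noteq> {}"
  proof (rule assms(1)[unfolded compact_space_fip, rule_format], intro conjI allI impI ballI)
    fix A assume "A \<in> (\<lambda>C. C - W) ` \<C>"
    then show "closedin X A" using closed W by auto
  next
    fix \<F> assume "finite \<F> \<and> \<F> \<subseteq> (\<lambda>C. C - W) ` \<C>"
    then obtain \<D> where D: "finite \<D>" "\<D> \<subseteq> \<C>" "\<F> = (\<lambda>C. C - W) ` \<D>"
      by (meson finite_subset_image)
    have "\<exists>C\<in>\<C>. \<forall>D\<in>\<D>. C \<subseteq> D"
      using D(1,2)
    proof (induction \<D>)
      case empty
      then show ?case using \<open>\<C> \<noteq> {}\<close> by auto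
    next
      case (insert A \<D>)
      then obtain C where C: "C \<in> \<C>" "\<And>D. D \<in> \<D> \<Longrightarrow> C \<subseteq> D" by auto
      have A: "A \<in> \<C>" using insert.prems by simp
      show ?case
      proof (cases "A \<subseteq> C")
        case True
        then show ?thesis using A C by (intro bexI[of _ A]) auto
      next
        case False
        then show ?thesis using A C chain[OF A C(1)] by (intro bexI[of _ C]) auto
      qed
    qed
    then obtain C where "C \<in> \<C>" "\<forall>D\<in>\<D>. C \<subseteq> D" by blast
    moreover obtain x where "x \<in> C - W" using no calculation(1) by blast
    ultimately have "x \<in> \<Inter>\<F>" unfolding D(3) by auto
    then show "\<Inter>\<F> \<noteq> {}" by auto
  qed
  then show False using W \<open>\<C> \<noteq> {}\<close> by blast
qed

lemma (in group) inv_mult_cancel [simp]: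
  assumes "x \<in> carrier G" "y \<in> carrier G"
  shows "inv x \<otimes> (x \<otimes> y) = y" "x \<otimes> (inv x \<otimes> y) = y"
  using assms by (simp_all flip: m_assoc)

section \<open>Open normal subgroups and closed subgroups of a pro-p group\<close>

locale pro_p = group G for G (structure) +
  fixes p :: nat and T
  assumes p: "Factorial_Ring.prime p" and pro_p: "pro_p_group p G T"
begin

lemma p_gt_1: "p > 1" using p prime_gt_1_nat by blast

lemma topspace [simp]: "topspace T = carrier G"
  and compact: "compact_space T" and Hausdorff: "Hausdorff_space T"
  and cont_mult: "continuous_map (prod_topology T T) T (\<lambda>(x, y). x \<otimes> y)"
  and cont_inv: "continuous_map T T (\<lambda>x. inv x)"
  using pro_p by (auto simp: pro_p_group_def profinite_group_def topological_group_def)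

lemma continuous_map_mult [continuous_intros]:
  assumes "continuous_map X T f" "continuous_map X T g"
  shows "continuous_map X T (\<lambda>x. f x \<otimes> g x)"
  using continuous_map_compose[OF continuous_map_pairedI[OF assms] cont_mult] by (simp add: o_def)

lemma continuous_map_inv [continuous_intros]:
  assumes "continuous_map X T f"
  shows "continuous_map X T (\<lambda>x. inv f x)"
  using continuous_map_compose[OF assms cont_inv] by (simp add: o_def)

definition open_normal :: "'a set \<Rightarrow> bool" where
  "open_normal N \<longleftrightarrow> N \<lhd> G \<and> openin T N"

text \<open>\<open>profinite_group\<close> supplies open subgroups \<open>M\<close>. Their normal
  core is open because, by compactness, one neighbourhood \<open>W\<close> of the identity has all
  its conjugates in \<open>M\<close>.\<close>

lemma open_normal_nbhd:
  assumes "openin T U" "\<one> \<in> U"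
  shows "\<exists>N. open_normal N \<and> N \<subseteq> U"
proof -
  obtain M where M: "subgroup M G" "openin T M" "M \<subseteq> U"
    using pro_p assms unfolding pro_p_group_def profinite_group_def by blast
  interpret M: subgroup M G by fact
  define N where "N = {x \<in> carrier G. \<forall>g\<in>carrier G. g \<otimes> x \<otimes> inv g \<in> M}"
  have c: "continuous_map (prod_topology T T) T (\<lambda>z. fst z \<otimes> snd z \<otimes> inv (fst z))"
    by (intro continuous_intros)
  have op: "openin (prod_topology T T) {z \<in> topspace (prod_topology T T). fst z \<otimes> snd z \<otimes> inv (fst z) \<in> M}"
    using openin_continuous_map_preimage[OF c M(2)] .
  obtain W where W: "openin T W" "\<one> \<in> W"
     and sub: "carrier G \<times> W \<subseteq> {z \<in> topspace (prod_topology T T). fst z \<otimes> snd z \<otimes> inv (fst z) \<in> M}"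
  proof -
    have "\<exists>U V. openin T U \<and> openin T V \<and> carrier G \<subseteq> U \<and> \<one> \<in> V \<and>
       U \<times> V \<subseteq> {z \<in> topspace (prod_topology T T). fst z \<otimes> snd z \<otimes> inv (fst z) \<in> M}"
      by (rule tube_lemma_left[OF op]) (use compact in \<open>auto simp: compact_space_def\<close>)
    then show ?thesis using that by blast
  qed
  have sN: "subgroup N G"
  proof (rule subgroupI)
    show "N \<subseteq> carrier G" by (auto simp: N_def)
    show "N \<noteq> {}" by (auto simp: N_def intro!: exI[of _ \<one>])
    fix a assume a: "a \<in> N"
    have "g \<otimes> inv a \<otimes> inv g = inv (g \<otimes> a \<otimes> inv g)" if "g \<in> carrier G" for g
      using a that by (auto simp: N_def inv_mult_group m_assoc)
    then show "inv a \<in> N" using a by (auto simp: N_def)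
    fix b assume b: "b \<in> N"
    have "g \<otimes> (a \<otimes> b) \<otimes> inv g = (g \<otimes> a \<otimes> inv g) \<otimes> (g \<otimes> b \<otimes> inv g)" if "g \<in> carrier G" for g
      using a b that by (auto simp: N_def inv_solve_left m_assoc)
    then show "a \<otimes> b \<in> N" using a b by (auto simp: N_def)
  qed
  have "N \<lhd> G"
    unfolding normal_inv_iff
  proof (intro conjI ballI sN)
    fix x h assume xh: "x \<in> carrier G" "h \<in> N"
    have "g \<otimes> (x \<otimes> h \<otimes> inv x) \<otimes> inv g = (g \<otimes> x) \<otimes> h \<otimes> inv (g \<otimes> x)" if "g \<in> carrier G" for g
      using xh that by (auto simp: N_def inv_mult_group m_assoc)
    then show "x \<otimes> h \<otimes> inv x \<in> N" using xh by (auto simp: N_def)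
  qed
  moreover have "openin T N"
  proof (subst openin_subopen, intro ballI)
    fix x assume x: "x \<in> N"
    then have xc: "x \<in> carrier G" by (auto simp: N_def)
    have WN: "W \<subseteq> N"
      using sub openin_subset[OF W(1)] by (auto simp: N_def)
    have "openin T {y \<in> topspace T. inv x \<otimes> y \<in> W}"
      by (rule openin_continuous_map_preimage[OF _ W(1)]) (use xc in \<open>intro continuous_intros; simp\<close>)
    moreover have "x \<in> {y \<in> topspace T. inv x \<otimes> y \<in> W}" using xc W by simp
    moreover have "{y \<in> topspace T. inv x \<otimes> y \<in> W} \<subseteq> N"
    proof
      fix y assume y: "y \<in> {y \<in> topspace T. inv x \<otimes> y \<in> W}"
      then have "x \<otimes> (inv x \<otimes> y) \<in> N" using WN x subgroup.m_closed[OF sN] by blast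
      then show "y \<in> N" using y xc by (simp add: inv_solve_left m_assoc[symmetric])
    qed
    ultimately show "\<exists>S. openin T S \<and> x \<in> S \<and> S \<subseteq> N" by blast
  qed
  moreover have "N \<subseteq> U"
  proof
    fix x assume "x \<in> N"
    then have "\<one> \<otimes> x \<otimes> inv \<one> \<in> M" "x \<in> carrier G" unfolding N_def by blast+
    then show "x \<in> U" using M by auto
  qed
  ultimately show ?thesis by (auto simp: open_normal_def)
qed

lemma open_normalD:
  assumes "open_normal N"
  shows "N \<lhd> G" "subgroup N G" "openin T N" "N \<subseteq> carrier G" "\<one> \<in> N"
    "\<And>x y. x \<in> N \<Longrightarrow> y \<in> N \<Longrightarrow> x \<otimes> y \<in> N" "\<And>x. x \<in> N \<Longrightarrow> inv x \<in> N"
    "\<And>g x. g \<in> carrier G \<Longrightarrow> x \<in> N \<Longrightarrow> g \<otimes> x \<otimes> inv g \<in> N"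
    "\<And>g x. g \<in> carrier G \<Longrightarrow> x \<in> N \<Longrightarrow> inv g \<otimes> x \<otimes> g \<in> N"
  using assms normal_imp_subgroup[of N G] subgroup.subset[of N G] subgroup.one_closed[of N G]
    subgroup.m_closed[of N G] subgroup.m_inv_closed[of N G] normal.inv_op_closed2[of N G] normal.inv_op_closed1[of N G]
  by (auto simp: open_normal_def)

lemma open_normal_Int: "open_normal M \<Longrightarrow> open_normal N \<Longrightarrow> open_normal (M \<inter> N)"
  using normal_subgroup_intersect by (auto simp: open_normal_def)

lemma open_normal_carrier: "open_normal (carrier G)"
  using openin_topspace[of T] by (auto simp: open_normal_def normal_inv_iff subgroup_self)

lemma open_normal_Inter:
  "finite \<N> \<Longrightarrow> (\<And>N. N \<in> \<N> \<Longrightarrow> open_normal N) \<Longrightarrow> open_normal (carrier G \<inter> \<Inter>\<N>)"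
proof (induction \<N> rule: finite_induct)
  case empty
  then show ?case using open_normal_carrier by simp
next
  case (insert N \<N>)
  have "carrier G \<inter> \<Inter>(insert N \<N>) = N \<inter> (carrier G \<inter> \<Inter>\<N>)" by auto
  then show ?case using insert open_normal_Int by (metis insertCI)
qed

lemma open_coset:
  assumes "openin T U" "x \<in> carrier G"
  shows "openin T {y \<in> carrier G. inv x \<otimes> y \<in> U}"
proof -
  have "openin T {y \<in> topspace T. inv x \<otimes> y \<in> U}"
    by (rule openin_continuous_map_preimage[OF _ assms(1)]) (use assms in \<open>intro continuous_intros; simp\<close>)
  then show ?thesis by simp
qed

lemma open_nbhd_contains_coset:
  assumes "openin T U" "x \<in> U"
  shows "\<exists>N. open_normal N \<and> (\<forall>y\<in>carrier G. inv x \<otimes> y \<in> N \<longrightarrow> y \<in> U)"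
proof -
  have x: "x \<in> carrier G" using openin_subset[OF assms(1)] assms(2) by auto
  have "openin T {y \<in> topspace T. x \<otimes> y \<in> U}"
    by (rule openin_continuous_map_preimage[OF _ assms(1)]) (use x in \<open>intro continuous_intros; simp\<close>)
  moreover have "\<one> \<in> {y \<in> topspace T. x \<otimes> y \<in> U}" using x assms by simp
  ultimately obtain N where N: "open_normal N" "N \<subseteq> {y \<in> topspace T. x \<otimes> y \<in> U}"
    using open_normal_nbhd by blast
  have "y \<in> U" if "y \<in> carrier G" "inv x \<otimes> y \<in> N" for y
  proof -
    have "x \<otimes> (inv x \<otimes> y) \<in> U" using N that by blast
    then show ?thesis using x that by (simp add: m_assoc[symmetric])
  qed
  then show ?thesis using N by blast
qed

lemma open_normal_order: "open_normal N \<Longrightarrow> \<exists>k. order (G Mod N) = p ^ k"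
  using pro_p by (auto simp: open_normal_def pro_p_group_def)

text \<open>The exponent depends on \<open>N\<close> only; this uniformity is what makes powers with
  \<open>p\<close>-adic exponents converge.\<close>

lemma open_normal_pow:
  assumes "open_normal N"
  shows "\<exists>k. \<forall>x\<in>carrier G. x [^] (p ^ k) \<in> N"
proof -
  interpret N: normal N G using open_normalD[OF assms] by simp
  interpret Q: group "G Mod N" by (rule N.factorgroup_is_group)
  obtain k where k: "order (G Mod N) = p ^ k" using open_normal_order[OF assms] by blast
  have "x [^] (p ^ k) \<in> N" if x: "x \<in> carrier G" for x
  proof -
    have "N #> x [^] (p ^ k) = N"
      using Q.pow_order_eq_1[of "N #> x"] x k N.FactGroup_pow[of x "p ^ k"] by (auto simp: FactGroup_def RCOSETS_def)
    then show ?thesis using x by (metis coset_join1 N.subset nat_pow_closed N.subgroup_axioms)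
  qed
  then show ?thesis by blast
qed

lemma closed_subgroupD:
  assumes "closed_subgroup C G T"
  shows "subgroup C G" "closedin T C" "C \<subseteq> carrier G" "\<one> \<in> C"
    "\<And>x y. x \<in> C \<Longrightarrow> y \<in> C \<Longrightarrow> x \<otimes> y \<in> C" "\<And>x. x \<in> C \<Longrightarrow> inv x \<in> C" "\<And>x. x \<in> C \<Longrightarrow> x \<in> carrier G"
  using assms subgroup.subset[of C G] subgroup.one_closed[of C G] subgroup.m_closed[of C G] subgroup.m_inv_closed[of C G]
  by (auto simp: closed_subgroup_def)

lemma closed_subgroup_pow: "closed_subgroup C G T \<Longrightarrow> x \<in> C \<Longrightarrow> x [^] (n::nat) \<in> C"
  using closed_subgroupD(4,5) by (induction n) auto

lemma closed_subgroup_separation: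
  assumes "closedin T C" "x \<in> carrier G" "x \<notin> C"
  shows "\<exists>N. open_normal N \<and> (\<forall>y\<in>C. inv x \<otimes> y \<notin> N)"
proof -
  have "openin T (topspace T - C)" using assms(1) by blast
  then show ?thesis using open_nbhd_contains_coset[of "topspace T - C" x] assms closedin_subset[OF assms(1)] by auto
qed

lemma open_normal_separation:
  assumes "x \<in> carrier G" "x \<noteq> \<one>"
  shows "\<exists>N. open_normal N \<and> x \<notin> N"
proof -
  have "closedin T {\<one>}" using Hausdorff by (simp add: closedin_Hausdorff_singleton)
  from closed_subgroup_separation[OF this assms(1)] assms
  obtain N where "open_normal N" "inv x \<notin> N" by auto
  then show ?thesis using open_normalD(7) assms by blast
qed

lemma closed_subgroup_Int:
  "closed_subgroup C G T \<Longrightarrow> closed_subgroup D G T \<Longrightarrow> closed_subgroup (C \<inter> D) G T"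
  by (simp add: closed_subgroup_def subgroups_Inter_pair closedin_Int)

lemma closed_subgroup_Inter:
  "\<C> \<noteq> {} \<Longrightarrow> (\<And>C. C \<in> \<C> \<Longrightarrow> closed_subgroup C G T) \<Longrightarrow> closed_subgroup (\<Inter>\<C>) G T"
  by (simp add: closed_subgroup_def subgroups_Inter closedin_Inter)

text \<open>Local constancy with one open normal subgroup for the whole of \<open>C\<close>. For
  closed \<open>C\<close> this is continuity into a discrete space, and it turns continuity
  arguments into congruences modulo \<open>N\<close>.\<close>

definition loc_const :: "'a set \<Rightarrow> ('a \<Rightarrow> 'c) \<Rightarrow> bool" where
  "loc_const C f \<longleftrightarrow> (\<exists>N. open_normal N \<and> (\<forall>x\<in>C. \<forall>y\<in>C. inv x \<otimes> y \<in> N \<longrightarrow> f x = f y))"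

lemma loc_const_subset: "loc_const C f \<Longrightarrow> D \<subseteq> C \<Longrightarrow> loc_const D f"
  unfolding loc_const_def by blast

lemma loc_const_comp: "loc_const C f \<Longrightarrow> loc_const C (\<lambda>x. h (f x))"
  unfolding loc_const_def by metis

lemma loc_const_const: "loc_const C (\<lambda>x. c)"
  using open_normal_carrier unfolding loc_const_def by blast

lemma loc_const_comp2:
  assumes "loc_const C f" "loc_const C g"
  shows "loc_const C (\<lambda>x. h (f x) (g x))"
proof -
  obtain M where M: "open_normal M" "\<And>x y. x \<in> C \<Longrightarrow> y \<in> C \<Longrightarrow> inv x \<otimes> y \<in> M \<Longrightarrow> f x = f y"
    using assms(1) by (auto simp: loc_const_def)
  obtain N where N: "open_normal N" "\<And>x y. x \<in> C \<Longrightarrow> y \<in> C \<Longrightarrow> inv x \<otimes> y \<in> N \<Longrightarrow> g x = g y"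
    using assms(2) by (auto simp: loc_const_def)
  show ?thesis unfolding loc_const_def
    using open_normal_Int[OF M(1) N(1)] M(2) N(2) by (metis IntE)
qed

lemma loc_const_translate:
  assumes "loc_const C f" "\<And>x. x \<in> D \<Longrightarrow> a \<otimes> x \<otimes> b \<in> C" "a \<in> carrier G" "b \<in> carrier G" "D \<subseteq> carrier G"
  shows "loc_const D (\<lambda>x. f (a \<otimes> x \<otimes> b))"
proof -
  obtain N where N: "open_normal N" "\<And>x y. x \<in> C \<Longrightarrow> y \<in> C \<Longrightarrow> inv x \<otimes> y \<in> N \<Longrightarrow> f x = f y"
    using assms(1) by (auto simp: loc_const_def)
  have "f (a \<otimes> x \<otimes> b) = f (a \<otimes> y \<otimes> b)" if xy: "x \<in> D" "y \<in> D" "inv x \<otimes> y \<in> N" for x y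
  proof (rule N(2))
    have c: "x \<in> carrier G" "y \<in> carrier G" using xy assms by auto
    have "inv (a \<otimes> x \<otimes> b) \<otimes> (a \<otimes> y \<otimes> b) = inv b \<otimes> (inv x \<otimes> y) \<otimes> b"
      using c assms by (simp add: inv_mult_group m_assoc)
    then show "inv (a \<otimes> x \<otimes> b) \<otimes> (a \<otimes> y \<otimes> b) \<in> N" using open_normalD(9)[OF N(1)] assms xy by simp
  qed (use xy assms in auto)
  then show ?thesis using N(1) unfolding loc_const_def by blast
qed

lemma loc_const_imp_continuous:
  assumes "loc_const C f" "C \<subseteq> carrier G"
  shows "continuous_map (subtopology T C) (discrete_topology UNIV) f"
proof -
  obtain N where N: "open_normal N" "\<And>x y. x \<in> C \<Longrightarrow> y \<in> C \<Longrightarrow> inv x \<otimes> y \<in> N \<Longrightarrow> f x = f y"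
    using assms(1) by (auto simp: loc_const_def)
  have "openin (subtopology T C) {x \<in> topspace (subtopology T C). f x \<in> U}" for U
  proof (subst openin_subopen, intro ballI)
    fix x assume x: "x \<in> {x \<in> topspace (subtopology T C). f x \<in> U}"
    then have xc: "x \<in> C" "x \<in> carrier G" by auto
    have "openin (subtopology T C) (C \<inter> {y \<in> carrier G. inv x \<otimes> y \<in> N})"
      using open_coset[OF open_normalD(3)[OF N(1)] xc(2)] by (simp add: openin_subtopology_Int2)
    moreover have "x \<in> C \<inter> {y \<in> carrier G. inv x \<otimes> y \<in> N}" using xc open_normalD(5)[OF N(1)] by simp
    moreover have "C \<inter> {y \<in> carrier G. inv x \<otimes> y \<in> N} \<subseteq> {x \<in> topspace (subtopology T C). f x \<in> U}"
      using N(2)[OF xc(1)] x by auto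
    ultimately show "\<exists>S. openin (subtopology T C) S \<and> x \<in> S \<and> S \<subseteq> {x \<in> topspace (subtopology T C). f x \<in> U}"
      by blast
  qed
  then show ?thesis by (auto simp: continuous_map)
qed

text \<open>Compactness of \<open>C\<close>: finitely many cosets s N(s) cover it, and the
  intersection of these N(s) serves everywhere.\<close>

lemma continuous_imp_loc_const:
  assumes "closedin T C" and f: "continuous_map (subtopology T C) (discrete_topology UNIV) f"
  shows "loc_const C f"
proof -
  have C: "C \<subseteq> carrier G" using closedin_subset[OF assms(1)] by simp
  have "\<exists>N. open_normal N \<and> (\<forall>y\<in>C. inv x \<otimes> y \<in> N \<longrightarrow> f y = f x)" if x: "x \<in> C" for x
  proof -
    have "openin (subtopology T C) {y \<in> topspace (subtopology T C). f y \<in> {f x}}"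
      by (rule openin_continuous_map_preimage[OF f]) simp
    then obtain V where V: "openin T V" "{y \<in> topspace (subtopology T C). f y \<in> {f x}} = V \<inter> C"
      by (auto simp: openin_subtopology)
    then have "x \<in> V" using x C by auto
    then obtain N where N: "open_normal N" "\<And>y. y \<in> carrier G \<Longrightarrow> inv x \<otimes> y \<in> N \<Longrightarrow> y \<in> V"
      using open_nbhd_contains_coset[OF V(1)] by blast
    have "f y = f x" if "y \<in> C" "inv x \<otimes> y \<in> N" for y
      using N(2)[of y] that C V(2) by auto
    then show ?thesis using N(1) by blast
  qed
  then have "\<forall>x\<in>C. \<exists>N. open_normal N \<and> (\<forall>y\<in>C. inv x \<otimes> y \<in> N \<longrightarrow> f y = f x)" by blast
  from bchoice[OF this] obtain N where N: "\<And>x. x \<in> C \<Longrightarrow> open_normal (N x)"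
     "\<And>x y. x \<in> C \<Longrightarrow> y \<in> C \<Longrightarrow> inv x \<otimes> y \<in> N x \<Longrightarrow> f y = f x" by blast
  let ?\<U> = "(\<lambda>x. {y \<in> carrier G. inv x \<otimes> y \<in> N x}) ` C"
  have comp: "compactin T C" using compact assms(1) by (simp add: closedin_compact_space)
  have op: "openin T U" if "U \<in> ?\<U>" for U
    using that open_coset N C open_normalD(3) by auto
  have "C \<subseteq> \<Union>((\<lambda>x. {y \<in> carrier G. inv x \<otimes> y \<in> N x}) ` C)"
  proof
    fix x assume "x \<in> C"
    then show "x \<in> \<Union>((\<lambda>x. {y \<in> carrier G. inv x \<otimes> y \<in> N x}) ` C)"
      using C open_normalD(5)[OF N(1)] by (intro UN_I[of x]) auto
  qed
  from compactinD[OF comp op this] obtain \<F> where F: "finite \<F>" "\<F> \<subseteq> ?\<U>" "C \<subseteq> \<Union>\<F>"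
    by blast
  then obtain S where S: "finite S" "S \<subseteq> C" "\<F> = (\<lambda>x. {y \<in> carrier G. inv x \<otimes> y \<in> N x}) ` S"
    by (meson finite_subset_image)
  define M where "M = carrier G \<inter> \<Inter>(N ` S)"
  have M: "open_normal M" unfolding M_def by (rule open_normal_Inter) (use S N in auto)
  have "f x = f y" if xy: "x \<in> C" "y \<in> C" "inv x \<otimes> y \<in> M" for x y
  proof -
    obtain s where s: "s \<in> S" "inv s \<otimes> x \<in> N s" using F S xy by blast
    have "inv s \<otimes> y = (inv s \<otimes> x) \<otimes> (inv x \<otimes> y)"
      using xy C S s by (subst m_assoc) (auto simp: m_assoc[symmetric] subset_iff)
    then have "inv s \<otimes> y \<in> N s"
      using s xy S N(1)[of s] open_normalD(6)[of "N s"] by (auto simp: M_def)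
    then show ?thesis using N(2)[of s] s xy S by (metis subsetD)
  qed
  then show ?thesis using M unfolding loc_const_def by blast
qed

text \<open>A continuous homomorphism to Z/p, represented by an integer-valued function so that
  representatives can be lifted, combined and divided. It is locally constant as an integer
  function, while additivity holds modulo \<open>p\<close> only.\<close>

definition fp_hom :: "'a set \<Rightarrow> ('a \<Rightarrow> int) \<Rightarrow> bool" where
  "fp_hom C f \<longleftrightarrow> loc_const C f \<and> (\<forall>x\<in>C. \<forall>y\<in>C. [f (x \<otimes> y) = f x + f y] (mod int p))"

text \<open>A point of \<open>B\<close> outside \<open>D\<close> stays outside the image of
  \<open>D\<close> in some finite quotient G/N, where the statement for finite
  \<open>p\<close>-groups applies to the images of \<open>B\<close> and \<open>D\<close>.\<close>

lemma exists_fp_hom_killing_closed_subgroup: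
  assumes B: "closed_subgroup B G T" and D: "closed_subgroup D G T" and ne: "D \<subseteq> B" "D \<noteq> B"
  shows "\<exists>f. fp_hom B f \<and> (\<forall>x\<in>D. f x = 0) \<and> (\<exists>x\<in>B. f x = 1)"
proof -
  obtain b where b: "b \<in> B" "b \<notin> D" using ne by blast
  then have bc: "b \<in> carrier G" using closed_subgroupD[OF B] by auto
  obtain N where N: "open_normal N" "\<And>y. y \<in> D \<Longrightarrow> inv b \<otimes> y \<notin> N"
    using closed_subgroup_separation[OF closed_subgroupD(2)[OF D] bc b(2)] by blast
  interpret N: normal N G using open_normalD[OF N(1)] by simp
  interpret Q: group "G Mod N" by (rule N.factorgroup_is_group)
  obtain k where k: "order (G Mod N) = p ^ k" using open_normal_order[OF N(1)] by blast
  have h: "group_hom G (G Mod N) (\<lambda>x. N #> x)"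
    by (simp add: group_hom_def group_hom_axioms_def N.r_coset_hom_Mod Q.is_group)
  define \<pi> where "\<pi> x = N #> x" for x
  interpret \<pi>: group_hom G "G Mod N" \<pi> using h unfolding \<pi>_def .
  have sB: "subgroup (\<pi> ` B) (G Mod N)" and sD: "subgroup (\<pi> ` D) (G Mod N)"
    using \<pi>.subgroup_img_is_subgroup closed_subgroupD(1) B D by blast+
  let ?P = "(G Mod N)\<lparr>carrier := \<pi> ` B\<rparr>"
  interpret P: group ?P by (rule Q.subgroup_imp_group[OF sB])
  have "card (\<pi> ` B) dvd p ^ k" using Q.lagrange[OF sB] k by (metis dvd_triv_right)
  then obtain j where j: "order ?P = p ^ j" using p by (auto simp: order_def divides_primepow_nat)
  have sD': "subgroup (\<pi> ` D) ?P"
    using Q.subgroup_incl[OF sD sB] ne by auto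
  have "\<pi> b \<notin> \<pi> ` D"
  proof
    assume "\<pi> b \<in> \<pi> ` D"
    then obtain d where d: "d \<in> D" "N #> b = N #> d" by (auto simp: \<pi>_def)
    have dc: "d \<in> carrier G" using d closed_subgroupD(7)[OF D] by auto
    have "d \<in> N #> b" using d dc rcos_self[OF dc N.subgroup_axioms] by simp
    then have "d \<otimes> inv b \<in> N" using dc bc N.rcos_module by simp
    then have "inv b \<otimes> (d \<otimes> inv b) \<otimes> b \<in> N" using open_normalD(9)[OF N(1)] bc by blast
    then show False using N(2)[OF d(1)] bc dc by (simp add: m_assoc)
  qed
  then have neP: "\<pi> ` D \<noteq> carrier ?P" using b by auto
  obtain f where f: "\<And>x y. x \<in> \<pi> ` B \<Longrightarrow> y \<in> \<pi> ` B \<Longrightarrow> [f (x \<otimes>\<^bsub>G Mod N\<^esub> y) = f x + f y] (mod int p)"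
     "\<And>x. x \<in> \<pi> ` D \<Longrightarrow> f x = (0::int)" "\<exists>x\<in>\<pi> ` B. f x = 1"
    using P.p_group_hom_killing_subgroup[OF p j sD' neP] by auto
  have "fp_hom B (\<lambda>x. f (\<pi> x))"
    unfolding fp_hom_def
  proof (intro conjI ballI)
    have "\<pi> x = \<pi> y" if "x \<in> B" "y \<in> B" "inv x \<otimes> y \<in> N" for x y
    proof -
      have c: "x \<in> carrier G" "y \<in> carrier G" using that closed_subgroupD[OF B] by auto
      have "x \<otimes> (inv x \<otimes> y) \<otimes> inv x \<in> N" using open_normalD(8)[OF N(1)] c that by blast
      then have "y \<otimes> inv x \<in> N" using c by (simp add: m_assoc[symmetric])
      then show ?thesis unfolding \<pi>_def using c N.subgroup_axioms
        by (metis N.rcos_module repr_independence is_group)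
    qed
    then show "loc_const B (\<lambda>x. f (\<pi> x))" unfolding loc_const_def using N(1) by metis
    fix x y assume "x \<in> B" "y \<in> B"
    then show "[f (\<pi> (x \<otimes> y)) = f (\<pi> x) + f (\<pi> y)] (mod int p)"
      using f(1)[of "\<pi> x" "\<pi> y"] closed_subgroupD(7)[OF B] by simp
  qed
  then show ?thesis using f(2,3) by auto
qed

text \<open>The Burnside basis theorem in dual form: a proper closed subgroup of \<open>B\<close>
  containing \<open>S\<close> would be killed by a nonzero homomorphism, so under \<open>h\<close>
  the set \<open>S\<close> generates \<open>B\<close> topologically.\<close>

lemma fp_homs_detect_generation:
  assumes B: "closed_subgroup B G T" and D: "closed_subgroup D G T" and S: "S \<subseteq> B" "S \<subseteq> D"
    and h: "\<And>f. fp_hom B f \<Longrightarrow> (\<forall>s\<in>S. f s = 0) \<Longrightarrow> (\<forall>x\<in>B. [f x = 0] (mod int p))"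
  shows "B \<subseteq> D"
proof (rule ccontr)
  assume "\<not> B \<subseteq> D"
  then have "B \<inter> D \<noteq> B" by blast
  then obtain f where f: "fp_hom B f" "\<forall>x\<in>B \<inter> D. f x = 0" "\<exists>x\<in>B. f x = 1"
    using exists_fp_hom_killing_closed_subgroup[OF B closed_subgroup_Int[OF B D]] by blast
  then have "[1 = 0] (mod int p)" using h[OF f(1)] S by force
  then show False using p_gt_1 by (simp add: cong_def)
qed

end

section \<open>Cochains and p-adic integers\<close>

text \<open>Tuples of explicit length, which turn \<open>differential\<close> in degrees 0, 1 and 2
  into the formulas \<open>d0\<close>, \<open>d1\<close> and \<open>d2\<close>.\<close>

definition tup :: "'x list \<Rightarrow> nat \<Rightarrow> 'x" where
  "tup xs = (\<lambda>j\<in>{..<length xs}. xs ! j)"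

lemma tup_nth [simp]: "tup [a] 0 = a" "tup [a, b] 0 = a" "tup [a, b] (Suc 0) = b"
    "tup [a, b, c] 0 = a" "tup [a, b, c] (Suc 0) = b" "tup [a, b, c] (Suc (Suc 0)) = c"
  by (simp_all add: tup_def)

lemma tup_in_tuples [simp]:
  "tup [] \<in> tuples \<Gamma> 0"
  "tup [a] \<in> tuples \<Gamma> (Suc 0) \<longleftrightarrow> a \<in> carrier \<Gamma>"
  "tup [a, b] \<in> tuples \<Gamma> (Suc (Suc 0)) \<longleftrightarrow> a \<in> carrier \<Gamma> \<and> b \<in> carrier \<Gamma>"
  "tup [a, b, c] \<in> tuples \<Gamma> (Suc (Suc (Suc 0))) \<longleftrightarrow> a \<in> carrier \<Gamma> \<and> b \<in> carrier \<Gamma> \<and> c \<in> carrier \<Gamma>"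
  by (auto simp: tup_def PiE_iff extensional_def lessThan_Suc)

lemma tuples_cases:
  "x \<in> tuples \<Gamma> 0 \<Longrightarrow> x = tup []"
  "x \<in> tuples \<Gamma> (Suc 0) \<Longrightarrow> \<exists>a\<in>carrier \<Gamma>. x = tup [a]"
  "x \<in> tuples \<Gamma> (Suc (Suc 0)) \<Longrightarrow> \<exists>a\<in>carrier \<Gamma>. \<exists>b\<in>carrier \<Gamma>. x = tup [a, b]"
  "x \<in> tuples \<Gamma> (Suc (Suc (Suc 0))) \<Longrightarrow> \<exists>a\<in>carrier \<Gamma>. \<exists>b\<in>carrier \<Gamma>. \<exists>c\<in>carrier \<Gamma>. x = tup [a, b, c]"
proof -
  show "x \<in> tuples \<Gamma> 0 \<Longrightarrow> x = tup []" by (auto simp: tup_def)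
  show "\<exists>a\<in>carrier \<Gamma>. x = tup [a]" if x: "x \<in> tuples \<Gamma> (Suc 0)"
  proof (rule bexI)
    show c: "x 0 \<in> carrier \<Gamma>" using PiE_mem[OF x] by simp
    show "x = tup [x 0]" by (rule PiE_ext[OF x]) (use c in \<open>auto simp: less_Suc_eq\<close>)
  qed
  show "\<exists>a\<in>carrier \<Gamma>. \<exists>b\<in>carrier \<Gamma>. x = tup [a, b]" if x: "x \<in> tuples \<Gamma> (Suc (Suc 0))"
  proof -
    have c: "x 0 \<in> carrier \<Gamma>" "x (Suc 0) \<in> carrier \<Gamma>" using PiE_mem[OF x] by simp_all
    have "x = tup [x 0, x (Suc 0)]" by (rule PiE_ext[OF x]) (use c in \<open>auto simp: less_Suc_eq\<close>)
    then show ?thesis using c by blast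
  qed
  show "\<exists>a\<in>carrier \<Gamma>. \<exists>b\<in>carrier \<Gamma>. \<exists>c\<in>carrier \<Gamma>. x = tup [a, b, c]" if x: "x \<in> tuples \<Gamma> (Suc (Suc (Suc 0)))"
  proof -
    have c: "x 0 \<in> carrier \<Gamma>" "x (Suc 0) \<in> carrier \<Gamma>" "x (Suc (Suc 0)) \<in> carrier \<Gamma>" using PiE_mem[OF x] by simp_all
    have "x = tup [x 0, x (Suc 0), x (Suc (Suc 0))]" by (rule PiE_ext[OF x]) (use c in \<open>auto simp: less_Suc_eq\<close>)
    then show ?thesis using c by blast
  qed
qed

lemma tup_manip:
  "restrict (tup [a]) {..<0} = tup []" "(\<lambda>j\<in>{..<0}. tup [a] (Suc j)) = tup []"
  "restrict (tup [a, b]) {..<Suc 0} = tup [a]" "(\<lambda>j\<in>{..<Suc 0}. tup [a, b] (Suc j)) = tup [b]"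
  "restrict (tup [a, b, c]) {..<Suc (Suc 0)} = tup [a, b]" "(\<lambda>j\<in>{..<Suc (Suc 0)}. tup [a, b, c] (Suc j)) = tup [b, c]"
  "contract_at \<Gamma> (Suc 0) 0 (tup [a, b]) = tup [a \<otimes>\<^bsub>\<Gamma>\<^esub> b]"
  "contract_at \<Gamma> (Suc (Suc 0)) 0 (tup [a, b, c]) = tup [a \<otimes>\<^bsub>\<Gamma>\<^esub> b, c]"
  "contract_at \<Gamma> (Suc (Suc 0)) (Suc 0) (tup [a, b, c]) = tup [a, b \<otimes>\<^bsub>\<Gamma>\<^esub> c]"
  by (auto simp: tup_def contract_at_def fun_eq_iff less_Suc_eq)

locale coefficient_module = \<Gamma>: group \<Gamma> + M: abelian_group M for \<Gamma> (structure) and M (structure) +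
  fixes act
  assumes act_closed [simp]: "x \<in> carrier \<Gamma> \<Longrightarrow> m \<in> carrier M \<Longrightarrow> act x m \<in> carrier M"
    and act_add: "x \<in> carrier \<Gamma> \<Longrightarrow> m \<in> carrier M \<Longrightarrow> m' \<in> carrier M \<Longrightarrow> act x (m \<oplus>\<^bsub>M\<^esub> m') = act x m \<oplus>\<^bsub>M\<^esub> act x m'"
begin

abbreviation d where "d \<equiv> differential \<Gamma> M act"

lemma neg_one_mult [simp]: "m \<in> carrier M \<Longrightarrow> [(- 1 :: int)] \<cdot>\<^bsub>M\<^esub> m = \<ominus>\<^bsub>M\<^esub> m"
  using M.add.int_pow_neg[of m 1] M.add.int_pow_1[of m] by simp

lemma finsum_lessThan:
  "finsum M f {..<0::nat} = \<zero>\<^bsub>M\<^esub>"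
  "f 0 \<in> carrier M \<Longrightarrow> finsum M f {..<Suc 0} = f 0"
  "f 0 \<in> carrier M \<Longrightarrow> f (Suc 0) \<in> carrier M \<Longrightarrow> finsum M f {..<Suc (Suc 0)} = f (Suc 0) \<oplus>\<^bsub>M\<^esub> f 0"
  by (simp_all add: lessThan_Suc)

lemma d0:
  assumes "f (tup []) \<in> carrier M" "a \<in> carrier \<Gamma>"
  shows "d 0 f (tup [a]) = act a (f (tup [])) \<oplus>\<^bsub>M\<^esub> \<ominus>\<^bsub>M\<^esub> f (tup [])"
  using assms by (simp add: differential_def tup_manip finsum_lessThan del: lessThan_0 M.finsum_empty)

lemma d1:
  assumes "\<And>a. a \<in> carrier \<Gamma> \<Longrightarrow> f (tup [a]) \<in> carrier M" "a \<in> carrier \<Gamma>" "b \<in> carrier \<Gamma>"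
  shows "d (Suc 0) f (tup [a, b]) = act a (f (tup [b])) \<oplus>\<^bsub>M\<^esub> \<ominus>\<^bsub>M\<^esub> f (tup [a \<otimes>\<^bsub>\<Gamma>\<^esub> b]) \<oplus>\<^bsub>M\<^esub> f (tup [a])"
  using assms by (simp add: differential_def tup_manip finsum_lessThan)

lemma d2:
  assumes "\<And>a b. a \<in> carrier \<Gamma> \<Longrightarrow> b \<in> carrier \<Gamma> \<Longrightarrow> f (tup [a, b]) \<in> carrier M"
    "a \<in> carrier \<Gamma>" "b \<in> carrier \<Gamma>" "c \<in> carrier \<Gamma>"
  shows "d (Suc (Suc 0)) f (tup [a, b, c]) =
    act a (f (tup [b, c])) \<oplus>\<^bsub>M\<^esub> (f (tup [a, b \<otimes>\<^bsub>\<Gamma>\<^esub> c]) \<oplus>\<^bsub>M\<^esub> \<ominus>\<^bsub>M\<^esub> f (tup [a \<otimes>\<^bsub>\<Gamma>\<^esub> b, c])) \<oplus>\<^bsub>M\<^esub> \<ominus>\<^bsub>M\<^esub> f (tup [a, b])"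
  using assms by (simp add: differential_def tup_manip finsum_lessThan)

end

section \<open>The ring of p-adic integers as compatible sequences of residues\<close>

lemma padic_carrier:
  "x \<in> carrier (padic_int_ring p) \<longleftrightarrow> (\<forall>n. x n \<in> {0..<int p ^ n} \<and> x (Suc n) mod int p ^ n = x n)"
  by (simp add: padic_int_ring_def)

lemma padic_ops:
  "x \<otimes>\<^bsub>padic_int_ring p\<^esub> y = (\<lambda>n. (x n * y n) mod int p ^ n)"
  "x \<oplus>\<^bsub>padic_int_ring p\<^esub> y = (\<lambda>n. (x n + y n) mod int p ^ n)"
  "\<one>\<^bsub>padic_int_ring p\<^esub> = (\<lambda>n. 1 mod int p ^ n)"
  "\<zero>\<^bsub>padic_int_ring p\<^esub> = (\<lambda>n. 0)"
  by (simp_all add: padic_int_ring_def)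

lemma padic_carrierI:
  assumes "p > 0" "\<And>n. [x (Suc n) = x n] (mod int p ^ n)"
  shows "(\<lambda>n. x n mod int p ^ n) \<in> carrier (padic_int_ring p)"
proof -
  have "x (Suc n) mod int p ^ Suc n mod int p ^ n = x n mod int p ^ n" for n
    using assms(2)[of n] by (simp add: cong_def mod_mod_cancel)
  then show ?thesis using assms(1) by (auto simp: padic_carrier)
qed

lemma padic_carrierD:
  assumes "x \<in> carrier (padic_int_ring p)"
  shows "x n mod int p ^ n = x n" "[x (Suc n) = x n] (mod int p ^ n)" "0 \<le> x n"
  using assms by (auto simp: padic_carrier cong_def)

lemma padic_cong_le:
  assumes "x \<in> carrier (padic_int_ring p)" "m \<le> n"
  shows "[x n = x m] (mod int p ^ m)"
  using assms(2)
proof (induction n rule: dec_induct)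
  case (step n)
  have "[x (Suc n) = x n] (mod int p ^ m)"
    using padic_carrierD(2)[OF assms(1)] by (rule cong_dvd_modulus) (use step in \<open>simp add: le_imp_power_dvd\<close>)
  then show ?case using step.IH cong_trans by blast
qed simp

lemma padic_eqI:
  assumes "x \<in> carrier (padic_int_ring p)" "y \<in> carrier (padic_int_ring p)" "\<And>n. [x n = y n] (mod int p ^ n)"
  shows "x = y"
  using assms padic_carrierD(1)[of x p] padic_carrierD(1)[of y p] by (auto simp: cong_def fun_eq_iff)

lemma padic_add_closed:
  assumes "p > 0" "x \<in> carrier (padic_int_ring p)" "y \<in> carrier (padic_int_ring p)"
  shows "x \<oplus>\<^bsub>padic_int_ring p\<^esub> y \<in> carrier (padic_int_ring p)"
  unfolding padic_ops by (rule padic_carrierI[OF assms(1)]) (intro cong_add padic_carrierD assms)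

lemma padic_mult_closed:
  assumes "p > 0" "x \<in> carrier (padic_int_ring p)" "y \<in> carrier (padic_int_ring p)"
  shows "x \<otimes>\<^bsub>padic_int_ring p\<^esub> y \<in> carrier (padic_int_ring p)"
  unfolding padic_ops by (rule padic_carrierI[OF assms(1)]) (intro cong_mult padic_carrierD assms)

lemma padic_neg_closed:
  assumes "p > 0" "x \<in> carrier (padic_int_ring p)"
  shows "(\<lambda>n. (- x n) mod int p ^ n) \<in> carrier (padic_int_ring p)"
  by (rule padic_carrierI[OF assms(1)]) (simp add: cong_minus_minus_iff padic_carrierD assms)

lemma padic_one_closed: "p > 0 \<Longrightarrow> \<one>\<^bsub>padic_int_ring p\<^esub> \<in> carrier (padic_int_ring p)"
  unfolding padic_ops by (rule padic_carrierI) auto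

lemma cring_padic_int_ring:
  assumes "p > 0"
  shows "cring (padic_int_ring p)"
proof (rule cringI)
  show "abelian_group (padic_int_ring p)"
  proof (rule abelian_groupI)
    fix x y z assume xyz: "x \<in> carrier (padic_int_ring p)" "y \<in> carrier (padic_int_ring p)" "z \<in> carrier (padic_int_ring p)"
    show "x \<oplus>\<^bsub>padic_int_ring p\<^esub> y \<oplus>\<^bsub>padic_int_ring p\<^esub> z = x \<oplus>\<^bsub>padic_int_ring p\<^esub> (y \<oplus>\<^bsub>padic_int_ring p\<^esub> z)"
      by (simp add: padic_ops mod_simps add.assoc)
    show "x \<oplus>\<^bsub>padic_int_ring p\<^esub> y = y \<oplus>\<^bsub>padic_int_ring p\<^esub> x"
      by (simp add: padic_ops add.commute)
    show "\<exists>y\<in>carrier (padic_int_ring p). y \<oplus>\<^bsub>padic_int_ring p\<^esub> x = \<zero>\<^bsub>padic_int_ring p\<^esub>"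
      using padic_neg_closed[OF assms xyz(1)] by (rule bexI[rotated]) (simp add: padic_ops mod_simps)
    show "\<zero>\<^bsub>padic_int_ring p\<^esub> \<oplus>\<^bsub>padic_int_ring p\<^esub> x = x"
      using padic_carrierD(1)[OF xyz(1)] by (simp add: padic_ops)
    show "x \<oplus>\<^bsub>padic_int_ring p\<^esub> y \<in> carrier (padic_int_ring p)" by (rule padic_add_closed[OF assms xyz(1,2)])
  next
    show "\<zero>\<^bsub>padic_int_ring p\<^esub> \<in> carrier (padic_int_ring p)" using assms by (simp add: padic_ops padic_carrier)
  qed
  show "Group.comm_monoid (padic_int_ring p)"
  proof (rule comm_monoidI)
    fix x y z assume xyz: "x \<in> carrier (padic_int_ring p)" "y \<in> carrier (padic_int_ring p)" "z \<in> carrier (padic_int_ring p)"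
    show "x \<otimes>\<^bsub>padic_int_ring p\<^esub> y \<otimes>\<^bsub>padic_int_ring p\<^esub> z = x \<otimes>\<^bsub>padic_int_ring p\<^esub> (y \<otimes>\<^bsub>padic_int_ring p\<^esub> z)"
      by (simp add: padic_ops mod_simps mult.assoc)
    show "x \<otimes>\<^bsub>padic_int_ring p\<^esub> y = y \<otimes>\<^bsub>padic_int_ring p\<^esub> x"
      by (simp add: padic_ops mult.commute)
    show "\<one>\<^bsub>padic_int_ring p\<^esub> \<otimes>\<^bsub>padic_int_ring p\<^esub> x = x"
      using padic_carrierD(1)[OF xyz(1)] by (simp add: padic_ops mod_simps)
    show "x \<otimes>\<^bsub>padic_int_ring p\<^esub> y \<in> carrier (padic_int_ring p)" by (rule padic_mult_closed[OF assms xyz(1,2)])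
  next
    show "\<one>\<^bsub>padic_int_ring p\<^esub> \<in> carrier (padic_int_ring p)" by (rule padic_one_closed[OF assms])
  qed
  fix x y z
  show "(x \<oplus>\<^bsub>padic_int_ring p\<^esub> y) \<otimes>\<^bsub>padic_int_ring p\<^esub> z = x \<otimes>\<^bsub>padic_int_ring p\<^esub> z \<oplus>\<^bsub>padic_int_ring p\<^esub> y \<otimes>\<^bsub>padic_int_ring p\<^esub> z"
    by (simp add: padic_ops mod_simps distrib_right)
qed

lemma padic_a_inv:
  assumes "p > 0" "x \<in> carrier (padic_int_ring p)"
  shows "\<ominus>\<^bsub>padic_int_ring p\<^esub> x = (\<lambda>n. (- x n) mod int p ^ n)"
proof -
  interpret R: cring "padic_int_ring p" by (rule cring_padic_int_ring[OF assms(1)])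
  show ?thesis
    by (rule R.minus_equality) (use assms padic_neg_closed in \<open>auto simp: padic_ops mod_simps\<close>)
qed

lemma topspace_padic [simp]: "topspace (padic_int_topology p) = carrier (padic_int_ring p)"
  by (simp add: padic_int_topology_def)

lemma continuous_map_padic_iff:
  "continuous_map X (padic_int_topology p) f \<longleftrightarrow>
     f \<in> topspace X \<rightarrow> carrier (padic_int_ring p) \<and> (\<forall>n. continuous_map X (discrete_topology UNIV) (\<lambda>x. f x n))"
proof -
  have "f \<in> extensional UNIV" for f :: "nat \<Rightarrow> int" by (simp add: extensional_def)
  then show ?thesis
    by (auto simp: padic_int_topology_def continuous_map_in_subtopology continuous_map_componentwise Pi_iff image_subset_iff)
qed

lemma continuous_map_discrete_comp:
  assumes "continuous_map X (discrete_topology UNIV) f"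
  shows "continuous_map X (discrete_topology UNIV) (\<lambda>x. h (f x))"
  using continuous_map_compose[OF assms, of "discrete_topology UNIV" h] by (simp add: o_def)

lemma continuous_map_discrete_comp2:
  assumes "continuous_map X (discrete_topology UNIV) f" "continuous_map X (discrete_topology UNIV) g"
  shows "continuous_map X (discrete_topology UNIV) (\<lambda>x. h (f x) (g x))"
proof -
  have "continuous_map X (discrete_topology UNIV) (\<lambda>x. (f x, g x))"
    using continuous_map_pairedI[OF assms] by (simp flip: prod_topology_discrete_topology)
  from continuous_map_discrete_comp[OF this, of "\<lambda>(a, b). h a b"] show ?thesis by simp
qed

section \<open>Kummer lifting\<close>

lemma continuous_map_tup1:
  assumes "topspace X = A"
  shows "continuous_map X (product_topology (\<lambda>_. X) {..<Suc 0}) (\<lambda>x. tup [x])"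
  by (subst continuous_map_componentwise) (auto simp: tup_def extensional_def image_subset_iff)

section \<open>Groups of cochains, cocycles and coboundaries\<close>

context coefficient_module
begin

abbreviation maps where "maps n \<equiv> tuples \<Gamma> n \<rightarrow>\<^sub>E carrier M"

lemma cochain_mult_closed: "f \<in> maps n \<Longrightarrow> g \<in> maps n \<Longrightarrow> f \<otimes>\<^bsub>cochains \<Gamma> T\<Gamma> M TM n\<^esub> g \<in> maps n"
  by (auto simp: cochains_def PiE_iff)

lemma cochain_assoc:
  "f \<in> maps n \<Longrightarrow> g \<in> maps n \<Longrightarrow> h \<in> maps n \<Longrightarrow> (f \<otimes>\<^bsub>cochains \<Gamma> T\<Gamma> M TM n\<^esub> g) \<otimes>\<^bsub>cochains \<Gamma> T\<Gamma> M TM n\<^esub> h = f \<otimes>\<^bsub>cochains \<Gamma> T\<Gamma> M TM n\<^esub> (g \<otimes>\<^bsub>cochains \<Gamma> T\<Gamma> M TM n\<^esub> h)"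
  by (auto simp: cochains_def fun_eq_iff PiE_iff M.a_assoc)

lemma cochain_comm:
  "f \<in> maps n \<Longrightarrow> g \<in> maps n \<Longrightarrow> f \<otimes>\<^bsub>cochains \<Gamma> T\<Gamma> M TM n\<^esub> g = g \<otimes>\<^bsub>cochains \<Gamma> T\<Gamma> M TM n\<^esub> f"
  by (auto simp: cochains_def fun_eq_iff PiE_iff M.a_comm)

lemma cochain_one: "f \<in> maps n \<Longrightarrow> \<one>\<^bsub>cochains \<Gamma> T\<Gamma> M TM n\<^esub> \<otimes>\<^bsub>cochains \<Gamma> T\<Gamma> M TM n\<^esub> f = f" "f \<in> maps n \<Longrightarrow> f \<otimes>\<^bsub>cochains \<Gamma> T\<Gamma> M TM n\<^esub> \<one>\<^bsub>cochains \<Gamma> T\<Gamma> M TM n\<^esub> = f"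
  by (auto simp: cochains_def fun_eq_iff PiE_iff extensional_def)

lemma cochains_subset_maps:
  assumes "topspace T\<Gamma> = carrier \<Gamma>" "topspace TM = carrier M"
  shows "carrier (cochains \<Gamma> T\<Gamma> M TM n) \<subseteq> maps n"
  using assms by (auto simp: cochains_def continuous_map_def topspace_product_topology PiE_def)

lemma neg_cochain:
  assumes f: "f \<in> maps n"
  shows "(\<lambda>x\<in>tuples \<Gamma> n. \<ominus>\<^bsub>M\<^esub> f x) \<in> maps n"
    "(\<lambda>x\<in>tuples \<Gamma> n. \<ominus>\<^bsub>M\<^esub> f x) \<otimes>\<^bsub>cochains \<Gamma> T\<Gamma> M TM n\<^esub> f = \<one>\<^bsub>cochains \<Gamma> T\<Gamma> M TM n\<^esub>"
  using PiE_mem[OF f] by (auto simp: cochains_def M.l_neg intro!: restrict_ext)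

text \<open>All functions on tuples, continuous or not, form one ambient commutative group in each
  degree. Cocycles and coboundaries become subgroups of it, and coset arithmetic is carried out
  there.\<close>

lemma comm_group_maps: "comm_group (cochains \<Gamma> T\<Gamma> M TM n\<lparr>carrier := maps n\<rparr>)"
proof (rule comm_groupI)
  fix x assume "x \<in> carrier (cochains \<Gamma> T\<Gamma> M TM n\<lparr>carrier := maps n\<rparr>)"
  then show "\<exists>y\<in>carrier (cochains \<Gamma> T\<Gamma> M TM n\<lparr>carrier := maps n\<rparr>).
      y \<otimes>\<^bsub>cochains \<Gamma> T\<Gamma> M TM n\<lparr>carrier := maps n\<rparr>\<^esub> x = \<one>\<^bsub>cochains \<Gamma> T\<Gamma> M TM n\<lparr>carrier := maps n\<rparr>\<^esub>"
    using neg_cochain(1)[of x n] neg_cochain(2)[of x n T\<Gamma> TM]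
    by (intro bexI[of _ "\<lambda>t\<in>tuples \<Gamma> n. \<ominus>\<^bsub>M\<^esub> x t"]) simp_all
qed (use cochain_mult_closed cochain_assoc cochain_comm cochain_one in \<open>auto simp: cochains_def\<close>)

lemma arguments_in_tuples:
  assumes "x \<in> tuples \<Gamma> (Suc n)"
  shows "x 0 \<in> carrier \<Gamma>" "(\<lambda>j\<in>{..<n}. x (Suc j)) \<in> tuples \<Gamma> n" "restrict x {..<n} \<in> tuples \<Gamma> n"
    "i < n \<Longrightarrow> contract_at \<Gamma> n i x \<in> tuples \<Gamma> n"
  using PiE_mem[OF assms] by (auto simp: contract_at_def)

lemma differential_closed:
  assumes f: "f \<in> maps n"
  shows "d n f \<in> maps (Suc n)"
proof (rule PiE_I)
  fix x assume x: "x \<in> tuples \<Gamma> (Suc n)"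
  note a = arguments_in_tuples[OF x]
  show "d n f x \<in> carrier M"
    using x a PiE_mem[OF f] by (auto simp: differential_def intro!: M.finsum_closed)
qed (simp add: differential_def)

lemma differential_mult:
  assumes f: "f \<in> maps n" and g: "g \<in> maps n"
  shows "d n (f \<otimes>\<^bsub>cochains \<Gamma> T\<Gamma> M TM n\<^esub> g) = d n f \<otimes>\<^bsub>cochains \<Gamma> T\<Gamma> M TM (Suc n)\<^esub> d n g"
proof (rule extensionalityI)
  fix x assume x: "x \<in> tuples \<Gamma> (Suc n)"
  note a = arguments_in_tuples[OF x]
  let ?h = "f \<otimes>\<^bsub>cochains \<Gamma> T\<Gamma> M TM n\<^esub> g"
  let ?s = "\<lambda>u. finsum M (\<lambda>i. [((- 1) ^ Suc i :: int)] \<cdot>\<^bsub>M\<^esub> u (contract_at \<Gamma> n i x)) {..<n}"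
  have h: "?h t = f t \<oplus>\<^bsub>M\<^esub> g t" if "t \<in> tuples \<Gamma> n" for t using that by (simp add: cochains_def)
  have cl: "f t \<in> carrier M" "g t \<in> carrier M" if "t \<in> tuples \<Gamma> n" for t using that PiE_mem[OF f] PiE_mem[OF g] by auto
  have dist: "[k] \<cdot>\<^bsub>M\<^esub> (u \<oplus>\<^bsub>M\<^esub> v) = [k] \<cdot>\<^bsub>M\<^esub> u \<oplus>\<^bsub>M\<^esub> [k] \<cdot>\<^bsub>M\<^esub> v" if "u \<in> carrier M" "v \<in> carrier M" for u v and k :: int
    using M.add.int_pow_distrib[of u v k] that by simp
  have "?s ?h = finsum M (\<lambda>i. [((- 1) ^ Suc i :: int)] \<cdot>\<^bsub>M\<^esub> f (contract_at \<Gamma> n i x) \<oplus>\<^bsub>M\<^esub> [((- 1) ^ Suc i :: int)] \<cdot>\<^bsub>M\<^esub> g (contract_at \<Gamma> n i x)) {..<n}"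
    using a cl by (intro M.finsum_cong') (auto simp: h dist)
  also have "\<dots> = ?s f \<oplus>\<^bsub>M\<^esub> ?s g" using a cl by (intro M.finsum_addf) auto
  finally have s: "?s ?h = ?s f \<oplus>\<^bsub>M\<^esub> ?s g" .
  have sc: "?s f \<in> carrier M" "?s g \<in> carrier M" using a cl by (auto intro!: M.finsum_closed)
  have v: "d n u x = act (x 0) (u (\<lambda>j\<in>{..<n}. x (Suc j))) \<oplus>\<^bsub>M\<^esub> ?s u \<oplus>\<^bsub>M\<^esub> [((- 1) ^ Suc n :: int)] \<cdot>\<^bsub>M\<^esub> u (restrict x {..<n})" for u
    using x by (simp add: differential_def)
  have "d n ?h x = d n f x \<oplus>\<^bsub>M\<^esub> d n g x"
    unfolding v s using a cl sc by (simp add: h dist act_add M.a_ac)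
  then show "d n ?h x = (d n f \<otimes>\<^bsub>cochains \<Gamma> T\<Gamma> M TM (Suc n)\<^esub> d n g) x"
    using x by (simp add: cochains_def)
qed (simp_all add: differential_def cochains_def)

lemma subgroup_cocycles_coboundaries:
  assumes top: "topspace T\<Gamma> = carrier \<Gamma>" "topspace TM = carrier M"
    and add: "\<And>(n::nat) f g. continuous_map (product_topology (\<lambda>_. T\<Gamma>) {..<n}) TM f \<Longrightarrow>
       continuous_map (product_topology (\<lambda>_. T\<Gamma>) {..<n}) TM g \<Longrightarrow>
       continuous_map (product_topology (\<lambda>_. T\<Gamma>) {..<n}) TM (\<lambda>x. f x \<oplus>\<^bsub>M\<^esub> g x)"
    and neg: "\<And>(n::nat) f. continuous_map (product_topology (\<lambda>_. T\<Gamma>) {..<n}) TM f \<Longrightarrow>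
       continuous_map (product_topology (\<lambda>_. T\<Gamma>) {..<n}) TM (\<lambda>x. \<ominus>\<^bsub>M\<^esub> f x)"
  shows "subgroup (cocycles \<Gamma> T\<Gamma> M TM act n) (cochains \<Gamma> T\<Gamma> M TM n\<lparr>carrier := maps n\<rparr>)"
    "subgroup (coboundaries \<Gamma> T\<Gamma> M TM act n) (cochains \<Gamma> T\<Gamma> M TM n\<lparr>carrier := maps n\<rparr>)"
proof -
  let ?Mp = "\<lambda>n. cochains \<Gamma> T\<Gamma> M TM n\<lparr>carrier := maps n\<rparr>"
  have comm: "comm_group (?Mp n)" for n by (rule comm_group_maps)
  then have gr: "group (?Mp n)" for n by (rule comm_group.axioms)
  have sub: "carrier (cochains \<Gamma> T\<Gamma> M TM n) \<subseteq> maps n" for n using cochains_subset_maps[OF top] .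
  have cochains: "subgroup (carrier (cochains \<Gamma> T\<Gamma> M TM n)) (?Mp n)" for n
  proof (rule group.subgroupI[OF gr])
    have "continuous_map (product_topology (\<lambda>_. T\<Gamma>) {..<n}) TM (\<lambda>x\<in>tuples \<Gamma> n. \<zero>\<^bsub>M\<^esub>)"
      by (rule continuous_map_eq[of _ _ "\<lambda>_. \<zero>\<^bsub>M\<^esub>"]) (use top in simp_all)
    then show "carrier (cochains \<Gamma> T\<Gamma> M TM n) \<noteq> {}" by (auto simp: cochains_def)
    fix f assume f: "f \<in> carrier (cochains \<Gamma> T\<Gamma> M TM n)"
    have "continuous_map (product_topology (\<lambda>_. T\<Gamma>) {..<n}) TM (\<lambda>x\<in>tuples \<Gamma> n. \<ominus>\<^bsub>M\<^esub> f x)"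
      by (rule continuous_map_eq[OF neg[of n f]]) (use top f in \<open>simp_all add: cochains_def\<close>)
    moreover have "inv\<^bsub>?Mp n\<^esub> f = (\<lambda>x\<in>tuples \<Gamma> n. \<ominus>\<^bsub>M\<^esub> f x)"
      using f sub[of n] neg_cochain(1)[of f n] neg_cochain(2)[of f n T\<Gamma> TM]
      by (intro group.inv_equality[OF gr]) (simp_all add: subset_iff)
    ultimately show "inv\<^bsub>?Mp n\<^esub> f \<in> carrier (cochains \<Gamma> T\<Gamma> M TM n)" by (simp add: cochains_def)
    fix g assume g: "g \<in> carrier (cochains \<Gamma> T\<Gamma> M TM n)"
    have "continuous_map (product_topology (\<lambda>_. T\<Gamma>) {..<n}) TM (\<lambda>x\<in>tuples \<Gamma> n. f x \<oplus>\<^bsub>M\<^esub> g x)"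
      by (rule continuous_map_eq[OF add[of n f g]]) (use top f g in \<open>simp_all add: cochains_def\<close>)
    then show "f \<otimes>\<^bsub>?Mp n\<^esub> g \<in> carrier (cochains \<Gamma> T\<Gamma> M TM n)" by (simp add: cochains_def)
  qed (use sub in auto)
  have hom: "group_hom (?Mp n) (?Mp (Suc n)) (d n)" for n
    using gr differential_closed differential_mult[of _ n _ T\<Gamma> TM]
    by (auto simp: group_hom_def group_hom_axioms_def hom_def)
  have "cocycles \<Gamma> T\<Gamma> M TM act n = carrier (cochains \<Gamma> T\<Gamma> M TM n) \<inter> kernel (?Mp n) (?Mp (Suc n)) (d n)"
    using sub by (auto simp: cocycles_def kernel_def)
  then show "subgroup (cocycles \<Gamma> T\<Gamma> M TM act n) (?Mp n)"
    using group.subgroups_Inter_pair[OF gr cochains group_hom.subgroup_kernel[OF hom]] by simp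
  show "subgroup (coboundaries \<Gamma> T\<Gamma> M TM act n) (?Mp n)"
  proof (cases n)
    case 0
    then show ?thesis using group.triv_subgroup[OF gr, of 0] by (simp add: coboundaries_def)
  next
    case (Suc m)
    then show ?thesis using group_hom.subgroup_img_is_subgroup[OF hom cochains] by (simp add: coboundaries_def)
  qed
qed

end

section \<open>Orientations and twisted cocycles modulo powers of p\<close>

locale cyclo_oriented_group = group G for G (structure) +
  fixes p :: nat and T and \<theta> :: "'a \<Rightarrow> nat \<Rightarrow> int"
  assumes prime: "Factorial_Ring.prime p" and cyclo_oriented: "cyclo_oriented p G T \<theta>"
begin

sublocale pro_p G p T
  using prime cyclo_oriented by unfold_locales (auto simp: cyclo_oriented_def bloch_kato_group_def)

abbreviation "\<Z>\<^sub>p \<equiv> padic_int_ring p"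

sublocale Zp: cring \<Z>\<^sub>p using p_gt_1 by (intro cring_padic_int_ring) simp

lemma theta_hom: "\<theta> \<in> hom G (units_of \<Z>\<^sub>p)"
  and theta_continuous: "continuous_map T (subtopology (padic_int_topology p) (Units \<Z>\<^sub>p)) \<theta>"
  using cyclo_oriented by (auto simp: cyclo_oriented_def orientation_def)

lemma theta_closed [simp]: "x \<in> carrier G \<Longrightarrow> \<theta> x \<in> carrier \<Z>\<^sub>p"
  using theta_hom by (auto simp: hom_def units_of_def Units_def)

lemma theta_mult:
  assumes "x \<in> carrier G" "y \<in> carrier G"
  shows "\<theta> (x \<otimes> y) = \<theta> x \<otimes>\<^bsub>\<Z>\<^sub>p\<^esub> \<theta> y" "[\<theta> (x \<otimes> y) n = \<theta> x n * \<theta> y n] (mod int p ^ n)"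
  using theta_hom assms by (auto simp: hom_def units_of_def padic_ops)

lemma theta_one: "\<theta> \<one> = \<one>\<^bsub>\<Z>\<^sub>p\<^esub>" "[\<theta> \<one> n = 1] (mod int p ^ n)"
  using hom_one[OF theta_hom is_group Zp.units_group] by (auto simp: units_of_def padic_ops)

lemma theta_loc_const: "loc_const (carrier G) (\<lambda>x. \<theta> x n)"
proof (rule continuous_imp_loc_const)
  have "continuous_map T (padic_int_topology p) \<theta>" using theta_continuous continuous_map_in_subtopology by blast
  then show "continuous_map (subtopology T (carrier G)) (discrete_topology UNIV) (\<lambda>x. \<theta> x n)"
    by (metis continuous_map_padic_iff subtopology_topspace topspace)
  show "closedin T (carrier G)" using closedin_topspace[of T] by simp
qed

lemma theta_pow: "x \<in> carrier G \<Longrightarrow> [\<theta> (x [^] (m::nat)) n = \<theta> x n ^ m] (mod int p ^ n)"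
proof (induction m)
  case 0
  then show ?case using theta_one(2)[of n] by simp
next
  case (Suc m)
  have "[\<theta> (x [^] Suc m) n = \<theta> (x [^] m) n * \<theta> x n] (mod int p ^ n)"
    using theta_mult(2)[of "x [^] m" x] Suc.prems by simp
  also have "[\<theta> (x [^] m) n * \<theta> x n = \<theta> x n ^ m * \<theta> x n] (mod int p ^ n)"
    by (intro cong_mult Suc cong_refl)
  finally show ?case by (simp add: mult.commute)
qed

lemma fermat_pow: "[a ^ (p ^ k) = a] (mod int p)"
proof (induction k)
  case (Suc k)
  have fermat: "[b ^ p = b] (mod int p)" for b :: int
  proof (cases "int p dvd b")
    case True
    then have "int p dvd b ^ p" using p_gt_1 by (meson dvd_power dvd_trans less_trans zero_less_one)
    then show ?thesis using True by (simp add: cong_iff_dvd_diff dvd_diff)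
  next
    case False
    define c where "c = nat (b mod int p)"
    have c: "[int c = b] (mod int p)" using p_gt_1 by (simp add: c_def cong_def)
    then have "\<not> p dvd c" using False cong_dvd_iff int_dvd_int_iff by blast
    then have "[c ^ (p - 1) = 1] (mod p)" using fermat_theorem prime by blast
    then have "[c ^ (p - 1) * c = 1 * c] (mod p)" by (rule cong_mult) simp
    moreover have "c ^ (p - 1) * c = c ^ p" using p_gt_1 by (simp flip: power_Suc2)
    ultimately have "[int c ^ p = int c] (mod int p)" by (metis cong_int_iff mult_1 of_nat_power)
    then show ?thesis using c cong_pow[OF c, of p] by (meson cong_sym cong_trans)
  qed
  have "[(a ^ p ^ k) ^ p = a ^ p ^ k] (mod int p)" by (rule fermat)
  then show ?case using Suc by (metis cong_trans power_Suc2 power_mult)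
qed simp

text \<open>By continuity some x^(p^k) has \<theta> equal to 1 modulo \<open>p\<close>, and a^(p^k)
  = a modulo \<open>p\<close>; so \<theta> takes values in 1 + p Z_p. This is why the twist of the
  coefficients disappears modulo \<open>p\<close>.\<close>

lemma theta_mod_p:
  assumes "x \<in> carrier G" "n > 0"
  shows "[\<theta> x n = 1] (mod int p)"
proof -
  obtain N where N: "open_normal N" "\<And>x y. x \<in> carrier G \<Longrightarrow> y \<in> carrier G \<Longrightarrow> inv x \<otimes> y \<in> N \<Longrightarrow> \<theta> x 1 = \<theta> y 1"
    using theta_loc_const[of 1] by (auto simp: loc_const_def)
  obtain k where k: "x [^] (p ^ k) \<in> N" using open_normal_pow[OF N(1)] assms by blast
  have "\<theta> \<one> 1 = \<theta> (x [^] (p ^ k)) 1" using N(2)[of \<one> "x [^] (p ^ k)"] k assms by simp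
  then have "[\<theta> x 1 ^ (p ^ k) = 1] (mod int p)"
    using theta_pow[of x "p ^ k" 1] theta_one(2)[of 1] assms by (simp add: cong_def)
  then have "[\<theta> x 1 = 1] (mod int p)" using fermat_pow[of "\<theta> x 1" k] by (meson cong_sym cong_trans)
  then show ?thesis using padic_cong_le[of "\<theta> x" p 1 n] assms by (metis Suc_leI One_nat_def cong_trans power_one_right theta_closed)
qed

text \<open>The coefficient module is Z/p^k(1). As for \<open>fp_hom\<close>, integer
  representatives are kept so that a cocycle can later be divided by \<open>p\<close>.\<close>

definition cocycle :: "'a set \<Rightarrow> nat \<Rightarrow> ('a \<Rightarrow> int) \<Rightarrow> bool" where
  "cocycle C k f \<longleftrightarrow> loc_const C f \<and> (\<forall>x\<in>C. \<forall>y\<in>C. [f (x \<otimes> y) = f x + \<theta> x k * f y] (mod int p ^ k))"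

context
  fixes C
  assumes C: "closed_subgroup C G T"
begin

abbreviation "K \<equiv> G\<lparr>carrier := C\<rparr>"
abbreviation "TC \<equiv> subtopology T C"
abbreviation "act \<equiv> (\<lambda>g x. \<theta> g \<otimes>\<^bsub>\<Z>\<^sub>p\<^esub> x)"

lemma topspace_TC: "topspace TC = C" using closed_subgroupD(3)[OF C] by auto

lemma padic_module: "coefficient_module K \<Z>\<^sub>p act"
proof -
  interpret K: group K using subgroup_imp_group closed_subgroupD(1)[OF C] by blast
  show ?thesis
    by unfold_locales (use closed_subgroupD(7)[OF C] in \<open>auto simp: Zp.r_distr\<close>)
qed

lemma continuous_map_component:
  "i < n \<Longrightarrow> continuous_map (product_topology (\<lambda>_. TC) {..<n}) TC (\<lambda>t. t i)"
  by (rule continuous_map_product_projection) simp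

lemma continuous_map_product_component:
  assumes "i < n" "j < n"
  shows "continuous_map (product_topology (\<lambda>_. TC) {..<n}) TC (\<lambda>t. t i \<otimes> t j)"
proof -
  have "continuous_map (product_topology (\<lambda>_. TC) {..<n}) T (\<lambda>t. t k)" if "k < n" for k
    using continuous_map_component[OF that] continuous_map_in_subtopology by blast
  then have "continuous_map (product_topology (\<lambda>_. TC) {..<n}) T (\<lambda>t. t i \<otimes> t j)"
    using assms by (intro continuous_map_mult) auto
  then show ?thesis using assms closed_subgroupD(5)[OF C]
    by (auto simp: continuous_map_in_subtopology topspace_TC topspace_product_topology PiE_iff)
qed

lemma loc_const_continuous:
  assumes "loc_const C f" "continuous_map X TC h"
  shows "continuous_map X (discrete_topology UNIV) (\<lambda>x. f (h x))"
  using continuous_map_compose[OF assms(2) loc_const_imp_continuous[OF assms(1) closed_subgroupD(3)[OF C]]]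
  by (simp add: o_def)

lemma tuple_fun_continuous:
  assumes "loc_const C P" "loc_const C Q" "loc_const C R"
  shows "continuous_map (product_topology (\<lambda>_. TC) {..<Suc (Suc 0)}) (discrete_topology UNIV)
     (\<lambda>t. h (P (t 0)) (Q (t (Suc 0))) (R (t 0 \<otimes> t (Suc 0))))"
proof -
  let ?X = "product_topology (\<lambda>_. TC) {..<Suc (Suc 0)}"
  have 1: "continuous_map ?X (discrete_topology UNIV) (\<lambda>t. P (t 0))"
    by (rule loc_const_continuous[OF assms(1)]) (rule continuous_map_component, simp)
  have 2: "continuous_map ?X (discrete_topology UNIV) (\<lambda>t. Q (t (Suc 0)))"
    by (rule loc_const_continuous[OF assms(2)]) (rule continuous_map_component, simp)
  have 3: "continuous_map ?X (discrete_topology UNIV) (\<lambda>t. R (t 0 \<otimes> t (Suc 0)))"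
    by (rule loc_const_continuous[OF assms(3)]) (rule continuous_map_product_component, simp_all)
  show ?thesis
    using continuous_map_discrete_comp2[OF continuous_map_discrete_comp2[OF 1 2, of Pair] 3, of "\<lambda>(a, b) c. h a b c"]
    by simp
qed

text \<open>The obstruction to lifting \<open>f\<close> to a cocycle in Z_p(1) is its image under
  the connecting map of multiplication by \<open>p\<close>, a class in degree 2 killed by
  \<open>p\<close>. Torsion-freeness removes it, and the lift is then read modulo p^k.\<close>

lemma kummer_lift:
  assumes f: "fp_hom C f"
  shows "\<exists>c. cocycle C k c \<and> (\<forall>x\<in>C. [c x = f x] (mod int p))"
proof (cases "k = 0")
  case True
  then show ?thesis using f by (intro exI[of _ f]) (auto simp: cocycle_def fp_hom_def)
next
  case False
  interpret cm: coefficient_module K "\<Z>\<^sub>p" act by (rule padic_module)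
  \<comment> \<open>A set-theoretic lift of \<open>f\<close>: the residue of f(x) modulo
    \<open>p\<close> as a constant \<open>p\<close>-adic integer.\<close>
  define F where "F = (\<lambda>t\<in>tuples K (Suc 0). (\<lambda>n. (f (t 0) mod int p) mod int p ^ n))"
  have Fval: "F (tup [x]) = (\<lambda>n. (f x mod int p) mod int p ^ n)" if "x \<in> C" for x
    using that tup_in_tuples(2)[of x K] by (simp add: F_def)
  have Fc: "F (tup [x]) \<in> carrier \<Z>\<^sub>p" if "x \<in> C" for x
    unfolding Fval[OF that] by (rule padic_carrierI) (use p_gt_1 in auto)
  define D where "D = cm.d (Suc 0) F"
  have C_mult: "x \<otimes> y \<in> C" if "x \<in> C" "y \<in> C" for x y using closed_subgroupD(5)[OF C] that .
  have Dv: "D (tup [x, y]) = \<theta> x \<otimes>\<^bsub>\<Z>\<^sub>p\<^esub> F (tup [y]) \<oplus>\<^bsub>\<Z>\<^sub>p\<^esub> \<ominus>\<^bsub>\<Z>\<^sub>p\<^esub> F (tup [x \<otimes> y]) \<oplus>\<^bsub>\<Z>\<^sub>p\<^esub> F (tup [x])"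
    if "x \<in> C" "y \<in> C" for x y
    unfolding D_def using that Fc by (subst cm.d1) auto
  have Dc: "D (tup [x, y]) \<in> carrier \<Z>\<^sub>p" if "x \<in> C" "y \<in> C" for x y
    using that Fc C_mult closed_subgroupD(7)[OF C] by (simp add: Dv)
  have Dn: "[D (tup [x, y]) n = \<theta> x n * (f y mod int p) - (f (x \<otimes> y) mod int p) + (f x mod int p)] (mod int p ^ n)"
    if "x \<in> C" "y \<in> C" for x y n
    using that Fc[of "x \<otimes> y"] C_mult p_gt_1
    by (simp add: Dv Fval padic_a_inv padic_ops cong_def mod_simps)
  have pdvd: "int p dvd D (tup [x, y]) (Suc n)" if xy: "x \<in> C" "y \<in> C" for x y n
  proof -
    have "[D (tup [x, y]) (Suc 0) = \<theta> x (Suc 0) * (f y mod int p) - (f (x \<otimes> y) mod int p) + (f x mod int p)] (mod int p)"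
      using Dn[OF xy, of "Suc 0"] by simp
    also have "[\<theta> x (Suc 0) * (f y mod int p) - (f (x \<otimes> y) mod int p) + (f x mod int p) = 1 * f y - (f x + f y) + f x] (mod int p)"
      using f xy closed_subgroupD(7)[OF C]
      by (intro cong_add cong_diff cong_mult theta_mod_p) (auto simp: fp_hom_def cong_def)
    finally have "[D (tup [x, y]) (Suc 0) = 0] (mod int p)" by simp
    moreover have "[D (tup [x, y]) (Suc n) = D (tup [x, y]) (Suc 0)] (mod int p)"
      using padic_cong_le[OF Dc[OF xy], of "Suc 0" "Suc n"] by simp
    ultimately show ?thesis using cong_0_iff cong_trans by blast
  qed
  \<comment> \<open>The 2-cocycle dF/p. Division by \<open>p\<close> costs one digit: residue
    \<open>n\<close> of the quotient comes from residue n + 1 of \<open>D\<close>, and identities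
    for \<open>b\<close> modulo p^n are proved modulo p^(n+1).\<close>
  define b where "b = (\<lambda>t\<in>tuples K (Suc (Suc 0)). (\<lambda>n. D t (Suc n) div int p))"
  have bv: "int p * b (tup [x, y]) n = D (tup [x, y]) (Suc n)" if "x \<in> C" "y \<in> C" for x y n
    using pdvd[OF that] that tup_in_tuples(3)[of x y K] by (simp add: b_def)
  have bc: "b (tup [x, y]) \<in> carrier \<Z>\<^sub>p" if xy: "x \<in> C" "y \<in> C" for x y
    unfolding padic_carrier
  proof (intro allI conjI)
    fix n
    have "int p * b (tup [x, y]) n \<in> {0..<int p ^ Suc n}"
      using Dc[OF xy] unfolding bv[OF xy] padic_carrier by blast
    then show "b (tup [x, y]) n \<in> {0..<int p ^ n}"
      using p_gt_1 by (auto simp: zero_le_mult_iff)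
    have "int p * (b (tup [x, y]) (Suc n) mod int p ^ n) = int p * b (tup [x, y]) (Suc n) mod int p ^ Suc n"
      by (simp only: power_Suc mult_mod_right)
    also have "\<dots> = int p * b (tup [x, y]) n"
      using Dc[OF xy] unfolding bv[OF xy] padic_carrier by blast
    finally show "b (tup [x, y]) (Suc n) mod int p ^ n = b (tup [x, y]) n" using p_gt_1 by simp
  qed
  have topZ: "topspace (padic_int_topology p) = carrier \<Z>\<^sub>p" by simp
  have topK: "topspace TC = carrier K" using topspace_TC by simp
  have bcochain: "b \<in> carrier (cochains K TC \<Z>\<^sub>p (padic_int_topology p) (Suc (Suc 0)))"
  proof -
    have "continuous_map (product_topology (\<lambda>_. TC) {..<Suc (Suc 0)}) (discrete_topology UNIV) (\<lambda>t. b t n)" for n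
    proof (rule continuous_map_eq)
      let ?h = "\<lambda>(th, fx) fy fxy. ((th * (fy mod int p) - (fxy mod int p) + (fx mod int p)) mod int p ^ Suc n) div int p"
      show "continuous_map (product_topology (\<lambda>_. TC) {..<Suc (Suc 0)}) (discrete_topology UNIV)
        (\<lambda>t. ?h (\<theta> (t 0) (Suc n), f (t 0)) (f (t (Suc 0))) (f (t 0 \<otimes> t (Suc 0))))"
      proof (rule tuple_fun_continuous[where P = "\<lambda>x. (\<theta> x (Suc n), f x)" and Q = f and R = f and h = ?h])
        show "loc_const C (\<lambda>x. (\<theta> x (Suc n), f x))"
          using f loc_const_subset[OF theta_loc_const closed_subgroupD(3)[OF C]] by (intro loc_const_comp2[where h = Pair]) (auto simp: fp_hom_def)
      qed (use f in \<open>auto simp: fp_hom_def\<close>)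
      fix t assume "t \<in> topspace (product_topology (\<lambda>_. TC) {..<Suc (Suc 0)})"
      then have "t \<in> tuples K (Suc (Suc 0))" using topK by (simp add: topspace_product_topology)
      then obtain x y where xy: "x \<in> C" "y \<in> C" "t = tup [x, y]" using tuples_cases(3)[of t K] by auto
      have "D t (Suc n) = (\<theta> x (Suc n) * (f y mod int p) - (f (x \<otimes> y) mod int p) + (f x mod int p)) mod int p ^ Suc n"
        using Dn[OF xy(1,2), of "Suc n"] padic_carrierD(1)[OF Dc[OF xy(1,2)], of "Suc n"] xy(3) by (simp add: cong_def)
      then show "?h (\<theta> (t 0) (Suc n), f (t 0)) (f (t (Suc 0))) (f (t 0 \<otimes> t (Suc 0))) = b t n"
        using xy tup_in_tuples(3)[of x y K] by (simp add: b_def)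
    qed
    moreover have "b t \<in> carrier \<Z>\<^sub>p" if "t \<in> topspace (product_topology (\<lambda>_. TC) {..<Suc (Suc 0)})" for t
    proof -
      have "t \<in> tuples K (Suc (Suc 0))" using that topK by (simp add: topspace_product_topology)
      then show ?thesis using tuples_cases(3)[of t K] bc by auto
    qed
    ultimately show ?thesis by (auto simp: cochains_def continuous_map_padic_iff b_def)
  qed
  have bcocycle: "cm.d (Suc (Suc 0)) b = \<one>\<^bsub>cochains K TC \<Z>\<^sub>p (padic_int_topology p) (Suc (Suc (Suc 0)))\<^esub>"
  proof (rule extensionalityI)
    fix t assume "t \<in> tuples K (Suc (Suc (Suc 0)))"
    then obtain x y z where xyz: "x \<in> C" "y \<in> C" "z \<in> C" "t = tup [x, y, z]" using tuples_cases(4)[of t K] by auto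
    have c: "x \<in> carrier G" "y \<in> carrier G" "z \<in> carrier G" using xyz closed_subgroupD(7)[OF C] by auto
    have "cm.d (Suc (Suc 0)) b t = \<theta> x \<otimes>\<^bsub>\<Z>\<^sub>p\<^esub> b (tup [y, z]) \<oplus>\<^bsub>\<Z>\<^sub>p\<^esub> (b (tup [x, y \<otimes> z]) \<oplus>\<^bsub>\<Z>\<^sub>p\<^esub> \<ominus>\<^bsub>\<Z>\<^sub>p\<^esub> b (tup [x \<otimes> y, z])) \<oplus>\<^bsub>\<Z>\<^sub>p\<^esub> \<ominus>\<^bsub>\<Z>\<^sub>p\<^esub> b (tup [x, y])"
      using xyz bc by (subst xyz(4), subst cm.d2) auto
    also have "\<dots> = \<zero>\<^bsub>\<Z>\<^sub>p\<^esub>" (is "?e = _")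
    proof (rule padic_eqI)
      show "?e \<in> carrier \<Z>\<^sub>p" "\<zero>\<^bsub>\<Z>\<^sub>p\<^esub> \<in> carrier \<Z>\<^sub>p" using xyz c bc C_mult by simp_all
      fix n
      have neg: "\<ominus>\<^bsub>\<Z>\<^sub>p\<^esub> w = (\<lambda>n. - w n mod int p ^ n)" if "w \<in> carrier \<Z>\<^sub>p" for w
        using padic_a_inv p_gt_1 that by simp
      let ?X = "\<theta> x n * b (tup [y, z]) n + (b (tup [x, y \<otimes> z]) n - b (tup [x \<otimes> y, z]) n) - b (tup [x, y]) n"
      have e: "[?e n = ?X] (mod int p ^ n)"
        using xyz bc C_mult by (simp add: neg padic_ops cong_def mod_simps)
      let ?t = "\<theta> x (Suc n)" and ?P = "int p ^ Suc n"
      define g where "g x = f x mod int p" for x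
      have bn: "[int p * b (tup [x, y]) n = \<theta> x (Suc n) * g y - g (x \<otimes> y) + g x] (mod ?P)" if "x \<in> C" "y \<in> C" for x y
        unfolding bv[OF that] g_def by (rule Dn[OF that])
      \<comment> \<open>The residues of \<theta>(x) at levels \<open>n\<close> and n + 1 agree
        modulo p^n only; the factor \<open>p\<close> raises this to p^(n+1).\<close>
      have th: "[int p * \<theta> x n = int p * ?t] (mod ?P)"
        using padic_carrierD(2)[OF theta_closed[OF c(1)], of n] by (simp add: cong_def mult_mod_right[symmetric])
      have "[int p * \<theta> x n * b (tup [y, z]) n = int p * ?t * b (tup [y, z]) n] (mod ?P)"
        by (rule cong_mult[OF th cong_refl])
      moreover have "int p * ?t * b (tup [y, z]) n = ?t * (int p * b (tup [y, z]) n)" by simp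
      ultimately have t: "[int p * \<theta> x n * b (tup [y, z]) n = ?t * (int p * b (tup [y, z]) n)] (mod ?P)"
        by (simp only:)
      have X: "int p * ?X = int p * \<theta> x n * b (tup [y, z]) n + (int p * b (tup [x, y \<otimes> z]) n - int p * b (tup [x \<otimes> y, z]) n) - int p * b (tup [x, y]) n"
        by (simp add: algebra_simps)
      let ?R = "?t * (\<theta> y (Suc n) * g z - g (y \<otimes> z) + g y) + ((?t * g (y \<otimes> z) - g (x \<otimes> (y \<otimes> z)) + g x)
           - (\<theta> x (Suc n) * \<theta> y (Suc n) * g z - g ((x \<otimes> y) \<otimes> z) + g (x \<otimes> y))) - (?t * g y - g (x \<otimes> y) + g x)"
      have XR: "[int p * ?X = ?R] (mod ?P)" unfolding X
      proof (intro cong_add cong_diff)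
        show "[int p * \<theta> x n * b (tup [y, z]) n = ?t * (\<theta> y (Suc n) * g z - g (y \<otimes> z) + g y)] (mod ?P)"
          using t cong_mult[OF cong_refl bn[OF xyz(2,3)]] cong_trans by blast
        show "[int p * b (tup [x, y \<otimes> z]) n = ?t * g (y \<otimes> z) - g (x \<otimes> (y \<otimes> z)) + g x] (mod ?P)"
          using bn xyz C_mult by blast
        have "[\<theta> (x \<otimes> y) (Suc n) * g z = \<theta> x (Suc n) * \<theta> y (Suc n) * g z] (mod ?P)"
          by (intro cong_mult cong_refl theta_mult(2)[OF c(1,2)])
        then have "[\<theta> (x \<otimes> y) (Suc n) * g z - g ((x \<otimes> y) \<otimes> z) + g (x \<otimes> y) = \<theta> x (Suc n) * \<theta> y (Suc n) * g z - g ((x \<otimes> y) \<otimes> z) + g (x \<otimes> y)] (mod ?P)"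
          by (intro cong_add cong_diff cong_refl)
        then show "[int p * b (tup [x \<otimes> y, z]) n = \<theta> x (Suc n) * \<theta> y (Suc n) * g z - g ((x \<otimes> y) \<otimes> z) + g (x \<otimes> y)] (mod ?P)"
          using bn[of "x \<otimes> y" z] xyz C_mult cong_trans by blast
        show "[int p * b (tup [x, y]) n = ?t * g y - g (x \<otimes> y) + g x] (mod ?P)" using bn xyz by blast
      qed
      \<comment> \<open>This is d(dF) = 0, written out with \<theta>(x y) = \<theta>(x)
        \<theta>(y).\<close>
      have "?R = 0" using c by (simp add: m_assoc right_diff_distrib distrib_left)
      then have "int p * int p ^ n dvd int p * ?X" using XR by (metis cong_0_iff power_Suc)
      then have "[?X = 0] (mod int p ^ n)" using p_gt_1 by (simp add: cong_0_iff)
      then show "[?e n = \<zero>\<^bsub>\<Z>\<^sub>p\<^esub> n] (mod int p ^ n)" using e cong_trans by (fastforce simp: padic_ops(4))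
    qed
    finally show "cm.d (Suc (Suc 0)) b t = \<one>\<^bsub>cochains K TC \<Z>\<^sub>p (padic_int_topology p) (Suc (Suc (Suc 0)))\<^esub> t"
      using \<open>t \<in> tuples K (Suc (Suc (Suc 0)))\<close> by (simp add: cochains_def)
  qed (auto simp: differential_def cochains_def)
  define Co where "Co = cochains K TC \<Z>\<^sub>p (padic_int_topology p) (Suc (Suc 0))"
  define B where "B = coboundaries K TC \<Z>\<^sub>p (padic_int_topology p) act (Suc (Suc 0))"
  have addcont: "continuous_map X (padic_int_topology p) (\<lambda>x. u x \<oplus>\<^bsub>\<Z>\<^sub>p\<^esub> v x)"
    if "continuous_map X (padic_int_topology p) u" "continuous_map X (padic_int_topology p) v" for X :: "(nat \<Rightarrow> 'a) topology" and u v
  proof -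
    have "continuous_map X (discrete_topology UNIV) (\<lambda>x. (u x n + v x n) mod int p ^ n)" for n
      by (rule continuous_map_discrete_comp2[where h = "\<lambda>a b. (a + b) mod int p ^ n"])
        (use that in \<open>simp_all add: continuous_map_padic_iff\<close>)
    moreover have "u x \<oplus>\<^bsub>\<Z>\<^sub>p\<^esub> v x \<in> carrier \<Z>\<^sub>p" if "x \<in> topspace X" for x
      using that \<open>continuous_map X (padic_int_topology p) u\<close> \<open>continuous_map X (padic_int_topology p) v\<close>
      by (auto simp: continuous_map_padic_iff Pi_iff)
    ultimately show ?thesis unfolding continuous_map_padic_iff by (auto simp: padic_ops(2))
  qed
  have negcont: "continuous_map X (padic_int_topology p) (\<lambda>x. \<ominus>\<^bsub>\<Z>\<^sub>p\<^esub> u x)"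
    if u: "continuous_map X (padic_int_topology p) u" for X :: "(nat \<Rightarrow> 'a) topology" and u
  proof -
    have uc: "u x \<in> carrier \<Z>\<^sub>p" if "x \<in> topspace X" for x
      using u that by (auto simp: continuous_map_padic_iff Pi_iff)
    have "continuous_map X (discrete_topology UNIV) (\<lambda>x. (\<ominus>\<^bsub>\<Z>\<^sub>p\<^esub> u x) n)" for n
    proof (rule continuous_map_eq)
      show "continuous_map X (discrete_topology UNIV) (\<lambda>x. - u x n mod int p ^ n)"
        by (rule continuous_map_discrete_comp[where h = "\<lambda>a. - a mod int p ^ n"]) (use u in \<open>simp add: continuous_map_padic_iff\<close>)
    qed (use uc p_gt_1 in \<open>simp add: padic_a_inv\<close>)
    then show ?thesis using uc unfolding continuous_map_padic_iff by auto
  qed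
  interpret Mn: comm_group "Co\<lparr>carrier := cm.maps (Suc (Suc 0))\<rparr>" unfolding Co_def by (rule cm.comm_group_maps)
  have B: "subgroup B (Co\<lparr>carrier := cm.maps (Suc (Suc 0))\<rparr>)"
    unfolding B_def Co_def by (rule cm.subgroup_cocycles_coboundaries(2)[OF topK topZ]) (erule (1) addcont, erule negcont)
  have B_maps: "B \<subseteq> cm.maps (Suc (Suc 0))" using subgroup.subset[OF B] by simp
  have coset: "(B #>\<^bsub>Co\<^esub> u) <#>\<^bsub>Co\<^esub> (B #>\<^bsub>Co\<^esub> v) = B #>\<^bsub>Co\<^esub> (u \<otimes>\<^bsub>Co\<^esub> v)"
    if "u \<in> cm.maps (Suc (Suc 0))" "v \<in> cm.maps (Suc (Suc 0))" for u v
    using normal.rcos_sum[OF Mn.subgroup_imp_normal[OF B]] that by simp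
  have coset_one: "B #>\<^bsub>Co\<^esub> \<one>\<^bsub>Co\<^esub> = B" using Mn.coset_mult_one[of B] B_maps by simp
  have bm: "b \<in> cm.maps (Suc (Suc 0))" using bcochain cm.cochains_subset_maps[OF topK topZ] by blast
  have Co_mult: "u \<otimes>\<^bsub>Co\<^esub> v = (\<lambda>t\<in>tuples K (Suc (Suc 0)). u t \<oplus>\<^bsub>\<Z>\<^sub>p\<^esub> v t)" for u v by (simp add: Co_def cochains_def)
  \<comment> \<open>The multiple of \<open>b\<close> by \<open>m\<close>, used to compute powers of
    its class in the multiplicatively written group \<open>H\<close>; for m = p it is the coboundary
    \<open>D\<close>.\<close>
  define mb where "mb m = (\<lambda>t\<in>tuples K (Suc (Suc 0)). \<lambda>n. (int m * b t n) mod int p ^ n)" for m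
  have mbv: "mb m (tup [x, y]) = (\<lambda>n. (int m * b (tup [x, y]) n) mod int p ^ n)" if "x \<in> C" "y \<in> C" for m x y
    using that tup_in_tuples(3)[of x y K] by (simp add: mb_def)
  have ext2: "u = v" if "u \<in> extensional (tuples K (Suc (Suc 0)))" "v \<in> extensional (tuples K (Suc (Suc 0)))"
    "\<And>x y. x \<in> C \<Longrightarrow> y \<in> C \<Longrightarrow> u (tup [x, y]) = v (tup [x, y])" for u v :: "(nat \<Rightarrow> 'a) \<Rightarrow> nat \<Rightarrow> int"
    by (rule extensionalityI[OF that(1,2)]) (use tuples_cases(3)[of _ K] that(3) in fastforce)
  have mbm: "mb m \<in> cm.maps (Suc (Suc 0))" for m
  proof (rule PiE_I)
    fix t assume "t \<in> tuples K (Suc (Suc 0))"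
    then obtain x y where xy: "x \<in> C" "y \<in> C" "t = tup [x, y]" using tuples_cases(3)[of t K] by auto
    show "mb m t \<in> carrier \<Z>\<^sub>p"
      unfolding xy(3) mbv[OF xy(1,2)] using p_gt_1 padic_carrierD(2)[OF bc[OF xy(1,2)]]
      by (intro padic_carrierI cong_mult) auto
  qed (simp add: mb_def)
  have mbSuc: "mb (Suc m) = mb m \<otimes>\<^bsub>Co\<^esub> b" for m
    by (rule ext2) (use tup_in_tuples(3)[of _ _ K] in \<open>auto simp: mbv Co_mult padic_ops mod_simps algebra_simps, auto simp: mb_def\<close>)
  have mb0: "mb 0 = \<one>\<^bsub>Co\<^esub>" by (simp add: mb_def Co_def cochains_def padic_ops)
  define H where "H = cohomology K TC \<Z>\<^sub>p (padic_int_topology p) act (Suc (Suc 0))"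
  have powH: "(B #>\<^bsub>Co\<^esub> b) [^]\<^bsub>H\<^esub> m = B #>\<^bsub>Co\<^esub> mb m" for m :: nat
  proof (induction m)
    case 0
    show ?case using coset_one by (simp add: mb0 nat_pow_def H_def cohomology_def B_def)
  next
    case (Suc m)
    have "(B #>\<^bsub>Co\<^esub> b) [^]\<^bsub>H\<^esub> Suc m = (B #>\<^bsub>Co\<^esub> mb m) <#>\<^bsub>Co\<^esub> (B #>\<^bsub>Co\<^esub> b)"
      unfolding Suc[symmetric] by (simp add: nat_pow_def) (simp add: H_def cohomology_def Co_def)
    then show ?case using coset[OF mbm bm] mbSuc by simp
  qed
  define \<iota> where "\<iota> g = (\<lambda>t\<in>tuples K (Suc 0). (\<lambda>n. g (t 0) mod int p ^ n))" for g :: "'a \<Rightarrow> int"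
  have \<iota>: "\<iota> g \<in> carrier (cochains K TC \<Z>\<^sub>p (padic_int_topology p) (Suc 0))" if g: "loc_const C g" for g
  proof -
    have "continuous_map (product_topology (\<lambda>_. TC) {..<Suc 0}) (discrete_topology UNIV) (\<lambda>t. \<iota> g t n)" for n
    proof (rule continuous_map_eq)
      show "continuous_map (product_topology (\<lambda>_. TC) {..<Suc 0}) (discrete_topology UNIV) (\<lambda>t. g (t 0) mod int p ^ n)"
        by (rule loc_const_continuous[OF loc_const_comp[OF g, of "\<lambda>a. a mod int p ^ n"] continuous_map_component]) simp
    qed (use topK in \<open>simp add: \<iota>_def topspace_product_topology\<close>)
    moreover have "\<iota> g t \<in> carrier \<Z>\<^sub>p" if "t \<in> topspace (product_topology (\<lambda>_. TC) {..<Suc 0})" for t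
    proof -
      have "t \<in> tuples K (Suc 0)" using that topK by (simp add: topspace_product_topology)
      then show ?thesis unfolding \<iota>_def using p_gt_1 padic_carrierI[of p "\<lambda>n. g (t 0)"] by simp
    qed
    ultimately show ?thesis by (auto simp: cochains_def continuous_map_padic_iff \<iota>_def)
  qed
  have F\<iota>: "F = \<iota> (\<lambda>x. f x mod int p)" by (simp add: F_def \<iota>_def)
  have lf: "loc_const C f" using f by (simp add: fp_hom_def)
  have DB: "D \<in> B"
    unfolding D_def F\<iota> B_def coboundaries_def using \<iota>[OF loc_const_comp[OF lf, of "\<lambda>a. a mod int p"]] by simp
  have mbp: "mb p = D"
  proof (rule ext2)
    fix x y assume xy: "x \<in> C" "y \<in> C"
    show "mb p (tup [x, y]) = D (tup [x, y])"
      unfolding mbv[OF xy] bv[OF xy] using Dc[OF xy] by (auto simp: padic_carrier)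
  qed (simp_all add: mb_def D_def differential_def)
  have "B #>\<^bsub>Co\<^esub> D = B" using Mn.coset_join2[of D B] B B_maps DB by auto
  then have "(B #>\<^bsub>Co\<^esub> b) [^]\<^bsub>H\<^esub> p = \<one>\<^bsub>H\<^esub>" unfolding powH mbp by (simp add: H_def cohomology_def B_def)
  moreover have "B #>\<^bsub>Co\<^esub> b \<in> carrier H"
    using bcochain bcocycle by (auto simp: H_def cohomology_def FactGroup_def RCOSETS_def B_def Co_def cocycles_def)
  moreover have "torsion_free_group H"
    using cyclo_oriented C unfolding cyclo_oriented_def H_def numeral_2_eq_2 by blast
  ultimately have "B #>\<^bsub>Co\<^esub> b = \<one>\<^bsub>H\<^esub>" using p_gt_1 unfolding torsion_free_group_def by (metis gr0I not_one_less_zero)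
  moreover have "b \<in> B #>\<^bsub>Co\<^esub> b" using Mn.rcos_self[of b B] bm B by simp
  ultimately have "b \<in> B" by (simp add: H_def cohomology_def B_def)
  then obtain a where a: "a \<in> carrier (cochains K TC \<Z>\<^sub>p (padic_int_topology p) (Suc 0))" "b = cm.d (Suc 0) a"
    by (auto simp: B_def coboundaries_def)
  have acont: "continuous_map TC (padic_int_topology p) (\<lambda>x. a (tup [x]))"
    using continuous_map_compose[OF continuous_map_tup1[OF refl, of TC], of "padic_int_topology p" a] a by (simp add: cochains_def o_def)
  define a' where "a' x = a (tup [x]) k" for x
  have a': "loc_const C a'"
    unfolding a'_def using acont closed_subgroupD(2)[OF C]
    by (intro continuous_imp_loc_const) (simp_all add: continuous_map_padic_iff)
  have ac: "a (tup [x]) \<in> carrier \<Z>\<^sub>p" if "x \<in> C" for x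
    using acont that topspace_TC by (auto simp: continuous_map_padic_iff)
  \<comment> \<open>The corrected lift F - p a, where da = b; its coboundary is dF - p b = 0. It is
    taken at residue level \<open>k\<close>.\<close>
  define c where "c x = f x mod int p - int p * a' x" for x
  have "cocycle C k c"
    unfolding cocycle_def
  proof (intro conjI ballI)
    show "loc_const C c" unfolding c_def
      by (rule loc_const_comp2[OF lf a', where h = "\<lambda>u v. u mod int p - int p * v"])
    fix x y assume xy: "x \<in> C" "y \<in> C"
    have "b (tup [x, y]) = \<theta> x \<otimes>\<^bsub>\<Z>\<^sub>p\<^esub> a (tup [y]) \<oplus>\<^bsub>\<Z>\<^sub>p\<^esub> \<ominus>\<^bsub>\<Z>\<^sub>p\<^esub> a (tup [x \<otimes> y]) \<oplus>\<^bsub>\<Z>\<^sub>p\<^esub> a (tup [x])"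
      unfolding a(2) using xy ac by (subst cm.d1) auto
    then have "[b (tup [x, y]) k = \<theta> x k * a' y - a' (x \<otimes> y) + a' x] (mod int p ^ k)"
      using padic_a_inv[OF _ ac[OF C_mult[OF xy]]] p_gt_1 by (simp add: a'_def padic_ops cong_def mod_simps)
    then have "[int p * b (tup [x, y]) k = int p * (\<theta> x k * a' y - a' (x \<otimes> y) + a' x)] (mod int p ^ k)"
      by (intro cong_mult cong_refl)
    moreover have "[int p * b (tup [x, y]) k = \<theta> x k * (f y mod int p) - (f (x \<otimes> y) mod int p) + (f x mod int p)] (mod int p ^ k)"
      unfolding bv[OF xy] using padic_carrierD(2)[OF Dc[OF xy], of k] Dn[OF xy, of k] cong_trans by blast
    ultimately have "int p ^ k dvd (\<theta> x k * (f y mod int p) - (f (x \<otimes> y) mod int p) + (f x mod int p)) - int p * (\<theta> x k * a' y - a' (x \<otimes> y) + a' x)"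
      by (meson cong_iff_dvd_diff cong_sym cong_trans)
    then have "int p ^ k dvd (c x + \<theta> x k * c y) - c (x \<otimes> y)" by (simp add: c_def algebra_simps)
    then show "[c (x \<otimes> y) = c x + \<theta> x k * c y] (mod int p ^ k)" by (metis cong_iff_dvd_diff cong_sym)
  qed
  moreover have "[c x = f x] (mod int p)" for x by (simp add: c_def cong_def mod_diff_left_eq) (simp add: mod_eq_dvd_iff)
  ultimately show ?thesis by blast
qed

end

end

text \<open>\<open>finprod\<close> is a \<open>THE\<close> over fold graphs. If no graph over
  \<open>S\<close> stays in the carrier, the value is \<open>THE x. False\<close>; otherwise it is a
  genuine iterated product and \<open>I\<close> follows by induction. Left-commutativity without
  carrier conditions gives uniqueness.\<close>

lemma finprod_junk_or_invariant:
  assumes comm: "\<And>a b c. a \<otimes>\<^bsub>G\<^esub> (b \<otimes>\<^bsub>G\<^esub> c) = b \<otimes>\<^bsub>G\<^esub> (a \<otimes>\<^bsub>G\<^esub> c)"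
    and one: "I \<one>\<^bsub>G\<^esub>" and step: "\<And>s x. s \<in> S \<Longrightarrow> I x \<Longrightarrow> I (g s \<otimes>\<^bsub>G\<^esub> x)"
  shows "finprod G g S = (THE x. False) \<or> I (finprod G g S)"
proof (cases "finite S")
  case False
  then show ?thesis using one by (simp add: finprod_def)
next
  case True
  let ?f = "(\<otimes>\<^bsub>G\<^esub>) \<circ> g"
  interpret comp_fun_commute ?f
    by unfold_locales (simp add: fun_eq_iff comm)
  have graph: "fold_graph ?f e A x" if "(A, x) \<in> foldSetD (carrier G) ?f e" for A x e
    using that by induction (auto intro: fold_graph.intros)
  have inv: "I x" if "(A, x) \<in> foldSetD (carrier G) ?f \<one>\<^bsub>G\<^esub>" "A \<subseteq> S" for A x
    using that by induction (auto intro: one step)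
  show ?thesis
  proof (cases "\<exists>x. (S, x) \<in> foldSetD (carrier G) ?f \<one>\<^bsub>G\<^esub>")
    case True
    then obtain x where x: "(S, x) \<in> foldSetD (carrier G) ?f \<one>\<^bsub>G\<^esub>" by blast
    have "foldD (carrier G) ?f \<one>\<^bsub>G\<^esub> S = x"
      unfolding foldD_def using x graph fold_graph_determ by blast
    then show ?thesis using inv[OF x] \<open>finite S\<close> by (simp add: finprod_def)
  next
    case False
    then have "foldD (carrier G) ?f \<one>\<^bsub>G\<^esub> S = (THE x. False)" by (simp add: foldD_def)
    then show ?thesis using \<open>finite S\<close> by (simp add: finprod_def)
  qed
qed

section \<open>Cohomology with coefficients in the field with p elements\<close>

lemma continuous_map_discrete_iff:
  "continuous_map X (discrete_topology S) f \<longleftrightarrow>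
     f \<in> topspace X \<rightarrow> S \<and> continuous_map X (discrete_topology UNIV) f"
proof -
  have "discrete_topology S = subtopology (discrete_topology UNIV) S" by (simp add: subtopology_discrete_topology)
  then show ?thesis by (metis continuous_map_in_subtopology image_subset_iff_funcset)
qed

context cyclo_oriented_group
begin

lemma fp_hom_mult: "fp_hom C f \<Longrightarrow> x \<in> C \<Longrightarrow> y \<in> C \<Longrightarrow> [f (x \<otimes> y) = f x + f y] (mod int p)"
  by (simp add: fp_hom_def)

lemma fp_hom_one:
  assumes C: "closed_subgroup C G T" and f: "fp_hom C f"
  shows "[f \<one> = 0] (mod int p)"
  using fp_hom_mult[OF f, of \<one> \<one>] closed_subgroupD(4)[OF C] by (simp add: cong_iff_dvd_diff)

lemma fp_hom_inv:
  assumes C: "closed_subgroup C G T" and f: "fp_hom C f" and x: "x \<in> C"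
  shows "[f (inv x) = - f x] (mod int p)"
proof -
  have "[f \<one> = f x + f (inv x)] (mod int p)"
    using fp_hom_mult[OF f x, of "inv x"] closed_subgroupD(6,7)[OF C x] by simp
  then have "[0 = f x + f (inv x)] (mod int p)" using fp_hom_one[OF C f] cong_sym cong_trans by blast
  then show ?thesis using cong_sym[of 0 "f x + f (inv x)"] by (simp add: cong_iff_dvd_diff add.commute)
qed

lemma fp_hom_conj:
  assumes C: "closed_subgroup C G T" and f: "fp_hom C f" and x: "x \<in> C" and y: "y \<in> C"
  shows "[f (x \<otimes> y \<otimes> inv x) = f y] (mod int p)"
proof -
  note Cm = closed_subgroupD(5,6)[OF C]
  have "[f (x \<otimes> y \<otimes> inv x) = f x + f y + - f x] (mod int p)"
    by (rule cong_trans[OF fp_hom_mult[OF f]]) (intro cong_add fp_hom_mult[OF f] fp_hom_inv[OF C f] Cm x y)+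
  then show ?thesis by simp
qed

lemma fp_hom_pow:
  assumes C: "closed_subgroup C G T" and f: "fp_hom C f" and x: "x \<in> C"
  shows "[f (x [^] n) = int n * f x] (mod int p)"
proof (induction n)
  case 0
  then show ?case using fp_hom_one[OF C f] by simp
next
  case (Suc n)
  have "[f (x [^] Suc n) = f (x [^] n) + f x] (mod int p)"
    using fp_hom_mult[OF f closed_subgroup_pow[OF C x] x] by simp
  also have "[f (x [^] n) + f x = int n * f x + f x] (mod int p)" by (intro cong_add Suc cong_refl)
  finally show ?case by (simp add: algebra_simps)
qed

abbreviation "\<F>\<^sub>p \<equiv> residue_ring (int p)"

lemma residues_p: "residues (int p)" by unfold_locales (use p_gt_1 in simp)

sublocale Fp: cring \<F>\<^sub>p by (rule residues.cring[OF residues_p])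

lemma Fp_ops:
  "carrier \<F>\<^sub>p = {0..<int p}" "x \<otimes>\<^bsub>\<F>\<^sub>p\<^esub> y = (x * y) mod int p" "x \<oplus>\<^bsub>\<F>\<^sub>p\<^esub> y = (x + y) mod int p"
  "\<zero>\<^bsub>\<F>\<^sub>p\<^esub> = 0" "\<one>\<^bsub>\<F>\<^sub>p\<^esub> = 1"
  using p_gt_1 by (auto simp: residue_ring_def)

lemma Fp_neg: "x \<in> carrier \<F>\<^sub>p \<Longrightarrow> \<ominus>\<^bsub>\<F>\<^sub>p\<^esub> x = (- x) mod int p"
  using residues.res_neg_eq[OF residues_p] by simp

text \<open>Writing the relation \<open>y z y\<inverse> = z\<^bsup>\<theta>(y)\<^esup>\<close> in the central extension by \<open>\<F>\<^sub>p\<close> defined by a 2-cocycle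
  \<open>\<beta>\<close> produces the following central error term, with \<open>\<theta>(y)\<close> approximated modulo \<open>p\<^sup>n\<close>.\<close>

definition conj_eval :: "'a \<Rightarrow> 'a \<Rightarrow> ((nat \<Rightarrow> 'a) \<Rightarrow> int) \<Rightarrow> nat \<Rightarrow> int" where
  "conj_eval z y \<beta> n = \<beta> (tup [y, z]) - \<beta> (tup [y \<otimes> z \<otimes> inv y, y]) -
     (\<Sum>i\<in>{1..<nat (\<theta> y n)}. \<beta> (tup [z, z [^] i]))"

definition conj_trivial :: "'a \<Rightarrow> 'a \<Rightarrow> ((nat \<Rightarrow> 'a) \<Rightarrow> int) set" where
  "conj_trivial z y = {\<beta>. eventually (\<lambda>n. [conj_eval z y \<beta> n = 0] (mod int p)) sequentially}"

text \<open>The relation y z y^{-1} = z^\<theta>(y) as convergence modulo every open normal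
  subgroup; it is later identified with the equation in terms of \<open>padic_pow\<close>.\<close>

definition acts_by_theta :: "'a \<Rightarrow> 'a \<Rightarrow> bool" where
  "acts_by_theta z y \<longleftrightarrow> (\<forall>N. open_normal N \<longrightarrow>
     eventually (\<lambda>n. inv (z [^] nat (\<theta> y n)) \<otimes> (y \<otimes> z \<otimes> inv y) \<in> N) sequentially)"

section \<open>Cohomology groups of a closed subgroup with trivial coefficients\<close>

context
  fixes C
  assumes C: "closed_subgroup C G T"
begin

abbreviation "KC \<equiv> G\<lparr>carrier := C\<rparr>"
abbreviation "TopC \<equiv> subtopology T C"
abbreviation "TF \<equiv> discrete_topology (carrier \<F>\<^sub>p)"
abbreviation "tact \<equiv> (\<lambda>(g::'a) (a::int). a)"
abbreviation "Cn n \<equiv> cochains KC TopC \<F>\<^sub>p TF n"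
abbreviation "Zn n \<equiv> cocycles KC TopC \<F>\<^sub>p TF tact n"
abbreviation "Bn n \<equiv> coboundaries KC TopC \<F>\<^sub>p TF tact n"
abbreviation "Hn n \<equiv> trivial_cohomology KC TopC \<F>\<^sub>p n"
abbreviation "Mn n \<equiv> cochains KC TopC \<F>\<^sub>p TF n\<lparr>carrier := tuples KC n \<rightarrow>\<^sub>E carrier \<F>\<^sub>p\<rparr>"
abbreviation "HR \<equiv> cohomology_ring KC TopC \<F>\<^sub>p"
abbreviation "gr \<equiv> cohomology_grading KC TopC \<F>\<^sub>p"

lemma trivial_module: "coefficient_module KC \<F>\<^sub>p tact"
proof -
  interpret K: group KC using subgroup_imp_group closed_subgroupD(1)[OF C] by blast
  show ?thesis by unfold_locales auto
qed

interpretation cm: coefficient_module KC \<F>\<^sub>p tact by (rule trivial_module)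
declare cm.act_closed [simp del]

lemma topspace_TopC: "topspace TopC = carrier KC" using closed_subgroupD(3)[OF C] by auto

interpretation Mn: comm_group "Mn n" for n by (rule cm.comm_group_maps)

lemma subgroup_Zn: "subgroup (Zn n) (Mn n)" and subgroup_Bn: "subgroup (Bn n) (Mn n)"
proof -
  note cdi = continuous_map_discrete_iff[of _ "carrier \<F>\<^sub>p"]
  have top: "topspace TopC = carrier KC" "topspace TF = carrier \<F>\<^sub>p" using topspace_TopC by simp_all
  have add: "continuous_map (product_topology (\<lambda>_. TopC) {..<n}) TF (\<lambda>x. f x \<oplus>\<^bsub>\<F>\<^sub>p\<^esub> g x)"
    if "continuous_map (product_topology (\<lambda>_. TopC) {..<n}) TF f" "continuous_map (product_topology (\<lambda>_. TopC) {..<n}) TF g"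
    for n :: nat and f g
  proof -
    have f: "f x \<in> carrier \<F>\<^sub>p" "g x \<in> carrier \<F>\<^sub>p" if "x \<in> topspace (product_topology (\<lambda>_. TopC) {..<n})" for x
      using \<open>continuous_map _ TF f\<close> \<open>continuous_map _ TF g\<close> that by (auto simp only: cdi Pi_iff)
    have "continuous_map (product_topology (\<lambda>_. TopC) {..<n}) (discrete_topology UNIV) (\<lambda>x. f x \<oplus>\<^bsub>\<F>\<^sub>p\<^esub> g x)"
      by (rule continuous_map_discrete_comp2[where h = "\<lambda>a b. a \<oplus>\<^bsub>\<F>\<^sub>p\<^esub> b"]) (use that in \<open>simp_all only: cdi\<close>)
    then show ?thesis using f unfolding cdi by (simp add: Pi_iff)
  qed
  have neg: "continuous_map (product_topology (\<lambda>_. TopC) {..<n}) TF (\<lambda>x. \<ominus>\<^bsub>\<F>\<^sub>p\<^esub> f x)"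
    if "continuous_map (product_topology (\<lambda>_. TopC) {..<n}) TF f" for n :: nat and f
  proof -
    have f: "f x \<in> carrier \<F>\<^sub>p" if "x \<in> topspace (product_topology (\<lambda>_. TopC) {..<n})" for x
      using \<open>continuous_map _ TF f\<close> that by (auto simp only: cdi Pi_iff)
    have "continuous_map (product_topology (\<lambda>_. TopC) {..<n}) (discrete_topology UNIV) (\<lambda>x. \<ominus>\<^bsub>\<F>\<^sub>p\<^esub> f x)"
      by (rule continuous_map_discrete_comp[where h = "\<lambda>a. \<ominus>\<^bsub>\<F>\<^sub>p\<^esub> a"]) (use that in \<open>simp_all only: cdi\<close>)
    then show ?thesis using f unfolding cdi by (simp add: Pi_iff)
  qed
  show "subgroup (Zn n) (Mn n)"
    by (rule cm.subgroup_cocycles_coboundaries(1)[OF top]) (erule (1) add, erule neg)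
  show "subgroup (Bn n) (Mn n)"
    by (rule cm.subgroup_cocycles_coboundaries(2)[OF top]) (erule (1) add, erule neg)
qed

lemma normal_Bn: "Bn n \<lhd> Mn n"
  by (rule Mn.subgroup_imp_normal[OF subgroup_Bn])

lemma Hn_simps:
  "carrier (Hn n) = (\<lambda>f. Bn n #>\<^bsub>Cn n\<^esub> f) ` Zn n" "\<one>\<^bsub>Hn n\<^esub> = Bn n" "A \<otimes>\<^bsub>Hn n\<^esub> A' = A <#>\<^bsub>Cn n\<^esub> A'"
  by (auto simp: cohomology_def FactGroup_def RCOSETS_def)

lemma Zn_maps: "f \<in> Zn n \<Longrightarrow> f \<in> carrier (Mn n)" and Bn_maps: "f \<in> Bn n \<Longrightarrow> f \<in> carrier (Mn n)"
  using subgroup.mem_carrier[OF subgroup_Zn] subgroup.mem_carrier[OF subgroup_Bn] by blast+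

lemma class_mult:
  assumes "f \<in> carrier (Mn n)" "g \<in> carrier (Mn n)"
  shows "(Bn n #>\<^bsub>Cn n\<^esub> f) <#>\<^bsub>Cn n\<^esub> (Bn n #>\<^bsub>Cn n\<^esub> g) = Bn n #>\<^bsub>Cn n\<^esub> (f \<otimes>\<^bsub>Cn n\<^esub> g)"
  using normal.rcos_sum[OF normal_Bn assms] by simp

lemma class_eq:
  assumes "f \<in> carrier (Mn n)" "g \<in> Bn n #>\<^bsub>Cn n\<^esub> f"
  shows "Bn n #>\<^bsub>Cn n\<^esub> g = Bn n #>\<^bsub>Cn n\<^esub> f"
  using Mn.repr_independence[OF _ assms(1) subgroup_Bn, of g] assms(2) by simp

lemma class_self: "f \<in> carrier (Mn n) \<Longrightarrow> f \<in> Bn n #>\<^bsub>Cn n\<^esub> f"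
  using Mn.rcos_self[OF _ subgroup_Bn, of f] by simp

lemma class_Bn: "f \<in> Bn n \<Longrightarrow> Bn n #>\<^bsub>Cn n\<^esub> f = Bn n"
  using Mn.coset_join2[OF Bn_maps subgroup_Bn, of f] by simp

text \<open>This structure evaluates the products over \<open>{..n}\<close> by which the
  multiplication of the cohomology ring is defined.\<close>

lemma comm_monoid_Hn: "Group.comm_monoid (Hn n)"
proof (rule comm_monoidI)
  note Z = subgroup.m_closed[OF subgroup_Zn[of n]]
  show "\<one>\<^bsub>Hn n\<^esub> \<in> carrier (Hn n)"
    using subgroup.one_closed[OF subgroup_Zn[of n]] class_Bn[OF subgroup.one_closed[OF subgroup_Bn[of n]]]
    by (force simp: Hn_simps)
  fix x y z assume xyz: "x \<in> carrier (Hn n)" "y \<in> carrier (Hn n)" "z \<in> carrier (Hn n)"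
  obtain f where f: "f \<in> Zn n" "x = Bn n #>\<^bsub>Cn n\<^esub> f" using xyz by (auto simp: Hn_simps)
  obtain g where g: "g \<in> Zn n" "y = Bn n #>\<^bsub>Cn n\<^esub> g" using xyz by (auto simp: Hn_simps)
  obtain h where h: "h \<in> Zn n" "z = Bn n #>\<^bsub>Cn n\<^esub> h" using xyz by (auto simp: Hn_simps)
  note fgh = Zn_maps[OF f(1)] Zn_maps[OF g(1)] Zn_maps[OF h(1)]
  show "x \<otimes>\<^bsub>Hn n\<^esub> y \<in> carrier (Hn n)"
    using class_mult[OF fgh(1,2)] Z[OF f(1) g(1)] by (auto simp: Hn_simps f g)
  show "x \<otimes>\<^bsub>Hn n\<^esub> y = y \<otimes>\<^bsub>Hn n\<^esub> x"
    using class_mult[OF fgh(1,2)] class_mult[OF fgh(2,1)] Mn.m_comm[OF fgh(1,2)] by (simp add: Hn_simps f g)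
  show "x \<otimes>\<^bsub>Hn n\<^esub> y \<otimes>\<^bsub>Hn n\<^esub> z = x \<otimes>\<^bsub>Hn n\<^esub> (y \<otimes>\<^bsub>Hn n\<^esub> z)"
    using fgh Mn.m_closed[OF fgh(1,2)] Mn.m_closed[OF fgh(2,3)] Mn.m_assoc[OF fgh]
    by (simp add: Hn_simps f g h class_mult)
  show "\<one>\<^bsub>Hn n\<^esub> \<otimes>\<^bsub>Hn n\<^esub> x = x"
    using normal.rcosets_mult_eq[OF normal_Bn, of x] fgh by (auto simp: Hn_simps f RCOSETS_def)
qed

text \<open>Addition of cochains is integer addition reduced modulo \<open>p\<close>, so
  left-commutativity holds for arbitrary sets of functions. \<open>finprod_junk_or_invariant\<close>
  asks for it in this unrestricted form.\<close>

lemma set_mult_lcomm: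
  "A <#>\<^bsub>Cn n\<^esub> (A' <#>\<^bsub>Cn n\<^esub> A'') = A' <#>\<^bsub>Cn n\<^esub> (A <#>\<^bsub>Cn n\<^esub> A'')"
proof -
  have l: "f \<otimes>\<^bsub>Cn n\<^esub> (g \<otimes>\<^bsub>Cn n\<^esub> h) = g \<otimes>\<^bsub>Cn n\<^esub> (f \<otimes>\<^bsub>Cn n\<^esub> h)" for f g h
  proof (rule ext)
    fix t show "(f \<otimes>\<^bsub>Cn n\<^esub> (g \<otimes>\<^bsub>Cn n\<^esub> h)) t = (g \<otimes>\<^bsub>Cn n\<^esub> (f \<otimes>\<^bsub>Cn n\<^esub> h)) t"
      by (cases "t \<in> tuples KC n") (simp_all add: cochains_def Fp_ops mod_simps add.left_commute)
  qed
  have sub: "A <#>\<^bsub>Cn n\<^esub> (A' <#>\<^bsub>Cn n\<^esub> A'') \<subseteq> A' <#>\<^bsub>Cn n\<^esub> (A <#>\<^bsub>Cn n\<^esub> A'')" for A A'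
  proof
    fix x assume "x \<in> A <#>\<^bsub>Cn n\<^esub> (A' <#>\<^bsub>Cn n\<^esub> A'')"
    then obtain f g h where f: "f \<in> A" "g \<in> A'" "h \<in> A''" "x = f \<otimes>\<^bsub>Cn n\<^esub> (g \<otimes>\<^bsub>Cn n\<^esub> h)"
      by (auto simp: set_mult_def)
    then have "x = g \<otimes>\<^bsub>Cn n\<^esub> (f \<otimes>\<^bsub>Cn n\<^esub> h)" using l by simp
    then show "x \<in> A' <#>\<^bsub>Cn n\<^esub> (A <#>\<^bsub>Cn n\<^esub> A'')" using f by (auto simp only: set_mult_def)
  qed
  show ?thesis using sub[of A A'] sub[of A' A] by (rule equalityI)
qed

lemma Zn1_hom:
  assumes f: "f \<in> Zn (Suc 0)"
  shows "fp_hom C (\<lambda>x. f (tup [x]))"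
proof -
  have fm: "f \<in> carrier (Mn (Suc 0))" using Zn_maps[OF f] .
  have fc: "f (tup [x]) \<in> carrier \<F>\<^sub>p" if "x \<in> C" for x
    using fm that tup_in_tuples(2)[of x KC] by (auto simp: PiE_iff)
  have "continuous_map TopC TF (\<lambda>x. f (tup [x]))"
    using continuous_map_compose[OF continuous_map_tup1[OF refl, of TopC], of TF f] f
    by (simp add: cocycles_def cochains_def o_def)
  then have "loc_const C (\<lambda>x. f (tup [x]))"
    using continuous_map_discrete_iff[of TopC "carrier \<F>\<^sub>p"] closed_subgroupD(2)[OF C] continuous_imp_loc_const by blast
  moreover have "[f (tup [x \<otimes> y]) = f (tup [x]) + f (tup [y])] (mod int p)" if xy: "x \<in> C" "y \<in> C" for x y
  proof -
    have "cm.d (Suc 0) f (tup [x, y]) = 0"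
      using f xy tup_in_tuples(3)[of x y KC] by (simp add: cocycles_def cochains_def Fp_ops)
    moreover have "cm.d (Suc 0) f (tup [x, y]) = f (tup [y]) \<oplus>\<^bsub>\<F>\<^sub>p\<^esub> \<ominus>\<^bsub>\<F>\<^sub>p\<^esub> f (tup [x \<otimes>\<^bsub>KC\<^esub> y]) \<oplus>\<^bsub>\<F>\<^sub>p\<^esub> f (tup [x])"
      by (rule cm.d1) (use fc xy in auto)
    ultimately have "(f (tup [y]) - f (tup [x \<otimes> y]) + f (tup [x])) mod int p = 0"
      using fc[OF closed_subgroupD(5)[OF C xy]] by (simp add: Fp_neg Fp_ops(3) mod_simps)
    then have "int p dvd f (tup [y]) - f (tup [x \<otimes> y]) + f (tup [x])" by auto
    then have "int p dvd - (f (tup [y]) - f (tup [x \<otimes> y]) + f (tup [x]))" by (simp only: dvd_minus_iff)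
    then show ?thesis by (simp add: cong_iff_dvd_diff algebra_simps)
  qed
  ultimately show ?thesis by (simp add: fp_hom_def)
qed

section \<open>Evaluation of 2-cocycles on the relation between z and y\<close>

context
  fixes z y
  assumes z: "z \<in> C" and y: "y \<in> C" and act: "acts_by_theta z y"
    and killed: "\<And>f. fp_hom C f \<Longrightarrow> [f z = 0] (mod int p)"
begin

lemma conj_trivial_mult:
  assumes "\<beta> \<in> conj_trivial z y" "\<gamma> \<in> conj_trivial z y"
  shows "\<beta> \<otimes>\<^bsub>Cn (Suc (Suc 0))\<^esub> \<gamma> \<in> conj_trivial z y"
proof -
  have yz: "y \<otimes> z \<otimes> inv y \<in> C" using closed_subgroupD[OF C] y z by auto
  have v: "[(\<beta> \<otimes>\<^bsub>Cn (Suc (Suc 0))\<^esub> \<gamma>) (tup [a, b]) = \<beta> (tup [a, b]) + \<gamma> (tup [a, b])] (mod int p)" if "a \<in> C" "b \<in> C" for a b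
    using that tup_in_tuples(3)[of a b KC] by (simp add: cochains_def Fp_ops cong_def)
  have "[conj_eval z y (\<beta> \<otimes>\<^bsub>Cn (Suc (Suc 0))\<^esub> \<gamma>) n = conj_eval z y \<beta> n + conj_eval z y \<gamma> n] (mod int p)" for n
  proof -
    have "[conj_eval z y (\<beta> \<otimes>\<^bsub>Cn (Suc (Suc 0))\<^esub> \<gamma>) n =
       (\<beta> (tup [y, z]) + \<gamma> (tup [y, z])) - (\<beta> (tup [y \<otimes> z \<otimes> inv y, y]) + \<gamma> (tup [y \<otimes> z \<otimes> inv y, y])) -
       (\<Sum>i\<in>{1..<nat (\<theta> y n)}. \<beta> (tup [z, z [^] i]) + \<gamma> (tup [z, z [^] i]))] (mod int p)"
      unfolding conj_eval_def
      by (intro cong_diff cong_sum v y z yz closed_subgroup_pow[OF C])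
    then show ?thesis by (simp add: conj_eval_def sum.distrib algebra_simps)
  qed
  note e = this
  have "eventually (\<lambda>n. [conj_eval z y \<beta> n = 0] (mod int p) \<and> [conj_eval z y \<gamma> n = 0] (mod int p)) sequentially"
    using assms by (simp add: conj_trivial_def eventually_conj_iff)
  then show ?thesis unfolding conj_trivial_def mem_Collect_eq
    by (rule eventually_mono) (use cong_trans[OF e] cong_add[of _ 0 "int p" _ 0] in fastforce)
qed

text \<open>For \<beta> = dg the sum telescopes and g(z^m) - g(y z y^{-1}) - (m - 1) g(z) remains,
  with \<open>m\<close> the residue of \<theta>(y) modulo p^n. The difference of the first two terms
  vanishes for large \<open>n\<close>, and m - 1 is divisible by \<open>p\<close>.\<close>

lemma coboundary_conj_trivial:
  assumes "\<beta> \<in> Bn (Suc (Suc 0))"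
  shows "\<beta> \<in> conj_trivial z y"
proof -
  obtain a where a: "a \<in> carrier (Cn (Suc 0))" "\<beta> = cm.d (Suc 0) a"
    using assms by (auto simp: coboundaries_def)
  define g where "g x = a (tup [x])" for x
  have top: "topspace TopC = carrier KC" "topspace TF = carrier \<F>\<^sub>p" using topspace_TopC by simp_all
  have am: "a \<in> carrier (Mn (Suc 0))" using a(1) cm.cochains_subset_maps[OF top, of "Suc 0"] by auto
  have gc: "g x \<in> carrier \<F>\<^sub>p" if "x \<in> C" for x
    using am that tup_in_tuples(2)[of x KC] by (auto simp: PiE_iff g_def)
  have "continuous_map TopC TF g"
    using continuous_map_compose[OF continuous_map_tup1[OF refl, of TopC], of TF a] a
    by (simp add: cochains_def o_def g_def[abs_def])
  then have lc: "loc_const C g"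
    using continuous_map_discrete_iff[of TopC "carrier \<F>\<^sub>p"] closed_subgroupD(2)[OF C] continuous_imp_loc_const by blast
  then obtain N where N: "open_normal N" "\<And>u v. u \<in> C \<Longrightarrow> v \<in> C \<Longrightarrow> inv u \<otimes> v \<in> N \<Longrightarrow> g u = g v"
    by (auto simp: loc_const_def)
  have b: "[\<beta> (tup [u, v]) = g v - g (u \<otimes> v) + g u] (mod int p)" if "u \<in> C" "v \<in> C" for u v
  proof -
    have "\<beta> (tup [u, v]) = g v \<oplus>\<^bsub>\<F>\<^sub>p\<^esub> \<ominus>\<^bsub>\<F>\<^sub>p\<^esub> g (u \<otimes>\<^bsub>KC\<^esub> v) \<oplus>\<^bsub>\<F>\<^sub>p\<^esub> g u"
      unfolding a(2) g_def by (rule cm.d1) (use gc[unfolded g_def] that in auto)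
    then show ?thesis using gc[OF closed_subgroupD(5)[OF C that]] by (simp add: Fp_neg Fp_ops(3) cong_def mod_simps)
  qed
  note Cm = closed_subgroupD(5)[OF C] closed_subgroupD(6)[OF C] closed_subgroupD(7)[OF C]
  have yz: "y \<otimes> z \<otimes> inv y \<in> C" using Cm y z by auto
  have zp: "z [^] i \<in> C" for i :: nat using closed_subgroup_pow[OF C z] .
  have tele: "(\<Sum>i\<in>{1..<Suc m}. g (z [^] i) - g (z \<otimes> z [^] i) + g z) = g z - g (z [^] Suc m) + int m * g z" for m
  proof (induction m)
    case 0
    then show ?case using Cm z by simp
  next
    case (Suc m)
    have "z \<otimes> z [^] Suc m = z [^] Suc (Suc m)" using Cm z nat_pow_Suc2[of z "Suc m"] by simp
    then show ?case using Suc by (simp add: algebra_simps)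
  qed
  have "eventually (\<lambda>n. inv (z [^] nat (\<theta> y n)) \<otimes> (y \<otimes> z \<otimes> inv y) \<in> N) sequentially"
    using act N(1) by (simp add: acts_by_theta_def)
  moreover have "eventually (\<lambda>n::nat. n > 0) sequentially" by (rule eventually_gt_at_top)
  ultimately have "eventually (\<lambda>n. inv (z [^] nat (\<theta> y n)) \<otimes> (y \<otimes> z \<otimes> inv y) \<in> N \<and> n > 0) sequentially"
    by (rule eventually_conj)
  then have "eventually (\<lambda>n. [conj_eval z y \<beta> n = 0] (mod int p)) sequentially"
  proof (rule eventually_mono)
    fix n assume n: "inv (z [^] nat (\<theta> y n)) \<otimes> (y \<otimes> z \<otimes> inv y) \<in> N \<and> n > 0"
    have m1: "[\<theta> y n = 1] (mod int p)" using theta_mod_p n y Cm by blast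
    have "\<theta> y n \<ge> 0" using padic_carrierD(3) theta_closed y Cm by blast
    moreover have "\<theta> y n \<noteq> 0" using m1 p_gt_1 by (auto simp: cong_def)
    ultimately obtain m where m: "nat (\<theta> y n) = Suc m" by (metis gr0_implies_Suc linorder_not_le nat_0_iff neq0_conv order_antisym)
    have "[int m = 0] (mod int p)"
    proof -
      have "\<theta> y n = int m + 1" using m by linarith
      then show ?thesis using m1 by (simp add: cong_iff_dvd_diff)
    qed
    moreover have "g (z [^] Suc m) = g (y \<otimes> z \<otimes> inv y)" using N(2)[OF zp yz] n m by metis
    moreover have "[conj_eval z y \<beta> n = (g z - g (y \<otimes> z) + g y) - (g y - g ((y \<otimes> z \<otimes> inv y) \<otimes> y) + g (y \<otimes> z \<otimes> inv y))
       - (\<Sum>i\<in>{1..<Suc m}. g (z [^] i) - g (z \<otimes> z [^] i) + g z)] (mod int p)"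
      unfolding conj_eval_def m by (intro cong_diff cong_sum b y z yz zp)
    moreover have "(y \<otimes> z \<otimes> inv y) \<otimes> y = y \<otimes> z" using y z Cm by (simp add: m_assoc)
    ultimately have "[conj_eval z y \<beta> n = - (int m * g z)] (mod int p)" unfolding tele by simp
    moreover have "[- (int m * g z) = 0] (mod int p)" using \<open>[int m = 0] (mod int p)\<close> by (simp add: cong_0_iff)
    ultimately show "[conj_eval z y \<beta> n = 0] (mod int p)" using cong_trans by blast
  qed
  then show ?thesis by (simp add: conj_trivial_def)
qed

text \<open>Each of the three kinds of terms contains a value of \<open>f\<close> or
  \<open>f'\<close> at \<open>z\<close> or of \<open>f\<close> at a conjugate of \<open>z\<close>.
  These values vanish by \<open>killed\<close>.\<close>

lemma cup_conj_trivial: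
  assumes f: "f \<in> Zn (Suc 0)" and f': "f' \<in> Zn (Suc 0)"
  shows "cup_cochain KC \<F>\<^sub>p (Suc 0) (Suc 0) f f' \<in> conj_trivial z y"
proof -
  note Cm = closed_subgroupD(5)[OF C] closed_subgroupD(6)[OF C] closed_subgroupD(7)[OF C]
  have yz: "y \<otimes> z \<otimes> inv y \<in> C" using Cm y z by auto
  have zp: "z [^] i \<in> C" for i :: nat using closed_subgroup_pow[OF C z] .
  have v: "[cup_cochain KC \<F>\<^sub>p (Suc 0) (Suc 0) f f' (tup [a, b]) = f (tup [a]) * f' (tup [b])] (mod int p)"
    if "a \<in> C" "b \<in> C" for a b
    using that tup_in_tuples(3)[of a b KC] by (simp add: cup_cochain_def tup_manip Fp_ops cong_def)
  have fz: "[f (tup [z]) = 0] (mod int p)" "[f' (tup [z]) = 0] (mod int p)" using killed Zn1_hom f f' by blast+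
  have fyz: "[f (tup [y \<otimes> z \<otimes> inv y]) = 0] (mod int p)"
    using fp_hom_conj[OF C Zn1_hom[OF f] y z] fz cong_trans by blast
  have "[conj_eval z y (cup_cochain KC \<F>\<^sub>p (Suc 0) (Suc 0) f f') n =
      f (tup [y]) * 0 - 0 * f' (tup [y]) - (\<Sum>i\<in>{1..<nat (\<theta> y n)}. 0 * f' (tup [z [^] i]))] (mod int p)" for n
    unfolding conj_eval_def
    by (intro cong_diff cong_sum cong_trans[OF v] y z yz zp cong_mult fz fyz cong_refl)
  then show ?thesis by (simp add: conj_trivial_def)
qed

abbreviation "P \<equiv> conj_trivial z y"

lemma class_subset_conj_trivial:
  "f \<in> P \<Longrightarrow> Bn (Suc (Suc 0)) #>\<^bsub>Cn (Suc (Suc 0))\<^esub> f \<subseteq> P"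
  using conj_trivial_mult coboundary_conj_trivial by (auto simp: r_coset_def)

text \<open>The invariant carried through the evaluation of noncommutative polynomials. Degrees 0
  and 1 are included because they enter the degree 2 part of a product.\<close>

definition good :: "(nat \<Rightarrow> ((nat \<Rightarrow> 'a) \<Rightarrow> int) set) \<Rightarrow> bool" where
  "good x \<longleftrightarrow> x 0 \<in> carrier (Hn 0) \<and> x (Suc 0) \<in> carrier (Hn (Suc 0)) \<and>
     x (Suc (Suc 0)) \<in> carrier (Hn (Suc (Suc 0))) \<and> x (Suc (Suc 0)) \<subseteq> P"

lemma Hn_one_closed: "Bn n \<in> carrier (Hn n)"
  using monoid.one_closed[OF comm_monoid.axioms(1)[OF comm_monoid_Hn[of n]]] by (simp add: Hn_simps(2))

lemma Hn_mult_closed: "a \<in> carrier (Hn n) \<Longrightarrow> b \<in> carrier (Hn n) \<Longrightarrow> a <#>\<^bsub>Cn n\<^esub> b \<in> carrier (Hn n)"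
  using monoid.m_closed[OF comm_monoid.axioms(1)[OF comm_monoid_Hn[of n]], of a b] by (simp add: Hn_simps(3))

lemma Bn2_subset: "Bn (Suc (Suc 0)) \<subseteq> P"
  using coboundary_conj_trivial by blast

lemma set_mult_subset_conj_trivial:
  "a \<subseteq> P \<Longrightarrow> b \<subseteq> P \<Longrightarrow> a <#>\<^bsub>Cn (Suc (Suc 0))\<^esub> b \<subseteq> P"
  using conj_trivial_mult by (auto simp: set_mult_def)

lemma good_add: "good a \<Longrightarrow> good b \<Longrightarrow> good (a \<oplus>\<^bsub>HR\<^esub> b)"
  using Hn_mult_closed set_mult_subset_conj_trivial by (simp add: good_def cohomology_ring_def Hn_simps(3))

lemma good_zero: "good \<zero>\<^bsub>HR\<^esub>"
  using Hn_one_closed Bn2_subset by (simp add: good_def cohomology_ring_def Hn_simps(2))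

text \<open>Scalar multiplication by a residue is thus a power in the group of cochains, so
  subgroups are stable under it.\<close>

lemma pow_Mn:
  assumes "f \<in> carrier (Mn n)"
  shows "f [^]\<^bsub>Mn n\<^esub> k = (\<lambda>t\<in>tuples KC n. (int k * f t) mod int p)"
proof (induction k)
  case 0
  then show ?case by (simp add: cochains_def Fp_ops)
next
  case (Suc k)
  have "f [^]\<^bsub>Mn n\<^esub> Suc k = (\<lambda>t\<in>tuples KC n. (int k * f t) mod int p) \<otimes>\<^bsub>Cn n\<^esub> f" unfolding Mn.nat_pow_Suc Suc by simp
  also have "\<dots> = (\<lambda>t\<in>tuples KC n. (int (Suc k) * f t) mod int p)" (is "?l = ?r")
  proof (rule ext)
    fix t show "?l t = ?r t"
      by (cases "t \<in> tuples KC n") (simp_all add: cochains_def Fp_ops mod_simps distrib_right add.commute)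
  qed
  finally show ?case .
qed

lemma pow_Zn: "f \<in> Zn n \<Longrightarrow> f [^]\<^bsub>Mn n\<^esub> (k::nat) \<in> Zn n"
  using subgroup.one_closed[OF subgroup_Zn[of n]] subgroup.m_closed[OF subgroup_Zn[of n]] by (induction k) simp_all

lemma pow_Bn: "f \<in> Bn n \<Longrightarrow> f [^]\<^bsub>Mn n\<^esub> (k::nat) \<in> Bn n"
  using subgroup.one_closed[OF subgroup_Bn[of n]] subgroup.m_closed[OF subgroup_Bn[of n]] by (induction k) simp_all

lemma pow_conj_trivial: "f \<in> P \<Longrightarrow> f [^]\<^bsub>Mn (Suc (Suc 0))\<^esub> (k::nat) \<in> P"
proof (induction k)
  case 0
  then show ?case using Bn2_subset subgroup.one_closed[OF subgroup_Bn[of "Suc (Suc 0)"]] by auto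
next
  case (Suc k)
  then show ?case using conj_trivial_mult by simp
qed

lemma union_of_classes:
  assumes "A \<noteq> {}" "g \<in> carrier (Mn n)" "\<And>f. f \<in> A \<Longrightarrow> h f \<in> Bn n #>\<^bsub>Cn n\<^esub> g"
  shows "(\<Union>f\<in>A. cohomology_class KC TopC \<F>\<^sub>p n (h f)) = Bn n #>\<^bsub>Cn n\<^esub> g"
  using assms class_eq[OF assms(2)] by (auto simp: cohomology_class_def)

lemma class_smult:
  assumes "c \<in> carrier \<F>\<^sub>p" "f \<in> Zn n"
  shows "class_smult KC TopC \<F>\<^sub>p n c (Bn n #>\<^bsub>Cn n\<^esub> f) = Bn n #>\<^bsub>Cn n\<^esub> (f [^]\<^bsub>Mn n\<^esub> nat c)"
  unfolding class_smult_def
proof (rule union_of_classes)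
  note fm = Zn_maps[OF assms(2)]
  show "Bn n #>\<^bsub>Cn n\<^esub> f \<noteq> {}" using class_self[OF fm] by blast
  show "f [^]\<^bsub>Mn n\<^esub> nat c \<in> carrier (Mn n)" using fm Mn.nat_pow_closed by blast
  fix g assume "g \<in> Bn n #>\<^bsub>Cn n\<^esub> f"
  then obtain b where b: "b \<in> Bn n" "g = b \<otimes>\<^bsub>Mn n\<^esub> f" by (auto simp: r_coset_def)
  have gm: "g \<in> carrier (Mn n)" unfolding b(2) using b(1) fm Bn_maps Mn.m_closed by blast
  have "(\<lambda>x\<in>tuples KC n. c \<otimes>\<^bsub>\<F>\<^sub>p\<^esub> g x) = g [^]\<^bsub>Mn n\<^esub> nat c"
    unfolding pow_Mn[OF gm] using assms(1) by (simp add: Fp_ops)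
  also have "\<dots> = b [^]\<^bsub>Mn n\<^esub> nat c \<otimes>\<^bsub>Mn n\<^esub> f [^]\<^bsub>Mn n\<^esub> nat c"
    unfolding b(2) using Mn.nat_pow_distrib[OF Bn_maps[OF b(1)] fm] by blast
  finally show "(\<lambda>x\<in>tuples KC n. c \<otimes>\<^bsub>\<F>\<^sub>p\<^esub> g x) \<in> Bn n #>\<^bsub>Cn n\<^esub> (f [^]\<^bsub>Mn n\<^esub> nat c)"
    using pow_Bn[OF b(1), of "nat c"] by (auto simp: r_coset_def)
qed

lemma good_smult:
  assumes c: "c \<in> carrier \<F>\<^sub>p" and x: "good x"
  shows "good (c \<odot>\<^bsub>HR\<^esub> x)"
proof -
  have v: "(c \<odot>\<^bsub>HR\<^esub> x) n = class_smult KC TopC \<F>\<^sub>p n c (x n)" for n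
    by (simp add: cohomology_ring_def)
  have cl: "class_smult KC TopC \<F>\<^sub>p n c A \<in> carrier (Hn n)" if "A \<in> carrier (Hn n)" for n A
    using that class_smult[OF c] pow_Zn by (auto simp: Hn_simps)
  have "class_smult KC TopC \<F>\<^sub>p (Suc (Suc 0)) c A \<subseteq> P" if A: "A \<in> carrier (Hn (Suc (Suc 0)))" "A \<subseteq> P" for A
  proof -
    obtain f where f: "f \<in> Zn (Suc (Suc 0))" "A = Bn (Suc (Suc 0)) #>\<^bsub>Cn (Suc (Suc 0))\<^esub> f"
      using A(1) by (auto simp: Hn_simps)
    have "f \<in> P" using class_self[OF Zn_maps[OF f(1)]] A(2) f(2) by blast
    then show ?thesis unfolding f(2) class_smult[OF c f(1)]
      by (intro class_subset_conj_trivial pow_conj_trivial)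
  qed
  then show ?thesis using x cl unfolding good_def v by blast
qed

lemma constant_Zn0:
  assumes "c \<in> carrier \<F>\<^sub>p"
  shows "(\<lambda>t\<in>tuples KC 0. c) \<in> Zn 0"
proof -
  have "continuous_map (product_topology (\<lambda>_. TopC) {..<0}) TF (\<lambda>t\<in>tuples KC 0. c)"
    by (rule continuous_map_eq[of _ _ "\<lambda>_. c"]) (use assms topspace_TopC in \<open>simp_all\<close>)
  moreover have "cm.d 0 (\<lambda>t\<in>tuples KC 0. c) = \<one>\<^bsub>Cn (Suc 0)\<^esub>"
  proof (rule extensionalityI)
    fix t assume t: "t \<in> tuples KC (Suc 0)"
    then obtain a where a: "a \<in> carrier KC" "t = tup [a]" using tuples_cases(2)[of t KC] by blast
    have "cm.d 0 (\<lambda>t\<in>tuples KC 0. c) (tup [a]) = (\<lambda>t\<in>tuples KC 0. c) (tup []) \<oplus>\<^bsub>\<F>\<^sub>p\<^esub> \<ominus>\<^bsub>\<F>\<^sub>p\<^esub> (\<lambda>t\<in>tuples KC 0. c) (tup [])"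
      by (rule cm.d0) (use assms a tup_in_tuples(1)[of KC] in simp_all)
    also have "\<dots> = \<zero>\<^bsub>\<F>\<^sub>p\<^esub>" using assms tup_in_tuples(1)[of KC] by (simp add: Fp.r_neg)
    finally show "cm.d 0 (\<lambda>t\<in>tuples KC 0. c) t = \<one>\<^bsub>Cn (Suc 0)\<^esub> t"
      using t a by (simp add: cochains_def)
  qed (simp_all add: differential_def cochains_def)
  ultimately show ?thesis by (simp add: cocycles_def cochains_def)
qed

lemma good_one: "good \<one>\<^bsub>HR\<^esub>"
proof -
  have "\<one>\<^bsub>HR\<^esub> 0 = Bn 0 #>\<^bsub>Cn 0\<^esub> (\<lambda>t\<in>tuples KC 0. \<one>\<^bsub>\<F>\<^sub>p\<^esub>)"
    by (simp add: cohomology_ring_def cohomology_class_def)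
  moreover have "\<one>\<^bsub>HR\<^esub> n = Bn n" if "n \<noteq> 0" for n using that by (simp add: cohomology_ring_def Hn_simps)
  ultimately show ?thesis
    using constant_Zn0[OF Fp.one_closed] Hn_one_closed Bn2_subset by (auto simp: good_def Hn_simps(1))
qed

lemma Bn0: "Bn 0 = {\<one>\<^bsub>Cn 0\<^esub>}" by (simp add: coboundaries_def)

text \<open>With trivial action the differential vanishes in degree 0. Hence classes in degrees 0
  and 1 are singletons and can be replaced by their cocycles.\<close>

lemma Bn1: "Bn (Suc 0) = {\<one>\<^bsub>Cn (Suc 0)\<^esub>}"
proof -
  have "cm.d 0 f = \<one>\<^bsub>Cn (Suc 0)\<^esub>" if f: "f \<in> carrier (Cn 0)" for f
  proof -
    have top: "topspace TopC = carrier KC" "topspace TF = carrier \<F>\<^sub>p" using topspace_TopC by simp_all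
    have fm: "f \<in> carrier (Mn 0)" using f cm.cochains_subset_maps[OF top, of 0] by auto
    have "f = (\<lambda>t\<in>tuples KC 0. f (tup []))"
    proof (rule extensionalityI)
      fix t assume "t \<in> tuples KC 0"
      then show "f t = (\<lambda>t\<in>tuples KC 0. f (tup [])) t" using tuples_cases(1)[of t KC] by simp
    qed (use fm in \<open>simp_all add: PiE_iff\<close>)
    moreover have "f (tup []) \<in> carrier \<F>\<^sub>p" using fm tup_in_tuples(1)[of KC] by (auto simp: PiE_iff)
    ultimately show ?thesis using constant_Zn0[of "f (tup [])"] by (simp add: cocycles_def)
  qed
  moreover have "(\<lambda>t\<in>tuples KC 0. 0) \<in> carrier (Cn 0)"
    using constant_Zn0[OF Fp.zero_closed] by (simp add: cocycles_def Fp_ops)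
  ultimately show ?thesis by (auto simp: coboundaries_def image_iff)
qed

lemma singleton_class: "n < Suc (Suc 0) \<Longrightarrow> f \<in> carrier (Mn n) \<Longrightarrow> Bn n #>\<^bsub>Cn n\<^esub> f = {f}"
  using Mn.l_one[of f n] Bn0 Bn1 by (auto simp: less_Suc_eq r_coset_def)

lemma Hn_singleton:
  assumes "A \<in> carrier (Hn n)" "n < Suc (Suc 0)"
  shows "\<exists>f\<in>Zn n. A = {f}"
proof -
  obtain f where f: "f \<in> Zn n" "A = Bn n #>\<^bsub>Cn n\<^esub> f" using assms(1) by (auto simp: Hn_simps)
  then show ?thesis using singleton_class[OF assms(2) Zn_maps[OF f(1)]] by blast
qed

lemma cup_product_value:
  assumes "a \<noteq> {}" "b \<noteq> {}" "g \<in> carrier (Mn (i + j))"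
    "\<And>f f'. f \<in> a \<Longrightarrow> f' \<in> b \<Longrightarrow> cup_cochain KC \<F>\<^sub>p i j f f' \<in> Bn (i + j) #>\<^bsub>Cn (i + j)\<^esub> g"
  shows "cup_product KC TopC \<F>\<^sub>p i j a b = Bn (i + j) #>\<^bsub>Cn (i + j)\<^esub> g"
proof -
  have "(\<Union>f'\<in>b. cohomology_class KC TopC \<F>\<^sub>p (i + j) (cup_cochain KC \<F>\<^sub>p i j f f')) = Bn (i + j) #>\<^bsub>Cn (i + j)\<^esub> g"
    if "f \<in> a" for f
    by (rule union_of_classes[OF assms(2,3)]) (use assms(4) that in blast)
  then show ?thesis using assms(1) by (auto simp: cup_product_def)
qed

lemma empty_tuple: "restrict t {} = tup []" "(\<lambda>j\<in>{}. t j) = tup []" for t :: "nat \<Rightarrow> 'a"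
  by (auto simp: tup_def)

lemma cup_cochain_one:
  "(\<And>t. t \<in> tuples KC n \<Longrightarrow> f' t \<in> carrier \<F>\<^sub>p) \<Longrightarrow> cup_cochain KC \<F>\<^sub>p 0 n \<one>\<^bsub>Cn 0\<^esub> f' = \<one>\<^bsub>Cn n\<^esub>"
  using tup_in_tuples(1)[of KC] by (auto simp: cup_cochain_def cochains_def Fp_ops empty_tuple intro!: restrict_ext)

lemma cup_product_zero_left:
  assumes "A \<in> carrier (Hn n)"
  shows "cup_product KC TopC \<F>\<^sub>p 0 n (Bn 0) A = Bn n"
proof -
  obtain f where f: "f \<in> Zn n" "A = Bn n #>\<^bsub>Cn n\<^esub> f" using assms by (auto simp: Hn_simps)
  have A: "g \<in> carrier (Mn n)" if "g \<in> A" for g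
    using that Bn_maps Zn_maps[OF f(1)] Mn.m_closed[of _ n f] unfolding f(2) r_coset_def by fastforce
  have "cup_product KC TopC \<F>\<^sub>p 0 n (Bn 0) A = Bn (0 + n) #>\<^bsub>Cn (0 + n)\<^esub> \<one>\<^bsub>Cn n\<^esub>"
  proof (rule cup_product_value)
    show "A \<noteq> {}" using class_self[OF Zn_maps[OF f(1)]] f by blast
    show "\<one>\<^bsub>Cn n\<^esub> \<in> carrier (Mn (0 + n))" using Mn.one_closed[of n] by simp
    fix g g' assume g: "g \<in> Bn 0" "g' \<in> A"
    have "cup_cochain KC \<F>\<^sub>p 0 n g g' = \<one>\<^bsub>Cn n\<^esub>"
      using g(1) cup_cochain_one[of n g'] A[OF g(2)] by (auto simp: Bn0 PiE_iff)
    then show "cup_cochain KC \<F>\<^sub>p 0 n g g' \<in> Bn (0 + n) #>\<^bsub>Cn (0 + n)\<^esub> \<one>\<^bsub>Cn n\<^esub>"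
      using class_self[of "\<one>\<^bsub>Cn n\<^esub>" n] Mn.one_closed[of n] by simp
  qed (simp add: Bn0)
  then show ?thesis using class_Bn[OF subgroup.one_closed[OF subgroup_Bn[of n]]] by simp
qed

lemma cup_cochain_constant:
  assumes "f \<in> carrier (Mn n)" "g \<in> carrier (Mn 0)"
  shows "cup_cochain KC \<F>\<^sub>p n 0 f g = f [^]\<^bsub>Mn n\<^esub> nat (g (tup []))"
proof -
  have g: "g (tup []) \<in> carrier \<F>\<^sub>p" using assms(2) tup_in_tuples(1)[of KC] by (auto simp: PiE_iff)
  have r: "restrict t {..<n} = t" if "t \<in> tuples KC n" for t using that by (simp add: PiE_restrict)
  show ?thesis
    unfolding pow_Mn[OF assms(1)] cup_cochain_def
  proof (rule ext)
    fix t
    show "(\<lambda>x\<in>tuples KC (n + 0). f (restrict x {..<n}) \<otimes>\<^bsub>\<F>\<^sub>p\<^esub> g (\<lambda>j\<in>{..<0}. x (n + j))) t =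
        (\<lambda>t\<in>tuples KC n. int (nat (g (tup []))) * f t mod int p) t"
      using g r[of t] empty_tuple(2)[of "\<lambda>j. t (n + j)"] by (cases "t \<in> tuples KC n") (simp_all add: Fp_ops mult.commute)
  qed
qed

lemma cup_cochain_Zn2:
  assumes f: "f \<in> Zn (Suc 0)" and f': "f' \<in> Zn (Suc 0)"
  shows "cup_cochain KC \<F>\<^sub>p (Suc 0) (Suc 0) f f' \<in> Zn (Suc (Suc 0))"
proof -
  let ?c = "cup_cochain KC \<F>\<^sub>p (Suc 0) (Suc 0) f f'"
  note Cm = closed_subgroupD(5)[OF C]
  note h = Zn1_hom[OF f] Zn1_hom[OF f']
  have v: "?c (tup [a, b]) = (f (tup [a]) * f' (tup [b])) mod int p" if "a \<in> C" "b \<in> C" for a b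
    using that tup_in_tuples(3)[of a b KC] by (simp add: cup_cochain_def tup_manip Fp_ops)
  have vc: "?c (tup [a, b]) \<in> carrier \<F>\<^sub>p" if "a \<in> C" "b \<in> C" for a b
    using v[OF that] p_gt_1 by (simp add: Fp_ops)
  have ext: "?c \<in> extensional (tuples KC (Suc (Suc 0)))" by (simp add: cup_cochain_def)
  have "continuous_map (product_topology (\<lambda>_. TopC) {..<Suc (Suc 0)}) (discrete_topology UNIV) ?c"
  proof (rule continuous_map_eq)
    show "continuous_map (product_topology (\<lambda>_. TopC) {..<Suc (Suc 0)}) (discrete_topology UNIV)
      (\<lambda>t. (\<lambda>a b c. (a * b) mod int p) (f (tup [t 0])) (f' (tup [t (Suc 0)])) ((\<lambda>_. 0::int) (t 0 \<otimes> t (Suc 0))))"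
      by (rule tuple_fun_continuous[OF C, where P = "\<lambda>x. f (tup [x])" and Q = "\<lambda>x. f' (tup [x])" and R = "\<lambda>_. 0"])
        (use h loc_const_const in \<open>auto simp: fp_hom_def\<close>)
    fix t assume "t \<in> topspace (product_topology (\<lambda>_. TopC) {..<Suc (Suc 0)})"
    then have "t \<in> tuples KC (Suc (Suc 0))" using topspace_TopC by simp
    then obtain a b where "a \<in> C" "b \<in> C" "t = tup [a, b]" using tuples_cases(3)[of t KC] by auto
    then show "(\<lambda>a b c. (a * b) mod int p) (f (tup [t 0])) (f' (tup [t (Suc 0)])) ((\<lambda>_. 0::int) (t 0 \<otimes> t (Suc 0))) = ?c t"
      using v by simp
  qed
  moreover have "?c t \<in> carrier \<F>\<^sub>p" if "t \<in> topspace (product_topology (\<lambda>_. TopC) {..<Suc (Suc 0)})" for t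
  proof -
    have "t \<in> tuples KC (Suc (Suc 0))" using that topspace_TopC by simp
    then show ?thesis using tuples_cases(3)[of t KC] vc by auto
  qed
  ultimately have "?c \<in> carrier (Cn (Suc (Suc 0)))"
    using ext continuous_map_discrete_iff[of _ "carrier \<F>\<^sub>p" ?c] by (simp add: cochains_def Pi_iff)
  moreover have "cm.d (Suc (Suc 0)) ?c = \<one>\<^bsub>Cn (Suc (Suc (Suc 0)))\<^esub>"
  proof (rule extensionalityI)
    fix t assume t: "t \<in> tuples KC (Suc (Suc (Suc 0)))"
    then obtain a b c where abc: "a \<in> C" "b \<in> C" "c \<in> C" "t = tup [a, b, c]" using tuples_cases(4)[of t KC] by auto
    have "cm.d (Suc (Suc 0)) ?c (tup [a, b, c]) =
        ?c (tup [b, c]) \<oplus>\<^bsub>\<F>\<^sub>p\<^esub> (?c (tup [a, b \<otimes>\<^bsub>KC\<^esub> c]) \<oplus>\<^bsub>\<F>\<^sub>p\<^esub> \<ominus>\<^bsub>\<F>\<^sub>p\<^esub> ?c (tup [a \<otimes>\<^bsub>KC\<^esub> b, c])) \<oplus>\<^bsub>\<F>\<^sub>p\<^esub> \<ominus>\<^bsub>\<F>\<^sub>p\<^esub> ?c (tup [a, b])"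
      by (rule cm.d2) (use vc abc in auto)
    also have "\<dots> = (f (tup [b]) * f' (tup [c]) + (f (tup [a]) * f' (tup [b \<otimes> c]) - f (tup [a \<otimes> b]) * f' (tup [c])) - f (tup [a]) * f' (tup [b])) mod int p"
      using vc[OF abc(1,2)] vc[OF Cm[OF abc(1,2)] abc(3)] v abc Cm by (simp add: Fp_neg Fp_ops(3) mod_simps)
    also have "\<dots> = 0"
    proof -
      have "[f (tup [b]) * f' (tup [c]) + (f (tup [a]) * f' (tup [b \<otimes> c]) - f (tup [a \<otimes> b]) * f' (tup [c])) - f (tup [a]) * f' (tup [b]) =
        f (tup [b]) * f' (tup [c]) + (f (tup [a]) * (f' (tup [b]) + f' (tup [c])) - (f (tup [a]) + f (tup [b])) * f' (tup [c])) - f (tup [a]) * f' (tup [b])] (mod int p)"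
        by (intro cong_diff cong_add cong_mult cong_refl fp_hom_mult[OF h(1)] fp_hom_mult[OF h(2)] abc)
      then show ?thesis by (simp add: cong_def algebra_simps)
    qed
    finally show "cm.d (Suc (Suc 0)) ?c t = \<one>\<^bsub>Cn (Suc (Suc (Suc 0)))\<^esub> t"
      using t abc by (simp add: cochains_def Fp_ops)
  qed (simp_all add: differential_def cochains_def)
  ultimately show ?thesis by (simp add: cocycles_def)
qed

text \<open>Words are evaluated by \<open>foldr\<close>, so the products that occur have an element
  of degree 1 on the left. In degree 2 the summands with \<open>v 0\<close> or \<open>v 2\<close>
  are trivial, and the cup product of the two degree 1 parts remains.\<close>

lemma good_mult:
  assumes v: "v \<in> gr (Suc 0)" and x: "good x"
  shows "good (v \<otimes>\<^bsub>HR\<^esub> x)"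
proof -
  let ?cup = "\<lambda>i j. cup_product KC TopC \<F>\<^sub>p i j (v i) (x j)"
  have v0: "v 0 = Bn 0" and v2: "v (Suc (Suc 0)) = Bn (Suc (Suc 0))" and v1: "v (Suc 0) \<in> carrier (Hn (Suc 0))"
    using v by (auto simp: cohomology_grading_def cohomology_ring_def Hn_simps(2))
  obtain f where f: "f \<in> Zn (Suc 0)" "v (Suc 0) = {f}"
    using Hn_singleton[OF v1] by blast
  obtain c where c: "c \<in> Zn 0" "x 0 = {c}"
    using Hn_singleton[of "x 0" 0] x by (auto simp: good_def)
  obtain f' where f': "f' \<in> Zn (Suc 0)" "x (Suc 0) = {f'}"
    using Hn_singleton[of "x (Suc 0)" "Suc 0"] x by (auto simp: good_def)
  have c0: "?cup 0 n = Bn n" if "x n \<in> carrier (Hn n)" for n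
    using cup_product_zero_left[OF that] v0 by simp
  let ?k = "nat (c (tup []))"
  have c10: "?cup (Suc 0) 0 = Bn (Suc 0) #>\<^bsub>Cn (Suc 0)\<^esub> (f [^]\<^bsub>Mn (Suc 0)\<^esub> ?k)"
  proof -
    have "?cup (Suc 0) 0 = Bn (Suc 0 + 0) #>\<^bsub>Cn (Suc 0 + 0)\<^esub> (f [^]\<^bsub>Mn (Suc 0)\<^esub> ?k)"
    proof (rule cup_product_value)
      show m: "f [^]\<^bsub>Mn (Suc 0)\<^esub> ?k \<in> carrier (Mn (Suc 0 + 0))" using Zn_maps[OF pow_Zn[OF f(1)]] by simp
      fix g g' assume "g \<in> v (Suc 0)" "g' \<in> x 0"
      then have "cup_cochain KC \<F>\<^sub>p (Suc 0) 0 g g' = f [^]\<^bsub>Mn (Suc 0)\<^esub> ?k"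
        using f c cup_cochain_constant[OF Zn_maps[OF f(1)] Zn_maps[OF c(1)]] by simp
      then show "cup_cochain KC \<F>\<^sub>p (Suc 0) 0 g g' \<in> Bn (Suc 0 + 0) #>\<^bsub>Cn (Suc 0 + 0)\<^esub> (f [^]\<^bsub>Mn (Suc 0)\<^esub> ?k)"
        using class_self[OF m] by simp
    qed (use f c in auto)
    then show ?thesis by simp
  qed
  have c20: "?cup (Suc (Suc 0)) 0 = Bn (Suc (Suc 0))"
  proof -
    have "?cup (Suc (Suc 0)) 0 = Bn (Suc (Suc 0) + 0) #>\<^bsub>Cn (Suc (Suc 0) + 0)\<^esub> \<one>\<^bsub>Cn (Suc (Suc 0))\<^esub>"
    proof (rule cup_product_value)
      show "\<one>\<^bsub>Cn (Suc (Suc 0))\<^esub> \<in> carrier (Mn (Suc (Suc 0) + 0))" using Mn.one_closed[of "Suc (Suc 0)"] by simp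
      fix g g' assume g: "g \<in> v (Suc (Suc 0))" "g' \<in> x 0"
      have gB: "g \<in> Bn (Suc (Suc 0))" using g v2 by simp
      have "cup_cochain KC \<F>\<^sub>p (Suc (Suc 0)) 0 g g' = g [^]\<^bsub>Mn (Suc (Suc 0))\<^esub> ?k"
        using g c cup_cochain_constant[OF Bn_maps[OF gB] Zn_maps[OF c(1)]] by simp
      then have "cup_cochain KC \<F>\<^sub>p (Suc (Suc 0)) 0 g g' \<in> Bn (Suc (Suc 0))" using pow_Bn[OF gB] by simp
      then show "cup_cochain KC \<F>\<^sub>p (Suc (Suc 0)) 0 g g' \<in> Bn (Suc (Suc 0) + 0) #>\<^bsub>Cn (Suc (Suc 0) + 0)\<^esub> \<one>\<^bsub>Cn (Suc (Suc 0))\<^esub>"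
        using class_Bn[OF subgroup.one_closed[OF subgroup_Bn[of "Suc (Suc 0)"]]] by simp
    qed (use v2 c subgroup.one_closed[OF subgroup_Bn[of "Suc (Suc 0)"]] in auto)
    then show ?thesis using class_Bn[OF subgroup.one_closed[OF subgroup_Bn[of "Suc (Suc 0)"]]] by simp
  qed
  have c11: "?cup (Suc 0) (Suc 0) = Bn (Suc (Suc 0)) #>\<^bsub>Cn (Suc (Suc 0))\<^esub> cup_cochain KC \<F>\<^sub>p (Suc 0) (Suc 0) f f'"
  proof -
    let ?g = "cup_cochain KC \<F>\<^sub>p (Suc 0) (Suc 0) f f'"
    have "?cup (Suc 0) (Suc 0) = Bn (Suc 0 + Suc 0) #>\<^bsub>Cn (Suc 0 + Suc 0)\<^esub> ?g"
      by (rule cup_product_value)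
        (use f f' Zn_maps[OF cup_cochain_Zn2[OF f(1) f'(1)]] class_self[OF Zn_maps[OF cup_cochain_Zn2[OF f(1) f'(1)]]] in auto)
    then show ?thesis by simp
  qed
  have xs: "x 0 \<in> carrier (Hn 0)" "x (Suc 0) \<in> carrier (Hn (Suc 0))" "x (Suc (Suc 0)) \<in> carrier (Hn (Suc (Suc 0)))"
    using x by (auto simp: good_def)
  have h10: "?cup (Suc 0) 0 \<in> carrier (Hn (Suc 0))" unfolding c10 using pow_Zn[OF f(1)] by (auto simp: Hn_simps)
  have h11: "?cup (Suc 0) (Suc 0) \<in> carrier (Hn (Suc (Suc 0)))" "?cup (Suc 0) (Suc 0) \<subseteq> P"
    unfolding c11 using cup_cochain_Zn2[OF f(1) f'(1)] class_subset_conj_trivial[OF cup_conj_trivial[OF f(1) f'(1)]]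
    by (auto simp: Hn_simps)
  interpret H: comm_monoid "Hn n" for n by (rule comm_monoid_Hn)
  have m: "(v \<otimes>\<^bsub>HR\<^esub> x) n = (\<Otimes>\<^bsub>Hn n\<^esub>i\<in>{..n}. ?cup i (n - i))" for n by (simp add: cohomology_ring_def)
  have e0: "(v \<otimes>\<^bsub>HR\<^esub> x) 0 = Bn 0" unfolding m using c0[OF xs(1)] Hn_one_closed[of 0] by simp
  have e1: "(v \<otimes>\<^bsub>HR\<^esub> x) (Suc 0) = ?cup (Suc 0) 0 \<otimes>\<^bsub>Hn (Suc 0)\<^esub> Bn (Suc 0)"
    unfolding m using c0[OF xs(2)] h10 Hn_one_closed[of "Suc 0"] by (simp add: atMost_Suc)
  have e2: "(v \<otimes>\<^bsub>HR\<^esub> x) (Suc (Suc 0)) =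
      ?cup (Suc (Suc 0)) 0 \<otimes>\<^bsub>Hn (Suc (Suc 0))\<^esub> (?cup (Suc 0) (Suc 0) \<otimes>\<^bsub>Hn (Suc (Suc 0))\<^esub> Bn (Suc (Suc 0)))"
    unfolding m using c0[OF xs(3)] h11 c20 Hn_one_closed[of "Suc (Suc 0)"] by (simp add: atMost_Suc)
  show ?thesis
    unfolding good_def e0 e1 e2 c20 Hn_simps(3)
    by (intro conjI Hn_mult_closed set_mult_subset_conj_trivial Hn_one_closed Bn2_subset h10 h11)
qed

text \<open>An undefined sum in \<open>free_algebra_eval\<close>, or an undefined value of \<open>the_elem\<close>, is always the
  element \<open>THE x. False\<close>. As \<open>H\<^sup>0\<close> has more than one element, this single element is
  negligible, and well-definedness of the algebra operations in higher degrees need not be checked.\<close>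

lemma free_algebra_eval_junk_or_good:
  assumes "f \<in> carrier (free_algebra \<F>\<^sub>p (gr (Suc 0)))"
  shows "free_algebra_eval \<F>\<^sub>p HR f = (THE x. False) \<or> good (free_algebra_eval \<F>\<^sub>p HR f)"
proof -
  have f: "f w \<in> carrier \<F>\<^sub>p" "f w \<noteq> \<zero>\<^bsub>\<F>\<^sub>p\<^esub> \<Longrightarrow> w \<in> lists (gr (Suc 0))" for w
    using assms by (auto simp: free_algebra_def)
  have word: "good (foldr (\<lambda>u v. u \<otimes>\<^bsub>HR\<^esub> v) w \<one>\<^bsub>HR\<^esub>)" if "w \<in> lists (gr (Suc 0))" for w
    using that by induction (auto intro: good_one good_mult)
  have lcomm: "a \<oplus>\<^bsub>HR\<^esub> (b \<oplus>\<^bsub>HR\<^esub> c) = b \<oplus>\<^bsub>HR\<^esub> (a \<oplus>\<^bsub>HR\<^esub> c)" for a b c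
    using set_mult_lcomm by (simp add: cohomology_ring_def Hn_simps(3))
  show ?thesis
    unfolding free_algebra_eval_def finsum_def
    by (rule finprod_junk_or_invariant)
      (use lcomm good_zero good_add good_smult word f in auto)
qed

lemma the_elem_cases: "the_elem A = (THE x. False) \<or> (\<exists>a. A = {a} \<and> the_elem A = a)"
proof (cases "\<exists>a. A = {a}")
  case False
  then have "(\<lambda>x. A = {x}) = (\<lambda>x. False)" by auto
  then show ?thesis by (simp add: the_elem_def)
qed auto

text \<open>\<open>genideal\<close> is an intersection of ideals, hence \<open>UNIV\<close> if no
  ideal contains the relators. In that case the quotient would have a single coset and its image a
  single element, against \<open>more\<close>. Otherwise cosets consist of elements of the free
  algebra, to which \<open>free_algebra_eval_junk_or_good\<close> applies.\<close>

lemma HR_junk_or_good: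
  assumes alg: "quadratic_algebra \<F>\<^sub>p HR gr" and x: "x \<in> carrier HR"
    and more: "\<exists>x'. x' \<in> carrier HR \<and> x' \<noteq> x"
  shows "x = (THE x. False) \<or> good x"
proof -
  let ?F = "free_algebra \<F>\<^sub>p (gr (Suc 0))"
  define I where "I = linearity_ideal \<F>\<^sub>p HR (gr (Suc 0))"
  have onto: "tensor_algebra_map \<F>\<^sub>p HR ` carrier (?F Quot I) = carrier HR"
    using alg by (simp add: quadratic_algebra_def Let_def tensor_algebra_def I_def)
  have carr: "carrier (?F Quot I) = (\<lambda>f. \<Union>h\<in>I. {h \<oplus>\<^bsub>?F\<^esub> f}) ` carrier ?F"
    by (auto simp: FactRing_def A_RCOSETS_def RCOSETS_def r_coset_def)
  have IU: "I = UNIV \<or> (ring ?F \<and> I \<subseteq> carrier ?F)"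
  proof -
    obtain S where S: "I = Idl\<^bsub>?F\<^esub> S" by (auto simp: I_def linearity_ideal_def Let_def)
    show ?thesis
    proof (cases "\<exists>J. ideal J ?F \<and> S \<subseteq> J")
      case True
      then obtain J where J: "ideal J ?F" "S \<subseteq> J" by blast
      then have "I \<subseteq> J" by (auto simp: S genideal_def)
      moreover have "J \<subseteq> carrier ?F" using J(1) ideal.axioms(1) additive_subgroup.a_subset by blast
      ultimately show ?thesis using J(1) ideal.axioms(2) by blast
    next
      case False
      then show ?thesis by (auto simp: S genideal_def)
    qed
  qed
  have sub: "t \<subseteq> carrier ?F" if t: "t \<in> carrier (?F Quot I)" for t
  proof (cases "I = UNIV")
    case True
    define U :: "((nat \<Rightarrow> ((nat \<Rightarrow> 'a) \<Rightarrow> int) set) list \<Rightarrow> int) set"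
      where "U = {g. \<forall>w. g w \<in> carrier \<F>\<^sub>p}"
    have "(\<Union>h\<in>I. {h \<oplus>\<^bsub>?F\<^esub> f}) = U" if f: "f \<in> carrier ?F" for f
    proof (intro equalityI subsetI)
      fix g assume "g \<in> (\<Union>h\<in>I. {h \<oplus>\<^bsub>?F\<^esub> f})"
      then show "g \<in> U" using p_gt_1 by (auto simp: U_def free_algebra_def Fp_ops)
    next
      fix g assume g: "g \<in> U"
      \<comment> \<open>With \<open>I = UNIV\<close> the pointwise integer difference is available
        as the summand from \<open>I\<close>, so the coset of \<open>f\<close> is \<open>U\<close>
        whatever \<open>f\<close> is.\<close>
      have "g = (\<lambda>w. g w - f w) \<oplus>\<^bsub>?F\<^esub> f" using g by (auto simp: U_def free_algebra_def Fp_ops)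
      then show "g \<in> (\<Union>h\<in>I. {h \<oplus>\<^bsub>?F\<^esub> f})" using True by blast
    qed
    then have "carrier (?F Quot I) \<subseteq> {U}" unfolding carr by auto
    then have "carrier HR \<subseteq> {tensor_algebra_map \<F>\<^sub>p HR U}"
      unfolding onto[symmetric] by auto
    then show ?thesis using x more by blast
  next
    case False
    then have F: "ring ?F" "I \<subseteq> carrier ?F" using IU by auto
    interpret F: ring ?F by (rule F(1))
    show ?thesis using t F(2) F.a_closed unfolding carr by auto
  qed
  obtain t where t: "t \<in> carrier (?F Quot I)" "x = the_elem (free_algebra_eval \<F>\<^sub>p HR ` t)"
    using x onto by (force simp: tensor_algebra_map_def)
  show ?thesis
    using the_elem_cases[of "free_algebra_eval \<F>\<^sub>p HR ` t"]
  proof (elim disjE exE conjE)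
    fix a assume a: "free_algebra_eval \<F>\<^sub>p HR ` t = {a}" "the_elem (free_algebra_eval \<F>\<^sub>p HR ` t) = a"
    then obtain f where "f \<in> t" "a = free_algebra_eval \<F>\<^sub>p HR f" by blast
    then show ?thesis using free_algebra_eval_junk_or_good[of f] sub[OF t(1)] t(2) a(2) by auto
  qed (use t in simp)
qed

text \<open>The Bloch-Kato property spreads the vanishing from cup products to all classes of degree
  2. The undefined element \<open>THE x. False\<close> might be an element of the ring; of two
  elements with the same degree 2 part and different degree 0 parts, at least one is not it.\<close>

lemma two_cocycles_conj_trivial:
  assumes \<beta>: "\<beta> \<in> Zn (Suc (Suc 0))"
  shows "\<beta> \<in> conj_trivial z y"
proof -
  have alg: "quadratic_algebra \<F>\<^sub>p HR gr"
    using cyclo_oriented C by (auto simp: cyclo_oriented_def bloch_kato_group_def)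
  define x where "x c = (\<lambda>n. if n = 0 then {\<lambda>t\<in>tuples KC 0. c} else if n = Suc (Suc 0) then Bn n #>\<^bsub>Cn n\<^esub> \<beta> else Bn n)" for c :: int
  have xc: "x c \<in> carrier HR" if "c \<in> carrier \<F>\<^sub>p" for c
  proof -
    have "{\<lambda>t\<in>tuples KC 0. c} \<in> carrier (Hn 0)"
      using singleton_class[OF _ Zn_maps[OF constant_Zn0[OF that]]] constant_Zn0[OF that] by (force simp: Hn_simps(1))
    then have "x c n \<in> carrier (Hn n)" for n
      using \<beta> Hn_one_closed by (auto simp: x_def Hn_simps(1))
    moreover have "finite {n. x c n \<noteq> \<one>\<^bsub>Hn n\<^esub>}"
      by (rule finite_subset[of _ "{0, Suc (Suc 0)}"]) (auto simp: x_def Hn_simps(2))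
    ultimately show ?thesis by (simp add: cohomology_ring_def)
  qed
  have ne: "x 0 \<noteq> x 1"
  proof
    assume "x 0 = x 1"
    then have "x 0 0 = x 1 0" by simp
    then have "(\<lambda>t\<in>tuples KC 0. 0::int) = (\<lambda>t\<in>tuples KC 0. 1)" by (simp add: x_def)
    then have "(\<lambda>t\<in>tuples KC 0. 0::int) (tup []) = (\<lambda>t\<in>tuples KC 0. 1) (tup [])" by simp
    then show False using tup_in_tuples(1)[of KC] by simp
  qed
  have c: "(0::int) \<in> carrier \<F>\<^sub>p" "(1::int) \<in> carrier \<F>\<^sub>p" using p_gt_1 by (auto simp: Fp_ops)
  have "x 0 = (THE x. False) \<or> good (x 0)" "x 1 = (THE x. False) \<or> good (x 1)"
    using HR_junk_or_good[OF alg xc[OF c(1)]] HR_junk_or_good[OF alg xc[OF c(2)]] xc[OF c(1)] xc[OF c(2)] ne by metis+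
  then obtain c where "good (x c)" using ne by metis
  then have "Bn (Suc (Suc 0)) #>\<^bsub>Cn (Suc (Suc 0))\<^esub> \<beta> \<subseteq> P" by (auto simp: good_def x_def)
  then show ?thesis using class_self[OF Zn_maps[OF \<beta>]] by blast
qed

end

end

end

section \<open>The corestriction obstruction\<close>

context cyclo_oriented_group
begin

lemma closed_subgroup_kernel:
  assumes C: "closed_subgroup C G T" and g: "fp_hom C g"
  shows "closed_subgroup {x \<in> C. [g x = 0] (mod int p)} G T"
  unfolding closed_subgroup_def
proof
  note Cm = closed_subgroupD[OF C]
  show "subgroup {x \<in> C. [g x = 0] (mod int p)} G"
  proof (rule subgroupI)
    show "{x \<in> C. [g x = 0] (mod int p)} \<noteq> {}" using Cm(4) fp_hom_one[OF C g] by blast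
    fix a assume a: "a \<in> {x \<in> C. [g x = 0] (mod int p)}"
    then show "inv a \<in> {x \<in> C. [g x = 0] (mod int p)}"
      using Cm(6) fp_hom_inv[OF C g, of a] by (auto simp: cong_0_iff cong_dvd_iff)
    fix b assume b: "b \<in> {x \<in> C. [g x = 0] (mod int p)}"
    have "[g (a \<otimes> b) = 0 + 0] (mod int p)"
      using a b fp_hom_mult[OF g, of a b] cong_add[of "g a" 0 "int p" "g b" 0] cong_trans by blast
    then show "a \<otimes> b \<in> {x \<in> C. [g x = 0] (mod int p)}" using a b Cm(5) by simp
  qed (use Cm in auto)
  have "continuous_map (subtopology T C) (discrete_topology UNIV) g"
    using loc_const_imp_continuous g Cm(3) by (auto simp: fp_hom_def)
  then have "closedin (subtopology T C) {x \<in> topspace (subtopology T C). g x \<in> {m. [m = 0] (mod int p)}}"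
    by (rule closedin_continuous_map_preimage) simp
  moreover have "{x \<in> topspace (subtopology T C). g x \<in> {m. [m = 0] (mod int p)}} = {x \<in> C. [g x = 0] (mod int p)}"
    using Cm(3) by auto
  ultimately show "closedin T {x \<in> C. [g x = 0] (mod int p)}" using closedin_trans_full Cm(2) by metis
qed

lemma fp_hom_subset: "fp_hom C f \<Longrightarrow> D \<subseteq> C \<Longrightarrow> fp_hom D f"
  using loc_const_subset[of C f D] unfolding fp_hom_def by blast

text \<open>Intersect the subgroups of the finitely many indices. This gives continuity of the
  corestriction cochain, whose value depends on all cosets at once.\<close>

lemma loc_const_finite_family:
  assumes "finite I" "\<And>i. i \<in> I \<Longrightarrow> loc_const C (f i)"
  shows "loc_const C (\<lambda>c. \<lambda>i\<in>I. f i c)"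
proof -
  have "\<forall>i\<in>I. \<exists>N. open_normal N \<and> (\<forall>x\<in>C. \<forall>y\<in>C. inv x \<otimes> y \<in> N \<longrightarrow> f i x = f i y)"
    using assms(2) by (simp add: loc_const_def)
  from bchoice[OF this] obtain N where N: "\<And>i. i \<in> I \<Longrightarrow> open_normal (N i)"
    "\<And>i x y. i \<in> I \<Longrightarrow> x \<in> C \<Longrightarrow> y \<in> C \<Longrightarrow> inv x \<otimes> y \<in> N i \<Longrightarrow> f i x = f i y" by blast
  have "open_normal (carrier G \<inter> \<Inter>(N ` I))"
    by (rule open_normal_Inter) (use assms(1) N(1) in auto)
  moreover have "(\<lambda>i\<in>I. f i x) = (\<lambda>i\<in>I. f i y)" if "x \<in> C" "y \<in> C" "inv x \<otimes> y \<in> carrier G \<inter> \<Inter>(N ` I)" for x y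
    using that N(2) by (intro restrict_ext) blast
  ultimately show ?thesis unfolding loc_const_def by blast
qed

text \<open>For \<open>h\<close> outside \<open>U\<close> the invariance of \<open>u\<close> at
  \<open>z\<close> comes from \<theta>(h) being 1 modulo \<open>p\<close>.\<close>

lemma fp_hom_theta_conj:
  assumes U: "closed_subgroup U G T" and u: "fp_hom U u" and z: "z \<in> U" and h: "h \<in> carrier G"
    and c: "h \<otimes> z \<otimes> inv h \<in> U" and act: "acts_by_theta z h"
  shows "[u (h \<otimes> z \<otimes> inv h) = u z] (mod int p)"
proof -
  obtain N where N: "open_normal N" "\<And>x y. x \<in> U \<Longrightarrow> y \<in> U \<Longrightarrow> inv x \<otimes> y \<in> N \<Longrightarrow> u x = u y"
    using u by (auto simp: fp_hom_def loc_const_def)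
  have "eventually (\<lambda>n. inv (z [^] nat (\<theta> h n)) \<otimes> (h \<otimes> z \<otimes> inv h) \<in> N \<and> n > 0) sequentially"
    using act N(1) eventually_gt_at_top[of 0] by (intro eventually_conj) (simp_all add: acts_by_theta_def)
  then obtain n where n: "inv (z [^] nat (\<theta> h n)) \<otimes> (h \<otimes> z \<otimes> inv h) \<in> N" "n > 0"
    using eventually_happens'[of sequentially] by fastforce
  have "u (h \<otimes> z \<otimes> inv h) = u (z [^] nat (\<theta> h n))" using N(2)[OF closed_subgroup_pow[OF U z] c n(1)] by simp
  also have "[\<dots> = int (nat (\<theta> h n)) * u z] (mod int p)" by (rule fp_hom_pow[OF U u z])
  also have "[int (nat (\<theta> h n)) * u z = 1 * u z] (mod int p)"
    using theta_mod_p[OF h n(2)] padic_carrierD(3)[OF theta_closed[OF h], of n] by (intro cong_mult) auto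
  finally show ?thesis by simp
qed

text \<open>The key consequence of the Bloch-Kato hypothesis: the corestriction of \<open>u \<union> v\<close> from the
  kernel \<open>U\<close> of \<open>g\<close> to \<open>C\<close> is annihilated by \<^const>\<open>conj_eval\<close>, on which it takes the value \<open>-v(y\<^sup>p)\<close>.\<close>

lemma corestriction_obstruction:
  assumes C: "closed_subgroup C G T" and z: "z \<in> C" and act: "\<And>h. h \<in> C \<Longrightarrow> acts_by_theta z h"
    and killed: "\<And>f. fp_hom C f \<Longrightarrow> [f z = 0] (mod int p)"
    and g: "fp_hom C g" and y: "y \<in> C" "[g y = 1] (mod int p)"
    and U: "U = {x \<in> C. [g x = 0] (mod int p)}"
    and u: "fp_hom U u" "[u z = 1] (mod int p)" and v: "fp_hom U v" "[v z = 0] (mod int p)"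
  shows "[v (y [^] p) = 0] (mod int p)"
proof -
  note Cm = closed_subgroupD[OF C]
  have sU: "closed_subgroup U G T" unfolding U by (rule closed_subgroup_kernel[OF C g])
  have yc: "y \<in> carrier G" using y Cm by blast
  have yp: "y [^] i \<in> C" for i :: nat using closed_subgroup_pow[OF C y(1)] .
  define gn where "gn c = nat (g c mod int p)" for c
  have gn: "[int (gn c) = g c] (mod int p)" "gn c < p" for c
    using p_gt_1 by (simp_all add: gn_def cong_def nat_less_iff)
  \<comment> \<open>Right multiplication by \<open>c\<close> permutes the cosets U y^i of
    \<open>C\<close>, i < p; \<open>j i c\<close> is the index of the image of U y^i.\<close>
  define j where "j i c = (i + gn c) mod p" for i c
  have jp: "j i c < p" for i c using p_gt_1 by (simp add: j_def)
  have jc: "[int (j i c) = int i + g c] (mod int p)" for i c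
    using cong_add[OF cong_refl[of "int i"] gn(1)[of c]] by (simp add: j_def of_nat_mod cong_def)
  have jj: "j (j i a) b = j i (a \<otimes> b)" if "a \<in> C" "b \<in> C" for i a b
  proof -
    have "[int (j (j i a) b) = (int i + g a) + g b] (mod int p)"
      by (rule cong_trans[OF jc]) (intro cong_add jc cong_refl)
    moreover have "[int (j i (a \<otimes> b)) = int i + (g a + g b)] (mod int p)"
      by (rule cong_trans[OF jc]) (intro cong_add fp_hom_mult[OF g] that cong_refl)
    ultimately have "[int (j (j i a) b) = int (j i (a \<otimes> b))] (mod int p)"
      by (simp add: cong_def add.assoc)
    then show ?thesis using jp by (simp add: cong_int_iff cong_less_modulus_unique_nat)
  qed
  \<comment> \<open>The \<open>U\<close>-component of y^i c relative to the transversal y^0, ...,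
    y^(p-1). The rule \<open>\<kappa>mult\<close> says that \<kappa> is a cocycle for the
    permutation action on the cosets.\<close>
  define \<kappa> where "\<kappa> i c = y [^] i \<otimes> c \<otimes> inv (y [^] j i c)" for i c
  have \<kappa>U: "\<kappa> i c \<in> U" if c: "c \<in> C" for i c
  proof -
    have k: "y [^] i \<otimes> c \<in> C" "inv (y [^] j i c) \<in> C" using c yp Cm(5,6) by simp_all
    then have "\<kappa> i c \<in> C" unfolding \<kappa>_def using Cm(5) by blast
    have "[g (inv (y [^] j i c)) = - ((int i + g c) * 1)] (mod int p)"
    proof (rule cong_trans[OF fp_hom_inv[OF C g yp]])
      have "[g (y [^] j i c) = (int i + g c) * 1] (mod int p)"
        by (rule cong_trans[OF fp_hom_pow[OF C g y(1)]]) (intro cong_mult jc y(2))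
      then show "[- g (y [^] j i c) = - ((int i + g c) * 1)] (mod int p)" by (simp only: cong_minus_minus_iff)
    qed
    moreover have "[g (y [^] i \<otimes> c) = int i * 1 + g c] (mod int p)"
      by (rule cong_trans[OF fp_hom_mult[OF g yp c]])
        (intro cong_add cong_refl cong_trans[OF fp_hom_pow[OF C g y(1)]] cong_mult y(2))
    ultimately have "[g (\<kappa> i c) = (int i * 1 + g c) + - ((int i + g c) * 1)] (mod int p)"
      unfolding \<kappa>_def using cong_trans[OF fp_hom_mult[OF g k]] cong_add by blast
    then have "[g (\<kappa> i c) = 0] (mod int p)" by simp
    then show ?thesis using \<open>\<kappa> i c \<in> C\<close> by (simp add: U)
  qed
  have \<kappa>mult: "\<kappa> i (a \<otimes> b) = \<kappa> i a \<otimes> \<kappa> (j i a) b" if "a \<in> C" "b \<in> C" for i a b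
    using that Cm yc by (simp add: \<kappa>_def jj m_assoc)
  have lc: "loc_const C (\<lambda>c. w (\<kappa> i c))" if w: "loc_const U w" for i and w :: "'a \<Rightarrow> int"
  proof -
    obtain N where N: "open_normal N" "\<And>x y. x \<in> U \<Longrightarrow> y \<in> U \<Longrightarrow> inv x \<otimes> y \<in> N \<Longrightarrow> w x = w y"
      using w by (auto simp: loc_const_def)
    obtain N' where N': "open_normal N'" "\<And>x y. x \<in> C \<Longrightarrow> y \<in> C \<Longrightarrow> inv x \<otimes> y \<in> N' \<Longrightarrow> g x = g y"
      using g by (auto simp: loc_const_def fp_hom_def)
    have "w (\<kappa> i a) = w (\<kappa> i b)" if ab: "a \<in> C" "b \<in> C" "inv a \<otimes> b \<in> N \<inter> N'" for a b
    proof (rule N(2)[OF \<kappa>U[OF ab(1)] \<kappa>U[OF ab(2)]])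
      have jab: "j i a = j i b" using N'(2)[OF ab(1,2)] ab(3) by (simp add: j_def gn_def)
      let ?t = "y [^] j i b"
      have "inv (\<kappa> i a) \<otimes> \<kappa> i b = ?t \<otimes> (inv a \<otimes> b) \<otimes> inv ?t"
        unfolding \<kappa>_def jab using yc ab Cm(7) by (simp add: inv_mult_group m_assoc)
      then show "inv (\<kappa> i a) \<otimes> \<kappa> i b \<in> N" using open_normalD(8)[OF N(1)] ab(3) yc by simp
    qed
    then show ?thesis unfolding loc_const_def using open_normal_Int[OF N(1) N'(1)] by blast
  qed
  have lu: "loc_const U u" "loc_const U v" using u v by (auto simp: fp_hom_def)
  \<comment> \<open>The corestriction of u \<union> v at the level of cochains: the cup product is
    transported to each coset and summed.\<close>
  define \<alpha> where "\<alpha> = (\<lambda>t\<in>tuples (KC C) (Suc (Suc 0)). (\<Sum>i<p. u (\<kappa> i (t 0)) * v (\<kappa> (j i (t 0)) (t (Suc 0)))) mod int p)"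
  have \<alpha>v: "\<alpha> (tup [a, b]) = (\<Sum>i<p. u (\<kappa> i a) * v (\<kappa> (j i a) b)) mod int p" if "a \<in> C" "b \<in> C" for a b
    using that tup_in_tuples(3)[of a b "KC C"] by (simp add: \<alpha>_def)
  have \<alpha>c: "\<alpha> (tup [a, b]) \<in> carrier \<F>\<^sub>p" if "a \<in> C" "b \<in> C" for a b
    using p_gt_1 by (simp add: \<alpha>v[OF that] Fp_ops)
  have top: "topspace (TopC C) = C" using Cm(3) by auto
  interpret cm: coefficient_module "KC C" "\<F>\<^sub>p" tact by (rule trivial_module[OF C])
  note cm.act_closed [simp del]
  have cont: "continuous_map (product_topology (\<lambda>_. TopC C) {..<Suc (Suc 0)}) (discrete_topology UNIV) \<alpha>"
  proof (rule continuous_map_eq)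
    let ?h = "\<lambda>(a, fu) fv (_::unit). (\<Sum>i<p. fu i * fv ((i + a) mod p)) mod int p"
    let ?P = "\<lambda>c. (gn c, \<lambda>i\<in>{..<p}. u (\<kappa> i c))"
    let ?Q = "\<lambda>c. \<lambda>i\<in>{..<p}. v (\<kappa> i c)"
    show "continuous_map (product_topology (\<lambda>_. TopC C) {..<Suc (Suc 0)}) (discrete_topology UNIV)
       (\<lambda>t. ?h (?P (t 0)) (?Q (t (Suc 0))) ((\<lambda>_. ()) (t 0 \<otimes> t (Suc 0))))"
    proof (rule tuple_fun_continuous[OF C, where P = ?P and Q = ?Q and R = "\<lambda>_. ()" and h = ?h])
      have "loc_const C gn" unfolding gn_def by (rule loc_const_comp) (use g in \<open>simp add: fp_hom_def\<close>)
      moreover have "loc_const C (\<lambda>c. \<lambda>i\<in>{..<p}. u (\<kappa> i c))" by (rule loc_const_finite_family) (auto intro: lc lu)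
      ultimately show "loc_const C ?P" by (rule loc_const_comp2[where h = Pair])
      show "loc_const C ?Q" by (rule loc_const_finite_family) (auto intro: lc lu)
      show "loc_const C (\<lambda>_. ())" by (rule loc_const_const)
    qed
    fix t assume "t \<in> topspace (product_topology (\<lambda>_. TopC C) {..<Suc (Suc 0)})"
    then have "t \<in> tuples (KC C) (Suc (Suc 0))" using top by simp
    then obtain a b where ab: "a \<in> C" "b \<in> C" "t = tup [a, b]" using tuples_cases(3)[of t "KC C"] by auto
    show "?h (?P (t 0)) (?Q (t (Suc 0))) ((\<lambda>_. ()) (t 0 \<otimes> t (Suc 0))) = \<alpha> t"
      unfolding ab(3) using \<alpha>v[OF ab(1,2)] p_gt_1 by (simp add: j_def)
  qed
  have "\<alpha> t \<in> carrier \<F>\<^sub>p" if "t \<in> topspace (product_topology (\<lambda>_. TopC C) {..<Suc (Suc 0)})" for t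
  proof -
    have "t \<in> tuples (KC C) (Suc (Suc 0))" using that top by simp
    then show ?thesis using tuples_cases(3)[of t "KC C"] \<alpha>c by auto
  qed
  then have \<alpha>cochain: "\<alpha> \<in> carrier (cochains (KC C) (TopC C) \<F>\<^sub>p TF (Suc (Suc 0)))"
    using cont continuous_map_discrete_iff[of _ "carrier \<F>\<^sub>p" \<alpha>] by (simp add: cochains_def Pi_iff \<alpha>_def)
  have bij: "bij_betw (\<lambda>i. j i a) {..<p} {..<p}" for a
  proof -
    have "inj_on (\<lambda>i. j i a) {..<p}"
    proof (rule inj_onI)
      fix i k assume ik: "i \<in> {..<p}" "k \<in> {..<p}" "j i a = j k a"
      then have "[i + gn a = k + gn a] (mod p)" by (simp add: j_def cong_def)
      then have "[i = k] (mod p)" using cong_add_rcancel_nat by blast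
      then show "i = k" using ik by (simp add: cong_less_modulus_unique_nat)
    qed
    moreover have "(\<lambda>i. j i a) ` {..<p} \<subseteq> {..<p}" using jp by auto
    ultimately show ?thesis by (simp add: bij_betw_def card_image card_subset_eq)
  qed
  have "cm.d (Suc (Suc 0)) \<alpha> = \<one>\<^bsub>cochains (KC C) (TopC C) \<F>\<^sub>p TF (Suc (Suc (Suc 0)))\<^esub>"
  proof (rule extensionalityI)
    fix t assume t: "t \<in> tuples (KC C) (Suc (Suc (Suc 0)))"
    then obtain a b c where abc: "a \<in> C" "b \<in> C" "c \<in> C" "t = tup [a, b, c]" using tuples_cases(4)[of t "KC C"] by auto
    have "cm.d (Suc (Suc 0)) \<alpha> (tup [a, b, c]) =
        \<alpha> (tup [b, c]) \<oplus>\<^bsub>\<F>\<^sub>p\<^esub> (\<alpha> (tup [a, b \<otimes>\<^bsub>KC C\<^esub> c]) \<oplus>\<^bsub>\<F>\<^sub>p\<^esub> \<ominus>\<^bsub>\<F>\<^sub>p\<^esub> \<alpha> (tup [a \<otimes>\<^bsub>KC C\<^esub> b, c])) \<oplus>\<^bsub>\<F>\<^sub>p\<^esub> \<ominus>\<^bsub>\<F>\<^sub>p\<^esub> \<alpha> (tup [a, b])"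
      by (rule cm.d2) (use \<alpha>c abc in auto)
    also have "\<dots> = ((\<Sum>i<p. u (\<kappa> i b) * v (\<kappa> (j i b) c)) + ((\<Sum>i<p. u (\<kappa> i a) * v (\<kappa> (j i a) (b \<otimes> c))) -
        (\<Sum>i<p. u (\<kappa> i (a \<otimes> b)) * v (\<kappa> (j i (a \<otimes> b)) c))) - (\<Sum>i<p. u (\<kappa> i a) * v (\<kappa> (j i a) b))) mod int p"
      using \<alpha>c[OF abc(1,2)] \<alpha>c[OF Cm(5)[OF abc(1,2)] abc(3)] \<alpha>v abc Cm(5) by (simp add: Fp_neg Fp_ops(3) mod_simps)
    \<comment> \<open>Reindexing by the permutation attached to \<open>a\<close> aligns this sum
      with the others; the summands then cancel as in d(u \<union> v) = 0.\<close>
    also have "(\<Sum>i<p. u (\<kappa> i b) * v (\<kappa> (j i b) c)) = (\<Sum>i<p. u (\<kappa> (j i a) b) * v (\<kappa> (j (j i a) b) c))"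
      using sum.reindex_bij_betw[OF bij[of a], of "\<lambda>i. u (\<kappa> i b) * v (\<kappa> (j i b) c)"] by simp
    also have "((\<Sum>i<p. u (\<kappa> (j i a) b) * v (\<kappa> (j (j i a) b) c)) + ((\<Sum>i<p. u (\<kappa> i a) * v (\<kappa> (j i a) (b \<otimes> c))) -
        (\<Sum>i<p. u (\<kappa> i (a \<otimes> b)) * v (\<kappa> (j i (a \<otimes> b)) c))) - (\<Sum>i<p. u (\<kappa> i a) * v (\<kappa> (j i a) b))) mod int p = 0"
    proof -
      have "[u (\<kappa> (j i a) b) * v (\<kappa> (j (j i a) b) c) + (u (\<kappa> i a) * v (\<kappa> (j i a) (b \<otimes> c)) -
        u (\<kappa> i (a \<otimes> b)) * v (\<kappa> (j i (a \<otimes> b)) c)) - u (\<kappa> i a) * v (\<kappa> (j i a) b) = 0] (mod int p)" for i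
      proof -
        let ?A = "\<kappa> i a" and ?B = "\<kappa> (j i a) b" and ?C = "\<kappa> (j (j i a) b) c"
        have "[u ?B * v ?C + (u ?A * v (?B \<otimes> ?C) - u (?A \<otimes> ?B) * v ?C) - u ?A * v ?B =
           u ?B * v ?C + (u ?A * (v ?B + v ?C) - (u ?A + u ?B) * v ?C) - u ?A * v ?B] (mod int p)"
          by (intro cong_diff cong_add cong_mult cong_refl fp_hom_mult[OF u(1)] fp_hom_mult[OF v(1)] \<kappa>U abc)
        then show ?thesis using abc by (simp add: \<kappa>mult jj algebra_simps)
      qed
      then have "[(\<Sum>i<p. u (\<kappa> (j i a) b) * v (\<kappa> (j (j i a) b) c) + (u (\<kappa> i a) * v (\<kappa> (j i a) (b \<otimes> c)) -
        u (\<kappa> i (a \<otimes> b)) * v (\<kappa> (j i (a \<otimes> b)) c)) - u (\<kappa> i a) * v (\<kappa> (j i a) b)) = (\<Sum>i<p. 0)] (mod int p)"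
        by (intro cong_sum)
      then show ?thesis by (simp add: sum.distrib sum_subtractf cong_def)
    qed
    finally show "cm.d (Suc (Suc 0)) \<alpha> t = \<one>\<^bsub>cochains (KC C) (TopC C) \<F>\<^sub>p TF (Suc (Suc (Suc 0)))\<^esub> t"
      using t abc by (simp add: cochains_def Fp_ops)
  qed (simp_all add: differential_def cochains_def)
  then have \<alpha>Z: "\<alpha> \<in> cocycles (KC C) (TopC C) \<F>\<^sub>p TF tact (Suc (Suc 0))" using \<alpha>cochain by (simp add: cocycles_def)
  have "\<alpha> \<in> conj_trivial z y"
    by (rule two_cocycles_conj_trivial[OF C z y(1) act[OF y(1)] _ \<alpha>Z]) (rule killed)
  then obtain n where n: "[conj_eval z y \<alpha> n = 0] (mod int p)"
    using eventually_happens'[of sequentially] by (fastforce simp: conj_trivial_def)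
  have zU: "z \<in> U" using z killed[OF g] by (simp add: U)
  have zpC: "z [^] i \<in> C" for i :: nat using closed_subgroup_pow[OF C z] .
  have zpU: "z [^] i \<in> U" for i :: nat using closed_subgroup_pow[OF sU zU] .
  have yzC: "y \<otimes> z \<otimes> inv y \<in> C" using y z Cm(5,6) by simp
  have jz: "j i (z [^] m) = i" if "i < p" for i and m :: nat
  proof -
    have "[g (z [^] m) = 0] (mod int p)" using zpU[of m] unfolding U by blast
    then have "gn (z [^] m) = 0" by (simp add: gn_def cong_def)
    then show ?thesis using that by (simp add: j_def)
  qed
  \<comment> \<open>The permutation of z^m is trivial, and \<kappa> i (z^m) is the
    \<open>m\<close>-th power of a conjugate of \<open>z\<close>, where \<open>v\<close>
    vanishes.\<close>
  have vz: "[v (\<kappa> i (z [^] m)) = 0] (mod int p)" if i: "i < p" for i and m :: nat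
  proof -
    let ?h = "y [^] i"
    have hz: "?h \<otimes> z \<otimes> inv ?h \<in> U" using \<kappa>U[OF z, of i] jz[OF i, of 1] z Cm(7)[OF z] by (simp add: \<kappa>_def del: One_nat_def)
    have "\<kappa> i (z [^] m) = (?h \<otimes> z \<otimes> inv ?h) [^] m"
      unfolding \<kappa>_def jz[OF i] using yc z Cm(7)
    proof (induction m)
      case (Suc m)
      have zc: "z \<in> carrier G" using z Cm(7) by blast
      have "?h \<otimes> z [^] Suc m \<otimes> inv ?h = (?h \<otimes> z [^] m \<otimes> inv ?h) \<otimes> (?h \<otimes> z \<otimes> inv ?h)"
        using yc zc by (simp add: m_assoc)
      then show ?case using Suc by simp
    qed (use yc in simp)
    then have "[v (\<kappa> i (z [^] m)) = int m * v (?h \<otimes> z \<otimes> inv ?h)] (mod int p)"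
      using fp_hom_pow[OF sU v(1) hz] by simp
    also have "[int m * v (?h \<otimes> z \<otimes> inv ?h) = int m * 0] (mod int p)"
      by (intro cong_mult cong_refl cong_trans[OF fp_hom_theta_conj[OF sU v(1) zU _ hz act] v(2)] yp) (use yc in simp)
    finally show ?thesis by simp
  qed
  have t1: "[\<alpha> (tup [c, z [^] m]) = 0] (mod int p)" if "c \<in> C" for c and m :: nat
  proof -
    have "[\<alpha> (tup [c, z [^] m]) = (\<Sum>i<p. u (\<kappa> i c) * 0)] (mod int p)"
    proof -
      have "[(\<Sum>i<p. u (\<kappa> i c) * v (\<kappa> (j i c) (z [^] m))) = (\<Sum>i<p. u (\<kappa> i c) * 0)] (mod int p)"
        by (intro cong_sum cong_mult cong_refl vz jp)
      then show ?thesis unfolding \<alpha>v[OF that zpC] by (simp add: cong_def)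
    qed
    then show ?thesis by simp
  qed
  \<comment> \<open>The factors with \<open>u\<close> are all 1, which leaves the transfer of
    \<open>v\<close> at \<open>y\<close>. Here \<kappa> i y is 1 except for i = p - 1, where the
    index wraps around and \<kappa> i y = y^p.\<close>
  have t2: "[\<alpha> (tup [y \<otimes> z \<otimes> inv y, y]) = v (y [^] p)] (mod int p)"
  proof -
    define w where "w = y \<otimes> z \<otimes> inv y"
    have "gn y = 1" using y(2) p_gt_1 by (simp add: gn_def cong_def)
    then have jy: "j i y = Suc i mod p" for i by (simp add: j_def)
    have zc: "z \<in> carrier G" using z Cm(7) by blast
    have "[g w = 0] (mod int p)" unfolding w_def using fp_hom_conj[OF C g y(1) z] killed[OF g] cong_trans by blast
    then have "gn w = 0" by (simp add: gn_def cong_def)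
    then have jw: "j i w = i" if "i < p" for i using that by (simp add: j_def)
    have uw: "[u (\<kappa> i w) = 1] (mod int p)" if i: "i < p" for i
    proof -
      let ?h = "y [^] Suc i"
      have e: "\<kappa> i w = ?h \<otimes> z \<otimes> inv ?h"
        unfolding \<kappa>_def jw[OF i] unfolding w_def using yc zc by (simp add: inv_mult_group m_assoc)
      have hz: "?h \<otimes> z \<otimes> inv ?h \<in> U" using \<kappa>U[of w i] yzC e by (simp add: w_def)
      show ?thesis unfolding e
        by (rule cong_trans[OF fp_hom_theta_conj[OF sU u(1) zU _ hz act[OF yp]] u(2)]) (use yc in simp)
    qed
    obtain q where q: "p = Suc q" using p_gt_1 by (cases p) auto
    have \<kappa>y: "\<kappa> i y = \<one>" if "i < q" for i
      unfolding \<kappa>_def jy using that yc r_inv[of "y [^] Suc i"] by (simp add: q)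
    have \<kappa>q: "\<kappa> q y = y [^] p"
      unfolding \<kappa>_def jy using yc by (simp add: q)
    have "[(\<Sum>i<p. u (\<kappa> i w) * v (\<kappa> (j i w) y)) = (\<Sum>i<p. 1 * v (\<kappa> i y))] (mod int p)"
      by (intro cong_sum cong_mult uw) (simp_all add: jw)
    also have "(\<Sum>i<p. 1 * v (\<kappa> i y)) = (\<Sum>i<q. v \<one>) + v (y [^] p)"
      using \<kappa>y \<kappa>q by (simp add: q)
    also have "[\<dots> = (\<Sum>i<q. 0) + v (y [^] p)] (mod int p)"
      by (intro cong_add cong_sum fp_hom_one[OF sU v(1)] cong_refl)
    finally have "[(\<Sum>i<p. u (\<kappa> i w) * v (\<kappa> (j i w) y)) = v (y [^] p)] (mod int p)" by simp
    then show ?thesis using \<alpha>v[OF yzC y(1)] by (simp add: w_def cong_def)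
  qed
  have "[conj_eval z y \<alpha> n = 0 - v (y [^] p) - (\<Sum>i\<in>{1..<nat (\<theta> y n)}. 0)] (mod int p)"
    unfolding conj_eval_def
    by (intro cong_diff cong_sum t1 t2 z) (use t1[OF y(1), of 1] Cm(7)[OF z] in simp)
  then have "[- v (y [^] p) = 0] (mod int p)" using n by (simp add: cong_def)
  then show ?thesis by (simp add: cong_0_iff)
qed

end

section \<open>The theta-centre\<close>

lemma closure_of_meets_open: "x \<in> X closure_of S \<Longrightarrow> openin X U \<Longrightarrow> x \<in> U \<Longrightarrow> \<exists>w\<in>S. w \<in> U"
  by (auto simp: in_closure_of)

section \<open>Congruences modulo open normal subgroups and closed generation\<close>

context pro_p
begin

definition ncong :: "'a set \<Rightarrow> 'a \<Rightarrow> 'a \<Rightarrow> bool" where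
  "ncong N x y \<longleftrightarrow> inv x \<otimes> y \<in> N"

context
  fixes N
  assumes N: "open_normal N"
begin

lemma ncong_refl: "x \<in> carrier G \<Longrightarrow> ncong N x x"
  using open_normalD(5)[OF N] by (simp add: ncong_def)

lemma ncong_sym: "x \<in> carrier G \<Longrightarrow> y \<in> carrier G \<Longrightarrow> ncong N x y \<Longrightarrow> ncong N y x"
  using open_normalD(7)[OF N, of "inv x \<otimes> y"] by (simp add: ncong_def inv_mult_group)

lemma ncong_trans:
  assumes "x \<in> carrier G" "y \<in> carrier G" "w \<in> carrier G" "ncong N x y" "ncong N y w"
  shows "ncong N x w"
  using open_normalD(6)[OF N, of "inv x \<otimes> y" "inv y \<otimes> w"] assms by (simp add: ncong_def m_assoc)

lemma ncong_mult:
  assumes "x \<in> carrier G" "y \<in> carrier G" "x' \<in> carrier G" "y' \<in> carrier G" "ncong N x y" "ncong N x' y'"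
  shows "ncong N (x \<otimes> x') (y \<otimes> y')"
proof -
  have "inv (x \<otimes> x') \<otimes> (y \<otimes> y') = (inv x' \<otimes> (inv x \<otimes> y) \<otimes> x') \<otimes> (inv x' \<otimes> y')"
    using assms by (simp add: inv_mult_group m_assoc)
  then show ?thesis
    using open_normalD(6,9)[OF N] assms by (simp add: ncong_def)
qed

lemma ncong_inv:
  assumes "x \<in> carrier G" "y \<in> carrier G" "ncong N x y"
  shows "ncong N (inv x) (inv y)"
proof -
  have "inv (inv x) \<otimes> inv y = inv (x \<otimes> (inv x \<otimes> y) \<otimes> inv x)"
    using assms by (simp add: inv_mult_group m_assoc)
  moreover have "x \<otimes> (inv x \<otimes> y) \<otimes> inv x \<in> N"
    using open_normalD(8)[OF N] assms unfolding ncong_def by blast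
  ultimately show ?thesis using open_normalD(7)[OF N] unfolding ncong_def by metis
qed

lemma ncong_pow:
  assumes "x \<in> carrier G" "y \<in> carrier G" "ncong N x y"
  shows "ncong N (x [^] (m::nat)) (y [^] m)"
  using assms by (induction m) (simp_all add: ncong_refl ncong_mult)

lemma ncong_conj:
  assumes "g \<in> carrier G" "x \<in> carrier G" "y \<in> carrier G" "ncong N x y"
  shows "ncong N (g \<otimes> x \<otimes> inv g) (g \<otimes> y \<otimes> inv g)"
  using assms by (intro ncong_mult) (simp_all add: ncong_refl)

lemma ncong_pow_exponent:
  assumes x: "x \<in> carrier G" and k: "x [^] (p ^ k) \<in> N" and mn: "[m = n] (mod p ^ k)"
  shows "ncong N (x [^] m) (x [^] n)"
proof -
  have le: "ncong N (x [^] m) (x [^] n)" if "m \<le> n" "[m = n] (mod p ^ k)" for m n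
  proof -
    have "p ^ k dvd n - m" using that cong_altdef_nat[of m n "p ^ k"] by (simp add: cong_sym_eq)
    then obtain q where "n - m = p ^ k * q" by (rule dvdE)
    then have q: "n = m + q * p ^ k" using that(1) by (simp add: mult.commute)
    have "inv (x [^] m) \<otimes> x [^] n = (x [^] (p ^ k)) [^] q"
      unfolding q using x by (simp add: nat_pow_mult[symmetric] nat_pow_pow mult.commute)
    moreover have "(x [^] (p ^ k)) [^] q \<in> N"
      by (induction q) (use open_normalD[OF N] k in simp_all)
    ultimately show ?thesis by (simp add: ncong_def)
  qed
  show ?thesis
  proof (cases "m \<le> n")
    case False
    then show ?thesis using ncong_sym[OF _ _ le[OF _ cong_sym[OF mn]]] x by simp
  qed (use le mn in blast)
qed

end

lemma eq_if_ncong: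
  assumes "x \<in> carrier G" "y \<in> carrier G" "\<And>N. open_normal N \<Longrightarrow> ncong N x y"
  shows "x = y"
proof (rule ccontr)
  assume "x \<noteq> y"
  then have "inv x \<otimes> y \<noteq> \<one>" using assms(1,2) by (metis inv_equality inv_inv inv_closed)
  then show False using open_normal_separation[of "inv x \<otimes> y"] assms by (auto simp: ncong_def)
qed

lemma closed_if_ncong:
  assumes "closedin T C" "x \<in> carrier G" "\<And>N. open_normal N \<Longrightarrow> \<exists>y\<in>C. ncong N x y"
  shows "x \<in> C"
  using closed_subgroup_separation[OF assms(1,2)] assms(3) unfolding ncong_def by blast

definition closed_gen :: "'a set \<Rightarrow> 'a set" where
  "closed_gen S = \<Inter>{C. closed_subgroup C G T \<and> S \<subseteq> C}"

lemma closed_subgroup_carrier: "closed_subgroup (carrier G) G T"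
  using closedin_topspace[of T] by (simp add: closed_subgroup_def subgroup_self)

lemma closed_gen:
  assumes "S \<subseteq> carrier G"
  shows "closed_subgroup (closed_gen S) G T" "S \<subseteq> closed_gen S"
proof -
  have "carrier G \<in> {C. closed_subgroup C G T \<and> S \<subseteq> C}" using closed_subgroup_carrier assms by simp
  then show "closed_subgroup (closed_gen S) G T"
    unfolding closed_gen_def by (intro closed_subgroup_Inter) blast+
qed (unfold closed_gen_def, blast)

lemma closed_gen_least: "closed_subgroup C G T \<Longrightarrow> S \<subseteq> C \<Longrightarrow> closed_gen S \<subseteq> C"
  by (auto simp: closed_gen_def)

lemma closed_subgroup_trivial: "closed_subgroup {\<one>} G T"
  using Hausdorff triv_subgroup by (simp add: closed_subgroup_def closedin_Hausdorff_singleton)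

lemma closed_subgroup_centralizer:
  assumes x: "x \<in> carrier G"
  shows "closed_subgroup {h \<in> carrier G. h \<otimes> x = x \<otimes> h} G T"
  unfolding closed_subgroup_def
proof
  show "subgroup {h \<in> carrier G. h \<otimes> x = x \<otimes> h} G"
  proof (rule subgroupI)
    fix a assume a: "a \<in> {h \<in> carrier G. h \<otimes> x = x \<otimes> h}"
    then have ac: "a \<in> carrier G" "a \<otimes> x = x \<otimes> a" by auto
    have "inv a \<otimes> x = inv a \<otimes> (x \<otimes> a) \<otimes> inv a" using ac(1) x by (simp add: m_assoc)
    also have "\<dots> = x \<otimes> inv a" unfolding ac(2)[symmetric] using ac(1) x by (simp add: m_assoc)
    finally show "inv a \<in> {h \<in> carrier G. h \<otimes> x = x \<otimes> h}" using ac by simp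
    fix b assume b: "b \<in> {h \<in> carrier G. h \<otimes> x = x \<otimes> h}"
    then show "a \<otimes> b \<in> {h \<in> carrier G. h \<otimes> x = x \<otimes> h}" using a x by (simp add: m_assoc) (simp flip: m_assoc)
  qed (use x in \<open>auto intro!: exI[of _ \<one>]\<close>)
  have "closedin T {h \<in> topspace T. h \<otimes> x = x \<otimes> h}"
    by (rule closedin_continuous_maps_eq[OF Hausdorff]) (use x in \<open>auto intro!: continuous_map_mult simp: continuous_map_const\<close>)
  then show "closedin T {h \<in> carrier G. h \<otimes> x = x \<otimes> h}" by simp
qed

end

section \<open>Powers with p-adic exponents and the group structure of the theta-centre\<close>

context cyclo_oriented_group
begin

text \<open>The relation y = x^a for a \<open>p\<close>-adic exponent, as eventual congruence modulo
  each open normal subgroup. The residues of a \<open>p\<close>-adic integer are nonnegative, so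
  \<open>nat\<close> loses nothing.\<close>

definition lim_pow :: "'a \<Rightarrow> (nat \<Rightarrow> int) \<Rightarrow> 'a \<Rightarrow> bool" where
  "lim_pow x a y \<longleftrightarrow> y \<in> carrier G \<and>
     (\<forall>N. open_normal N \<longrightarrow> eventually (\<lambda>n. ncong N (x [^] nat (a n)) y) sequentially)"

lemma limitin_iff_lim_pow:
  assumes x: "x \<in> carrier G" and a: "a \<in> carrier \<Z>\<^sub>p"
  shows "limitin T (\<lambda>n. x [^] a n) y sequentially \<longleftrightarrow> lim_pow x a y"
proof -
  have pow: "x [^] a n = x [^] nat (a n)" for n
    using padic_carrierD(3)[OF a, of n] by (metis int_pow_int nat_0_le)
  show ?thesis
  proof
    assume L: "limitin T (\<lambda>n. x [^] a n) y sequentially"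
    then have y: "y \<in> carrier G" by (auto simp: limitin_def)
    show "lim_pow x a y"
      unfolding lim_pow_def
    proof (intro conjI allI impI y)
      fix N assume N: "open_normal N"
      have "openin T {w \<in> carrier G. inv y \<otimes> w \<in> N}" using open_coset[OF open_normalD(3)[OF N] y] .
      moreover have "y \<in> {w \<in> carrier G. inv y \<otimes> w \<in> N}" using y open_normalD(5)[OF N] by simp
      ultimately have "eventually (\<lambda>n. x [^] a n \<in> {w \<in> carrier G. inv y \<otimes> w \<in> N}) sequentially"
        using L unfolding limitin_def by blast
      then show "eventually (\<lambda>n. ncong N (x [^] nat (a n)) y) sequentially"
        by (rule eventually_mono) (use ncong_sym[OF N y] x y in \<open>auto simp: pow ncong_def[of N y]\<close>)
    qed
  next
    assume L: "lim_pow x a y"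
    then have y: "y \<in> carrier G" by (simp add: lim_pow_def)
    show "limitin T (\<lambda>n. x [^] a n) y sequentially"
      unfolding limitin_def
    proof (intro conjI allI impI)
      fix U assume U: "openin T U \<and> y \<in> U"
      then obtain N where N: "open_normal N" "\<And>w. w \<in> carrier G \<Longrightarrow> inv y \<otimes> w \<in> N \<Longrightarrow> w \<in> U"
        using open_nbhd_contains_coset[of U y] by auto
      have "eventually (\<lambda>n. ncong N (x [^] nat (a n)) y) sequentially" using L N(1) by (simp add: lim_pow_def)
      then show "eventually (\<lambda>n. x [^] a n \<in> U) sequentially"
        by (rule eventually_mono) (use N(2) ncong_sym[OF N(1) _ y] x in \<open>auto simp: pow ncong_def\<close>)
    qed (use y in simp)
  qed
qed

lemma padic_cong_nat:
  assumes "a \<in> carrier \<Z>\<^sub>p" "k \<le> m" "k \<le> n"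
  shows "[nat (a m) = nat (a n)] (mod p ^ k)"
proof -
  have "[a m = a n] (mod int p ^ k)"
    using padic_cong_le[OF assms(1,2)] padic_cong_le[OF assms(1,3)] cong_sym cong_trans by blast
  then show ?thesis using padic_carrierD(3)[OF assms(1)] by (simp flip: cong_int_iff)
qed

text \<open>Exponents congruent modulo p^k give the same power in a quotient killed by p^k, so the
  powers form a Cauchy sequence. By compactness the closures of all tails have a common point, which
  is the limit.\<close>

lemma lim_pow_ex:
  assumes x: "x \<in> carrier G" and a: "a \<in> carrier \<Z>\<^sub>p"
  shows "\<exists>y. lim_pow x a y"
proof -
  define s where "s n = x [^] nat (a n)" for n
  have sc: "s n \<in> carrier G" for n using x by (simp add: s_def)
  have cauchy: "\<exists>k. \<forall>m\<ge>k. \<forall>n\<ge>k. ncong N (s m) (s n)" if N: "open_normal N" for N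
  proof -
    obtain k where k: "\<And>x. x \<in> carrier G \<Longrightarrow> x [^] (p ^ k) \<in> N" using open_normal_pow[OF N] by blast
    show ?thesis unfolding s_def
      by (intro exI[of _ k] allI impI ncong_pow_exponent[OF N x k[OF x]] padic_cong_nat[OF a])
  qed
  have "\<Inter>(range (\<lambda>m. T closure_of (s ` {m..}))) \<noteq> {}"
  proof (rule compact_space_imp_nest[OF compact])
    show "closedin T (T closure_of (s ` {m..}))" for m by simp
    have "s ` {m..} \<subseteq> T closure_of (s ` {m..})" for m by (rule closure_of_subset) (use sc in auto)
    then show "T closure_of (s ` {m..}) \<noteq> {}" for m by blast
    show "decseq (\<lambda>m. T closure_of (s ` {m..}))"
      by (auto simp: decseq_def intro!: closure_of_mono image_mono)
  qed
  then obtain y where y: "\<And>m. y \<in> T closure_of (s ` {m..})" by blast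
  have yc: "y \<in> carrier G" using y[of 0] by (metis in_closure_of topspace)
  have "lim_pow x a y"
    unfolding lim_pow_def
  proof (intro conjI allI impI yc)
    fix N assume N: "open_normal N"
    obtain k where k: "\<And>m n. m \<ge> k \<Longrightarrow> n \<ge> k \<Longrightarrow> ncong N (s m) (s n)" using cauchy[OF N] by blast
    have "openin T {w \<in> carrier G. inv y \<otimes> w \<in> N}" using open_coset[OF open_normalD(3)[OF N] yc] .
    moreover have "y \<in> {w \<in> carrier G. inv y \<otimes> w \<in> N}" using yc open_normalD(5)[OF N] by simp
    ultimately have "\<exists>w\<in>s ` {k..}. w \<in> {w \<in> carrier G. inv y \<otimes> w \<in> N}"
      by (rule closure_of_meets_open[OF y])
    then obtain m where m: "m \<ge> k" "inv y \<otimes> s m \<in> N" by auto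
    have "ncong N (s n) y" if "n \<ge> k" for n
      using ncong_trans[OF N sc sc yc k[OF that m(1)]] ncong_sym[OF N yc sc] m(2) by (simp add: ncong_def)
    then show "eventually (\<lambda>n. ncong N (x [^] nat (a n)) y) sequentially"
      unfolding s_def eventually_sequentially by blast
  qed
  then show ?thesis by blast
qed

lemma lim_pow_unique:
  assumes x: "x \<in> carrier G" and "lim_pow x a y" "lim_pow x a y'"
  shows "y = y'"
proof (rule eq_if_ncong)
  show yc: "y \<in> carrier G" "y' \<in> carrier G" using assms by (auto simp: lim_pow_def)
  fix N assume N: "open_normal N"
  have "eventually (\<lambda>n. ncong N (x [^] nat (a n)) y \<and> ncong N (x [^] nat (a n)) y') sequentially"
    using assms N by (intro eventually_conj) (auto simp: lim_pow_def)
  then obtain n where "ncong N (x [^] nat (a n)) y" "ncong N (x [^] nat (a n)) y'"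
    using eventually_happens'[OF sequentially_bot] by blast
  then show "ncong N y y'" using ncong_trans[OF N] ncong_sym[OF N] yc x by (meson nat_pow_closed)
qed

lemma padic_pow_eq_iff:
  assumes x: "x \<in> carrier G" and a: "a \<in> carrier \<Z>\<^sub>p"
  shows "y = padic_pow G T x a \<longleftrightarrow> lim_pow x a y"
proof -
  obtain w where w: "lim_pow x a w" using lim_pow_ex[OF x a] by blast
  have "padic_pow G T x a = w"
    unfolding padic_pow_def limitin_iff_lim_pow[OF x a] using w lim_pow_unique[OF x] by blast
  then show ?thesis using w lim_pow_unique[OF x] by blast
qed

lemma acts_by_theta_iff:
  assumes "z \<in> carrier G" "g \<in> carrier G"
  shows "acts_by_theta z g \<longleftrightarrow> lim_pow z (\<theta> g) (g \<otimes> z \<otimes> inv g)"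
  using assms by (simp add: acts_by_theta_def lim_pow_def ncong_def)

abbreviation "Z \<equiv> theta_centre p G T \<theta>"

lemma theta_centre_iff:
  "z \<in> Z \<longleftrightarrow> z \<in> carrier G \<and> \<theta> z = \<one>\<^bsub>\<Z>\<^sub>p\<^esub> \<and> (\<forall>g\<in>carrier G. acts_by_theta z g)"
  using padic_pow_eq_iff[OF _ theta_closed] acts_by_theta_iff
  by (auto simp: theta_centre_def kernel_def units_of_def)

lemma lim_pow_closed:
  assumes C: "closed_subgroup C G T" and x: "x \<in> C" and y: "lim_pow x a y"
  shows "y \<in> C"
proof (rule closed_if_ncong)
  show yc: "y \<in> carrier G" using y by (simp add: lim_pow_def)
  note Cm = closed_subgroupD[OF C]
  show "closedin T C" by (rule Cm)
  fix N assume N: "open_normal N"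
  then obtain n where "ncong N (x [^] nat (a n)) y"
    using y eventually_happens'[OF sequentially_bot] unfolding lim_pow_def by blast
  then show "\<exists>w\<in>C. ncong N y w"
    using ncong_sym[OF N] yc closed_subgroup_pow[OF C x] Cm(7) by blast
qed

definition ker_theta :: "'a set" where
  "ker_theta = {x \<in> carrier G. \<theta> x = \<one>\<^bsub>\<Z>\<^sub>p\<^esub>}"

lemma closed_subgroup_ker_theta: "closed_subgroup ker_theta G T"
  unfolding closed_subgroup_def
proof
  interpret \<theta>: group_hom G "units_of \<Z>\<^sub>p" \<theta>
    using theta_hom Zp.units_group is_group by (simp add: group_hom_def group_hom_axioms_def)
  have "ker_theta = kernel G (units_of \<Z>\<^sub>p) \<theta>" by (simp add: ker_theta_def kernel_def units_of_def)
  then show "subgroup ker_theta G" using \<theta>.subgroup_kernel by simp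
  have cont: "continuous_map T (discrete_topology UNIV) (\<lambda>x. \<theta> x n)" for n
    using loc_const_imp_continuous[OF theta_loc_const, of n] by (metis order_refl subtopology_topspace topspace)
  have "closedin T {x \<in> topspace T. \<theta> x n \<in> {1 mod int p ^ n}}" for n
    by (rule closedin_continuous_map_preimage[OF cont]) simp
  then have "closedin T (\<Inter>n. {x \<in> carrier G. \<theta> x n = 1 mod int p ^ n})"
    by (intro closedin_Inter) auto
  moreover have "(\<Inter>n. {x \<in> carrier G. \<theta> x n = 1 mod int p ^ n}) = ker_theta"
    by (auto simp: ker_theta_def padic_ops fun_eq_iff)
  ultimately show "closedin T ker_theta" by simp
qed

lemma acts_trivially:
  assumes z: "z \<in> carrier G" and h: "h \<in> ker_theta" and act: "acts_by_theta z h"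
  shows "h \<otimes> z \<otimes> inv h = z"
proof -
  have hc: "h \<in> carrier G" "\<theta> h = \<one>\<^bsub>\<Z>\<^sub>p\<^esub>" using h by (auto simp: ker_theta_def)
  have "lim_pow z (\<theta> h) z"
    unfolding lim_pow_def
  proof (intro conjI allI impI z)
    fix N assume N: "open_normal N"
    have "ncong N (z [^] nat (\<theta> h n)) z" if "n > 0" for n
    proof -
      have "1 < int p ^ n" using p_gt_1 that by (simp add: one_less_power)
      then have "\<theta> h n = 1" by (simp add: hc(2) padic_ops)
      then show ?thesis using ncong_refl[OF N z] z by simp
    qed
    then show "eventually (\<lambda>n. ncong N (z [^] nat (\<theta> h n)) z) sequentially"
      using eventually_gt_at_top[of 0] by (rule eventually_mono[rotated])
  qed
  then show ?thesis using lim_pow_unique[OF z] act acts_by_theta_iff[OF z hc(1)] by blast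
qed

lemma closedin_if_ncong:
  assumes "A \<subseteq> carrier G" "\<And>x. x \<in> carrier G \<Longrightarrow> (\<And>N. open_normal N \<Longrightarrow> \<exists>w\<in>A. ncong N x w) \<Longrightarrow> x \<in> A"
  shows "closedin T A"
proof -
  have "T closure_of A \<subseteq> A"
  proof
    fix x assume x: "x \<in> T closure_of A"
    then have xc: "x \<in> carrier G" by (metis in_closure_of topspace)
    show "x \<in> A"
    proof (rule assms(2)[OF xc])
      fix N assume N: "open_normal N"
      have "openin T {w \<in> carrier G. inv x \<otimes> w \<in> N}" "x \<in> {w \<in> carrier G. inv x \<otimes> w \<in> N}"
        using open_coset[OF open_normalD(3)[OF N] xc] xc open_normalD(5)[OF N] by simp_all
      then have "\<exists>w\<in>A. w \<in> {w \<in> carrier G. inv x \<otimes> w \<in> N}" by (rule closure_of_meets_open[OF x])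
      then show "\<exists>w\<in>A. ncong N x w" by (auto simp: ncong_def)
    qed
  qed
  moreover have "A \<subseteq> T closure_of A" using assms(1) by (intro closure_of_subset) simp
  ultimately show ?thesis by (simp only: closure_of_eq[symmetric])
qed

lemma theta_centre_closed_subgroup: "closed_subgroup Z G T"
  unfolding closed_subgroup_def
proof
  show "subgroup Z G"
  proof (rule subgroupI)
    show "Z \<subseteq> carrier G" by (auto simp: theta_centre_iff)
    have "acts_by_theta \<one> g" if "g \<in> carrier G" for g
      using that open_normalD(5) by (simp add: acts_by_theta_def)
    then have "\<one> \<in> Z" using theta_one by (simp add: theta_centre_iff)
    then show "Z \<noteq> {}" by blast
    fix a assume a: "a \<in> Z"
    then have ac: "a \<in> carrier G" "a \<in> ker_theta" by (auto simp: theta_centre_iff ker_theta_def)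
    have "acts_by_theta (inv a) g" if g: "g \<in> carrier G" for g
      unfolding acts_by_theta_def ncong_def[symmetric]
    proof (intro allI impI)
      fix N assume N: "open_normal N"
      have "eventually (\<lambda>n. ncong N (a [^] nat (\<theta> g n)) (g \<otimes> a \<otimes> inv g)) sequentially"
        using a N g by (simp add: theta_centre_iff acts_by_theta_def ncong_def)
      then show "eventually (\<lambda>n. ncong N (inv a [^] nat (\<theta> g n)) (g \<otimes> inv a \<otimes> inv g)) sequentially"
      proof (rule eventually_mono)
        fix n assume "ncong N (a [^] nat (\<theta> g n)) (g \<otimes> a \<otimes> inv g)"
        from ncong_inv[OF N _ _ this] show "ncong N (inv a [^] nat (\<theta> g n)) (g \<otimes> inv a \<otimes> inv g)"
          using ac g by (simp add: nat_pow_inv inv_mult_group m_assoc)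
      qed
    qed
    moreover have "inv a \<in> ker_theta" using closed_subgroupD(6)[OF closed_subgroup_ker_theta ac(2)] .
    ultimately show "inv a \<in> Z" by (simp add: theta_centre_iff ker_theta_def)
    fix b assume b: "b \<in> Z"
    then have bc: "b \<in> carrier G" "b \<in> ker_theta" by (auto simp: theta_centre_iff ker_theta_def)
    \<comment> \<open>As \<theta> is trivial on \<open>Z\<close>, its elements commute; this lets
      powers of the product split.\<close>
    have "a \<otimes> b \<otimes> inv a = b"
      by (rule acts_trivially[OF bc(1) ac(2)]) (use b ac in \<open>simp add: theta_centre_iff\<close>)
    then have comm: "a \<otimes> b = b \<otimes> a" using ac bc by (metis inv_solve_right m_closed)
    have "acts_by_theta (a \<otimes> b) g" if g: "g \<in> carrier G" for g
      unfolding acts_by_theta_def ncong_def[symmetric]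
    proof (intro allI impI)
      fix N assume N: "open_normal N"
      have "eventually (\<lambda>n. ncong N (a [^] nat (\<theta> g n)) (g \<otimes> a \<otimes> inv g) \<and> ncong N (b [^] nat (\<theta> g n)) (g \<otimes> b \<otimes> inv g)) sequentially"
        using a b N g by (intro eventually_conj) (simp_all add: theta_centre_iff acts_by_theta_def ncong_def)
      then show "eventually (\<lambda>n. ncong N ((a \<otimes> b) [^] nat (\<theta> g n)) (g \<otimes> (a \<otimes> b) \<otimes> inv g)) sequentially"
      proof (rule eventually_mono)
        fix n assume *: "ncong N (a [^] nat (\<theta> g n)) (g \<otimes> a \<otimes> inv g) \<and> ncong N (b [^] nat (\<theta> g n)) (g \<otimes> b \<otimes> inv g)"
        have "ncong N (a [^] nat (\<theta> g n) \<otimes> b [^] nat (\<theta> g n)) ((g \<otimes> a \<otimes> inv g) \<otimes> (g \<otimes> b \<otimes> inv g))"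
          by (rule ncong_mult[OF N]) (use * ac bc g in auto)
        then show "ncong N ((a \<otimes> b) [^] nat (\<theta> g n)) (g \<otimes> (a \<otimes> b) \<otimes> inv g)"
          using ac bc g by (simp add: pow_mult_distrib[OF comm] m_assoc)
      qed
    qed
    moreover have "a \<otimes> b \<in> ker_theta" using closed_subgroupD(5)[OF closed_subgroup_ker_theta ac(2) bc(2)] .
    ultimately show "a \<otimes> b \<in> Z" by (simp add: theta_centre_iff ker_theta_def)
  qed
  show "closedin T Z"
  proof (rule closedin_if_ncong)
    fix x assume x: "x \<in> carrier G" and lim: "\<And>N. open_normal N \<Longrightarrow> \<exists>w\<in>Z. ncong N x w"
    have "x \<in> ker_theta"
    proof (rule closed_if_ncong[OF closed_subgroupD(2)[OF closed_subgroup_ker_theta] x])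
      fix N assume "open_normal N"
      then obtain w where "w \<in> Z" "ncong N x w" using lim by blast
      then show "\<exists>w\<in>ker_theta. ncong N x w" by (intro bexI[of _ w]) (auto simp: theta_centre_iff ker_theta_def)
    qed
    moreover have "acts_by_theta x g" if g: "g \<in> carrier G" for g
      unfolding acts_by_theta_def ncong_def[symmetric]
    proof (intro allI impI)
      fix N assume N: "open_normal N"
      obtain w where w: "w \<in> Z" "ncong N x w" using lim[OF N] by blast
      then have wc: "w \<in> carrier G" by (simp add: theta_centre_iff)
      have "eventually (\<lambda>n. ncong N (w [^] nat (\<theta> g n)) (g \<otimes> w \<otimes> inv g)) sequentially"
        using w N g by (simp add: theta_centre_iff acts_by_theta_def ncong_def)
      then show "eventually (\<lambda>n. ncong N (x [^] nat (\<theta> g n)) (g \<otimes> x \<otimes> inv g)) sequentially"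
      proof (rule eventually_mono)
        fix n assume 1: "ncong N (w [^] nat (\<theta> g n)) (g \<otimes> w \<otimes> inv g)"
        have 2: "ncong N (x [^] nat (\<theta> g n)) (w [^] nat (\<theta> g n))" by (rule ncong_pow[OF N x wc w(2)])
        have 3: "ncong N (g \<otimes> w \<otimes> inv g) (g \<otimes> x \<otimes> inv g)"
          by (rule ncong_conj[OF N g wc x ncong_sym[OF N x wc w(2)]])
        show "ncong N (x [^] nat (\<theta> g n)) (g \<otimes> x \<otimes> inv g)"
          using ncong_trans[OF N _ _ _ ncong_trans[OF N _ _ _ 2 1] 3] x wc g by simp
      qed
    qed
    ultimately show "x \<in> Z" by (simp add: theta_centre_iff ker_theta_def)
  qed (auto simp: theta_centre_iff)
qed

lemma theta_centre_normal: "Z \<lhd> G"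
  unfolding normal_inv_iff
proof (intro conjI ballI)
  show "subgroup Z G" using closed_subgroupD(1)[OF theta_centre_closed_subgroup] .
  fix k z assume k: "k \<in> carrier G" and z: "z \<in> Z"
  then have zc: "z \<in> carrier G" "\<theta> z = \<one>\<^bsub>\<Z>\<^sub>p\<^esub>" by (auto simp: theta_centre_iff)
  note th = theta_mult(1)
  have kinv: "\<theta> k \<otimes>\<^bsub>\<Z>\<^sub>p\<^esub> \<theta> (inv k) = \<one>\<^bsub>\<Z>\<^sub>p\<^esub>" if "k \<in> carrier G" for k
    using th[of k "inv k"] that theta_one(1) by simp
  have "\<theta> (k \<otimes> z \<otimes> inv k) = \<one>\<^bsub>\<Z>\<^sub>p\<^esub>" using k zc kinv[OF k] by (simp add: th)
  moreover have "acts_by_theta (k \<otimes> z \<otimes> inv k) g" if g: "g \<in> carrier G" for g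
    unfolding acts_by_theta_def ncong_def[symmetric]
  proof (intro allI impI)
    fix N assume N: "open_normal N"
    \<comment> \<open>The commutator measuring g k = (k g) c. Units of Z_p commute, so
      \<open>c\<close> lies in the kernel of \<theta> and fixes \<open>z\<close>; hence conjugating
      \<open>z\<close> by \<open>k\<close> and by \<open>g\<close> can be interchanged.\<close>
    define c where "c = inv (k \<otimes> g) \<otimes> (g \<otimes> k)"
    have cc: "c \<in> carrier G" using k g by (simp add: c_def)
    have "\<theta> (k \<otimes> g) = \<theta> (g \<otimes> k)" using k g by (simp add: th Zp.m_comm)
    then have "\<theta> c = \<theta> (inv (k \<otimes> g)) \<otimes>\<^bsub>\<Z>\<^sub>p\<^esub> \<theta> (k \<otimes> g)" using k g by (simp add: c_def th)
    then have "c \<in> ker_theta" using kinv[of "k \<otimes> g"] cc k g by (simp add: ker_theta_def Zp.m_comm)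
    then have "c \<otimes> z \<otimes> inv c = z" using acts_trivially[OF zc(1)] z cc by (simp add: theta_centre_iff)
    then have "(k \<otimes> g) \<otimes> (c \<otimes> z \<otimes> inv c) \<otimes> inv (k \<otimes> g) = (k \<otimes> g) \<otimes> z \<otimes> inv (k \<otimes> g)" by simp
    moreover have "(k \<otimes> g) \<otimes> (c \<otimes> z \<otimes> inv c) \<otimes> inv (k \<otimes> g) = g \<otimes> (k \<otimes> z \<otimes> inv k) \<otimes> inv g"
      unfolding c_def using k g zc by (simp add: m_assoc inv_mult_group)
    ultimately have e: "g \<otimes> (k \<otimes> z \<otimes> inv k) \<otimes> inv g = k \<otimes> (g \<otimes> z \<otimes> inv g) \<otimes> inv k"
      using k g zc by (simp add: m_assoc inv_mult_group)
    have pow: "(k \<otimes> z \<otimes> inv k) [^] m = k \<otimes> z [^] m \<otimes> inv k" for m :: nat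
    proof (induction m)
      case (Suc m)
      then show ?case using k zc by (simp add: m_assoc)
    qed (use k in simp)
    have "eventually (\<lambda>n. ncong N (z [^] nat (\<theta> g n)) (g \<otimes> z \<otimes> inv g)) sequentially"
      using z N g by (simp add: theta_centre_iff acts_by_theta_def ncong_def)
    then show "eventually (\<lambda>n. ncong N ((k \<otimes> z \<otimes> inv k) [^] nat (\<theta> g n)) (g \<otimes> (k \<otimes> z \<otimes> inv k) \<otimes> inv g)) sequentially"
      by (rule eventually_mono) (unfold e pow, rule ncong_conj[OF N], use k g zc in auto)
  qed
  ultimately show "k \<otimes> z \<otimes> inv k \<in> Z" using k zc by (simp add: theta_centre_iff)
qed

section \<open>Cocycles on closed subgroups and roots of elements of the theta-centre\<close>

lemma fp_hom_zero_on_closed_gen: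
  assumes S: "S \<subseteq> carrier G" and f: "fp_hom (closed_gen S) f" "\<And>s. s \<in> S \<Longrightarrow> [f s = 0] (mod int p)"
    and x: "x \<in> closed_gen S"
  shows "[f x = 0] (mod int p)"
proof -
  have "closed_gen S \<subseteq> {x \<in> closed_gen S. [f x = 0] (mod int p)}"
    using closed_subgroup_kernel[OF closed_gen(1)[OF S] f(1)] closed_gen(2)[OF S] f(2)
    by (intro closed_gen_least) auto
  then show ?thesis using x by blast
qed

lemma cocycle_mult: "cocycle C k c \<Longrightarrow> x \<in> C \<Longrightarrow> y \<in> C \<Longrightarrow> [c (x \<otimes> y) = c x + \<theta> x k * c y] (mod int p ^ k)"
  by (simp add: cocycle_def)

lemma cocycle_pow:
  assumes C: "closed_subgroup C G T" and c: "cocycle C k c" and x: "x \<in> C"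
  shows "[c (x [^] m) = c x * (\<Sum>i<m. \<theta> x k ^ i)] (mod int p ^ k)"
proof (induction m)
  case 0
  have "[c (\<one> \<otimes> \<one>) = c \<one> + \<theta> \<one> k * c \<one>] (mod int p ^ k)"
    using cocycle_mult[OF c] closed_subgroupD(4)[OF C] by blast
  also have "[c \<one> + \<theta> \<one> k * c \<one> = c \<one> + 1 * c \<one>] (mod int p ^ k)"
    by (intro cong_add cong_mult cong_refl theta_one)
  finally show ?case by (simp add: cong_iff_dvd_diff)
next
  case (Suc m)
  have xc: "x \<in> carrier G" using closed_subgroupD(7)[OF C x] .
  have "[c (x [^] m \<otimes> x) = c (x [^] m) + \<theta> (x [^] m) k * c x] (mod int p ^ k)"
    by (rule cocycle_mult[OF c closed_subgroup_pow[OF C x] x])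
  also have "[c (x [^] m) + \<theta> (x [^] m) k * c x = c x * (\<Sum>i<m. \<theta> x k ^ i) + \<theta> x k ^ m * c x] (mod int p ^ k)"
    by (intro cong_add cong_mult Suc theta_pow[OF xc] cong_refl)
  finally show ?case by (simp add: algebra_simps)
qed

lemma cocycle_pow_ker:
  assumes C: "closed_subgroup C G T" and c: "cocycle C k c" and x: "x \<in> C" and th: "[\<theta> x k = 1] (mod int p ^ k)"
  shows "[c (x [^] m) = int m * c x] (mod int p ^ k)"
proof -
  have "[c x * (\<Sum>i<m. \<theta> x k ^ i) = c x * (\<Sum>i<m. 1 ^ i)] (mod int p ^ k)"
    by (intro cong_mult cong_refl cong_sum cong_pow th)
  then show ?thesis using cong_trans[OF cocycle_pow[OF C c x]] by (simp add: mult.commute)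
qed

lemma ker_theta_theta: "x \<in> ker_theta \<Longrightarrow> [\<theta> x k = 1] (mod int p ^ k)"
  by (simp add: ker_theta_def padic_ops)

text \<open>The twisted counterpart of \<open>fp_hom_theta_conj\<close>: modulo p^k the factor
  \<theta>(h) remains visible, also for \<open>h\<close> outside the domain of
  \<open>c\<close>.\<close>

lemma cocycle_theta_conj:
  assumes U: "closed_subgroup U G T" and c: "cocycle U k c" and z: "z \<in> U" "z \<in> ker_theta" and h: "h \<in> carrier G"
    and hz: "h \<otimes> z \<otimes> inv h \<in> U" and act: "acts_by_theta z h"
  shows "[c (h \<otimes> z \<otimes> inv h) = \<theta> h k * c z] (mod int p ^ k)"
proof -
  obtain N where N: "open_normal N" "\<And>x y. x \<in> U \<Longrightarrow> y \<in> U \<Longrightarrow> inv x \<otimes> y \<in> N \<Longrightarrow> c x = c y"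
    using c by (auto simp: cocycle_def loc_const_def)
  have "eventually (\<lambda>n. inv (z [^] nat (\<theta> h n)) \<otimes> (h \<otimes> z \<otimes> inv h) \<in> N \<and> n \<ge> k) sequentially"
    using act N(1) eventually_ge_at_top[of k] by (intro eventually_conj) (simp_all add: acts_by_theta_def)
  then obtain n where n: "inv (z [^] nat (\<theta> h n)) \<otimes> (h \<otimes> z \<otimes> inv h) \<in> N" "n \<ge> k"
    using eventually_happens'[OF sequentially_bot] by blast
  have "c (h \<otimes> z \<otimes> inv h) = c (z [^] nat (\<theta> h n))" using N(2)[OF closed_subgroup_pow[OF U z(1)] hz n(1)] by simp
  also have "[\<dots> = int (nat (\<theta> h n)) * c z] (mod int p ^ k)"
    by (rule cocycle_pow_ker[OF U c z(1) ker_theta_theta[OF z(2)]])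
  also have "[int (nat (\<theta> h n)) * c z = \<theta> h k * c z] (mod int p ^ k)"
    using padic_cong_le[OF theta_closed[OF h] n(2)] padic_carrierD(3)[OF theta_closed[OF h], of n]
    by (intro cong_mult) auto
  finally show ?thesis .
qed

text \<open>A nonzero homomorphism of the procyclic group generated by \<open>t\<close> cannot
  vanish at \<open>t\<close>, and its lift has the same value there modulo \<open>p\<close>.\<close>

lemma unit_cocycle_on_procyclic:
  assumes t: "t \<in> ker_theta" "t \<noteq> \<one>"
  shows "\<exists>c. cocycle (closed_gen {t}) k c \<and> \<not> [c t = 0] (mod int p)"
proof -
  have tc: "{t} \<subseteq> carrier G" using t by (auto simp: ker_theta_def)
  note K = closed_gen[OF tc]
  have "{\<one>} \<subseteq> closed_gen {t}" "{\<one>} \<noteq> closed_gen {t}" using closed_subgroupD(4)[OF K(1)] K(2) t(2) by auto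
  then obtain f where f: "fp_hom (closed_gen {t}) f" "\<exists>x\<in>closed_gen {t}. f x = 1"
    using exists_fp_hom_killing_closed_subgroup[OF K(1) closed_subgroup_trivial] by blast
  have ft: "\<not> [f t = 0] (mod int p)"
  proof
    assume "[f t = 0] (mod int p)"
    then have "[1 = 0] (mod int p)" using fp_hom_zero_on_closed_gen[OF tc f(1)] f(2) by force
    then show False using p_gt_1 by (simp add: cong_def)
  qed
  obtain c where "cocycle (closed_gen {t}) k c" "\<forall>x\<in>closed_gen {t}. [c x = f x] (mod int p)"
    using kummer_lift[OF K(1) f(1)] by blast
  then show ?thesis using ft K(2) cong_trans cong_sym by blast
qed

lemma cong_p_cancel:
  "[int p * a = int p * b] (mod int p ^ 2) \<longleftrightarrow> [a = b] (mod int p)"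
  using p_gt_1 by (simp add: cong_iff_dvd_diff power2_eq_square flip: right_diff_distrib)

text \<open>The relation c(t^p) = p c(t) modulo p^2 would make the unit c(t) divisible by
  \<open>p\<close>.\<close>

lemma ker_theta_torsion_free:
  assumes t: "t \<in> ker_theta" and tp: "t [^] p = \<one>"
  shows "t = \<one>"
proof (rule ccontr)
  assume "t \<noteq> \<one>"
  then obtain c where c: "cocycle (closed_gen {t}) 2 c" "\<not> [c t = 0] (mod int p)"
    using unit_cocycle_on_procyclic[OF t] by blast
  have tc: "{t} \<subseteq> carrier G" using t by (auto simp: ker_theta_def)
  have tK: "t \<in> closed_gen {t}" using closed_gen(2)[OF tc] by blast
  note pow = cocycle_pow_ker[OF closed_gen(1)[OF tc] c(1) tK ker_theta_theta[OF t]]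
  have "[c \<one> = 0] (mod int p ^ 2)" "[c \<one> = int p * c t] (mod int p ^ 2)" using pow[of 0] pow[of p] tp by simp_all
  then have "[int p * c t = int p * 0] (mod int p ^ 2)" using cong_trans[OF cong_sym] by simp
  then show False using c(2) by (simp only: cong_p_cancel)
qed

text \<open>If \<open>x\<^sup>p = z\<close>, then \<open>g x g\<inverse>\<close> and \<open>x\<^bsup>\<theta>(g)\<^esup>\<close> have the same \<open>p\<close>-th power. Subgroups of \<open>ker \<theta>\<close> have
  torsion-free abelianization, so two such elements agree modulo the Frattini subgroup of the group they
  generate, which is therefore procyclic.\<close>

lemma theta_centre_isolated:
  assumes x: "x \<in> carrier G" and z: "x [^] p \<in> Z" "x [^] p \<noteq> \<one>"
  shows "x \<in> Z"
proof -
  define w where "w = x [^] p"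
  have wZ: "w \<in> Z" "w \<noteq> \<one>" using z by (auto simp: w_def)
  then have wc: "w \<in> carrier G" "w \<in> ker_theta" and wact: "\<And>g. g \<in> carrier G \<Longrightarrow> acts_by_theta w g"
    by (auto simp: theta_centre_iff ker_theta_def)
  \<comment> \<open>\<open>x\<close> commutes with its power \<open>w\<close>, while conjugation by
    \<open>x\<close> multiplies the unit c(w) by \<theta>(x).\<close>
  have "\<theta> x = \<one>\<^bsub>\<Z>\<^sub>p\<^esub>"
  proof (rule padic_eqI)
    fix k
    have wsub: "{w} \<subseteq> carrier G" using wc by simp
    have wK: "w \<in> closed_gen {w}" using closed_gen(2)[OF wsub] by blast
    have xw: "x \<otimes> w \<otimes> inv x = w"
    proof -
      have "x \<otimes> w = w \<otimes> x" using nat_pow_Suc2[OF x, of p] by (simp add: w_def)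
      then show ?thesis using x wc by (simp add: m_assoc)
    qed
    obtain c where c: "cocycle (closed_gen {w}) k c" "\<not> [c w = 0] (mod int p)"
      using unit_cocycle_on_procyclic[OF wc(2) wZ(2)] by blast
    have "[c w = \<theta> x k * c w] (mod int p ^ k)"
      using cocycle_theta_conj[OF closed_gen(1)[OF wsub] c(1) wK wc(2) x _ wact[OF x]] wK by (simp add: xw)
    then have "[1 * c w = \<theta> x k * c w] (mod int p ^ k)" by simp
    moreover have "coprime (c w) (int p)"
      using c(2) prime_imp_coprime[of "int p" "c w"] prime by (simp add: cong_0_iff coprime_commute)
    then have "coprime (c w) (int p ^ k)" by simp
    ultimately have "[1 = \<theta> x k] (mod int p ^ k)" using cong_mult_rcancel by blast
    then show "[\<theta> x k = \<one>\<^bsub>\<Z>\<^sub>p\<^esub> k] (mod int p ^ k)" by (simp add: padic_ops cong_sym_eq)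
  qed (use x in auto)
  then have xk: "x \<in> ker_theta" using x by (simp add: ker_theta_def)
  moreover have "acts_by_theta x g" if g: "g \<in> carrier G" for g
  proof -
    define y where "y = g \<otimes> x \<otimes> inv g"
    obtain x' where x': "lim_pow x (\<theta> g) x'" using lim_pow_ex[OF x theta_closed[OF g]] by blast
    have x'k: "x' \<in> ker_theta" by (rule lim_pow_closed[OF closed_subgroup_ker_theta xk x'])
    have x'c: "x' \<in> carrier G" using x' by (simp add: lim_pow_def)
    have yc: "y \<in> carrier G" using x g by (simp add: y_def)
    have yk: "y \<in> ker_theta"
    proof -
      have "\<theta> g \<otimes>\<^bsub>\<Z>\<^sub>p\<^esub> \<theta> (inv g) = \<one>\<^bsub>\<Z>\<^sub>p\<^esub>" using theta_mult(1)[OF g, of "inv g"] theta_one(1) g by simp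
      then show ?thesis using xk g yc by (simp add: ker_theta_def y_def theta_mult(1))
    qed
    \<comment> \<open>Both are w^\<theta>(g): the first because \<open>w\<close> is in
      \<open>Z\<close>, the second because taking \<open>p\<close>-th powers is compatible with the
      limit.\<close>
    have pows: "y [^] p = x' [^] p"
    proof (rule eq_if_ncong)
      fix N assume N: "open_normal N"
      have yp: "y [^] m = g \<otimes> x [^] m \<otimes> inv g" for m :: nat
        unfolding y_def by (induction m) (use x g in \<open>simp_all add: m_assoc\<close>)
      have "eventually (\<lambda>n. ncong N (w [^] nat (\<theta> g n)) (g \<otimes> w \<otimes> inv g) \<and> ncong N (x [^] nat (\<theta> g n)) x') sequentially"
        using wact[OF g] x' N by (intro eventually_conj) (simp_all add: acts_by_theta_def lim_pow_def ncong_def)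
      then obtain n where n: "ncong N (w [^] nat (\<theta> g n)) (g \<otimes> w \<otimes> inv g)" "ncong N (x [^] nat (\<theta> g n)) x'"
        using eventually_happens'[OF sequentially_bot] by blast
      have "ncong N (w [^] nat (\<theta> g n)) (x' [^] p)"
        using ncong_pow[OF N _ x'c n(2), of p] x by (simp add: w_def nat_pow_pow mult.commute)
      then have "ncong N (g \<otimes> w \<otimes> inv g) (x' [^] p)"
        using ncong_trans[OF N _ _ _ ncong_sym[OF N _ _ n(1)]] wc g x'c by simp
      then show "ncong N (y [^] p) (x' [^] p)" by (simp add: yp w_def)
    qed (use yc x'c in auto)
    have sub: "{x', y} \<subseteq> carrier G" "{x'} \<subseteq> carrier G" using x'c yc by auto
    let ?B = "closed_gen {x', y}"
    note B = closed_gen[OF sub(1)]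
    \<comment> \<open>On powers of an element of the kernel of \<theta> a lift of \<open>f\<close>
      modulo p^2 is multiplicative in the exponent, so equal \<open>p\<close>-th powers force equal
      values modulo \<open>p\<close>.\<close>
    have "[f x' = f y] (mod int p)" if f: "fp_hom ?B f" for f
    proof -
      obtain c where c: "cocycle ?B 2 c" "\<And>x. x \<in> ?B \<Longrightarrow> [c x = f x] (mod int p)"
        using kummer_lift[OF B(1) f] by blast
      have xyB: "x' \<in> ?B" "y \<in> ?B" using B(2) by auto
      have "[c (x' [^] p) = int p * c x'] (mod int p ^ 2)" "[c (y [^] p) = int p * c y] (mod int p ^ 2)"
        by (intro cocycle_pow_ker[OF B(1) c(1)] xyB ker_theta_theta x'k yk)+
      then have "[int p * c x' = int p * c y] (mod int p ^ 2)" unfolding pows using cong_sym cong_trans by blast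
      then have "[c x' = c y] (mod int p)" by (simp only: cong_p_cancel)
      then show ?thesis using c(2)[OF xyB(1)] c(2)[OF xyB(2)] cong_sym cong_trans by meson
    qed
    note feq = this
    have "?B \<subseteq> closed_gen {x'}"
    proof (rule fp_homs_detect_generation[OF B(1) closed_gen(1)[OF sub(2)], of "{x'}"])
      show "{x'} \<subseteq> ?B" "{x'} \<subseteq> closed_gen {x'}" using B(2) closed_gen(2)[OF sub(2)] by auto
      fix f assume f: "fp_hom ?B f" "\<forall>s\<in>{x'}. f s = 0"
      show "\<forall>x\<in>?B. [f x = 0] (mod int p)"
      proof (rule ballI)
        fix u assume u: "u \<in> ?B"
        have "[f s = 0] (mod int p)" if "s \<in> {x', y}" for s
          using that feq[OF f(1)] f(2) by (auto simp: cong_sym_eq)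
        then show "[f u = 0] (mod int p)" by (rule fp_hom_zero_on_closed_gen[OF sub(1) f(1) _ u])
      qed
    qed
    moreover have "closed_gen {x'} \<subseteq> {h \<in> carrier G. h \<otimes> x' = x' \<otimes> h}"
      by (rule closed_gen_least[OF closed_subgroup_centralizer[OF x'c]]) (use x'c in auto)
    ultimately have comm: "y \<otimes> x' = x' \<otimes> y" using B(2) by blast
    have comm': "y \<otimes> inv x' = inv x' \<otimes> y"
    proof -
      have "inv x' \<otimes> (y \<otimes> x') \<otimes> inv x' = inv x' \<otimes> (x' \<otimes> y) \<otimes> inv x'" using comm by simp
      then show ?thesis using yc x'c by (simp add: m_assoc)
    qed
    \<comment> \<open>Commuting elements with equal \<open>p\<close>-th powers differ by
      \<open>p\<close>-torsion, of which the kernel of \<theta> has none.\<close>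
    have "(y \<otimes> inv x') [^] p = \<one>"
      using pow_mult_distrib[OF comm' yc] x'c yc pows by (simp add: nat_pow_inv)
    moreover have "y \<otimes> inv x' \<in> ker_theta"
      using closed_subgroupD(5,6)[OF closed_subgroup_ker_theta] yk x'k by blast
    ultimately have "y \<otimes> inv x' = \<one>" by (rule ker_theta_torsion_free[rotated])
    then have "y = x'" using yc x'c by (metis inv_equality inv_inv inv_closed)
    then show ?thesis using x' acts_by_theta_iff[OF x g] by (simp add: y_def)
  qed
  ultimately show ?thesis using x by (simp add: theta_centre_iff ker_theta_def)
qed

text \<open>With t = 1 + p s the sum is p + p s (p (p - 1) / 2) modulo p^2, and p (p - 1) / 2 is
  divisible by \<open>p\<close> exactly when \<open>p\<close> is odd. For p = 2 the sum is 1 + t,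
  which is 2 modulo 4 when \<open>t\<close> is 1 modulo 4.\<close>

lemma geometric_sum_cong:
  assumes t: "[t = 1] (mod int p)" and odd: "odd p \<or> [t = 1] (mod 4)"
  shows "[(\<Sum>i<p. t ^ i) = int p] (mod int p ^ 2)"
proof (cases "odd p")
  case True
  obtain s where s: "t = 1 + int p * s" using t by (metis cong_iff_lin cong_sym add.commute mult.commute)
  have pw: "[t ^ i = 1 + int i * int p * s] (mod int p ^ 2)" for i
  proof (induction i)
    case (Suc i)
    have "[t ^ Suc i = (1 + int p * s) * (1 + int i * int p * s)] (mod int p ^ 2)"
      unfolding power_Suc by (intro cong_mult Suc) (simp add: s)
    moreover have "(1 + int p * s) * (1 + int i * int p * s) = 1 + int (Suc i) * int p * s + int p ^ 2 * (int i * s * s)"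
      by (simp add: algebra_simps power2_eq_square)
    moreover have "[1 + int (Suc i) * int p * s + int p ^ 2 * (int i * s * s) = 1 + int (Suc i) * int p * s] (mod int p ^ 2)"
      by (simp add: cong_iff_dvd_diff)
    ultimately show ?case using cong_trans by metis
  qed simp
  have "[(\<Sum>i<p. t ^ i) = (\<Sum>i<p. 1 + int i * int p * s)] (mod int p ^ 2)" by (intro cong_sum pw)
  moreover have "(\<Sum>i<p. 1 + int i * int p * s) = int p + int p * s * int (\<Sum>i<p. i)"
    by (simp add: sum.distrib sum_distrib_left sum_distrib_right algebra_simps)
  moreover have "p dvd (\<Sum>i<p. i)"
  proof -
    obtain m where m: "p = Suc m" using p_gt_1 by (cases p) auto
    have "2 * (\<Sum>i<Suc m. i) = Suc m * m" by (induction m) auto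
    then have "2 * (\<Sum>i<p. i) = p * m" unfolding m .
    then have "p dvd 2 * (\<Sum>i<p. i)" by simp
    moreover have "coprime p 2" using True by (simp add: coprime_commute)
    ultimately show ?thesis using coprime_dvd_mult_right_iff by blast
  qed
  then obtain k where "(\<Sum>i<p. i) = p * k" by (rule dvdE)
  then have "int p * s * int (\<Sum>i<p. i) = int p ^ 2 * (s * int k)" by (simp only: of_nat_mult power2_eq_square ac_simps)
  then have "int p ^ 2 dvd int p * s * int (\<Sum>i<p. i)" by (metis dvd_triv_left)
  ultimately show ?thesis by (simp add: cong_iff_dvd_diff) (metis (no_types, lifting) add_diff_cancel_left' cong_iff_dvd_diff cong_trans)
next
  case False
  then have p2: "p = 2" using prime primes_dvd_imp_eq two_is_prime_nat by blast
  have "[t = 1] (mod 4)" using odd False by blast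
  then show ?thesis by (simp add: p2 numeral_2_eq_2 lessThan_Suc cong_iff_dvd_diff)
qed

end

section \<open>Minimal subgroups with a central Frattini element\<close>

lemma inverse_mod_prime:
  assumes "Factorial_Ring.prime p" "\<not> [a = 0] (mod int p)"
  shows "\<exists>b. [b * a = 1] (mod int p)"
proof -
  have "coprime a (int p)"
    using assms prime_imp_coprime[of "int p" a] by (simp add: cong_0_iff coprime_commute)
  then show ?thesis using cong_solve_coprime_int[of a "int p"] by (auto simp: mult.commute)
qed

section \<open>Division of cocycles and extension of homomorphisms\<close>

context cyclo_oriented_group
begin

lemma fp_hom_comb:
  assumes "fp_hom C f" "fp_hom C g"
  shows "fp_hom C (\<lambda>x. a * f x + b * g x)"
  unfolding fp_hom_def
proof (intro conjI ballI)
  show "loc_const C (\<lambda>x. a * f x + b * g x)"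
    by (rule loc_const_comp2[where h = "\<lambda>u v. a * u + b * v"]) (use assms in \<open>auto simp: fp_hom_def\<close>)
  fix x y assume "x \<in> C" "y \<in> C"
  then have "[a * f (x \<otimes> y) + b * g (x \<otimes> y) = a * (f x + f y) + b * (g x + g y)] (mod int p)"
    by (intro cong_add cong_mult cong_refl fp_hom_mult[OF assms(1)] fp_hom_mult[OF assms(2)])
  then show "[a * f (x \<otimes> y) + b * g (x \<otimes> y) = a * f x + b * g x + (a * f y + b * g y)] (mod int p)"
    by (simp add: algebra_simps)
qed

lemma cocycle_comb:
  assumes "cocycle C k f" "cocycle C k g"
  shows "cocycle C k (\<lambda>x. a * f x + b * g x)"
  unfolding cocycle_def
proof (intro conjI ballI)
  show "loc_const C (\<lambda>x. a * f x + b * g x)"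
    by (rule loc_const_comp2[where h = "\<lambda>u v. a * u + b * v"]) (use assms in \<open>auto simp: cocycle_def\<close>)
  fix x y assume "x \<in> C" "y \<in> C"
  then have "[a * f (x \<otimes> y) + b * g (x \<otimes> y) = a * (f x + \<theta> x k * f y) + b * (g x + \<theta> x k * g y)] (mod int p ^ k)"
    by (intro cong_add cong_mult cong_refl cocycle_mult[OF assms(1)] cocycle_mult[OF assms(2)])
  then show "[a * f (x \<otimes> y) + b * g (x \<otimes> y) = a * f x + b * g x + \<theta> x k * (a * f y + b * g y)] (mod int p ^ k)"
    by (simp add: algebra_simps)
qed

text \<open>Modulo \<open>p\<close> the action on Z/p(1) is trivial, so the twisted identity becomes
  additivity.\<close>

lemma cocycle_reduction:
  assumes C: "C \<subseteq> carrier G" and c: "cocycle C k c" and k: "k > 0"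
  shows "fp_hom C c"
  unfolding fp_hom_def
proof (intro conjI ballI)
  show "loc_const C c" using c by (simp add: cocycle_def)
  fix x y assume xy: "x \<in> C" "y \<in> C"
  have "[c (x \<otimes> y) = c x + \<theta> x k * c y] (mod int p)"
    by (rule cong_dvd_modulus[OF cocycle_mult[OF c xy]]) (use k in \<open>simp add: dvd_power\<close>)
  also have "[c x + \<theta> x k * c y = c x + 1 * c y] (mod int p)"
    by (intro cong_add cong_mult cong_refl theta_mod_p) (use C xy k in auto)
  finally show "[c (x \<otimes> y) = c x + c y] (mod int p)" by simp
qed

text \<open>The multiples of \<open>p\<close> in Z/p^2(1) form a copy of Z/p with trivial action, so
  a cocycle with values there becomes a homomorphism after division by \<open>p\<close>.\<close>

lemma cocycle_div:
  assumes U: "U \<subseteq> C" "closed_subgroup U G T" and C: "C \<subseteq> carrier G" and c: "cocycle C 2 c"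
    and div: "\<And>x. x \<in> U \<Longrightarrow> [c x = 0] (mod int p)"
  shows "fp_hom U (\<lambda>x. c x div int p)"
  unfolding fp_hom_def
proof (intro conjI ballI)
  show "loc_const U (\<lambda>x. c x div int p)"
    by (rule loc_const_comp[OF loc_const_subset[OF _ U(1)]]) (use c in \<open>simp add: cocycle_def\<close>)
  fix x y assume xy: "x \<in> U" "y \<in> U"
  have e: "c w = int p * (c w div int p)" if "w \<in> U" for w using div[OF that] by (simp add: cong_0_iff)
  have xyU: "x \<otimes> y \<in> U" using closed_subgroupD(5)[OF U(2) xy] .
  have "[int p * (c (x \<otimes> y) div int p) = int p * (c x div int p + \<theta> x 2 * (c y div int p))] (mod int p ^ 2)"
    using cocycle_mult[OF c, of x y] xy U(1) e[OF xy(1)] e[OF xy(2)] e[OF xyU]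
    by (metis (no_types, lifting) distrib_left mult.left_commute subsetD)
  then have "[c (x \<otimes> y) div int p = c x div int p + \<theta> x 2 * (c y div int p)] (mod int p)" by (simp only: cong_p_cancel)
  also have "[c x div int p + \<theta> x 2 * (c y div int p) = c x div int p + 1 * (c y div int p)] (mod int p)"
    by (intro cong_add cong_mult cong_refl theta_mod_p) (use C xy U in auto)
  finally show "[c (x \<otimes> y) div int p = c x div int p + c y div int p] (mod int p)" by simp
qed

text \<open>Elements outside the kernel of \<open>h\<close> have the form m b with \<open>m\<close>
  in the kernel; put F(m b) = v(m). Invariance under \<open>b\<close> and the vanishing of v(b^2)
  are what additivity of \<open>F\<close> demands.\<close>

lemma fp_hom_extend_index_two:
  assumes p2: "p = 2" and B: "closed_subgroup B G T" and h: "fp_hom B h" and b: "b \<in> B" "odd (h b)"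
    and v: "fp_hom {m \<in> B. even (h m)} v"
    and inv: "\<And>m. m \<in> B \<Longrightarrow> even (h m) \<Longrightarrow> even (v (b \<otimes> m \<otimes> inv b)) \<longleftrightarrow> even (v m)"
    and sq: "even (v (b \<otimes> b))"
  obtains F where "fp_hom B F" "\<And>m. m \<in> B \<Longrightarrow> even (h m) \<Longrightarrow> F m = v m" "even (F b)"
proof -
  note Bm = closed_subgroupD[OF B]
  have Bc: "\<And>x. x \<in> B \<Longrightarrow> x \<in> carrier G" using Bm by blast
  let ?M = "{m \<in> B. even (h m)}"
  have hom: "even (f (x \<otimes> y)) \<longleftrightarrow> (even (f x) \<longleftrightarrow> even (f y))" if "fp_hom D f" "x \<in> D" "y \<in> D" for D f x y
    using fp_hom_mult[OF that] by (simp add: p2 cong_iff_dvd_diff)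
  have hinv: "even (h (inv b)) \<longleftrightarrow> even (h b)"
    using fp_hom_inv[OF B h b(1)] by (simp add: p2 cong_iff_dvd_diff)
  have hI: "even (h (x \<otimes> inv b)) \<longleftrightarrow> odd (h x)" if "x \<in> B" for x
    using hom[OF h that Bm(6)[OF b(1)]] hinv b(2) by simp
  have hC: "even (h (b \<otimes> x \<otimes> inv b)) \<longleftrightarrow> even (h x)" if "x \<in> B" for x
    using hI[OF Bm(5)[OF b(1) that]] hom[OF h b(1) that] b(2) by simp
  have cl: "x \<otimes> inv b \<in> B" "b \<otimes> x \<otimes> inv b \<in> B" if "x \<in> B" for x using that b(1) Bm(5,6) by auto
  define F where "F x = (if even (h x) then v x else v (x \<otimes> inv b))" for x
  have "fp_hom B F"
    unfolding fp_hom_def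
  proof (intro conjI ballI)
    obtain N where N: "open_normal N" "\<And>x y. x \<in> B \<Longrightarrow> y \<in> B \<Longrightarrow> inv x \<otimes> y \<in> N \<Longrightarrow> h x = h y"
      using h by (auto simp: fp_hom_def loc_const_def)
    obtain N' where N': "open_normal N'" "\<And>x y. x \<in> ?M \<Longrightarrow> y \<in> ?M \<Longrightarrow> inv x \<otimes> y \<in> N' \<Longrightarrow> v x = v y"
      using v by (auto simp: fp_hom_def loc_const_def)
    have "F x = F y" if xy: "x \<in> B" "y \<in> B" "inv x \<otimes> y \<in> N \<inter> N'" for x y
    proof (cases "even (h x)")
      case True
      then show ?thesis using N(2)[OF xy(1,2)] N'(2)[of x y] xy by (simp add: F_def)
    next
      case False
      have "inv (x \<otimes> inv b) \<otimes> (y \<otimes> inv b) = b \<otimes> (inv x \<otimes> y) \<otimes> inv b"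
        using Bc xy(1,2) b(1) by (simp add: inv_mult_group m_assoc)
      then have "inv (x \<otimes> inv b) \<otimes> (y \<otimes> inv b) \<in> N'" using open_normalD(8)[OF N'(1)] Bc b(1) xy(3) by simp
      then show ?thesis using N(2)[OF xy(1,2)] N'(2)[of "x \<otimes> inv b" "y \<otimes> inv b"] xy cl hI False by (simp add: F_def)
    qed
    then show "loc_const B F" unfolding loc_const_def using open_normal_Int[OF N(1) N'(1)] by blast
    fix x y assume x: "x \<in> B" and y: "y \<in> B"
    have xy: "even (h (x \<otimes> y)) \<longleftrightarrow> (even (h x) \<longleftrightarrow> even (h y))" by (rule hom[OF h x y])
    have vm: "even (v (a \<otimes> d)) \<longleftrightarrow> (even (v a) \<longleftrightarrow> even (v d))" if "a \<in> ?M" "d \<in> ?M" for a d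
      by (rule hom[OF v that])
    have "even (F (x \<otimes> y)) \<longleftrightarrow> (even (F x) \<longleftrightarrow> even (F y))"
    proof (cases "even (h x)"; cases "even (h y)")
      assume "even (h x)" "even (h y)"
      then show ?thesis using xy x y vm by (simp add: F_def)
    next
      assume a: "even (h x)" "odd (h y)"
      have "x \<otimes> y \<otimes> inv b = x \<otimes> (y \<otimes> inv b)" using Bc x y b(1) by (simp add: m_assoc)
      then show ?thesis using a xy x y vm[of x "y \<otimes> inv b"] cl hI by (simp add: F_def)
    next
      assume a: "odd (h x)" "even (h y)"
      have "x \<otimes> y \<otimes> inv b = (x \<otimes> inv b) \<otimes> (b \<otimes> y \<otimes> inv b)" using Bc x y b(1) by (simp add: m_assoc)
      then show ?thesis using a xy x y vm[of "x \<otimes> inv b" "b \<otimes> y \<otimes> inv b"] cl hI hC inv[of y] by (simp add: F_def)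
    next
      assume a: "odd (h x)" "odd (h y)"
      \<comment> \<open>Moving both factors into the kernel produces b^2; this case uses the
        assumption on v(b^2).\<close>
      have e: "x \<otimes> y = (x \<otimes> inv b) \<otimes> ((b \<otimes> (y \<otimes> inv b) \<otimes> inv b) \<otimes> (b \<otimes> b))"
        using Bc x y b(1) by (simp add: m_assoc)
      have bb: "b \<otimes> b \<in> ?M" using Bm(5)[OF b(1) b(1)] hom[OF h b(1) b(1)] by simp
      have yi: "y \<otimes> inv b \<in> ?M" using cl(1)[OF y] hI[OF y] a by simp
      then have k: "b \<otimes> (y \<otimes> inv b) \<otimes> inv b \<in> ?M" using cl hC by simp
      have xi: "x \<otimes> inv b \<in> ?M" using cl(1)[OF x] hI[OF x] a by simp
      have "even (v ((b \<otimes> (y \<otimes> inv b) \<otimes> inv b) \<otimes> (b \<otimes> b))) \<longleftrightarrow> even (v (y \<otimes> inv b))"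
        using vm[OF k bb] sq inv yi by simp
      moreover have "(b \<otimes> (y \<otimes> inv b) \<otimes> inv b) \<otimes> (b \<otimes> b) \<in> ?M" using Bm(5) hom[OF h] k bb by simp
      ultimately have "even (v (x \<otimes> y)) \<longleftrightarrow> (even (v (x \<otimes> inv b)) \<longleftrightarrow> even (v (y \<otimes> inv b)))"
        unfolding e using vm[OF xi] by blast
      then show ?thesis using a xy by (simp add: F_def)
    qed
    then show "[F (x \<otimes> y) = F x + F y] (mod int p)" by (simp add: p2 cong_iff_dvd_diff)
  qed
  moreover have "even (F b)"
  proof -
    have "\<one> \<in> ?M" using hI[OF b(1)] b Bc Bm(4) by simp
    from hom[OF v this this] show ?thesis using b Bc by (simp add: F_def)
  qed
  moreover have "F m = v m" if "even (h m)" for m using that by (simp add: F_def)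
  ultimately show thesis using that by blast
qed

text \<open>A minimal closed subgroup \<open>C\<close> containing \<open>z\<close> in its Frattini subgroup; it will be shown not to
  exist.\<close>

context
  fixes C z
  assumes C: "closed_subgroup C G T" and z: "z \<in> C" "z \<in> Z"
    and killed: "\<And>f. fp_hom C f \<Longrightarrow> [f z = 0] (mod int p)"
    and minimal: "\<And>D. closed_subgroup D G T \<Longrightarrow> z \<in> D \<Longrightarrow> D \<subset> C \<Longrightarrow> \<exists>u. fp_hom D u \<and> \<not> [u z = 0] (mod int p)"
    and no_root: "\<And>x. x \<in> C \<Longrightarrow> x [^] p \<noteq> z"
begin

lemma C_carrier: "C \<subseteq> carrier G" using closed_subgroupD(3)[OF C] .

lemma zc: "z \<in> carrier G" "z \<in> ker_theta" and zact: "h \<in> carrier G \<Longrightarrow> acts_by_theta z h"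
  using z by (auto simp: theta_centre_iff ker_theta_def)

lemma hom_on_kernel_nontrivial:
  assumes g: "fp_hom C g" and y: "y \<in> C" "[g y = 1] (mod int p)"
  shows "\<exists>u. fp_hom {x \<in> C. [g x = 0] (mod int p)} u \<and> [u z = 1] (mod int p)"
proof -
  let ?U = "{x \<in> C. [g x = 0] (mod int p)}"
  have "y \<notin> ?U" using y p_gt_1 by (auto simp: cong_def)
  then have "?U \<subset> C" using y by blast
  then obtain u where u: "fp_hom ?U u" "\<not> [u z = 0] (mod int p)"
    using minimal[OF closed_subgroup_kernel[OF C g]] z killed[OF g] by auto
  obtain b where b: "[b * u z = 1] (mod int p)" using inverse_mod_prime[OF prime u(2)] by blast
  have "fp_hom ?U (\<lambda>x. b * u x + 0 * u x)" by (rule fp_hom_comb[OF u(1) u(1)])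
  then show ?thesis using b by (intro exI[of _ "\<lambda>x. b * u x"]) simp
qed

lemma obstruction:
  assumes g: "fp_hom C g" and y: "y \<in> C" "[g y = 1] (mod int p)"
    and v: "fp_hom {x \<in> C. [g x = 0] (mod int p)} v" "[v z = 0] (mod int p)"
  shows "[v (y [^] p) = 0] (mod int p)"
proof -
  obtain u where u: "fp_hom {x \<in> C. [g x = 0] (mod int p)} u" "[u z = 1] (mod int p)"
    using hom_on_kernel_nontrivial[OF g y] by blast
  show ?thesis
    by (rule corestriction_obstruction[OF C z(1) _ _ g y refl u v]) (use zact C_carrier killed in blast)+
qed

text \<open>Divide \<open>c\<close> by \<open>p\<close> on the kernel of its reduction: the quotient
  vanishes at \<open>z\<close>, but by the congruence for the geometric sum it takes the value c(y)
  = 1 at y^p. This contradicts \<open>obstruction\<close>.\<close>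

lemma no_lift_vanishing_at_z:
  assumes c: "cocycle C 2 c" and y: "y \<in> C" "[c y = 1] (mod int p)" and cz: "[c z = 0] (mod int p ^ 2)"
    and sum: "odd p \<or> [\<theta> y 2 = 1] (mod 4)"
  shows False
proof -
  have g: "fp_hom C c" by (rule cocycle_reduction[OF C_carrier c]) simp
  let ?U = "{x \<in> C. [c x = 0] (mod int p)}"
  have yc: "y \<in> carrier G" using y C_carrier by blast
  have U: "closed_subgroup ?U G T" by (rule closed_subgroup_kernel[OF C g])
  have v: "fp_hom ?U (\<lambda>x. c x div int p)"
    by (rule cocycle_div[OF _ U C_carrier c]) auto
  have e: "c w = int p * (c w div int p)" if "[c w = 0] (mod int p)" for w using that by (simp add: cong_0_iff)
  have "[int p * (c z div int p) = int p * 0] (mod int p ^ 2)" using cz e[OF killed[OF g]] by simp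
  then have vz: "[c z div int p = 0] (mod int p)" by (simp only: cong_p_cancel)
  have "[c (y [^] p) = c y * (\<Sum>i<p. \<theta> y 2 ^ i)] (mod int p ^ 2)" by (rule cocycle_pow[OF C c y(1)])
  also have "[c y * (\<Sum>i<p. \<theta> y 2 ^ i) = c y * int p] (mod int p ^ 2)"
    by (intro cong_mult cong_refl geometric_sum_cong theta_mod_p sum yc) simp
  finally have cyp: "[c (y [^] p) = int p * c y] (mod int p ^ 2)" by (simp add: mult.commute)
  then have "[c (y [^] p) = int p * c y] (mod int p)" by (rule cong_dvd_modulus) simp
  then have "[c (y [^] p) = 0] (mod int p)" by (simp add: cong_def)
  from e[OF this] cyp have "[int p * (c (y [^] p) div int p) = int p * c y] (mod int p ^ 2)" by simp
  then have "[c (y [^] p) div int p = c y] (mod int p)" by (simp only: cong_p_cancel)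
  then have "[c y = 0] (mod int p)" using obstruction[OF g y v vz] cong_sym cong_trans by blast
  then have "[1 = 0] (mod int p)" using y(2) cong_sym cong_trans by blast
  then show False using p_gt_1 by (simp add: cong_def)
qed

text \<open>The hypothesis \<open>gen\<close> means that \<open>y\<close> generates \<open>C\<close>
  topologically. In a procyclic pro-\<open>p\<close> group the elements killed by all homomorphisms
  to Z/p are \<open>p\<close>-th powers, and \<open>z\<close> is not one.\<close>

lemma not_procyclic:
  assumes y: "y \<in> C" and gen: "\<And>f x. fp_hom C f \<Longrightarrow> [f y = 0] (mod int p) \<Longrightarrow> x \<in> C \<Longrightarrow> [f x = 0] (mod int p)"
  shows False
proof -
  note Cm = closed_subgroupD[OF C]
  have yc: "y \<in> carrier G" using y C_carrier by blast
  have CY: "C \<subseteq> D" if "closed_subgroup D G T" "y \<in> D" for D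
    by (rule fp_homs_detect_generation[OF C that(1), of "{y}"]) (use y that(2) gen in auto)
  \<comment> \<open>As the image of a compact set this is closed, so a \<open>p\<close>-th root of
    \<open>z\<close> may be sought modulo each open normal subgroup.\<close>
  define P where "P = (\<lambda>x. x [^] p) ` C"
  have cont: "continuous_map T T (\<lambda>x. x [^] (n::nat))" for n
    by (induction n) (auto intro!: continuous_map_mult simp: continuous_map_const)
  have "closedin T P"
    unfolding P_def
    by (rule compactin_imp_closedin[OF Hausdorff image_compactin[OF closedin_compact_space[OF compact Cm(2)] cont]])
  have "z \<in> P"
  proof (rule closed_if_ncong[OF \<open>closedin T P\<close> zc(1)])
    fix N assume N: "open_normal N"
    show "\<exists>w\<in>P. ncong N z w"
    proof (cases "\<exists>f. fp_hom C f \<and> \<not> [f y = 0] (mod int p)")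
      case False
      have "C \<subseteq> {\<one>}"
      proof (rule fp_homs_detect_generation[OF C closed_subgroup_trivial, of "{}"])
        fix f assume "fp_hom C f"
        then show "\<forall>x\<in>C. [f x = 0] (mod int p)" using False gen by blast
      qed auto
      then have "z = \<one>" using z by blast
      then have "z \<in> P" unfolding P_def using Cm(4) by (intro image_eqI[of _ _ \<one>]) simp_all
      then show ?thesis using ncong_refl[OF N zc(1)] by blast
    next
      case True
      then obtain f where f: "fp_hom C f" "\<not> [f y = 0] (mod int p)" by blast
      obtain N' where N': "open_normal N'" "\<And>a b. a \<in> C \<Longrightarrow> b \<in> C \<Longrightarrow> inv a \<otimes> b \<in> N' \<Longrightarrow> f a = f b"
        using f(1) by (auto simp: fp_hom_def loc_const_def)
      \<comment> \<open>Refining \<open>N\<close> by \<open>N'\<close> lets \<open>f\<close> see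
        congruence modulo \<open>M\<close>: z = y^m modulo \<open>M\<close> forces m f(y) = f(z) = 0
        modulo \<open>p\<close>, so \<open>p\<close> divides \<open>m\<close>.\<close>
      define M where "M = N \<inter> N'"
      have M: "open_normal M" unfolding M_def by (rule open_normal_Int[OF N N'(1)])
      \<comment> \<open>The preimage of the cyclic group generated by \<open>y\<close> modulo
        \<open>M\<close>: a closed subgroup containing \<open>y\<close>, which therefore contains
        \<open>C\<close>.\<close>
      define D where "D = {x \<in> carrier G. \<exists>m::nat. ncong M x (y [^] m)}"
      have "closed_subgroup D G T"
        unfolding closed_subgroup_def
      proof
        obtain k where k: "\<And>x. x \<in> carrier G \<Longrightarrow> x [^] (p ^ k) \<in> M" using open_normal_pow[OF M] by blast
        show "subgroup D G"
        proof (rule subgroupI)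
          have "ncong M \<one> (y [^] (0::nat))" using ncong_refl[OF M] by simp
          then have "\<one> \<in> D" unfolding D_def by blast
          then show "D \<noteq> {}" by blast
          fix a assume a: "a \<in> D"
          then obtain m :: nat where m: "a \<in> carrier G" "ncong M a (y [^] m)" by (auto simp: D_def)
          have "ncong M (inv (y [^] m)) (y [^] (m * (p ^ k - 1)))"
          proof -
            have "m + m * (p ^ k - 1) = p ^ k * m" using p_gt_1 by (cases "p ^ k") (auto simp: algebra_simps)
            then have "y [^] m \<otimes> y [^] (m * (p ^ k - 1)) = (y [^] (p ^ k)) [^] m"
              using yc by (simp add: nat_pow_mult nat_pow_pow)
            moreover have "(y [^] (p ^ k)) [^] m \<in> M"
              by (induction m) (use open_normalD(5,6)[OF M] k[OF yc] in simp_all)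
            ultimately show ?thesis using yc by (simp add: ncong_def)
          qed
          then have "ncong M (inv a) (y [^] (m * (p ^ k - 1)))"
            using ncong_trans[OF M _ _ _ ncong_inv[OF M _ _ m(2)]] m(1) yc by simp
          then show "inv a \<in> D" using m(1) unfolding D_def by blast
          fix b assume "b \<in> D"
          then obtain n :: nat where n: "b \<in> carrier G" "ncong M b (y [^] n)" by (auto simp: D_def)
          have "ncong M (a \<otimes> b) (y [^] (m + n))"
            using ncong_mult[OF M _ _ _ _ m(2) n(2)] m(1) n(1) yc by (simp add: nat_pow_mult)
          then show "a \<otimes> b \<in> D" using m(1) n(1) unfolding D_def by blast
        qed (auto simp: D_def)
        show "closedin T D"
        proof (rule closedin_if_ncong)
          fix x assume x: "x \<in> carrier G" "\<And>N. open_normal N \<Longrightarrow> \<exists>w\<in>D. ncong N x w"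
          then obtain w where w: "w \<in> D" "ncong M x w" using M by blast
          then obtain m :: nat where "w \<in> carrier G" "ncong M w (y [^] m)" by (auto simp: D_def)
          then have "ncong M x (y [^] m)" using ncong_trans[OF M x(1) _ _ w(2)] yc by simp
          then show "x \<in> D" using x(1) unfolding D_def by blast
        qed (auto simp: D_def)
      qed
      moreover have "y \<in> D" using yc ncong_refl[OF M yc] unfolding D_def by (auto intro!: exI[of _ 1])
      ultimately have "z \<in> D" using CY z(1) by blast
      then obtain m :: nat where m: "ncong M z (y [^] m)" by (auto simp: D_def)
      then have "f z = f (y [^] m)"
        by (intro N'(2) z closed_subgroup_pow[OF C y]) (simp add: ncong_def M_def)
      then have "[int m * f y = 0] (mod int p)"
        using killed[OF f(1)] fp_hom_pow[OF C f(1) y, of m] cong_sym cong_trans by metis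
      then have "p dvd m"
        using f(2) prime by (auto simp: cong_0_iff prime_dvd_mult_iff)
      then obtain q where q: "m = p * q" by (rule dvdE)
      have "y [^] m = (y [^] q) [^] p" using yc by (simp add: q nat_pow_pow mult.commute)
      then have "y [^] m \<in> P" unfolding P_def using closed_subgroup_pow[OF C y, of q] by blast
      moreover have "ncong N z (y [^] m)" using m by (simp add: ncong_def M_def)
      ultimately show ?thesis by blast
    qed
  qed
  then show False using no_root by (auto simp: P_def)
qed

lemma lift_exists:
  assumes "fp_hom C g"
  obtains c where "cocycle C 2 c" "\<And>x. x \<in> C \<Longrightarrow> [c x = g x] (mod int p)"
  using kummer_lift[OF C assms] by blast

text \<open>By \<open>van\<close> a lift is determined modulo \<open>p\<close> by its value at
  \<open>z\<close> modulo p^2, which is a multiple of \<open>p\<close>. Hence the homomorphisms from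
  \<open>C\<close> to Z/p form a space of dimension at most 1, and \<open>C\<close> is
  procyclic.\<close>

lemma contradiction_odd:
  assumes odd: "odd p"
  shows False
proof -
  have van: "[c x = 0] (mod int p)" if c: "cocycle C 2 c" and cz: "[c z = 0] (mod int p ^ 2)" and x: "x \<in> C" for c x
  proof (rule ccontr)
    assume "\<not> [c x = 0] (mod int p)"
    then obtain b where b: "[b * c x = 1] (mod int p)" using inverse_mod_prime[OF prime] by blast
    have "cocycle C 2 (\<lambda>x. b * c x + 0 * c x)" by (rule cocycle_comb[OF c c])
    moreover have "[b * c z = b * 0] (mod int p ^ 2)" by (intro cong_mult cong_refl cz)
    ultimately show False using no_lift_vanishing_at_z[of "\<lambda>x. b * c x" x] b x odd by simp
  qed
  show False
  proof (cases "\<exists>g. fp_hom C g \<and> (\<exists>x\<in>C. \<not> [g x = 0] (mod int p))")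
    case False
    show False by (rule not_procyclic[OF z(1)]) (use False in blast)
  next
    case True
    then obtain g y where g: "fp_hom C g" "y \<in> C" "\<not> [g y = 0] (mod int p)" by blast
    obtain c where c: "cocycle C 2 c" "\<And>x. x \<in> C \<Longrightarrow> [c x = g x] (mod int p)" using lift_exists[OF g(1)] by blast
    have cy: "\<not> [c y = 0] (mod int p)" using g(2,3) c(2) cong_sym cong_trans by blast
    have dvd: "int p dvd d z" if "cocycle C 2 d" for d
      using killed[OF cocycle_reduction[OF C_carrier that]] by (simp add: cong_0_iff)
    obtain \<mu> where \<mu>: "c z = int p * \<mu>" using dvd[OF c(1)] by (rule dvdE)
    have \<mu>0: "\<not> [\<mu> = 0] (mod int p)"
    proof
      assume "[\<mu> = 0] (mod int p)"
      then have "[int p * \<mu> = int p * 0] (mod int p ^ 2)" by (simp only: cong_p_cancel)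
      then show False using van[OF c(1) _ g(2)] cy by (simp add: \<mu>)
    qed
    show False
    proof (rule not_procyclic[OF g(2)])
      fix f x assume f: "fp_hom C f" "[f y = 0] (mod int p)" and x: "x \<in> C"
      obtain c' where c': "cocycle C 2 c'" "\<And>x. x \<in> C \<Longrightarrow> [c' x = f x] (mod int p)" using lift_exists[OF f(1)] by blast
      obtain \<mu>' where \<mu>': "c' z = int p * \<mu>'" using dvd[OF c'(1)] by (rule dvdE)
      \<comment> \<open>The combination of the two lifts that vanishes at \<open>z\<close>. Its
        value at \<open>y\<close> shows that \<open>p\<close> divides \<mu>', and its value at
        \<open>x\<close> then gives the claim.\<close>
      have d: "cocycle C 2 (\<lambda>x. \<mu> * c' x + (- \<mu>') * c x)" by (rule cocycle_comb[OF c'(1) c(1)])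
      have dz: "[\<mu> * c' z + (- \<mu>') * c z = 0] (mod int p ^ 2)" by (simp add: \<mu> \<mu>' ac_simps)
      have pr: "Factorial_Ring.prime (int p)" using prime by simp
      have "int p dvd \<mu> * c' y + (- \<mu>') * c y" using van[OF d dz g(2)] by (simp add: cong_0_iff)
      moreover have "int p dvd c' y" using c'(2)[OF g(2)] f(2) cong_trans cong_0_iff by blast
      ultimately have "int p dvd \<mu>' * c y" by (simp add: dvd_diff_right_iff)
      then have "int p dvd \<mu>'" using cy pr by (auto simp: cong_0_iff prime_dvd_mult_iff)
      moreover have "int p dvd \<mu> * c' x + (- \<mu>') * c x" using van[OF d dz x] by (simp add: cong_0_iff)
      ultimately have "int p dvd \<mu> * c' x" by (simp add: dvd_diff_left_iff)
      then have "int p dvd c' x" using \<mu>0 pr by (auto simp: cong_0_iff prime_dvd_mult_iff)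
      then show "[f x = 0] (mod int p)" using c'(2)[OF x] by (meson cong_0_iff cong_sym cong_trans)
    qed
  qed
qed

text \<open>For \<open>p = 2\<close> lifts vanishing at \<open>z\<close> can only be excluded on elements \<open>y\<close> with \<open>\<theta>(y) \<equiv> 1\<close> modulo
  4. Hence, besides \<open>0\<close>, the homomorphisms \<open>C \<rightarrow> \<int>/2\<close> are the reduction \<open>w\<close> of \<open>(\<theta> - 1)/2\<close>, a homomorphism \<open>c\<close>
  whose lift has the value 2 at \<open>z\<close>, and \<open>c + w\<close>. The contradiction comes from a homomorphism \<open>u\<close> on
  \<open>U = ker w\<close> with \<open>u(z) = 1\<close>: one computes that \<open>u(y\<^sup>2) = 1\<close> for \<open>w(y) = 1\<close>, \<open>c(y) = 0\<close>, while comparing a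
  lift of \<open>u\<close> with its conjugate by \<open>y\<close> yields a homomorphism \<open>q\<close> with \<open>q(z) = 1\<close> and \<open>q(y\<^sup>2) = 0\<close>, so that
  \<open>q + u\<close> violates the obstruction.\<close>

lemma contradiction_even:
  assumes p2: "p = 2"
  shows False
proof -
  note Cm = closed_subgroupD[OF C]
  have par: "[a = 0] (mod int p) \<longleftrightarrow> even a" for a :: int by (simp add: p2 cong_0_iff)
  have one: "[a = 1] (mod int p) \<longleftrightarrow> odd a" for a :: int unfolding p2 cong_def by simp presburger
  have hom: "even (f (x \<otimes> y)) \<longleftrightarrow> (even (f x) \<longleftrightarrow> even (f y))" if "fp_hom D f" "x \<in> D" "y \<in> D" for D f x y
    using fp_hom_mult[OF that] by (simp add: p2 cong_iff_dvd_diff)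
  have add: "fp_hom D (\<lambda>x. f x + g x)" if "fp_hom D f" "fp_hom D g" for D f g
    using fp_hom_comb[OF that, of 1 1] by simp
  \<comment> \<open>Both \<open>hw\<close> and \<open>w\<close> are (\<theta> - 1)/2, taken from
    \<theta> modulo 4 and modulo 8. Halving loses a binary digit, so \<open>w\<close> is meaningful
    modulo 4 and \<open>hw\<close> modulo 2.\<close>
  define hw where "hw x = (\<theta> x 2 - 1) div 2" for x
  define w where "w x = (\<theta> x 3 - 1) div 2" for x
  have th1: "odd (\<theta> x n)" if "x \<in> carrier G" "n > 0" for x n using theta_mod_p[OF that] one by blast
  have w2: "\<theta> x 3 = 1 + 2 * w x" if "x \<in> carrier G" for x
    using th1[OF that, of 3] by (simp add: w_def)
  have th2: "\<theta> x 2 = 1 + 2 * hw x" if "x \<in> carrier G" for x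
    using th1[OF that, of 2] by (simp add: hw_def)
  have w_hw: "even (w x) \<longleftrightarrow> even (hw x)" if x: "x \<in> carrier G" for x
  proof -
    have "[\<theta> x 3 = \<theta> x 2] (mod 4)" using padic_cong_le[OF theta_closed[OF x], of 2 3] by (simp add: p2)
    then have "4 dvd 2 * (w x - hw x)" using w2[OF x] th2[OF x] by (simp add: cong_iff_dvd_diff)
    then have "2 dvd w x - hw x" by presburger
    then show ?thesis by presburger
  qed
  \<comment> \<open>The identity \<theta>(x y) - 1 = (\<theta>(x) - 1) + \<theta>(x) (\<theta>(y) -
    1) modulo 8, divided by 2.\<close>
  have w_cocycle: "cocycle C 2 w"
    unfolding cocycle_def
  proof (intro conjI ballI)
    show "loc_const C w" unfolding w_def
      by (rule loc_const_subset[OF loc_const_comp[OF theta_loc_const] C_carrier])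
    fix x y assume "x \<in> C" "y \<in> C"
    then have xy: "x \<in> carrier G" "y \<in> carrier G" "x \<otimes> y \<in> carrier G" using C_carrier by auto
    have "8 dvd \<theta> (x \<otimes> y) 3 - \<theta> x 3 * \<theta> y 3" using theta_mult(2)[OF xy(1,2), of 3] by (simp add: p2 cong_iff_dvd_diff)
    moreover have "\<theta> (x \<otimes> y) 3 - \<theta> x 3 * \<theta> y 3 = 2 * (w (x \<otimes> y) - (w x + \<theta> x 3 * w y))"
      using w2[OF xy(1)] w2[OF xy(2)] w2[OF xy(3)] by (simp add: algebra_simps)
    ultimately have "8 dvd 2 * (w (x \<otimes> y) - (w x + \<theta> x 3 * w y))" by simp
    then have "4 dvd w (x \<otimes> y) - (w x + \<theta> x 3 * w y)" by presburger
    then have "[w (x \<otimes> y) = w x + \<theta> x 3 * w y] (mod 4)" by (simp add: cong_iff_dvd_diff)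
    also have "[w x + \<theta> x 3 * w y = w x + \<theta> x 2 * w y] (mod 4)"
      using padic_cong_le[OF theta_closed[OF xy(1)], of 2 3] by (intro cong_add cong_mult cong_refl) (simp add: p2)
    finally show "[w (x \<otimes> y) = w x + \<theta> x 2 * w y] (mod int p ^ 2)" by (simp add: p2)
  qed
  have w_hom: "fp_hom C w" by (rule cocycle_reduction[OF C_carrier w_cocycle]) simp
  have wz: "w z = 0"
  proof -
    have "\<theta> z 3 = 1" using z(2) unfolding theta_centre_iff padic_ops by (simp add: p2)
    then show ?thesis by (simp add: w_def)
  qed
  have below: "odd (w y)" if c: "cocycle C 2 c" and cz: "4 dvd c z" and y: "y \<in> C" "odd (c y)" for c y
  proof (rule ccontr)
    assume "\<not> odd (w y)"
    then have "even (hw y)" using w_hw y C_carrier by blast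
    moreover have "\<theta> y 2 = 1 + 2 * hw y" using th2 y C_carrier by blast
    ultimately have "[\<theta> y 2 = 1] (mod 4)" by (simp add: cong_iff_dvd_diff) presburger
    then show False using no_lift_vanishing_at_z[OF c y(1)] y(2) cz one by (simp add: p2 cong_0_iff)
  qed
  \<comment> \<open>A homomorphism to Z/2 whose support lies in that of another one is zero or equal
    to it: otherwise a product of two witnesses violates the inclusion.\<close>
  have dominated: "(\<forall>x\<in>C. even (h x)) \<or> (\<forall>x\<in>C. even (h x) \<longleftrightarrow> even (k x))"
    if h: "fp_hom C h" and k: "fp_hom C k" and hk: "\<And>x. x \<in> C \<Longrightarrow> odd (h x) \<Longrightarrow> odd (k x)" for h k
  proof (rule ccontr)
    assume "\<not> ?thesis"
    then obtain a b where ab: "a \<in> C" "odd (h a)" "b \<in> C" "even (h b) \<noteq> even (k b)" by blast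
    then have "even (h b)" "odd (k b)" using hk by blast+
    then have "odd (h (a \<otimes> b))" "even (k (a \<otimes> b))" using hom[OF h ab(1,3)] hom[OF k ab(1,3)] hk[OF ab(1,2)] ab(2) by auto
    then show False using hk Cm(5)[OF ab(1,3)] by blast
  qed
  have class0: "(\<forall>x\<in>C. even (c x)) \<or> (\<forall>x\<in>C. even (c x) \<longleftrightarrow> even (w x))" if c: "cocycle C 2 c" and cz: "4 dvd c z" for c
    by (rule dominated[OF cocycle_reduction[OF C_carrier c] w_hom below[OF c cz]]) simp_all
  have ev: "even (c z)" if "cocycle C 2 c" for c
    using killed[OF cocycle_reduction[OF C_carrier that]] par by simp
  have lift: "\<exists>c. cocycle C 2 c \<and> (\<forall>x\<in>C. even (c x) \<longleftrightarrow> even (f x))" if f: "fp_hom C f" for f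
  proof -
    obtain c where c: "cocycle C 2 c" "\<And>x. x \<in> C \<Longrightarrow> [c x = f x] (mod int p)" using lift_exists[OF f] by blast
    have "even (c x) \<longleftrightarrow> even (f x)" if "x \<in> C" for x using c(2)[OF that] by (simp add: p2 cong_iff_dvd_diff)
    then show ?thesis using c(1) by blast
  qed
  have procyclic: False if y: "y \<in> C" and gen: "\<And>f x. fp_hom C f \<Longrightarrow> even (f y) \<Longrightarrow> x \<in> C \<Longrightarrow> even (f x)" for y
    by (rule not_procyclic[OF y]) (use gen par in blast)
  \<comment> \<open>If all lifts vanished at \<open>z\<close> modulo 4, every homomorphism would be
    zero or equal to \<open>w\<close>, and \<open>C\<close> would be procyclic.\<close>
  obtain c where c: "cocycle C 2 c" "\<not> 4 dvd c z"
  proof (rule ccontr)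
    assume "\<not> thesis"
    then have all: "\<And>c. cocycle C 2 c \<Longrightarrow> 4 dvd c z" using that by blast
    have cl: "(\<forall>x\<in>C. even (f x)) \<or> (\<forall>x\<in>C. even (f x) \<longleftrightarrow> even (w x))" if f: "fp_hom C f" for f
      using lift[OF f] class0 all by blast
    show False
    proof (cases "\<exists>y\<in>C. odd (w y)")
      case True
      then obtain y where y: "y \<in> C" "odd (w y)" by blast
      show False by (rule procyclic[OF y(1)]) (use cl y in blast)
    next
      case False
      show False by (rule procyclic[OF z(1)]) (use cl False in blast)
    qed
  qed
  have g: "fp_hom C c" by (rule cocycle_reduction[OF C_carrier c(1)]) simp
  have cz2: "[c z = 2] (mod 4)" using ev[OF c(1)] c(2) by (simp add: cong_iff_dvd_diff) presburger
  have classes: "(\<forall>x\<in>C. even (f x)) \<or> (\<forall>x\<in>C. even (f x) \<longleftrightarrow> even (w x)) \<or>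
      (\<forall>x\<in>C. even (f x) \<longleftrightarrow> even (c x)) \<or> (\<forall>x\<in>C. even (f x) \<longleftrightarrow> even (c x + w x))" if f: "fp_hom C f" for f
  proof -
    obtain d where d: "cocycle C 2 d" "\<And>x. x \<in> C \<Longrightarrow> even (d x) \<longleftrightarrow> even (f x)" using lift[OF f] by blast
    show ?thesis
    proof (cases "4 dvd d z")
      case True
      then show ?thesis using class0[OF d(1)] d(2) by blast
    next
      case False
      have e: "cocycle C 2 (\<lambda>x. d x + c x)" using cocycle_comb[OF d(1) c(1), of 1 1] by simp
      have "4 dvd d z + c z" using False c(2) ev[OF d(1)] ev[OF c(1)] by presburger
      from class0[OF e this] show ?thesis
      proof
        assume "\<forall>x\<in>C. even (d x + c x)"
        then have "\<forall>x\<in>C. even (f x) \<longleftrightarrow> even (c x)" using d(2) by simp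
        then show ?thesis by blast
      next
        assume a: "\<forall>x\<in>C. even (d x + c x) \<longleftrightarrow> even (w x)"
        have "even (f x) \<longleftrightarrow> even (c x + w x)" if "x \<in> C" for x using d(2)[OF that] a that by auto
        then show ?thesis by blast
      qed
    qed
  qed
  have div2: "fp_hom C (\<lambda>x. e x div 2)" if "cocycle C 2 e" "\<And>x. x \<in> C \<Longrightarrow> even (e x)" for e
    using cocycle_div[OF order_refl C C_carrier that(1)] that(2) par by (simp add: p2)
  have c_ne: "\<not> (\<forall>x\<in>C. even (c x))" "\<not> (\<forall>x\<in>C. even (c x) \<longleftrightarrow> even (w x))"
  proof -
    \<comment> \<open>A lift that is even everywhere can be halved, and \<open>killed\<close> then
      makes its value at \<open>z\<close> divisible by 4, unlike that of \<open>c\<close>.\<close>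
    have nz: "False" if "cocycle C 2 e" "\<And>x. x \<in> C \<Longrightarrow> even (e x)" "e z = c z" for e
      using killed[OF div2[OF that(1,2)]] that(3) ev[OF c(1)] c(2) par by simp presburger
    show "\<not> (\<forall>x\<in>C. even (c x))" using nz[OF c(1)] by blast
    have "cocycle C 2 (\<lambda>x. c x + w x)" using cocycle_comb[OF c(1) w_cocycle, of 1 1] by simp
    from nz[OF this] show "\<not> (\<forall>x\<in>C. even (c x) \<longleftrightarrow> even (w x))" using wz by auto
  qed
  \<comment> \<open>\<open>x\<close> and \<open>y\<close> are dual to the basis \<open>c\<close>,
    \<open>w\<close> of the homomorphisms from \<open>C\<close> to Z/2.\<close>
  obtain x where x: "x \<in> C" "odd (c x)" "even (w x)"
    using dominated[OF g w_hom] c_ne by blast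
  obtain y where y: "y \<in> C" "odd (w y)" "even (c y)"
  proof (rule ccontr)
    assume "\<not> thesis"
    then have "\<And>y. y \<in> C \<Longrightarrow> odd (w y) \<Longrightarrow> odd (c y)" using that by blast
    then have w0: "\<forall>x\<in>C. even (w x)" using dominated[OF w_hom g] c_ne by blast
    show False
      by (rule procyclic[OF x(1)]) (use classes w0 x in auto)
  qed
  note Cc = subsetD[OF C_carrier]
  have pow2: "a [^] p = a \<otimes> a" if "a \<in> carrier G" for a using that by (simp add: p2 numeral_2_eq_2)
  \<comment> \<open>The obstruction makes v(a^2) even for every \<open>a\<close> outside the kernel
    of \<open>h\<close>. Applied to m b, where (m b)^2 = m (b m b^{-1}) b^2, this yields the
    invariance by which \<open>v\<close> extends to \<open>C\<close>.\<close>
  have ext: "\<exists>F. fp_hom C F \<and> (\<forall>m\<in>C. even (h m) \<longrightarrow> F m = v m) \<and> even (F b)"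
    if h: "fp_hom C h" and b: "b \<in> C" "odd (h b)" and v: "fp_hom {m \<in> C. even (h m)} v" "even (v z)" for h v b
  proof -
    let ?M = "{m \<in> C. even (h m)}"
    have sq: "even (v (a \<otimes> a))" if a: "a \<in> C" "odd (h a)" for a
      using obstruction[OF h a(1), of v] v a Cc by (simp add: par one pow2)
    have bb: "b \<otimes> b \<in> ?M" using Cm(5) b hom[OF h b(1) b(1)] by simp
    have "even (v (b \<otimes> m \<otimes> inv b)) \<longleftrightarrow> even (v m)" if m: "m \<in> C" "even (h m)" for m
    proof -
      have "[h (b \<otimes> m \<otimes> inv b) = h m] (mod int p)" by (rule fp_hom_conj[OF C h b(1) m(1)])
      then have k: "b \<otimes> m \<otimes> inv b \<in> ?M" using m b Cm(5,6) by (simp add: p2 cong_iff_dvd_diff)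
      then have kb: "(b \<otimes> m \<otimes> inv b) \<otimes> (b \<otimes> b) \<in> ?M" using bb Cm(5) hom[OF h] by simp
      have "(m \<otimes> b) \<otimes> (m \<otimes> b) = m \<otimes> ((b \<otimes> m \<otimes> inv b) \<otimes> (b \<otimes> b))" using Cc b(1) m(1) by (simp add: m_assoc)
      moreover have "even (v ((m \<otimes> b) \<otimes> (m \<otimes> b)))" using sq Cm(5)[OF m(1) b(1)] hom[OF h m(1) b(1)] m b by simp
      ultimately have "even (v m) \<longleftrightarrow> even (v ((b \<otimes> m \<otimes> inv b) \<otimes> (b \<otimes> b)))" using hom[OF v(1) _ kb, of m] m by simp
      then show ?thesis using hom[OF v(1) k bb] sq[OF b] by simp
    qed
    then show ?thesis using fp_hom_extend_index_two[OF p2 C h b v(1)] sq[OF b] by metis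
  qed
  have wker: "closed_subgroup {e \<in> D. even (w e)} G T" if "closed_subgroup D G T" "D \<subseteq> C" for D
    using closed_subgroup_kernel[OF that(1) fp_hom_subset[OF w_hom that(2)]] by (simp add: par)
  have conj_sum: "fp_hom M (\<lambda>e. \<psi> e + \<psi> (a \<otimes> e \<otimes> inv a))" "even (\<psi> z + \<psi> (a \<otimes> z \<otimes> inv a))"
    if a: "a \<in> C" and M: "closed_subgroup M G T" "z \<in> M" and cl: "\<And>e. e \<in> M \<Longrightarrow> a \<otimes> e \<otimes> inv a \<in> M"
      and \<psi>: "fp_hom M \<psi>" for a M \<psi>
  proof -
    have "fp_hom M (\<lambda>e. \<psi> (a \<otimes> e \<otimes> inv a))"
      unfolding fp_hom_def
    proof (intro conjI ballI)
      show "loc_const M (\<lambda>e. \<psi> (a \<otimes> e \<otimes> inv a))"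
        by (rule loc_const_translate[of M]) (use \<psi> cl a Cc closed_subgroupD(3)[OF M(1)] in \<open>auto simp: fp_hom_def\<close>)
      fix d e assume de: "d \<in> M" "e \<in> M"
      then have "a \<otimes> (d \<otimes> e) \<otimes> inv a = (a \<otimes> d \<otimes> inv a) \<otimes> (a \<otimes> e \<otimes> inv a)"
        using Cc[OF a] subsetD[OF closed_subgroupD(3)[OF M(1)]] by (simp add: m_assoc)
      then show "[\<psi> (a \<otimes> (d \<otimes> e) \<otimes> inv a) = \<psi> (a \<otimes> d \<otimes> inv a) + \<psi> (a \<otimes> e \<otimes> inv a)] (mod int p)"
        using fp_hom_mult[OF \<psi> cl[OF de(1)] cl[OF de(2)]] by simp
    qed
    from add[OF \<psi> this] show "fp_hom M (\<lambda>e. \<psi> e + \<psi> (a \<otimes> e \<otimes> inv a))" .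
    have "[\<psi> (a \<otimes> z \<otimes> inv a) = \<psi> z] (mod int p)"
      by (rule fp_hom_theta_conj[OF M(1) \<psi> M(2) Cc[OF a] cl[OF M(2)] zact[OF Cc[OF a]]])
    then show "even (\<psi> z + \<psi> (a \<otimes> z \<otimes> inv a))" by (simp add: p2 cong_iff_dvd_diff)
  qed
  define E where "E = {e \<in> C. even (w e) \<and> even (c e)}"
  \<comment> \<open>A homomorphism on \<open>E\<close> is extended to the kernel \<open>D\<close> of
    \<open>g'\<close> by means of \<open>a\<close>, then to \<open>C\<close>, where it is zero or
    \<open>g'\<close> and hence trivial on \<open>D\<close>. The extension to \<open>D\<close> asks
    for invariance under \<open>a\<close>; the sum of \<psi> and its conjugate is invariant, and its
    vanishing says that \<psi> itself is.\<close>
  have E_vanish: "even (\<psi> e)"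
    if g': "fp_hom C g'" "odd (g' x)" "\<And>e. e \<in> C \<Longrightarrow> even (w e) \<Longrightarrow> even (g' e) \<longleftrightarrow> even (c e)"
      and a: "a \<in> C" "odd (w a)" "even (g' a)"
      and cls: "\<And>F. fp_hom C F \<Longrightarrow> even (F a) \<Longrightarrow> (\<forall>x\<in>C. even (F x)) \<or> (\<forall>x\<in>C. even (F x) \<longleftrightarrow> even (g' x))"
      and \<psi>: "fp_hom E \<psi>" "even (\<psi> z)" "even (\<psi> (a \<otimes> a))" and e: "e \<in> E" for g' a \<psi> e
  proof -
    let ?D = "{d \<in> C. even (g' d)}"
    have D: "closed_subgroup ?D G T" using closed_subgroup_kernel[OF C g'(1)] by (simp add: par)
    note Dm = closed_subgroupD[OF D]
    have aD: "a \<in> ?D" using a by simp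
    have ED: "E = {d \<in> ?D. even (w d)}" using g'(3) by (auto simp: E_def)
    have Ecl: "closed_subgroup E G T" unfolding ED by (rule wker[OF D]) auto
    note Em = closed_subgroupD[OF Ecl]
    have wD: "fp_hom ?D w" by (rule fp_hom_subset[OF w_hom]) auto
    have zE: "z \<in> E" using z wz ev[OF c(1)] by (simp add: E_def)
    have aE: "a \<otimes> a \<in> E" unfolding ED using Dm(5)[OF aD aD] hom[OF wD aD aD] by simp
    have conjE: "a \<otimes> e \<otimes> inv a \<in> E" if "e \<in> E" for e
    proof -
      have d: "e \<in> ?D" "even (w e)" using that unfolding ED by blast+
      then have "a \<otimes> e \<otimes> inv a \<in> ?D" using aD Dm(5,6) by blast
      moreover have "even (w (a \<otimes> e \<otimes> inv a))" using fp_hom_conj[OF D wD aD d(1)] d(2) by (simp add: p2 cong_iff_dvd_diff)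
      ultimately show ?thesis unfolding ED by blast
    qed
    have D_vanish: "even (v d)" if v: "fp_hom ?D v" "even (v z)" "even (v a)" and d: "d \<in> ?D" for v d
    proof -
      obtain F where F: "fp_hom C F" "\<And>m. m \<in> C \<Longrightarrow> even (g' m) \<Longrightarrow> F m = v m"
        using ext[OF g'(1) x(1) g'(2) v(1,2)] by blast
      then have "even (F a)" using v(3) aD by simp
      then have "even (F d)" using cls[OF F(1)] d by blast
      then show ?thesis using F(2) d by simp
    qed
    have invariant_vanish: "even (v e)" if v: "fp_hom E v" "even (v z)" "even (v (a \<otimes> a))" and e: "e \<in> E"
      and i: "\<And>m. m \<in> E \<Longrightarrow> even (v (a \<otimes> m \<otimes> inv a)) \<longleftrightarrow> even (v m)" for v e
    proof -
      obtain F where F: "fp_hom ?D F" "\<And>m. m \<in> ?D \<Longrightarrow> even (w m) \<Longrightarrow> F m = v m" "even (F a)"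
        by (rule fp_hom_extend_index_two[OF p2 D wD aD a(2) v(1)[unfolded ED] _ v(3)]) (use i ED in blast)+
      have "even (F e)" by (rule D_vanish[OF F(1) _ F(3)]) (use F(2) v(2) zE e in \<open>auto simp: ED\<close>)
      then show ?thesis using F(2) e by (auto simp: ED)
    qed
    have "even (\<psi> m + \<psi> (a \<otimes> m \<otimes> inv a))" if m: "m \<in> E" for m
    proof (rule invariant_vanish[OF conj_sum(1)[OF a(1) Ecl zE conjE \<psi>(1)] conj_sum(2)[OF a(1) Ecl zE conjE \<psi>(1)] _ m])
      have "a \<otimes> (a \<otimes> a) \<otimes> inv a = a \<otimes> a" using Cc[OF a(1)] by (simp add: m_assoc)
      then show "even (\<psi> (a \<otimes> a) + \<psi> (a \<otimes> (a \<otimes> a) \<otimes> inv a))" by simp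
      fix m assume m: "m \<in> E"
      have mc: "m \<in> carrier G" using m Em(3) by blast
      have "a \<otimes> (a \<otimes> m \<otimes> inv a) \<otimes> inv a = (a \<otimes> a) \<otimes> m \<otimes> inv (a \<otimes> a)"
        using Cc[OF a(1)] mc by (simp add: m_assoc inv_mult_group)
      moreover have "even (\<psi> ((a \<otimes> a) \<otimes> m \<otimes> inv (a \<otimes> a))) \<longleftrightarrow> even (\<psi> m)"
        using fp_hom_conj[OF Ecl \<psi>(1) aE m] by (simp add: p2 cong_iff_dvd_diff)
      ultimately show "even (\<psi> (a \<otimes> m \<otimes> inv a) + \<psi> (a \<otimes> (a \<otimes> m \<otimes> inv a) \<otimes> inv a)) \<longleftrightarrow> even (\<psi> m + \<psi> (a \<otimes> m \<otimes> inv a))"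
        by auto
    qed
    then show ?thesis by (intro invariant_vanish[OF \<psi> e]) simp
  qed
  let ?U = "{e \<in> C. even (w e)}"
  have U: "closed_subgroup ?U G T" by (rule wker[OF C]) simp
  have EU: "E = {e \<in> ?U. even (c e)}" by (auto simp: E_def)
  have Ecl: "closed_subgroup E G T"
    using closed_subgroup_kernel[OF U fp_hom_subset[OF g]] by (simp add: par EU)
  have zU: "z \<in> ?U" using z wz by simp
  obtain u where u: "fp_hom ?U u" "odd (u z)" using hom_on_kernel_nontrivial[OF w_hom y(1)] y(2) by (auto simp: par one)
  have yc: "y \<in> carrier G" and xc: "x \<in> carrier G" using x y Cc by auto
  have conjU: "y \<otimes> h \<otimes> inv y \<in> ?U" if "h \<in> ?U" for h
    using that fp_hom_conj[OF C w_hom y(1), of h] y(1) Cm(5,6) by (simp add: p2 cong_iff_dvd_diff)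
  have sqU: "a \<otimes> a \<in> ?U" if "a \<in> C" for a using Cm(5)[OF that that] hom[OF w_hom that that] by simp
  have csq: "[c (a \<otimes> a) = c a * (1 + \<theta> a 2)] (mod 4)" if "a \<in> C" for a
    using cocycle_pow[OF C c(1) that, of 2] Cc[OF that] by (simp add: p2 numeral_2_eq_2)
  \<comment> \<open>\<open>u\<close> and c/2 are both odd at \<open>z\<close>, so the sum is even
    there, while at x^2 it is odd because c(x^2) is 2 modulo 4. By \<open>E_vanish\<close> this
    forces \<psi>(a^2) to be odd for every admissible \<open>a\<close>.\<close>
  define \<psi> where "\<psi> e = u e + c e div 2" for e
  have "fp_hom E (\<lambda>e. c e div int p)"
    by (rule cocycle_div[OF _ Ecl C_carrier c(1)]) (auto simp: E_def par)
  then have "fp_hom E (\<lambda>e. c e div 2)" using p2 by simp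
  then have \<psi>: "fp_hom E \<psi>"
    unfolding \<psi>_def by (intro add fp_hom_subset[OF u(1)]) (auto simp: EU)
  have \<psi>z: "even (\<psi> z)"
  proof -
    have "odd (c z div 2)" using cz2 unfolding cong_iff_dvd_diff by presburger
    then show ?thesis using u(2) by (simp add: \<psi>_def)
  qed
  have xE: "x \<otimes> x \<in> E" using sqU[OF x(1)] hom[OF g x(1) x(1)] by (simp add: EU)
  have \<psi>x: "odd (\<psi> (x \<otimes> x))"
  proof -
    have "even (u (x \<otimes> x))" using hom[OF u(1), of x x] x by simp
    moreover have "odd (c (x \<otimes> x) div 2)"
    proof -
      obtain k where k: "hw x = 2 * k" using x(3) w_hw[OF xc] by auto
      have "[c (x \<otimes> x) = c x * (2 + 4 * k)] (mod 4)" using csq[OF x(1)] th2[OF xc] k by simp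
      moreover have "[c x * (2 + 4 * k) = 2] (mod 4)"
      proof -
        obtain l where "c x = 2 * l + 1" using x(2) by (rule oddE)
        then have "c x * (2 + 4 * k) - 2 = 4 * (l + 2 * l * k + k)" by (simp add: algebra_simps)
        then show ?thesis by (simp add: cong_iff_dvd_diff)
      qed
      ultimately have "[c (x \<otimes> x) = 2] (mod 4)" by (rule cong_trans)
      then show ?thesis unfolding cong_iff_dvd_diff by presburger
    qed
    ultimately show ?thesis by (simp add: \<psi>_def)
  qed
  \<comment> \<open>Here \<theta>(a) is 3 modulo 4, so c(a^2) = c(a) (1 + \<theta>(a)) is divisible
    by 4, and the oddness of \<psi>(a^2) is that of u(a^2).\<close>
  have usq: "odd (u (a \<otimes> a))"
    if "fp_hom C g'" "odd (g' x)" "\<And>e. e \<in> C \<Longrightarrow> even (w e) \<Longrightarrow> even (g' e) \<longleftrightarrow> even (c e)"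
      and a: "a \<in> C" "odd (w a)" "even (g' a)"
      and "\<And>F. fp_hom C F \<Longrightarrow> even (F a) \<Longrightarrow> (\<forall>x\<in>C. even (F x)) \<or> (\<forall>x\<in>C. even (F x) \<longleftrightarrow> even (g' x))" for g' a
  proof -
    have "odd (\<psi> (a \<otimes> a))"
    proof
      assume "even (\<psi> (a \<otimes> a))"
      then show False using E_vanish[OF that(1-7) \<psi> \<psi>z _ xE] \<psi>x by blast
    qed
    moreover have "even (c (a \<otimes> a) div 2)"
    proof -
      obtain k where "hw a = 2 * k + 1" using a(2) w_hw[OF Cc[OF a(1)]] by (auto elim: oddE)
      then have "1 + \<theta> a 2 = 4 * (k + 1)" using th2[OF Cc[OF a(1)]] by simp
      then have "[c (a \<otimes> a) = c a * (4 * (k + 1))] (mod 4)" using csq[OF a(1)] by (simp only:)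
      then have "4 dvd c (a \<otimes> a)" by (simp add: cong_dvd_iff)
      then show ?thesis by presburger
    qed
    ultimately show ?thesis by (simp add: \<psi>_def)
  qed
  have uy: "odd (u (y \<otimes> y))"
    by (rule usq[OF g x(2) refl y(1,2,3)]) (use classes y in auto)
  \<comment> \<open>Besides \<open>y\<close> with g' = c, the product x y is admissible with g' = c
    + w. Since (x y)^2 = x (y x y^{-1}) y^2 and \<open>u\<close> is odd at both squares, u(x) and
    u(y x y^{-1}) have the same parity.\<close>
  have "odd (u ((x \<otimes> y) \<otimes> (x \<otimes> y)))"
  proof (rule usq[OF add[OF g w_hom]])
    have "odd (w (x \<otimes> y))" "odd (c (x \<otimes> y))" using hom[OF w_hom x(1) y(1)] hom[OF g x(1) y(1)] x y by auto
    then show "x \<otimes> y \<in> C" "odd (w (x \<otimes> y))" "even (c (x \<otimes> y) + w (x \<otimes> y))"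
      "\<And>F. fp_hom C F \<Longrightarrow> even (F (x \<otimes> y)) \<Longrightarrow> (\<forall>x\<in>C. even (F x)) \<or> (\<forall>xa\<in>C. even (F xa) \<longleftrightarrow> even (c xa + w xa))"
      using Cm(5)[OF x(1) y(1)] classes by auto
  qed (use x in auto)
  moreover have "(x \<otimes> y) \<otimes> (x \<otimes> y) = x \<otimes> ((y \<otimes> x \<otimes> inv y) \<otimes> (y \<otimes> y))" using xc yc by (simp add: m_assoc)
  moreover have xU: "x \<in> ?U" using x by simp
  moreover have "(y \<otimes> x \<otimes> inv y) \<otimes> (y \<otimes> y) \<in> ?U"
    by (rule closed_subgroupD(5)[OF U conjU[OF xU] sqU[OF y(1)]])
  ultimately have ux: "even (u x + u (y \<otimes> x \<otimes> inv y))"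
    using hom[OF u(1)] hom[OF u(1) conjU[OF xU] sqU[OF y(1)]] uy by auto
  \<comment> \<open>The extension to \<open>C\<close> of the sum of \<open>u\<close> and its
    conjugate is even at \<open>x\<close> and at \<open>y\<close>, hence zero by
    \<open>classes\<close>: modulo 2 \<open>u\<close> is invariant under \<open>y\<close>.\<close>
  have f_even: "even (u h + u (y \<otimes> h \<otimes> inv y))" if h: "h \<in> ?U" for h
  proof -
    obtain F where F: "fp_hom C F" "\<And>m. m \<in> C \<Longrightarrow> even (w m) \<Longrightarrow> F m = u m + u (y \<otimes> m \<otimes> inv y)" "even (F y)"
      using ext[OF w_hom y(1,2) conj_sum[OF y(1) U zU conjU u(1)]] by blast
    have "even (F x)" using F(2)[OF x(1,3)] ux by simp
    then have "even (F h)" using classes[OF F(1)] F(3) x y h by auto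
    then show ?thesis using F(2) h by simp
  qed
  obtain k where k: "cocycle ?U 2 k" "\<And>h. h \<in> ?U \<Longrightarrow> [k h = u h] (mod int p)"
    using kummer_lift[OF U u(1)] by blast
  have k_par: "even (k h) \<longleftrightarrow> even (u h)" if "h \<in> ?U" for h using k(2)[OF that] by (simp add: p2 cong_iff_dvd_diff)
  have k_add: "[k (a \<otimes> b) = k a + k b] (mod 4)" if ab: "a \<in> ?U" "b \<in> ?U" for a b
  proof -
    have ac: "a \<in> carrier G" "even (hw a)" using ab w_hw Cc by auto
    have "[\<theta> a 2 = 1] (mod 4)" using th2[OF ac(1)] ac(2) by (auto simp: cong_iff_dvd_diff elim: evenE)
    then have "[k a + \<theta> a 2 * k b = k a + 1 * k b] (mod 4)" by (intro cong_add cong_mult cong_refl)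
    then show ?thesis using cong_trans[OF cocycle_mult[OF k(1) ab]] by (simp add: p2)
  qed
  \<comment> \<open>By invariance of \<open>u\<close> modulo 2 this difference is even. On
    \<open>U\<close> \<theta> is 1 modulo 4, so \<open>k\<close> is additive modulo 4 and half the
    difference is a homomorphism.\<close>
  define \<delta> where "\<delta> h = k h - k (y \<otimes> h \<otimes> inv y)" for h
  have \<delta>_even: "even (\<delta> h)" if "h \<in> ?U" for h
    using f_even[OF that] k_par[OF that] k_par[OF conjU[OF that]] by (simp add: \<delta>_def)
  define q where "q h = \<delta> h div 2" for h
  have q: "fp_hom ?U q"
    unfolding fp_hom_def
  proof (intro conjI ballI)
    have lk: "loc_const ?U k" using k(1) by (simp add: cocycle_def)
    have "loc_const ?U (\<lambda>h. k (y \<otimes> h \<otimes> inv y))"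
      by (rule loc_const_translate[OF lk conjU]) (use yc Cc in auto)
    from loc_const_comp2[OF lk this, of "\<lambda>s t. (s - t) div 2"]
    show "loc_const ?U q" unfolding q_def \<delta>_def .
    fix a b assume ab: "a \<in> ?U" "b \<in> ?U"
    have "y \<otimes> (a \<otimes> b) \<otimes> inv y = (y \<otimes> a \<otimes> inv y) \<otimes> (y \<otimes> b \<otimes> inv y)" using ab Cc yc by (simp add: m_assoc)
    then have "[\<delta> (a \<otimes> b) = (k a + k b) - (k (y \<otimes> a \<otimes> inv y) + k (y \<otimes> b \<otimes> inv y))] (mod 4)"
      unfolding \<delta>_def using cong_diff[OF k_add[OF ab] k_add[OF conjU[OF ab(1)] conjU[OF ab(2)]]] by simp
    then have "4 dvd \<delta> (a \<otimes> b) - (\<delta> a + \<delta> b)" by (simp add: \<delta>_def cong_iff_dvd_diff algebra_simps)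
    moreover have "even (\<delta> a)" "even (\<delta> b)" "even (\<delta> (a \<otimes> b))"
      using \<delta>_even ab closed_subgroupD(5)[OF U] by blast+
    ultimately have "2 dvd q (a \<otimes> b) - (q a + q b)" unfolding q_def by presburger
    then show "[q (a \<otimes> b) = q a + q b] (mod int p)" by (simp add: p2 cong_iff_dvd_diff)
  qed
  \<comment> \<open>Conjugation by \<open>y\<close> multiplies k(z) by \<theta>(y) = 3 modulo 4, so
    \<delta>(z) = -2 k(z) modulo 4, with k(z) odd.\<close>
  have "odd (q z)"
  proof -
    have "[k (y \<otimes> z \<otimes> inv y) = \<theta> y 2 * k z] (mod 4)"
      using cocycle_theta_conj[OF U k(1) zU zc(2) yc conjU[OF zU] zact[OF yc]] by (simp add: p2)
    moreover obtain l where "hw y = 2 * l + 1" using y(2) w_hw[OF yc] by (auto elim: oddE)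
    moreover obtain m where m: "k z = 2 * m + 1" using k_par[OF zU] u(2) by (auto elim: oddE)
    ultimately have "[k (y \<otimes> z \<otimes> inv y) = (3 + 4 * l) * (2 * m + 1)] (mod 4)" using th2[OF yc] by simp
    moreover have "(3 + 4 * l) * (2 * m + 1) = 4 * (m + 2 * l * m + l) + 2 * m + 3" by (simp add: algebra_simps)
    ultimately have "4 dvd k (y \<otimes> z \<otimes> inv y) - (4 * (m + 2 * l * m + l) + 2 * m + 3)" by (simp only: cong_iff_dvd_diff)
    then show ?thesis unfolding q_def \<delta>_def m by presburger
  qed
  moreover have "q (y \<otimes> y) = 0"
  proof -
    have "y \<otimes> (y \<otimes> y) \<otimes> inv y = y \<otimes> y" using yc by (simp add: m_assoc)
    then show ?thesis by (simp add: q_def \<delta>_def)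
  qed
  moreover have "even (q (y \<otimes> y) + u (y \<otimes> y))" if "even (q z + u z)"
    using obstruction[OF w_hom y(1), of "\<lambda>h. q h + u h"] add[OF q u(1)] that y(2) yc
    by (simp add: par one pow2)
  ultimately show False using uy u(2) by simp
qed

end

end

section \<open>The complement\<close>

context cyclo_oriented_group
begin

lemma fp_hom_nonzero_at_rootless_central:
  assumes H: "closed_subgroup H G T" and z: "z \<in> H" "z \<in> Z" and no_root: "\<And>x. x \<in> H \<Longrightarrow> x [^] p \<noteq> z"
  shows "\<exists>f. fp_hom H f \<and> \<not> [f z = 0] (mod int p)"
proof (rule ccontr)
  assume none: "\<not> ?thesis"
  define \<A> where "\<A> = {C. closed_subgroup C G T \<and> C \<subseteq> H \<and> z \<in> C \<and> (\<forall>f. fp_hom C f \<longrightarrow> [f z = 0] (mod int p))}"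
  have "\<exists>M\<in>\<A>. \<forall>A\<in>\<A>. A \<subseteq> M \<longrightarrow> A = M"
  proof (rule minimal_member_of_family)
    show "\<A> \<noteq> {}" using H z none by (auto simp: \<A>_def)
    fix \<C> assume \<C>: "\<C> \<noteq> {}" "\<C> \<subseteq> \<A>" "\<And>A B. A \<in> \<C> \<Longrightarrow> B \<in> \<C> \<Longrightarrow> A \<subseteq> B \<or> B \<subseteq> A"
    let ?I = "\<Inter>\<C>"
    have cl: "closed_subgroup C G T" if "C \<in> \<C>" for C using \<C>(2) that by (auto simp: \<A>_def)
    have I: "closed_subgroup ?I G T" by (rule closed_subgroup_Inter[OF \<C>(1) cl])
    note Im = closed_subgroupD[OF I]
    have Ic: "x \<in> carrier G" if "x \<in> ?I" for x using Im(3) that by blast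
    have "[f z = 0] (mod int p)" if f: "fp_hom ?I f" for f
    proof -
      obtain N where N: "open_normal N" "\<And>x y. x \<in> ?I \<Longrightarrow> y \<in> ?I \<Longrightarrow> inv x \<otimes> y \<in> N \<Longrightarrow> f x = f y"
        using f unfolding fp_hom_def loc_const_def by blast
      \<comment> \<open>A homomorphism \<open>f\<close> on the intersection depends on classes
        modulo \<open>N\<close> only. By compactness some member \<open>C\<close> of the chain lies
        in the union \<open>W\<close> of these classes, and \<open>f\<close> extends to
        \<open>C\<close>; so \<open>z\<close> is killed on the intersection as well.\<close>
      define W where "W = (\<Union>c\<in>?I. {x \<in> carrier G. inv c \<otimes> x \<in> N})"
      have W: "openin T W" unfolding W_def by (intro openin_Union) (use open_coset[OF open_normalD(3)[OF N(1)]] Ic in blast)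
      have IW: "?I \<subseteq> W" using Ic open_normalD(5)[OF N(1)] by (auto simp: W_def)
      obtain C where C: "C \<in> \<C>" "C \<subseteq> W"
        using compact_space_chain_Inter_subset_open[OF compact \<C>(1,3) closed_subgroupD(2)[OF cl] W IW] by blast
      note Cm = closed_subgroupD[OF cl[OF C(1)]]
      have ex: "\<exists>c. c \<in> ?I \<and> ncong N c x" if "x \<in> C" for x
        using C(2) that unfolding W_def ncong_def by blast
      define F where "F x = f (SOME c. c \<in> ?I \<and> ncong N c x)" for x
      have F: "F x = f c" if x: "x \<in> C" and c: "c \<in> ?I" "ncong N c x" for x c
      proof -
        define d where "d = (SOME c. c \<in> ?I \<and> ncong N c x)"
        have d: "d \<in> ?I" "ncong N d x" using someI_ex[OF ex[OF x]] unfolding d_def by blast+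
        have "ncong N d c" using ncong_trans[OF N(1) _ _ _ d(2) ncong_sym[OF N(1) _ _ c(2)]] Cm(7)[OF x] Ic c(1) d(1) by blast
        then show ?thesis using N(2)[OF d(1) c(1)] by (simp add: F_def d_def ncong_def)
      qed
      have "fp_hom C F"
        unfolding fp_hom_def
      proof (intro conjI ballI)
        have "F x = F y" if xy: "x \<in> C" "y \<in> C" "inv x \<otimes> y \<in> N" for x y
        proof -
          obtain c where c: "c \<in> ?I" "ncong N c x" using ex[OF xy(1)] by blast
          have "ncong N c y" by (rule ncong_trans[OF N(1) Ic[OF c(1)] _ _ c(2)]) (use xy Cm(7) in \<open>auto simp: ncong_def\<close>)
          then show ?thesis using F[OF xy(1) c] F[OF xy(2) c(1)] by simp
        qed
        then show "loc_const C F" unfolding loc_const_def using N(1) by blast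
        fix x y assume xy: "x \<in> C" "y \<in> C"
        obtain c where c: "c \<in> ?I" "ncong N c x" using ex[OF xy(1)] by blast
        obtain d where d: "d \<in> ?I" "ncong N d y" using ex[OF xy(2)] by blast
        have "ncong N (c \<otimes> d) (x \<otimes> y)"
          by (rule ncong_mult[OF N(1) Ic[OF c(1)] Cm(7)[OF xy(1)] Ic[OF d(1)] Cm(7)[OF xy(2)] c(2) d(2)])
        then have "F (x \<otimes> y) = f (c \<otimes> d)" by (rule F[OF Cm(5)[OF xy] Im(5)[OF c(1) d(1)]])
        then show "[F (x \<otimes> y) = F x + F y] (mod int p)"
          using fp_hom_mult[OF f c(1) d(1)] F[OF xy(1) c] F[OF xy(2) d] by simp
      qed
      moreover have zI: "z \<in> ?I" "z \<in> C" using \<C>(2) C(1) by (auto simp: \<A>_def)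
      moreover have "F z = f z" by (rule F[OF zI(2,1) ncong_refl[OF N(1) Ic[OF zI(1)]]])
      ultimately show ?thesis using \<C>(2) C(1) by (fastforce simp: \<A>_def)
    qed
    moreover have "?I \<subseteq> H" "z \<in> ?I" using \<C>(1,2) unfolding \<A>_def by blast+
    ultimately show "?I \<in> \<A>" using I by (simp add: \<A>_def)
  qed
  then obtain M where M: "M \<in> \<A>" "\<And>A. A \<in> \<A> \<Longrightarrow> A \<subseteq> M \<Longrightarrow> A = M" by blast
  have M1: "closed_subgroup M G T" "z \<in> M" and MH: "M \<subseteq> H"
    and M2: "\<And>f. fp_hom M f \<Longrightarrow> [f z = 0] (mod int p)" using M(1) by (auto simp: \<A>_def)
  have M3: "\<exists>u. fp_hom D u \<and> \<not> [u z = 0] (mod int p)" if "closed_subgroup D G T" "z \<in> D" "D \<subset> M" for D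
    using M(2)[of D] that MH by (auto simp: \<A>_def)
  have M4: "x [^] p \<noteq> z" if "x \<in> M" for x using no_root MH that by blast
  show False
  proof (cases "odd p")
    case True
    show False by (rule contradiction_odd[OF M1 z(2) _ _ _ True]) (fact M2 M3 M4)+
  next
    case False
    then have "p = 2" using prime primes_dvd_imp_eq two_is_prime_nat by metis
    show False by (rule contradiction_even[OF M1 z(2) _ _ _ \<open>p = 2\<close>]) (fact M2 M3 M4)+
  qed
qed

text \<open>Otherwise a nontrivial \<open>a\<close> in the intersection has p^k-th roots in
  \<open>H\<close> for all \<open>k\<close>; they stay in \<open>Z\<close> by
  \<open>theta_centre_isolated\<close>. Then \<open>a\<close> lies in every open normal
  subgroup.\<close>

lemma rootless_central_element:
  assumes H: "closed_subgroup H G T" and ne: "H \<inter> Z \<noteq> {\<one>}"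
  shows "\<exists>z\<in>H \<inter> Z. \<forall>x\<in>H. x [^] p \<noteq> z"
proof (rule ccontr)
  assume "\<not> ?thesis"
  then have root: "\<exists>x\<in>H. x [^] p = z" if "z \<in> H" "z \<in> Z" for z using that by blast
  note Hm = closed_subgroupD[OF H]
  obtain a where a: "a \<in> H" "a \<in> Z" "a \<noteq> \<one>"
    using ne Hm(4) closed_subgroupD(4)[OF theta_centre_closed_subgroup] by blast
  have roots: "\<exists>b. b \<in> H \<and> b \<in> Z \<and> b [^] (p ^ k) = a" for k
  proof (induction k)
    case 0
    show ?case using a Hm(7) by (intro exI[of _ a]) simp
  next
    case (Suc k)
    then obtain b where b: "b \<in> H" "b \<in> Z" "b [^] (p ^ k) = a" by blast
    obtain x where x: "x \<in> H" "x [^] p = b" using root[OF b(1,2)] by blast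
    have "b \<noteq> \<one>" using b(3) a(3) by auto
    then have "x \<in> Z" using theta_centre_isolated[of x] x b(2) Hm(7) by simp
    moreover have "x [^] (p ^ Suc k) = a" using x b(3) Hm(7)[OF x(1)] by (simp flip: nat_pow_pow)
    ultimately show ?case using x(1) by blast
  qed
  obtain N where N: "open_normal N" "a \<notin> N" using open_normal_separation[OF Hm(7)[OF a(1)] a(3)] by blast
  obtain k where "\<forall>x\<in>carrier G. x [^] (p ^ k) \<in> N" using open_normal_pow[OF N(1)] by blast
  then show False using roots[of k] N(2) Hm(7) by blast
qed

text \<open>H Z = G in the form that \<open>H\<close> meets every coset g Z, a condition that passes
  to intersections of chains by compactness.\<close>

definition supplement :: "'a set \<Rightarrow> bool" where
  "supplement H \<longleftrightarrow> closed_subgroup H G T \<and> (\<forall>g\<in>carrier G. \<exists>h\<in>H. inv g \<otimes> h \<in> Z)"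

lemma minimal_supplement_exists: "\<exists>M\<in>Collect supplement. \<forall>A\<in>Collect supplement. A \<subseteq> M \<longrightarrow> A = M"
proof (rule minimal_member_of_family)
  note Zm = closed_subgroupD[OF theta_centre_closed_subgroup]
  have "supplement (carrier G)"
    unfolding supplement_def using closed_subgroup_carrier Zm(4) by (metis l_inv)
  then show "Collect supplement \<noteq> {}" by blast
  fix \<C> assume \<C>: "\<C> \<noteq> {}" "\<C> \<subseteq> Collect supplement" "\<And>A B. A \<in> \<C> \<Longrightarrow> B \<in> \<C> \<Longrightarrow> A \<subseteq> B \<or> B \<subseteq> A"
  have cl: "closed_subgroup C G T" if "C \<in> \<C>" for C using \<C>(2) that by (auto simp: supplement_def)
  have "\<exists>h\<in>\<Inter>\<C>. inv g \<otimes> h \<in> Z" if g: "g \<in> carrier G" for g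
  proof (rule ccontr)
    assume no: "\<not> ?thesis"
    define K where "K = {h \<in> topspace T. inv g \<otimes> h \<in> Z}"
    have K: "closedin T K"
      unfolding K_def by (rule closedin_continuous_map_preimage[OF _ Zm(2)]) (use g in \<open>intro continuous_intros; simp\<close>)
    have "\<exists>C\<in>(\<lambda>C. C \<inter> K) ` \<C>. C \<subseteq> {}"
    proof (rule compact_space_chain_Inter_subset_open[OF compact])
      show "\<Inter>((\<lambda>C. C \<inter> K) ` \<C>) \<subseteq> {}" using no \<C>(1) by (auto simp: K_def)
      show "C \<subseteq> D \<or> D \<subseteq> C" if "C \<in> (\<lambda>C. C \<inter> K) ` \<C>" "D \<in> (\<lambda>C. C \<inter> K) ` \<C>" for C D
        using that \<C>(3) by blast
      show "closedin T C" if "C \<in> (\<lambda>C. C \<inter> K) ` \<C>" for C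
        using that closed_subgroupD(2)[OF cl] K by blast
    qed (use \<C>(1) in auto)
    then obtain C where "C \<in> \<C>" "C \<inter> K = {}" by blast
    moreover then have "\<exists>h\<in>C. inv g \<otimes> h \<in> Z" using \<C>(2) g by (auto simp: supplement_def)
    ultimately show False using closed_subgroupD(3)[OF cl] by (auto simp: K_def)
  qed
  then show "\<Inter>\<C> \<in> Collect supplement"
    using closed_subgroup_Inter[OF \<C>(1) cl] by (simp add: supplement_def)
qed

lemma complement_exists:
  obtains H where "closed_subgroup H G T" "H \<inter> Z = {\<one>}" "H <#> Z = carrier G"
proof -
  note Zm = closed_subgroupD[OF theta_centre_closed_subgroup]
  obtain H where H: "supplement H" "\<And>A. supplement A \<Longrightarrow> A \<subseteq> H \<Longrightarrow> A = H" using minimal_supplement_exists by blast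
  have Hc: "closed_subgroup H G T" using H(1) by (simp add: supplement_def)
  note Hm = closed_subgroupD[OF Hc]
  have "H \<inter> Z = {\<one>}"
  proof (rule ccontr)
    assume "H \<inter> Z \<noteq> {\<one>}"
    then obtain z where z: "z \<in> H" "z \<in> Z" "\<forall>x\<in>H. x [^] p \<noteq> z" using rootless_central_element[OF Hc] by blast
    obtain f where f: "fp_hom H f" "\<not> [f z = 0] (mod int p)"
      using fp_hom_nonzero_at_rootless_central[OF Hc z(1,2)] z(3) by blast
    obtain b where b: "[b * f z = 1] (mod int p)" using inverse_mod_prime[OF prime f(2)] by blast
    let ?D = "{x \<in> H. [f x = 0] (mod int p)}"
    have "\<exists>h\<in>?D. inv g \<otimes> h \<in> Z" if g: "g \<in> carrier G" for g
    proof -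
      obtain h where h: "h \<in> H" "inv g \<otimes> h \<in> Z" using H(1) g by (auto simp: supplement_def)
      \<comment> \<open>Chosen so that f(h z^m) = f(h) - f(h) b f(z) = 0, where \<open>b\<close>
        inverts f(z): \<open>h\<close> is moved into the kernel within its coset modulo
        \<open>Z\<close>.\<close>
      define m where "m = nat ((- (f h * b)) mod int p)"
      have m: "[int m = - (f h * b)] (mod int p)" using p_gt_1 by (simp add: m_def)
      have zm: "z [^] m \<in> H" "z [^] m \<in> Z"
        using closed_subgroup_pow[OF Hc z(1)] closed_subgroup_pow[OF theta_centre_closed_subgroup z(2)] by auto
      have "[f (h \<otimes> z [^] m) = f h + int m * f z] (mod int p)"
        by (rule cong_trans[OF fp_hom_mult[OF f(1) h(1) zm(1)]]) (intro cong_add cong_refl fp_hom_pow[OF Hc f(1) z(1)])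
      also have "[f h + int m * f z = f h + - (f h * b) * f z] (mod int p)" by (intro cong_add cong_mult cong_refl m)
      also have "f h + - (f h * b) * f z = f h + - f h * (b * f z)" by (simp add: algebra_simps)
      also have "[f h + - f h * (b * f z) = f h + - f h * 1] (mod int p)" by (intro cong_add cong_mult cong_refl b)
      finally have "h \<otimes> z [^] m \<in> ?D" using Hm(5)[OF h(1) zm(1)] by simp
      have e: "inv g \<otimes> (h \<otimes> z [^] m) = (inv g \<otimes> h) \<otimes> z [^] m" using g h(1) zm(1) Hm(7) by (simp add: m_assoc)
      have "inv g \<otimes> (h \<otimes> z [^] m) \<in> Z" unfolding e by (rule Zm(5)[OF h(2) zm(2)])
      with \<open>h \<otimes> z [^] m \<in> ?D\<close> show ?thesis by blast
    qed
    then have "supplement ?D" using closed_subgroup_kernel[OF Hc f(1)] by (simp add: supplement_def)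
    then have "?D = H" by (rule H(2)) blast
    then show False using z(1) f(2) by blast
  qed
  moreover have "H <#> Z = carrier G"
  proof
    show "H <#> Z \<subseteq> carrier G" using Hm(7) Zm(7) by (auto simp: set_mult_def)
    show "carrier G \<subseteq> H <#> Z"
    proof
      fix g assume g: "g \<in> carrier G"
      obtain h where h: "h \<in> H" "inv g \<otimes> h \<in> Z" using H(1) g by (auto simp: supplement_def)
      have "g = h \<otimes> inv (inv g \<otimes> h)" using g Hm(7)[OF h(1)] by (simp add: inv_mult_group)
      then show "g \<in> H <#> Z" using h(1) Zm(6)[OF h(2)] by (auto simp: set_mult_def)
    qed
  qed
  ultimately show thesis using that Hc by blast
qed

end

section \<open>The quotient topology and the topological splitting\<close>

context group
begin

text \<open>The defining family is a topology: cosets are disjoint, so forming unions of sets of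
  cosets commutes with binary intersections.\<close>

lemma coset_topology:
  assumes N: "subgroup N G"
  shows "openin (coset_topology G T N) \<U> \<longleftrightarrow> \<U> \<subseteq> rcosets N \<and> openin T (\<Union>\<U>)"
proof -
  have "istopology (\<lambda>\<U>. \<U> \<subseteq> rcosets N \<and> openin T (\<Union>\<U>))"
    unfolding istopology_def
  proof (intro conjI allI impI)
    fix A B assume AB: "A \<subseteq> rcosets N \<and> openin T (\<Union>A)" "B \<subseteq> rcosets N \<and> openin T (\<Union>B)"
    have "\<Union>(A \<inter> B) = \<Union>A \<inter> \<Union>B"
      using pairwiseD[OF rcos_disjoint[OF N]] AB unfolding disjnt_iff by blast
    then show "A \<inter> B \<subseteq> rcosets N" "openin T (\<Union>(A \<inter> B))" using AB by auto
  next
    fix \<K> assume K: "\<forall>A\<in>\<K>. A \<subseteq> rcosets N \<and> openin T (\<Union>A)"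
    have "\<Union>(\<Union>\<K>) = \<Union>(Union ` \<K>)" by auto
    moreover have "openin T (\<Union>(Union ` \<K>))" using K by (intro openin_Union) auto
    ultimately show "\<Union>\<K> \<subseteq> rcosets N" "openin T (\<Union>(\<Union>\<K>))" using K by auto
  qed
  then show ?thesis by (simp add: coset_topology_def topology_inverse')
qed

end

context cyclo_oriented_group
begin

text \<open>Multiplication from H \<times> Z to \<open>G\<close> is a continuous bijection from a
  compact to a Hausdorff space, hence a homeomorphism. This also makes the bijection from
  \<open>H\<close> to the quotient open, and the section is its inverse.\<close>

theorem theta_centre_split:
  "Z \<lhd> G \<and>
    (\<exists>H. closed_subgroup H G T \<and>
       H \<inter> Z = {\<one>} \<and> H <#> Z = carrier G \<and>
       (\<exists>s \<in> hom (G Mod Z) G.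
          continuous_map (coset_topology G T Z) T s \<and>
          (\<forall>x \<in> carrier (G Mod Z). Z #> s x = x) \<and>
          s ` carrier (G Mod Z) = H) \<and>
       topological_group_iso (G\<lparr>carrier := H\<rparr>) (subtopology T H)
         (G Mod Z) (coset_topology G T Z) (\<lambda>h. Z #> h) \<and>
       topological_group_iso
         (semidirect_product (G\<lparr>carrier := H\<rparr>) (G\<lparr>carrier := Z\<rparr>) (\<lambda>h z. padic_pow G T z (\<theta> h)))
         (prod_topology (subtopology T H) (subtopology T Z))
         G T (\<lambda>(h, z). z \<otimes> h))"
proof -
  note Zm = closed_subgroupD[OF theta_centre_closed_subgroup]
  interpret N: normal Z G by (rule theta_centre_normal)
  obtain H where H: "closed_subgroup H G T" "H \<inter> Z = {\<one>}" "H <#> Z = carrier G" by (rule complement_exists)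
  note Hm = closed_subgroupD[OF H(1)]
  let ?m = "\<lambda>(h, z). z \<otimes> h"
  let ?\<phi> = "\<lambda>h. Z #> h"
  let ?HZ = "prod_topology (subtopology T H) (subtopology T Z)"
  have topH: "topspace (subtopology T H) = H" "topspace (subtopology T Z) = Z" using Hm(3) Zm(3) by auto
  have mult_surj: "\<exists>h\<in>H. \<exists>z\<in>Z. g = z \<otimes> h" if "g \<in> carrier G" for g
  proof -
    have "g \<in> H <#> Z" using that H(3) by simp
    then obtain h z where hz: "h \<in> H" "z \<in> Z" "g = h \<otimes> z" unfolding set_mult_def by blast
    then have "g = (h \<otimes> z \<otimes> inv h) \<otimes> h" using Hm(7) Zm(7) by (simp add: m_assoc)
    then show ?thesis using N.inv_op_closed2[OF Hm(7)[OF hz(1)] hz(2)] hz(1) by blast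
  qed
  have \<phi>_eq: "h = k" if hk: "h \<in> H" "k \<in> H" "Z #> h = Z #> k" for h k
  proof -
    have "h \<in> Z #> k" using rcos_self[OF Hm(7)[OF hk(1)] Zm(1)] hk(3) by simp
    then have "h \<otimes> inv k \<in> Z" using subgroup.rcos_module[OF Zm(1) is_group] Hm(7) hk by simp
    then have "h \<otimes> inv k = \<one>" using H(2) Hm(5,6) hk by blast
    then show ?thesis using Hm(7) hk by (metis inv_closed inv_equality inv_inv)
  qed
  have \<phi>_absorb: "Z #> (z \<otimes> h) = Z #> h" if "z \<in> Z" "h \<in> H" for z h
    using coset_mult_assoc[OF Zm(3) Zm(7)[OF that(1)] Hm(7)[OF that(2)]] coset_join2[OF Zm(7)[OF that(1)] Zm(1) that(1)]
    by simp
  have \<phi>_image: "?\<phi> ` H = carrier (G Mod Z)"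
  proof
    show "?\<phi> ` H \<subseteq> carrier (G Mod Z)" using Hm(7) by (auto simp: FactGroup_def RCOSETS_def)
    show "carrier (G Mod Z) \<subseteq> ?\<phi> ` H"
      using mult_surj \<phi>_absorb by (fastforce simp: FactGroup_def RCOSETS_def)
  qed
  have m_inj: "inj_on ?m (H \<times> Z)"
  proof (rule inj_onI, clarify)
    fix h z h' z' assume a: "h \<in> H" "z \<in> Z" "h' \<in> H" "z' \<in> Z" "z \<otimes> h = z' \<otimes> h'"
    have "h = h'" by (rule \<phi>_eq) (use \<phi>_absorb[OF a(2,1)] \<phi>_absorb[OF a(4,3)] a in auto)
    then show "h = h' \<and> z = z'" using a Zm(7) Hm(7) by simp
  qed
  have m_image: "?m ` (H \<times> Z) = carrier G"
  proof
    show "?m ` (H \<times> Z) \<subseteq> carrier G" using Hm(7) Zm(7) by auto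
    show "carrier G \<subseteq> ?m ` (H \<times> Z)" using mult_surj by (fastforce simp: image_iff)
  qed
  have m_cont: "continuous_map ?HZ T ?m"
  proof -
    have "continuous_map ?HZ T fst" "continuous_map ?HZ T snd"
      using continuous_map_fst[of "subtopology T H"] continuous_map_snd[of _ "subtopology T Z"] continuous_map_into_fulltopology
      by blast+
    from continuous_map_mult[OF this(2,1)] show ?thesis by (simp add: case_prod_unfold)
  qed
  have compactHZ: "compact_space ?HZ"
    using compact_space_subtopology[OF closedin_compact_space[OF compact Hm(2)]]
      compact_space_subtopology[OF closedin_compact_space[OF compact Zm(2)]]
    by (simp add: compact_space_prod_topology)
  have m_homeo: "homeomorphic_map ?HZ T ?m"
    by (rule continuous_imp_homeomorphic_map[OF m_cont compactHZ Hausdorff]) (use m_image m_inj topH in simp_all)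
  have m_iso: "?m \<in> iso (semidirect_product (G\<lparr>carrier := H\<rparr>) (G\<lparr>carrier := Z\<rparr>) (\<lambda>h z. padic_pow G T z (\<theta> h))) G"
  proof (rule isoI)
    have act: "h \<otimes> z \<otimes> inv h = padic_pow G T z (\<theta> h)" if "h \<in> H" "z \<in> Z" for h z
      using that Hm(7) unfolding theta_centre_def by blast
    have "z \<otimes> padic_pow G T z' (\<theta> h) \<otimes> (h \<otimes> h') = z \<otimes> h \<otimes> (z' \<otimes> h')"
      if "h \<in> H" "z \<in> Z" "h' \<in> H" "z' \<in> Z" for h z h' z'
      using that Hm(7) Zm(7) by (simp flip: act add: m_assoc)
    then show "?m \<in> hom (semidirect_product (G\<lparr>carrier := H\<rparr>) (G\<lparr>carrier := Z\<rparr>) (\<lambda>h z. padic_pow G T z (\<theta> h))) G"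
      using Hm(7) Zm(7) by (auto simp: hom_def semidirect_product_def)
    show "bij_betw ?m (carrier (semidirect_product (G\<lparr>carrier := H\<rparr>) (G\<lparr>carrier := Z\<rparr>) (\<lambda>h z. padic_pow G T z (\<theta> h)))) (carrier G)"
      using m_inj m_image by (simp add: bij_betw_def semidirect_product_def)
  qed
  note open_coset_top = coset_topology[OF Zm(1), of T]
  have rc: "rcosets Z = carrier (G Mod Z)" by (simp add: FactGroup_def)
  have top_coset: "topspace (coset_topology G T Z) = carrier (G Mod Z)"
  proof (rule antisym)
    show "topspace (coset_topology G T Z) \<subseteq> carrier (G Mod Z)"
      using open_coset_top openin_topspace rc by blast
    have "openin (coset_topology G T Z) (rcosets Z)"
      using open_coset_top rcosets_part_G[OF Zm(1)] openin_topspace[of T] by simp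
    then show "carrier (G Mod Z) \<subseteq> topspace (coset_topology G T Z)" using rc openin_subset by blast
  qed
  \<comment> \<open>The preimage in \<open>G\<close> of a set of cosets represented by
    \<open>U\<close> is the product of \<open>U\<close> and \<open>Z\<close>, open by
    \<open>m_homeo\<close> when \<open>U\<close> is open in \<open>H\<close>.\<close>
  have union: "\<Union>(?\<phi> ` U) = ?m ` (U \<times> Z)" if "U \<subseteq> H" for U
    using that by (auto simp: r_coset_def image_iff)
  have \<phi>_homeo: "homeomorphic_map (subtopology T H) (coset_topology G T Z) ?\<phi>"
  proof (rule bijective_open_imp_homeomorphic_map)
    show "continuous_map (subtopology T H) (coset_topology G T Z) ?\<phi>"
      unfolding continuous_map_alt
    proof (intro conjI allI impI)
      fix \<U> assume "openin (coset_topology G T Z) \<U>"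
      then have U: "\<U> \<subseteq> rcosets Z" "openin T (\<Union>\<U>)" using open_coset_top by auto
      have "h \<in> \<Union>\<U> \<longleftrightarrow> Z #> h \<in> \<U>" if "h \<in> H" for h
      proof
        assume "Z #> h \<in> \<U>"
        then show "h \<in> \<Union>\<U>" using rcos_self[OF Hm(7)[OF that] Zm(1)] by blast
      next
        assume "h \<in> \<Union>\<U>"
        then obtain A where A: "A \<in> \<U>" "h \<in> A" by blast
        then obtain a where "a \<in> carrier G" "A = Z #> a" using U(1) by (auto simp: RCOSETS_def)
        then show "Z #> h \<in> \<U>" using repr_independence[of h Z a] A Zm(1) by simp
      qed
      then have "?\<phi> -` \<U> \<inter> topspace (subtopology T H) = \<Union>\<U> \<inter> H" using topH by auto
      then show "openin (subtopology T H) (?\<phi> -` \<U> \<inter> topspace (subtopology T H))"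
        using U(2) by (metis openin_subtopology)
    next
      show "?\<phi> \<in> topspace (subtopology T H) \<rightarrow> topspace (coset_topology G T Z)"
        using \<phi>_image topH top_coset by auto
    qed
    show "open_map (subtopology T H) (coset_topology G T Z) ?\<phi>"
      unfolding open_map_def
    proof (intro allI impI)
      fix U assume U: "openin (subtopology T H) U"
      then have UH: "U \<subseteq> H" using openin_subset topH by metis
      have "openin ?HZ (U \<times> Z)" using U topH openin_topspace[of "subtopology T Z"] by (simp add: openin_prod_Times_iff)
      then have "openin T (?m ` (U \<times> Z))" using m_homeo homeomorphic_imp_open_map open_map_def by metis
      then show "openin (coset_topology G T Z) (?\<phi> ` U)"
        unfolding open_coset_top rc using union[OF UH] image_mono[OF UH, of ?\<phi>] \<phi>_image by simp
    qed
    show "?\<phi> ` topspace (subtopology T H) = topspace (coset_topology G T Z)" using \<phi>_image topH top_coset by simp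
    show "inj_on ?\<phi> (topspace (subtopology T H))" using \<phi>_eq topH by (auto intro: inj_onI)
  qed
  have \<phi>_bij: "bij_betw ?\<phi> H (carrier (G Mod Z))" using \<phi>_image \<phi>_eq by (auto simp: bij_betw_def inj_on_def)
  have \<phi>_iso: "?\<phi> \<in> iso (G\<lparr>carrier := H\<rparr>) (G Mod Z)"
    using \<phi>_bij \<phi>_image N.rcos_sum Hm(7) by (auto simp: iso_def hom_def FactGroup_def)
  obtain s where s: "homeomorphic_maps (subtopology T H) (coset_topology G T Z) ?\<phi> s"
    using \<phi>_homeo homeomorphic_map_maps by blast
  have s_cont: "continuous_map (coset_topology G T Z) T s"
    and s\<phi>: "\<And>h. h \<in> H \<Longrightarrow> s (Z #> h) = h" and \<phi>s: "\<And>x. x \<in> carrier (G Mod Z) \<Longrightarrow> Z #> s x = x"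
    using s topH top_coset continuous_map_into_fulltopology by (auto simp: homeomorphic_maps_def)
  have s_image: "s ` carrier (G Mod Z) = H" using s\<phi> by (auto simp flip: \<phi>_image simp: image_image)
  have s_hom: "s \<in> hom (G Mod Z) G"
  proof (rule homI)
    show "s x \<in> carrier G" if "x \<in> carrier (G Mod Z)" for x using s_image Hm(7) that by blast
    fix x y assume xy: "x \<in> carrier (G Mod Z)" "y \<in> carrier (G Mod Z)"
    then obtain h k where hk: "h \<in> H" "k \<in> H" "x = Z #> h" "y = Z #> k" unfolding \<phi>_image[symmetric] by blast
    then have "x \<otimes>\<^bsub>G Mod Z\<^esub> y = Z #> (h \<otimes> k)" using N.rcos_sum Hm(7) by (simp add: FactGroup_def)
    then show "s (x \<otimes>\<^bsub>G Mod Z\<^esub> y) = s x \<otimes> s y" using s\<phi> hk Hm(5)[OF hk(1,2)] by simp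
  qed
  show ?thesis
    unfolding topological_group_iso_def
    using theta_centre_normal H s_hom s_cont \<phi>s s_image \<phi>_iso \<phi>_homeo m_iso m_homeo by blast
qed

end

theorem theorem4p13:
  fixes p :: nat
    and G :: "('a, 'b) monoid_scheme"
    and T :: "'a topology"
    and \<theta> :: "'a \<Rightarrow> nat \<Rightarrow> int"
  assumes "Factorial_Ring.prime p"
    and "cyclo_oriented p G T \<theta>"
    and "topologically_finitely_generated G T"
  shows "let Z = theta_centre p G T \<theta> in
    Z \<lhd> G \<and>
    (\<exists>H. closed_subgroup H G T \<and>
       H \<inter> Z = {\<one>\<^bsub>G\<^esub>} \<and> H <#>\<^bsub>G\<^esub> Z = carrier G \<and>
       (\<exists>s \<in> hom (G Mod Z) G.
          continuous_map (coset_topology G T Z) T s \<and>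
          (\<forall>x \<in> carrier (G Mod Z). Z #>\<^bsub>G\<^esub> s x = x) \<and>
          s ` carrier (G Mod Z) = H) \<and>
       topological_group_iso (G\<lparr>carrier := H\<rparr>) (subtopology T H)
         (G Mod Z) (coset_topology G T Z) (\<lambda>h. Z #>\<^bsub>G\<^esub> h) \<and>
       topological_group_iso
         (semidirect_product (G\<lparr>carrier := H\<rparr>) (G\<lparr>carrier := Z\<rparr>) (\<lambda>h z. padic_pow G T z (\<theta> h)))
         (prod_topology (subtopology T H) (subtopology T Z))
         G T (\<lambda>(h, z). z \<otimes>\<^bsub>G\<^esub> h))"
proof -
  have "group G"
    using assms(2) by (simp add: cyclo_oriented_def bloch_kato_group_def pro_p_group_def profinite_group_def topological_group_def)
  then interpret cyclo_oriented_group G p T \<theta>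
    using assms by (simp add: cyclo_oriented_group_def cyclo_oriented_group_axioms_def)
  show ?thesis unfolding Let_def by (rule theta_centre_split)
qed

end
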